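(* Let $d\ge1$. Suppose that $\mathcal T$ is a metric space, and that for every $t\in\mathcal T$ there is a unital C*-algebra $\mathcal A_t$ and a $d$-tuple $\xi_t=(\xi_{t,1},\ldots,\xi_{t,d})\in\mathcal A_t^d$ generating $\mathcal A_t$ as a unital C*-algebra. Consider the following conditions for $t_0\in\mathcal T$: (i) $\lim_{t\to t_0}\|p(\xi_t)\|=\|p(\xi_{t_0})\|$ for all $p\in\mathbb C\langle z,z^*\rangle$. (ii) $\lim_{t\to t_0}\|p(\xi_t)\|=\|p(\xi_{t_0})\|$ for all $n\in\mathbb N$ and all $p\in M_n(\mathbb C\langle z,z^*\rangle)$. (iii) $\lim_{t\to t_0}\|p(\xi_t)\|=\|p(\xi_{t_0})\|$ for all $n\in\mathbb N$ and all $p\in M_n(\mathbb C_1\langle z,z^*\rangle)$. (iv) $\lim_{t\to t_0}d_H(\mathcal W_n(\xi_t),\mathcal W_n(\xi_{t_0}))=0$ for all $n\in\mathbb N$. Then (i) $\Longleftrightarrow$ (ii) $\Longrightarrow$ (iii) $\Longleftrightarrow$ (iv).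
   Context: $M_n=M_n(\mathbb C)$, and $M_n^d$ is the set of $d$-tuples of $n\times n$ complex matrices. $\mathbb C\langle z,z^*\rangle$ is the $*$-algebra of $*$-polynomials in noncommuting variables $z_1,\ldots,z_d,z_1^*,\ldots,z_d^*$; $\mathbb C_1\langle z,z^*\rangle$ is the subspace of $*$-polynomials of degree at most $1$. $M_n(\mathbb C\langle z,z^*\rangle)$ is the space of $*$-polynomials with $n\times n$ matrix coefficients (equivalently $n\times n$ matrices with entries in $\mathbb C\langle z,z^*\rangle$), and $M_n(\mathbb C_1\langle z,z^*\rangle)$ is its subspace of polynomials of degree at most $1$. For $p\in M_n(\mathbb C\langle z,z^*\rangle)$ and $\xi_t\in\mathcal A_t^d$, $p(\xi_t)\in M_n\otimes\mathcal A_t$, with the C*-norm. For a tuple $X$ of operators, $\|X\|:=\|\sum_i X_iX_i^*\|^{1/2}$; $M_n^d$ is a metric space with $d(X,Y)=\|X-Y\|$. For compact $E,F\subseteq M_n^d$, the Hausdorff metric is $d_H(E,F)=\max\{\sup_{x\in E}d(x,F),\sup_{y\in F}d(y,E)\}$, where $d(x,F)=\inf_{y\in F}d(x,y)$. UCP means unital completely positive. The matrix range of a $d$-tuple $A\in B(\mathcal H)^d$ is $\mathcal W(A)=\bigcup_n\mathcal W_n(A)$, where $\mathcal W_n(A)=\{(\phi(A_1),\ldots,\phi(A_d)):\phi\in \mathrm{UCP}(B(\mathcal H),M_n)\}\subseteq M_n^d$. For a tuple in an abstract (nonzero) unital C*-algebra one uses any faithful unital representation on a Hilbert space; the result does not depend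 on the choice. *)

theory Defs
  imports Complex_Main "HOL-Library.Poly_Mapping" "HOL-Library.FuncSet"
    "Jordan_Normal_Form.Matrix"
begin

section \<open>Unital C*-algebras\<close>

definition complex_ring :: "complex ring" where
  "complex_ring = \<lparr>carrier = UNIV, mult = (*), one = 1, zero = 0, add = (+)\<rparr>"

record 'a cstar = "(complex, 'a) module" +
  star :: "'a \<Rightarrow> 'a"
  anorm :: "'a \<Rightarrow> real"

text \<open>A unital C*-algebra is by convention nonzero.\<close>

locale unital_cstar_algebra = module complex_ring A + ring A
  for A :: "('a, 'm) cstar_scheme" (structure) +
  assumes smult_mult_left:
      "\<lbrakk>x \<in> carrier A; y \<in> carrier A\<rbrakk> \<Longrightarrow> (c \<odot> x) \<otimes> y = c \<odot> (x \<otimes> y)"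
    and smult_mult_right:
      "\<lbrakk>x \<in> carrier A; y \<in> carrier A\<rbrakk> \<Longrightarrow> x \<otimes> (c \<odot> y) = c \<odot> (x \<otimes> y)"
    and one_neq_zero: "\<one> \<noteq> \<zero>"
    and star_closed: "x \<in> carrier A \<Longrightarrow> star A x \<in> carrier A"
    and star_star: "x \<in> carrier A \<Longrightarrow> star A (star A x) = x"
    and star_add: "\<lbrakk>x \<in> carrier A; y \<in> carrier A\<rbrakk> \<Longrightarrow> star A (x \<oplus> y) = star A x \<oplus> star A y"
    and star_smult: "x \<in> carrier A \<Longrightarrow> star A (c \<odot> x) = cnj c \<odot> star A x"
    and star_mult: "\<lbrakk>x \<in> carrier A; y \<in> carrier A\<rbrakk> \<Longrightarrow> star A (x \<otimes> y) = star A y \<otimes> star A x"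
    and norm_eq_zero: "x \<in> carrier A \<Longrightarrow> anorm A x = 0 \<longleftrightarrow> x = \<zero>"
    and norm_triangle:
      "\<lbrakk>x \<in> carrier A; y \<in> carrier A\<rbrakk> \<Longrightarrow> anorm A (x \<oplus> y) \<le> anorm A x + anorm A y"
    and norm_smult: "x \<in> carrier A \<Longrightarrow> anorm A (c \<odot> x) = cmod c * anorm A x"
    and norm_mult:
      "\<lbrakk>x \<in> carrier A; y \<in> carrier A\<rbrakk> \<Longrightarrow> anorm A (x \<otimes> y) \<le> anorm A x * anorm A y"
    and cstar_identity: "x \<in> carrier A \<Longrightarrow> anorm A (star A x \<otimes> x) = (anorm A x)\<^sup>2"
    and complete:
      "\<lbrakk>\<And>k. s k \<in> carrier A; \<And>e. e > 0 \<Longrightarrow> \<exists>N. \<forall>k\<ge>N. \<forall>l\<ge>N. anorm A (s k \<ominus> s l) < e\<rbrakk>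
        \<Longrightarrow> \<exists>x \<in> carrier A. (\<lambda>k. anorm A (s k \<ominus> x)) \<longlonglongrightarrow> 0"

definition unital_cstar_subalgebra :: "('a, 'm) cstar_scheme \<Rightarrow> 'a set \<Rightarrow> bool" where
  "unital_cstar_subalgebra A B \<longleftrightarrow>
     B \<subseteq> carrier A \<and> \<one>\<^bsub>A\<^esub> \<in> B \<and>
     (\<forall>x\<in>B. \<forall>y\<in>B. x \<oplus>\<^bsub>A\<^esub> y \<in> B \<and> x \<otimes>\<^bsub>A\<^esub> y \<in> B) \<and>
     (\<forall>c. \<forall>x\<in>B. c \<odot>\<^bsub>A\<^esub> x \<in> B) \<and>
     (\<forall>x\<in>B. star A x \<in> B) \<and>
     (\<forall>s x. (\<forall>k. s k \<in> B) \<and> x \<in> carrier A \<and> (\<lambda>k. anorm A (s k \<ominus>\<^bsub>A\<^esub> x)) \<longlonglongrightarrow> 0 \<longrightarrow> x \<in> B)"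

text \<open>A \<open>d\<close>-tuple is a function on a finite type \<^typ>\<open>'d\<close> with \<open>d\<close> elements; as types are
  nonempty, \<open>d \<ge> 1\<close>.\<close>

definition generates_cstar :: "('a, 'm) cstar_scheme \<Rightarrow> ('d::finite \<Rightarrow> 'a) \<Rightarrow> bool" where
  "generates_cstar A X \<longleftrightarrow> range X \<subseteq> carrier A \<and>
     (\<forall>B. unital_cstar_subalgebra A B \<and> range X \<subseteq> B \<longrightarrow> B = carrier A)"

definition unital_star_hom ::
  "('a, 'm) cstar_scheme \<Rightarrow> ('b, 'n) cstar_scheme \<Rightarrow> ('a \<Rightarrow> 'b) \<Rightarrow> bool" where
  "unital_star_hom A B f \<longleftrightarrow> f \<in> Ring.ring_hom A B \<and>
     (\<forall>c. \<forall>x\<in>carrier A. f (c \<odot>\<^bsub>A\<^esub> x) = c \<odot>\<^bsub>B\<^esub> f x) \<and>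
     (\<forall>x\<in>carrier A. f (star A x) = star B (f x))"

definition positive_elements :: "('a, 'm) cstar_scheme \<Rightarrow> 'a set" where
  "positive_elements A = {star A y \<otimes>\<^bsub>A\<^esub> y |y. y \<in> carrier A}"

section \<open>Matrices over a C*-algebra\<close>

text \<open>The *-algebra \<open>M\<^sub>n(A)\<close>, equipped with a given function \<open>N\<close> as its norm.\<close>

definition matrix_algebra_with ::
  "('a, 'm) cstar_scheme \<Rightarrow> nat \<Rightarrow> ('a mat \<Rightarrow> real) \<Rightarrow> 'a mat cstar" where
  "matrix_algebra_with A n N =
     \<lparr>carrier = {X \<in> carrier_mat n n. elements_mat X \<subseteq> carrier A},
      mult = (\<lambda>X Y. mat n n (\<lambda>(i, j). \<Oplus>\<^bsub>A\<^esub>k\<in>{..<n}. X $$ (i, k) \<otimes>\<^bsub>A\<^esub> Y $$ (k, j))),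
      one = mat n n (\<lambda>(i, j). if i = j then \<one>\<^bsub>A\<^esub> else \<zero>\<^bsub>A\<^esub>),
      zero = mat n n (\<lambda>_. \<zero>\<^bsub>A\<^esub>),
      add = (\<lambda>X Y. mat n n (\<lambda>ij. X $$ ij \<oplus>\<^bsub>A\<^esub> Y $$ ij)),
      smult = (\<lambda>c X. mat n n (\<lambda>ij. c \<odot>\<^bsub>A\<^esub> X $$ ij)),
      star = (\<lambda>X. mat n n (\<lambda>(i, j). star A (X $$ (j, i)))),
      anorm = N\<rparr>"

text \<open>The C*-norm of \<open>M\<^sub>n(A)\<close>, which is the only norm turning this *-algebra into a C*-algebra.
  Since \<open>N\<close> is arbitrary off the carrier, uniqueness holds for the value \<open>N X\<close> rather than
  for \<open>N\<close>.\<close>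

definition matrix_norm :: "('a, 'm) cstar_scheme \<Rightarrow> nat \<Rightarrow> 'a mat \<Rightarrow> real" where
  "matrix_norm A n X =
     (THE r. \<exists>N. unital_cstar_algebra (matrix_algebra_with A n N) \<and> r = N X)"

definition matrix_algebra :: "('a, 'm) cstar_scheme \<Rightarrow> nat \<Rightarrow> 'a mat cstar" where
  "matrix_algebra A n = matrix_algebra_with A n (matrix_norm A n)"

definition complex_cstar :: "complex cstar" where
  "complex_cstar = \<lparr>carrier = UNIV, mult = (*), one = 1, zero = 0, add = (+),
     smult = (*), star = cnj, anorm = cmod\<rparr>"

abbreviation complex_matrices :: "nat \<Rightarrow> complex mat cstar" where
  "complex_matrices n \<equiv> matrix_algebra complex_cstar n"

section \<open>Noncommutative *-polynomials\<close>

text \<open>*-polynomials are the finitely supported functions from words in the letters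
  \<open>z\<^sub>i, z\<^sub>i\<^sup>*\<close> to the complex numbers. The elements of \<open>M\<^sub>n(\<complex>\<langle>z,z\<^sup>*\<rangle>)\<close> are matrices with such
  entries.\<close>

datatype 'd letter = Z 'd | ZStar 'd

type_synonym 'd star_poly = "'d letter list \<Rightarrow>\<^sub>0 complex"

definition degree_le_one :: "'d star_poly \<Rightarrow> bool" where
  "degree_le_one p \<longleftrightarrow> (\<forall>w \<in> Poly_Mapping.keys p. length w \<le> 1)"

primrec eval_letter :: "('a, 'm) cstar_scheme \<Rightarrow> ('d \<Rightarrow> 'a) \<Rightarrow> 'd letter \<Rightarrow> 'a" where
  "eval_letter A X (Z i) = X i"
| "eval_letter A X (ZStar i) = star A (X i)"

primrec eval_word :: "('a, 'm) cstar_scheme \<Rightarrow> ('d \<Rightarrow> 'a) \<Rightarrow> 'd letter list \<Rightarrow> 'a" where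
  "eval_word A X [] = \<one>\<^bsub>A\<^esub>"
| "eval_word A X (l # w) = eval_letter A X l \<otimes>\<^bsub>A\<^esub> eval_word A X w"

definition eval_poly :: "('a, 'm) cstar_scheme \<Rightarrow> ('d \<Rightarrow> 'a) \<Rightarrow> 'd star_poly \<Rightarrow> 'a" where
  "eval_poly A X p =
     (\<Oplus>\<^bsub>A\<^esub>w\<in>Poly_Mapping.keys p. Poly_Mapping.lookup p w \<odot>\<^bsub>A\<^esub> eval_word A X w)"

abbreviation eval_poly_mat ::
  "('a, 'm) cstar_scheme \<Rightarrow> ('d \<Rightarrow> 'a) \<Rightarrow> 'd star_poly mat \<Rightarrow> 'a mat" where
  "eval_poly_mat A X p \<equiv> map_mat (eval_poly A X) p"

section \<open>Hilbert spaces and bounded operators\<close>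

text \<open>The fields \<^const>\<open>mult\<close> and \<^const>\<open>one\<close> inherited from the ring record play no role.
  The inner product is linear in its first argument.\<close>

record 'h inner_product_space = "(complex, 'h) module" +
  ip :: "'h \<Rightarrow> 'h \<Rightarrow> complex"

definition hnorm :: "('h, 'm) inner_product_space_scheme \<Rightarrow> 'h \<Rightarrow> real" where
  "hnorm H x = sqrt (Re (ip H x x))"

locale complex_hilbert_space = module complex_ring H
  for H :: "('h, 'm) inner_product_space_scheme" (structure) +
  assumes ip_add: "\<lbrakk>x \<in> carrier H; y \<in> carrier H; z \<in> carrier H\<rbrakk>
      \<Longrightarrow> ip H (x \<oplus> y) z = ip H x z + ip H y z"
    and ip_smult: "\<lbrakk>x \<in> carrier H; y \<in> carrier H\<rbrakk> \<Longrightarrow> ip H (c \<odot> x) y = c * ip H x y"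
    and ip_cnj: "\<lbrakk>x \<in> carrier H; y \<in> carrier H\<rbrakk> \<Longrightarrow> ip H y x = cnj (ip H x y)"
    and ip_nonneg: "x \<in> carrier H \<Longrightarrow> 0 \<le> Re (ip H x x)"
    and ip_eq_zero: "x \<in> carrier H \<Longrightarrow> ip H x x = 0 \<Longrightarrow> x = \<zero>"
    and complete:
      "\<lbrakk>\<And>k. s k \<in> carrier H; \<And>e. e > 0 \<Longrightarrow> \<exists>N. \<forall>k\<ge>N. \<forall>l\<ge>N. hnorm H (s k \<ominus> s l) < e\<rbrakk>
        \<Longrightarrow> \<exists>x \<in> carrier H. (\<lambda>k. hnorm H (s k \<ominus> x)) \<longlonglongrightarrow> 0"

definition bounded_operator ::
  "('h, 'm) inner_product_space_scheme \<Rightarrow> ('h \<Rightarrow> 'h) \<Rightarrow> bool" where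
  "bounded_operator H T \<longleftrightarrow> T \<in> carrier H \<rightarrow>\<^sub>E carrier H \<and>
     (\<forall>x\<in>carrier H. \<forall>y\<in>carrier H. T (x \<oplus>\<^bsub>H\<^esub> y) = T x \<oplus>\<^bsub>H\<^esub> T y) \<and>
     (\<forall>c. \<forall>x\<in>carrier H. T (c \<odot>\<^bsub>H\<^esub> x) = c \<odot>\<^bsub>H\<^esub> T x) \<and>
     (\<exists>C. \<forall>x\<in>carrier H. hnorm H (T x) \<le> C * hnorm H x)"

definition adjoint_operator ::
  "('h, 'm) inner_product_space_scheme \<Rightarrow> ('h \<Rightarrow> 'h) \<Rightarrow> 'h \<Rightarrow> 'h" where
  "adjoint_operator H T =
     (\<lambda>y\<in>carrier H. THE z. z \<in> carrier H \<and> (\<forall>x\<in>carrier H. ip H (T x) y = ip H x z))"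

text \<open>\<open>B(H)\<close>; operators are extensional functions on the carrier.\<close>

definition bounded_operators ::
  "('h, 'm) inner_product_space_scheme \<Rightarrow> ('h \<Rightarrow> 'h) cstar" where
  "bounded_operators H =
     \<lparr>carrier = {T. bounded_operator H T},
      mult = (\<lambda>S T. compose (carrier H) S T),
      one = (\<lambda>x\<in>carrier H. x),
      zero = (\<lambda>x\<in>carrier H. \<zero>\<^bsub>H\<^esub>),
      add = (\<lambda>S T. \<lambda>x\<in>carrier H. S x \<oplus>\<^bsub>H\<^esub> T x),
      smult = (\<lambda>c T. \<lambda>x\<in>carrier H. c \<odot>\<^bsub>H\<^esub> T x),
      star = adjoint_operator H,
      anorm = (\<lambda>T. Sup {hnorm H (T x) |x. x \<in> carrier H \<and> hnorm H x \<le> 1})\<rparr>"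

definition faithful_representation ::
  "('a, 'm) cstar_scheme \<Rightarrow> ('h, 'n) inner_product_space_scheme \<Rightarrow> ('a \<Rightarrow> 'h \<Rightarrow> 'h) \<Rightarrow> bool" where
  "faithful_representation A H \<pi> \<longleftrightarrow>
     unital_star_hom A (bounded_operators H) \<pi> \<and> inj_on \<pi> (carrier A)"

section \<open>Matrix ranges\<close>

definition ucp :: "('a, 'm) cstar_scheme \<Rightarrow> ('b, 'n) cstar_scheme \<Rightarrow> ('a \<Rightarrow> 'b) set" where
  "ucp A B = {\<phi> \<in> carrier A \<rightarrow> carrier B.
     (\<forall>x\<in>carrier A. \<forall>y\<in>carrier A. \<phi> (x \<oplus>\<^bsub>A\<^esub> y) = \<phi> x \<oplus>\<^bsub>B\<^esub> \<phi> y) \<and>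
     (\<forall>c. \<forall>x\<in>carrier A. \<phi> (c \<odot>\<^bsub>A\<^esub> x) = c \<odot>\<^bsub>B\<^esub> \<phi> x) \<and>
     \<phi> \<one>\<^bsub>A\<^esub> = \<one>\<^bsub>B\<^esub> \<and>
     (\<forall>k\<ge>1. \<forall>X \<in> positive_elements (matrix_algebra A k).
        map_mat \<phi> X \<in> positive_elements (matrix_algebra B k))}"

text \<open>The matrix range of a tuple of operators on \<open>H\<close>. For a tuple in an abstract C*-algebra one takes
  the matrix range of its image under an arbitrary faithful representation.\<close>

definition matrix_range ::
  "('h, 'm) inner_product_space_scheme \<Rightarrow> nat \<Rightarrow> ('d \<Rightarrow> 'h \<Rightarrow> 'h) \<Rightarrow> ('d \<Rightarrow> complex mat) set" where
  "matrix_range H n X = {(\<lambda>i. \<phi> (X i)) |\<phi>. \<phi> \<in> ucp (bounded_operators H) (complex_matrices n)}"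

definition tuple_norm :: "('a, 'm) cstar_scheme \<Rightarrow> ('d::finite \<Rightarrow> 'a) \<Rightarrow> real" where
  "tuple_norm A X = sqrt (anorm A (\<Oplus>\<^bsub>A\<^esub>i\<in>UNIV. X i \<otimes>\<^bsub>A\<^esub> star A (X i)))"

definition tuple_dist :: "('a, 'm) cstar_scheme \<Rightarrow> ('d::finite \<Rightarrow> 'a) \<Rightarrow> ('d \<Rightarrow> 'a) \<Rightarrow> real" where
  "tuple_dist A X Y = tuple_norm A (\<lambda>i. X i \<ominus>\<^bsub>A\<^esub> Y i)"

text \<open>Meant for nonempty compact sets, where all suprema and infima are over nonempty bounded sets.\<close>

definition hausdorff_dist :: "('b \<Rightarrow> 'b \<Rightarrow> real) \<Rightarrow> 'b set \<Rightarrow> 'b set \<Rightarrow> real" where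
  "hausdorff_dist \<delta> E F =
     max (SUP x\<in>E. INF y\<in>F. \<delta> x y) (SUP y\<in>F. INF x\<in>E. \<delta> y x)"

section \<open>Convergence of a family of tuples\<close>

definition poly_norms_converge ::
  "('t::metric_space \<Rightarrow> 'a cstar) \<Rightarrow> ('t \<Rightarrow> 'd::finite \<Rightarrow> 'a) \<Rightarrow> 't \<Rightarrow> bool" where
  "poly_norms_converge A \<xi> t0 \<longleftrightarrow>
     (\<forall>p :: 'd star_poly.
        ((\<lambda>t. anorm (A t) (eval_poly (A t) (\<xi> t) p))
          \<longlongrightarrow> anorm (A t0) (eval_poly (A t0) (\<xi> t0) p)) (at t0))"

definition matrix_poly_norms_converge ::
  "('t::metric_space \<Rightarrow> 'a cstar) \<Rightarrow> ('t \<Rightarrow> 'd::finite \<Rightarrow> 'a) \<Rightarrow> 't \<Rightarrow> bool" where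
  "matrix_poly_norms_converge A \<xi> t0 \<longleftrightarrow>
     (\<forall>n\<ge>1. \<forall>p :: 'd star_poly mat. p \<in> carrier_mat n n \<longrightarrow>
        ((\<lambda>t. matrix_norm (A t) n (eval_poly_mat (A t) (\<xi> t) p))
          \<longlongrightarrow> matrix_norm (A t0) n (eval_poly_mat (A t0) (\<xi> t0) p)) (at t0))"

definition linear_matrix_poly_norms_converge ::
  "('t::metric_space \<Rightarrow> 'a cstar) \<Rightarrow> ('t \<Rightarrow> 'd::finite \<Rightarrow> 'a) \<Rightarrow> 't \<Rightarrow> bool" where
  "linear_matrix_poly_norms_converge A \<xi> t0 \<longleftrightarrow>
     (\<forall>n\<ge>1. \<forall>p :: 'd star_poly mat. p \<in> carrier_mat n n \<and> (\<forall>q\<in>elements_mat p. degree_le_one q) \<longrightarrow>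
        ((\<lambda>t. matrix_norm (A t) n (eval_poly_mat (A t) (\<xi> t) p))
          \<longlongrightarrow> matrix_norm (A t0) n (eval_poly_mat (A t0) (\<xi> t0) p)) (at t0))"

definition matrix_ranges_converge ::
  "('t::metric_space \<Rightarrow> 'h inner_product_space) \<Rightarrow> ('t \<Rightarrow> 'd::finite \<Rightarrow> 'h \<Rightarrow> 'h) \<Rightarrow> 't \<Rightarrow> bool" where
  "matrix_ranges_converge H X t0 \<longleftrightarrow>
     (\<forall>n\<ge>1. ((\<lambda>t. hausdorff_dist (tuple_dist (complex_matrices n))
                (matrix_range (H t) n (X t)) (matrix_range (H t0) n (X t0))) \<longlongrightarrow> 0) (at t0))"

end

theory Submission
  imports Defs
begin

text \<open>
  For an abstract C*-algebra and a faithful representation, the norm of \<open>a\<close> is the least bound of the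
  representing operator. This rests on square roots: for self-adjoint \<open>x\<close> with norm at most \<open>1\<close>, the
  iteration \<open>y \<mapsto> (x + y\<^sup>2) / 2\<close> converges to \<open>1 - sqrt (1 - x)\<close>, with a rate that does not depend on
  the algebra. Applied to matrices over the algebras, all norms become norms of forms on powers of the
  Hilbert space.

  (i) implies (ii): let \<open>x = P\<^sup>* P\<close> and let \<open>y\<^sub>m\<close> be the iterates for \<open>x\<close>. If the norm of \<open>P(\<xi>\<^sub>t)\<close> is at most \<open>1\<close>,
  then the polynomial \<open>1 - x - (1 - y\<^sub>m)\<^sup>2\<close> has small norm at \<open>t\<close>, uniformly in \<open>t\<close>; conversely, smallness of
  this polynomial bounds \<open>P\<^sup>* P\<close> by nearly \<open>1\<close>. Smallness can be tested on the matrix entries, to which (i)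
  applies.

  (iv) implies (iii): the norm of an \<open>N \<times> N\<close> pencil \<open>P(\<xi>)\<close> is approximated on the span of \<open>2N\<close> vectors of \<open>H\<close>,
  so it is the supremum of the norms of \<open>P(X)\<close> over \<open>X\<close> in the first \<open>2N\<close> levels of the matrix range; it is
  an upper bound because UCP maps are completely contractive.

  (iii) implies (iv): if \<open>X\<close> is far from level \<open>n\<close> of the matrix range of \<open>\<xi>\<close>, then \<open>(1, X)\<close> is far from the convex
  cone of the tuples \<open>\<Sum>\<^sub>c V\<^sub>c\<^sup>* (1, \<xi>) V\<^sub>c\<close>. A separating functional is a self-adjoint pencil whose norm at \<open>\<xi>\<close> is
  smaller than at \<open>X\<close>. Such functionals may be taken from a compact set, and (iii) for a finite net
  gives uniformity.
\<close>

section \<open>Representations on inner product spaces\<close>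

text \<open>\<open>matrix_norm\<close> is a definite description, so before any matrix norm can be
  computed it must be known that every C*-norm on a represented *-algebra is the operator bound. The
  square root iteration takes the place of spectral theory there. Because its error is one scalar
  sequence for all algebras, it serves a second time in (i) implies (ii): for a fixed index the
  defect is a single *-polynomial, the same for all t, and (i) controls its norms. Iterating until
  convergence would not produce a polynomial.

  In (iii) implies (iv) the difficulty is that the separating functional depends on t and on X,
  while (iii) speaks about one pencil at a time. The functionals are confined to a ball whose radius
  depends only on n and on a common bound K for the generators near t0; K itself comes from (iii)
  for the pencils z_i. On this ball the norms at t are Lipschitz in the functional, with a constant
  depending on n, d and K but not on t. The cone is not known to be closed, so the separation is
  approximate, with errors chosen in advance.\<close>

lemma complex_ring_simps [simp]:
  "carrier complex_ring = UNIV" "(x \<otimes>\<^bsub>complex_ring\<^esub> y) = x * y" "\<one>\<^bsub>complex_ring\<^esub> = 1"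
  "(x \<oplus>\<^bsub>complex_ring\<^esub> y) = x + y" "\<zero>\<^bsub>complex_ring\<^esub> = 0"
  by (simp_all add: complex_ring_def)

lemma cring_complex_ring: "cring complex_ring"
proof (intro cringI abelian_groupI comm_monoidI)
  fix x :: complex
  show "\<exists>y\<in>carrier complex_ring. y \<oplus>\<^bsub>complex_ring\<^esub> x = \<zero>\<^bsub>complex_ring\<^esub>"
    by (rule bexI[of _ "-x"]) auto
qed (auto simp: algebra_simps)

text \<open>The form may be degenerate. In the coordinate spaces \<open>vpow n V\<close> below,
  functions are unconstrained from \<open>n\<close> on, so distinct functions can be at distance
  zero. Equality of vectors is therefore replaced by equality of inner products.\<close>

locale ip_space =
  fixes V :: "'v set" and ip :: "'v \<Rightarrow> 'v \<Rightarrow> complex"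
    and vzero :: 'v and vadd :: "'v \<Rightarrow> 'v \<Rightarrow> 'v" and vscale :: "complex \<Rightarrow> 'v \<Rightarrow> 'v"
  assumes vzero_closed [simp]: "vzero \<in> V"
    and vadd_closed [simp]: "\<lbrakk>x \<in> V; y \<in> V\<rbrakk> \<Longrightarrow> vadd x y \<in> V"
    and vscale_closed [simp]: "x \<in> V \<Longrightarrow> vscale c x \<in> V"
    and ip_vzero [simp]: "y \<in> V \<Longrightarrow> ip vzero y = 0"
    and ip_vadd [simp]: "\<lbrakk>x \<in> V; y \<in> V; z \<in> V\<rbrakk> \<Longrightarrow> ip (vadd x y) z = ip x z + ip y z"
    and ip_vscale [simp]: "\<lbrakk>x \<in> V; y \<in> V\<rbrakk> \<Longrightarrow> ip (vscale c x) y = c * ip x y"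
    and ip_commute: "\<lbrakk>x \<in> V; y \<in> V\<rbrakk> \<Longrightarrow> ip y x = cnj (ip x y)"
    and ip_self_nonneg: "x \<in> V \<Longrightarrow> 0 \<le> Re (ip x x)"
begin

definition sq :: "'v \<Rightarrow> real" where "sq x = Re (ip x x)"

lemma ip_vzero_right [simp]: "y \<in> V \<Longrightarrow> ip y vzero = 0"
  using ip_commute[of vzero y] by simp

lemma ip_vadd_right [simp]:
  "\<lbrakk>x \<in> V; y \<in> V; z \<in> V\<rbrakk> \<Longrightarrow> ip z (vadd x y) = ip z x + ip z y"
  using ip_commute[of "vadd x y" z] ip_commute[of x z] ip_commute[of y z] by simp

lemma ip_vscale_right [simp]:
  "\<lbrakk>x \<in> V; y \<in> V\<rbrakk> \<Longrightarrow> ip y (vscale c x) = cnj c * ip y x"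
  using ip_commute[of "vscale c x" y] ip_commute[of x y] by simp

lemma sq_nonneg [simp]: "x \<in> V \<Longrightarrow> 0 \<le> sq x"
  by (simp add: sq_def ip_self_nonneg)

lemma ip_self: "x \<in> V \<Longrightarrow> ip x x = complex_of_real (sq x)"
  using ip_commute[of x x] by (simp add: sq_def complex_eq_iff)

lemma sq_vzero [simp]: "sq vzero = 0"
  by (simp add: sq_def)

lemma sq_vscale [simp]: "x \<in> V \<Longrightarrow> sq (vscale c x) = (cmod c)\<^sup>2 * sq x"
proof -
  assume x: "x \<in> V"
  have "ip (vscale c x) (vscale c x) = (c * cnj c) * ip x x"
    using x by simp
  also have "\<dots> = complex_of_real ((cmod c)\<^sup>2 * sq x)"
    using x by (simp add: ip_self complex_norm_square del: of_real_power)
  finally show ?thesis by (simp add: sq_def)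
qed

lemma sq_vadd:
  assumes "x \<in> V" "y \<in> V"
  shows "sq (vadd x y) = sq x + 2 * Re (ip x y) + sq y"
  using assms ip_commute[of x y] by (simp add: sq_def)

text \<open>Expanding the square of x - t <x,y> y gives a polynomial in the real number t. If
  \<open>sq y = 0\<close> it is affine and bounded below, so its slope vanishes; otherwise t = 1 /
  \<open>sq y\<close> is its minimum.\<close>

lemma Cauchy_Schwarz:
  assumes x: "x \<in> V" and y: "y \<in> V"
  shows "(cmod (ip x y))\<^sup>2 \<le> sq x * sq y"
proof -
  define s where "s = (cmod (ip x y))\<^sup>2"
  have ineq: "0 \<le> sq x - 2 * t * s + t\<^sup>2 * s * sq y" for t :: real
  proof -
    define c where "c = - complex_of_real t * ip x y"
    have "0 \<le> sq (vadd x (vscale c y))" using x y by simp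
    also have "\<dots> = sq x + 2 * Re (cnj c * ip x y) + (cmod c)\<^sup>2 * sq y"
      using x y by (simp add: sq_vadd)
    also have "cnj c * ip x y = - complex_of_real t * complex_of_real s"
      unfolding s_def c_def complex_norm_square by (simp add: mult_ac)
    also have "(cmod c)\<^sup>2 = t\<^sup>2 * s"
      by (simp add: c_def s_def norm_mult power_mult_distrib)
    finally show ?thesis by simp
  qed
  have s0: "0 \<le> s" by (simp add: s_def)
  show ?thesis
  proof (cases "sq y = 0")
    case True
    have "s = 0"
    proof (rule ccontr)
      assume "s \<noteq> 0"
      then have "s > 0" using s0 by simp
      then show False using ineq[of "(sq x + 1) / (2 * s)"] True by (simp add: field_simps)
    qed
    then show ?thesis using True by (simp add: s_def)
  next
    case False
    then have "sq y > 0" using sq_nonneg[OF y] by linarith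
    then show ?thesis using ineq[of "1 / sq y"] by (simp add: s_def field_simps power2_eq_square)
  qed
qed

lemma cmod_ip_le: "\<lbrakk>x \<in> V; y \<in> V\<rbrakk> \<Longrightarrow> cmod (ip x y) \<le> sqrt (sq x) * sqrt (sq y)"
  using Cauchy_Schwarz[of x y] by (metis real_le_rsqrt real_sqrt_mult)

lemma sqrt_sq_vadd:
  assumes "x \<in> V" "y \<in> V"
  shows "sqrt (sq (vadd x y)) \<le> sqrt (sq x) + sqrt (sq y)"
proof (rule real_le_lsqrt)
  have "Re (ip x y) \<le> sqrt (sq x) * sqrt (sq y)"
    using cmod_ip_le[OF assms] complex_Re_le_cmod[of "ip x y"] by linarith
  then show "sq (vadd x y) \<le> (sqrt (sq x) + sqrt (sq y))\<^sup>2"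
    using assms by (simp add: sq_vadd power2_sum)
qed (use assms in auto)

lemma ip_self_zero_imp: "\<lbrakk>x \<in> V; y \<in> V; sq x = 0\<rbrakk> \<Longrightarrow> ip x y = 0"
  using Cauchy_Schwarz[of x y] by simp

text \<open>The locale has no laws of addition, so the bracketing is fixed by recursion. What is
  used of the sum is its membership in \<open>V\<close> and its inner products.\<close>

primrec vsum :: "nat \<Rightarrow> (nat \<Rightarrow> 'v) \<Rightarrow> 'v" where
  "vsum 0 f = vzero"
| "vsum (Suc n) f = vadd (vsum n f) (f n)"

lemma vsum_closed [simp]: "(\<And>i. i < n \<Longrightarrow> f i \<in> V) \<Longrightarrow> vsum n f \<in> V"
  by (induction n) auto

lemma ip_vsum: "\<lbrakk>\<And>i. i < n \<Longrightarrow> f i \<in> V; z \<in> V\<rbrakk> \<Longrightarrow> ip (vsum n f) z = (\<Sum>i<n. ip (f i) z)"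
  by (induction n) auto

lemma ip_vsum_right:
  "\<lbrakk>\<And>i. i < n \<Longrightarrow> f i \<in> V; z \<in> V\<rbrakk> \<Longrightarrow> ip z (vsum n f) = (\<Sum>i<n. ip z (f i))"
  by (induction n) auto

end

text \<open>The action is only constrained through the forms \<open>ip (act a x) y\<close>, so that neither definiteness of \<open>ip\<close>
  nor vector space axioms for \<open>V\<close> are needed, and faithfulness is injectivity of \<open>a \<mapsto> ip (act a \<cdot>) \<cdot>\<close>.\<close>

locale star_rep = ip_space V ip vzero vadd vscale
  for A :: "('a, 'm) cstar_scheme" (structure)
    and V :: "'v set" and ip vzero vadd vscale +
  fixes act :: "'a \<Rightarrow> 'v \<Rightarrow> 'v"
  assumes sr_add: "\<lbrakk>a \<in> carrier A; b \<in> carrier A\<rbrakk> \<Longrightarrow> a \<oplus> b \<in> carrier A"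
    and sr_mult: "\<lbrakk>a \<in> carrier A; b \<in> carrier A\<rbrakk> \<Longrightarrow> a \<otimes> b \<in> carrier A"
    and sr_zero: "\<zero> \<in> carrier A"
    and sr_one: "\<one> \<in> carrier A"
    and sr_smult: "a \<in> carrier A \<Longrightarrow> c \<odot> a \<in> carrier A"
    and sr_star [simp]: "a \<in> carrier A \<Longrightarrow> star A a \<in> carrier A"
    and act_closed [simp]: "\<lbrakk>a \<in> carrier A; x \<in> V\<rbrakk> \<Longrightarrow> act a x \<in> V"
    and act_add [simp]: "\<lbrakk>a \<in> carrier A; b \<in> carrier A; x \<in> V; y \<in> V\<rbrakk>
        \<Longrightarrow> ip (act (a \<oplus> b) x) y = ip (act a x) y + ip (act b x) y"
    and act_mult: "\<lbrakk>a \<in> carrier A; b \<in> carrier A; x \<in> V; y \<in> V\<rbrakk>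
        \<Longrightarrow> ip (act (a \<otimes> b) x) y = ip (act a (act b x)) y"
    and act_zero [simp]: "\<lbrakk>x \<in> V; y \<in> V\<rbrakk> \<Longrightarrow> ip (act \<zero> x) y = 0"
    and act_one [simp]: "\<lbrakk>x \<in> V; y \<in> V\<rbrakk> \<Longrightarrow> ip (act \<one> x) y = ip x y"
    and act_smult [simp]: "\<lbrakk>a \<in> carrier A; x \<in> V; y \<in> V\<rbrakk>
        \<Longrightarrow> ip (act (c \<odot> a) x) y = c * ip (act a x) y"
    and act_star: "\<lbrakk>a \<in> carrier A; x \<in> V; y \<in> V\<rbrakk>
        \<Longrightarrow> ip (act (star A a) x) y = ip x (act a y)"
    and act_faithful: "\<lbrakk>a \<in> carrier A; b \<in> carrier A;
        \<And>x y. \<lbrakk>x \<in> V; y \<in> V\<rbrakk> \<Longrightarrow> ip (act a x) y = ip (act b x) y\<rbrakk> \<Longrightarrow> a = b"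
begin

lemma act_mult': "\<lbrakk>a \<in> carrier A; b \<in> carrier A; x \<in> V; y \<in> V\<rbrakk>
        \<Longrightarrow> ip (act (a \<otimes> b) x) y = ip (act b x) (act (star A a) y)"
  by (metis act_mult act_star act_closed ip_commute sr_star)

lemma ip_act_commute: "\<lbrakk>a \<in> carrier A; x \<in> V; y \<in> V\<rbrakk>
        \<Longrightarrow> ip (act (star A a) x) y = cnj (ip (act a y) x)"
  by (metis act_star act_closed ip_commute)

lemma act_swap: "\<lbrakk>a \<in> carrier A; x \<in> V; y \<in> V\<rbrakk>
        \<Longrightarrow> ip (act a x) y = ip x (act (star A a) y)"
  by (metis act_star act_closed ip_commute sr_star)

lemma act_mult_right: "\<lbrakk>a \<in> carrier A; b \<in> carrier A; x \<in> V; y \<in> V\<rbrakk>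
        \<Longrightarrow> ip x (act (a \<otimes> b) y) = ip x (act a (act b y))"
  by (metis act_mult act_closed ip_commute sr_mult)

text \<open>Each law holds for the forms, and faithfulness lifts it to \<open>A\<close>. Matrix
  algebras get their algebraic structure in this way: only forms have to be computed.\<close>

lemma is_module_ring: "module complex_ring A \<and> ring A"
proof -
  have ag: "abelian_group A"
  proof (rule abelian_groupI)
    fix x assume x: "x \<in> carrier A"
    show "\<exists>y\<in>carrier A. y \<oplus> x = \<zero>"
      by (rule bexI[of _ "(-1) \<odot> x"], rule act_faithful) (use x sr_add sr_smult sr_zero in auto)
  qed (auto intro!: act_faithful simp: sr_add sr_zero)
  have "module complex_ring A"
    by (rule moduleI[OF cring_complex_ring ag])
       (auto intro!: act_faithful simp: sr_smult sr_add algebra_simps)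
  moreover have "ring A"
  proof (rule ringI[OF ag])
    show "Group.monoid A"
    proof (rule monoidI)
      fix a b c assume abc: "a \<in> carrier A" "b \<in> carrier A" "c \<in> carrier A"
      \<comment> \<open>\<open>act_mult\<close> identifies vectors only up to inner products, so it
        cannot rewrite below \<open>act a\<close>. Moving \<open>a\<close> to the second argument
        exposes an inner product again.\<close>
      show "a \<otimes> b \<otimes> c = a \<otimes> (b \<otimes> c)"
        by (rule act_faithful) (use abc in \<open>simp_all add: sr_mult act_mult act_swap[of a]\<close>)
    next
      fix a assume a: "a \<in> carrier A"
      show "a \<otimes> \<one> = a"
        by (rule act_faithful) (use a in \<open>simp_all add: sr_mult sr_one act_mult act_swap[of a]\<close>)
    qed (auto intro!: act_faithful simp: sr_mult sr_one act_mult)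
  next
    fix a b c assume abc: "a \<in> carrier A" "b \<in> carrier A" "c \<in> carrier A"
    show "(a \<oplus> b) \<otimes> c = a \<otimes> c \<oplus> b \<otimes> c"
      by (rule act_faithful) (use abc in \<open>simp_all add: sr_add sr_mult act_mult\<close>)
    show "c \<otimes> (a \<oplus> b) = c \<otimes> a \<oplus> c \<otimes> b"
      by (rule act_faithful) (use abc in \<open>simp_all add: sr_add sr_mult act_mult act_swap[of c]\<close>)
  qed
  ultimately show ?thesis by blast
qed

end

sublocale star_rep \<subseteq> module complex_ring A
  using is_module_ring by blast

sublocale star_rep \<subseteq> ring A
  using is_module_ring by blast

context star_rep
begin

lemma smult_cl [simp]: "a \<in> carrier A \<Longrightarrow> c \<odot> a \<in> carrier A"
  by (rule sr_smult)

lemma star_star_rep [simp]: "a \<in> carrier A \<Longrightarrow> star A (star A a) = a"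
  by (rule act_faithful) (auto simp: ip_act_commute)

lemma star_add_rep [simp]:
  "\<lbrakk>a \<in> carrier A; b \<in> carrier A\<rbrakk> \<Longrightarrow> star A (a \<oplus> b) = star A a \<oplus> star A b"
  by (rule act_faithful) (auto simp: ip_act_commute)

lemma star_smult_rep [simp]: "a \<in> carrier A \<Longrightarrow> star A (c \<odot> a) = cnj c \<odot> star A a"
  by (rule act_faithful) (auto simp: ip_act_commute)

lemma star_mult_rep [simp]:
  "\<lbrakk>a \<in> carrier A; b \<in> carrier A\<rbrakk> \<Longrightarrow> star A (a \<otimes> b) = star A b \<otimes> star A a"
  by (rule act_faithful) (simp_all add: act_star act_mult act_mult_right)

lemma star_one_rep [simp]: "star A \<one> = \<one>"
proof (rule act_faithful)
  fix x y assume "x \<in> V" "y \<in> V"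
  then show "ip (act (star A \<one>) x) y = ip (act \<one> x) y"
    by (metis act_one act_star one_closed ip_commute act_closed)
qed simp_all

lemma star_zero_rep [simp]: "star A \<zero> = \<zero>"
  by (rule act_faithful) (auto simp: ip_act_commute)

lemma a_inv_eq: "a \<in> carrier A \<Longrightarrow> \<ominus> a = (-1) \<odot> a"
  by (rule minus_equality) (auto intro!: act_faithful)

lemma minus_rep: "\<lbrakk>a \<in> carrier A; b \<in> carrier A\<rbrakk> \<Longrightarrow> a \<ominus> b = a \<oplus> (-1) \<odot> b"
  by (simp add: a_minus_def a_inv_eq)

lemma act_minus [simp]: "\<lbrakk>a \<in> carrier A; b \<in> carrier A; x \<in> V; y \<in> V\<rbrakk>
    \<Longrightarrow> ip (act (a \<ominus> b) x) y = ip (act a x) y - ip (act b x) y"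
  by (simp add: minus_rep)

lemma smult_mult_left_rep: "\<lbrakk>a \<in> carrier A; b \<in> carrier A\<rbrakk> \<Longrightarrow> (c \<odot> a) \<otimes> b = c \<odot> (a \<otimes> b)"
  by (rule act_faithful) (auto simp: act_mult)

lemma smult_mult_right_rep: "\<lbrakk>a \<in> carrier A; b \<in> carrier A\<rbrakk> \<Longrightarrow> a \<otimes> (c \<odot> b) = c \<odot> (a \<otimes> b)"
  by (rule act_faithful) (simp_all add: act_mult act_swap[of a])

lemmas algebra_expand = l_distr r_distr smult_mult_left_rep smult_mult_right_rep minus_rep m_assoc

lemma act_finsum:
  assumes "finite I" "\<And>i. i \<in> I \<Longrightarrow> f i \<in> carrier A" "x \<in> V" "y \<in> V"
  shows "ip (act (\<Oplus>i\<in>I. f i) x) y = (\<Sum>i\<in>I. ip (act (f i) x) y)"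
  using assms(1,2)
proof (induction I rule: finite_induct)
  case (insert i I)
  then have "(\<Oplus>i\<in>insert i I. f i) = f i \<oplus> (\<Oplus>i\<in>I. f i)"
    by (intro finsum_insert) auto
  moreover have "(\<Oplus>i\<in>I. f i) \<in> carrier A"
    using insert by (intro finsum_closed) auto
  ultimately show ?case using insert assms(3,4) by simp
qed (use assms in simp)

section \<open>Operator bounds and positivity in terms of forms\<close>

definition bnd :: "'a \<Rightarrow> real \<Rightarrow> bool" where
  "bnd a C \<longleftrightarrow> 0 \<le> C \<and> (\<forall>x\<in>V. sq (act a x) \<le> C\<^sup>2 * sq x)"

definition form_pos :: "'a \<Rightarrow> bool" where
  "form_pos a \<longleftrightarrow> (\<forall>x\<in>V. Im (ip (act a x) x) = 0 \<and> 0 \<le> Re (ip (act a x) x))"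

lemma bnd_ip:
  assumes "a \<in> carrier A" "bnd a C" "x \<in> V" "y \<in> V"
  shows "cmod (ip (act a x) y) \<le> C * sqrt (sq x) * sqrt (sq y)"
proof -
  have "sqrt (sq (act a x)) \<le> sqrt (C\<^sup>2 * sq x)"
    using assms(2,3) unfolding bnd_def by (metis real_sqrt_le_mono)
  also have "\<dots> = C * sqrt (sq x)"
    using assms by (simp add: real_sqrt_mult bnd_def)
  finally have "sqrt (sq (act a x)) * sqrt (sq y) \<le> C * sqrt (sq x) * sqrt (sq y)"
    using assms by (simp add: mult_right_mono)
  then show ?thesis using cmod_ip_le[of "act a x" y] assms by simp
qed

text \<open>The choice y = a x turns the estimate into |a x|^2 \<le> C |x| |a x|, where one factor
  |a x| cancels unless it vanishes.\<close>

lemma bndI_ip: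
  assumes a: "a \<in> carrier A" and C: "0 \<le> C"
    and le: "\<And>x y. \<lbrakk>x \<in> V; y \<in> V\<rbrakk> \<Longrightarrow> cmod (ip (act a x) y) \<le> C * sqrt (sq x) * sqrt (sq y)"
  shows "bnd a C"
proof -
  have "sq (act a x) \<le> C\<^sup>2 * sq x" if x: "x \<in> V" for x
  proof (cases "sq (act a x) = 0")
    case True
    then show ?thesis using x by simp
  next
    case False
    define s where "s = sqrt (sq (act a x))"
    have s: "s > 0" "sq (act a x) = s * s" using False a x by (simp_all add: s_def less_le)
    have "cmod (ip (act a x) (act a x)) = s * s"
      using a x s by (simp add: ip_self norm_mult)
    then have "s * s \<le> C * sqrt (sq x) * s"
      using le[OF x act_closed[OF a x]] by (simp add: s_def)
    then have "s \<le> C * sqrt (sq x)" using s by simp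
    then have "s\<^sup>2 \<le> (C * sqrt (sq x))\<^sup>2" using s by (intro power_mono) auto
    then show ?thesis using s x by (simp add: power_mult_distrib power2_eq_square[of s])
  qed
  then show ?thesis using C by (simp add: bnd_def)
qed

lemma bnd_star:
  assumes a: "a \<in> carrier A" and b: "bnd a C"
  shows "bnd (star A a) C"
proof (rule bndI_ip)
  fix x y assume xy: "x \<in> V" "y \<in> V"
  have "cmod (ip (act (star A a) x) y) = cmod (ip (act a y) x)"
    using a xy by (simp add: ip_act_commute)
  also have "\<dots> \<le> C * sqrt (sq y) * sqrt (sq x)"
    using a b xy by (intro bnd_ip)
  finally show "cmod (ip (act (star A a) x) y) \<le> C * sqrt (sq x) * sqrt (sq y)"
    by (simp only: mult.assoc mult.commute[of "sqrt (sq y)"])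
qed (use assms in \<open>auto simp: bnd_def\<close>)

lemma bnd_mult:
  assumes "a \<in> carrier A" "b \<in> carrier A" "bnd a C" "bnd b D"
  shows "bnd (a \<otimes> b) (C * D)"
proof (rule bndI_ip)
  fix x y assume xy: "x \<in> V" "y \<in> V"
  have "cmod (ip (act (a \<otimes> b) x) y) \<le> C * sqrt (sq (act b x)) * sqrt (sq y)"
    using assms xy by (simp add: act_mult bnd_ip)
  also have "sqrt (sq (act b x)) \<le> D * sqrt (sq x)"
    using assms(4) xy unfolding bnd_def
    by (metis real_sqrt_le_mono real_sqrt_mult real_sqrt_unique)
  then have "C * sqrt (sq (act b x)) * sqrt (sq y) \<le> C * (D * sqrt (sq x)) * sqrt (sq y)"
    using assms(3) xy by (intro mult_right_mono mult_left_mono) (auto simp: bnd_def)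
  finally show "cmod (ip (act (a \<otimes> b) x) y) \<le> C * D * sqrt (sq x) * sqrt (sq y)"
    by (simp add: mult_ac)
qed (use assms in \<open>auto simp: bnd_def\<close>)

lemma bnd_add:
  assumes "a \<in> carrier A" "b \<in> carrier A" "bnd a C" "bnd b D"
  shows "bnd (a \<oplus> b) (C + D)"
proof (rule bndI_ip)
  fix x y assume xy: "x \<in> V" "y \<in> V"
  have "cmod (ip (act (a \<oplus> b) x) y) \<le> cmod (ip (act a x) y) + cmod (ip (act b x) y)"
    using assms xy by (simp add: norm_triangle_ineq)
  also have "\<dots> \<le> C * sqrt (sq x) * sqrt (sq y) + D * sqrt (sq x) * sqrt (sq y)"
    using assms xy by (intro add_mono bnd_ip) auto
  finally show "cmod (ip (act (a \<oplus> b) x) y) \<le> (C + D) * sqrt (sq x) * sqrt (sq y)"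
    by (simp add: algebra_simps)
qed (use assms in \<open>auto simp: bnd_def\<close>)

lemma bnd_smult:
  assumes "a \<in> carrier A" "bnd a C"
  shows "bnd (c \<odot> a) (cmod c * C)"
proof (rule bndI_ip)
  fix x y assume xy: "x \<in> V" "y \<in> V"
  show "cmod (ip (act (c \<odot> a) x) y) \<le> cmod c * C * sqrt (sq x) * sqrt (sq y)"
    using mult_left_mono[OF bnd_ip[OF assms xy], of "cmod c"] assms xy by (simp add: norm_mult mult_ac)
qed (use assms in \<open>auto simp: bnd_def\<close>)

lemma bnd_zero: "bnd \<zero> 0"
  by (rule bndI_ip) auto

lemma bnd_zero_imp: "\<lbrakk>a \<in> carrier A; bnd a 0\<rbrakk> \<Longrightarrow> a = \<zero>"
  using bnd_ip[of a 0] by (intro act_faithful) auto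

lemma bnd_mono: "\<lbrakk>bnd a C; C \<le> D\<rbrakk> \<Longrightarrow> bnd a D"
  unfolding bnd_def by (meson mult_right_mono order_trans power_mono sq_nonneg)

text \<open>The operator side of the C*-identity: the form of the product at (x, x) is |a
  x|^2.\<close>

lemma bnd_of_star_mult:
  assumes a: "a \<in> carrier A" and C: "0 \<le> C" and b: "bnd (star A a \<otimes> a) (C\<^sup>2)"
  shows "bnd a C"
  unfolding bnd_def
proof (intro conjI ballI)
  fix x assume x: "x \<in> V"
  have "ip (act (star A a \<otimes> a) x) x = complex_of_real (sq (act a x))"
    using a x by (simp add: act_mult act_star ip_self)
  then have "\<bar>sq (act a x)\<bar> \<le> C\<^sup>2 * sqrt (sq x) * sqrt (sq x)"
    using bnd_ip[OF _ b x x] a by (simp del: power2_eq_square)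
  then show "sq (act a x) \<le> C\<^sup>2 * sq x"
    using a x by (simp add: mult.assoc)
qed (rule C)

lemma form_pos_star_mult: "a \<in> carrier A \<Longrightarrow> form_pos (star A a \<otimes> a)"
  by (simp add: form_pos_def act_mult act_star ip_self)

text \<open>Polarization. The vanishing imaginary parts at x + y and at x + i y compare the
  imaginary and the real parts of <a x, y> and <a y, x>, so these two numbers are conjugate.\<close>

lemma form_pos_self_adjoint:
  assumes a: "a \<in> carrier A" and p: "form_pos a"
  shows "star A a = a"
proof (rule act_faithful)
  fix x y assume x: "x \<in> V" and y: "y \<in> V"
  let ?B = "\<lambda>x y. ip (act a x) y"
  have B: "?B (vadd x z) (vadd x z) = ?B x x + ?B z z + ?B x z + ?B z x" if "z \<in> V" for z
    using x that a by (simp add: act_swap[OF a] algebra_simps)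
  have s: "?B (vscale c y) z = c * ?B y z" if "z \<in> V" for c z
    using y that a by (simp add: act_swap[OF a])
  have im: "Im (?B z z) = 0" if "z \<in> V" for z using p that by (simp add: form_pos_def)
  have "Im (?B x y + ?B y x) = 0"
    using B[OF y] im[of "vadd x y"] im[OF x] im[OF y] x y by simp
  moreover have "Im (?B x (vscale \<i> y) + ?B (vscale \<i> y) x) = 0"
    using B[of "vscale \<i> y"] im[of "vadd x (vscale \<i> y)"] im[OF x] im[of "vscale \<i> y"] x y by simp
  then have "Re (?B y x) = Re (?B x y)"
    using x y a by (simp add: s)
  ultimately show "ip (act (star A a) x) y = ip (act a x) y"
    using a x y by (simp add: ip_act_commute complex_eq_iff)
qed (use a in auto)

text \<open>For self-adjoint operators the numerical radius bounds the norm: the forms at x + y and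
  x - y together with the parallelogram identity bound Re <a x, y>, and y is taken to be a multiple
  of a x. Division is by an arbitrary D > C, since C may be zero; D tends to C at the end.\<close>

lemma bnd_self_adjoint:
  assumes a: "a \<in> carrier A" and sa: "star A a = a" and C: "0 \<le> C"
    and le: "\<And>x. x \<in> V \<Longrightarrow> \<bar>Re (ip (act a x) x)\<bar> \<le> C * sq x"
  shows "bnd a C"
  unfolding bnd_def
proof (intro conjI ballI)
  fix x assume x: "x \<in> V"
  have swap: "ip (act a u) v = ip u (act a v)" if "u \<in> V" "v \<in> V" for u v
    using act_swap[OF a that] sa by metis
  have strict: "sq (act a x) \<le> D\<^sup>2 * sq x" if D: "D > C" for D
  proof -
    define y where "y = vscale (complex_of_real (1 / D)) (act a x)"
    have D0: "D > 0" using D C by linarith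
    have y: "y \<in> V" using a x by (simp add: y_def)
    have sqy: "sq y = sq (act a x) / D\<^sup>2"
      using a x D0 by (simp add: y_def norm_divide power_divide)
    have "ip (act a x) y = complex_of_real (sq (act a x) / D)"
      using a x by (simp add: y_def ip_self)
    then have re: "Re (ip (act a x) y) = sq (act a x) / D" by simp
    have re': "Re (ip (act a y) x) = sq (act a x) / D"
      using re ip_commute[of "act a x" y] swap[OF y x] a x y by simp
    have "Re (ip (act a (vadd x y)) (vadd x y)) \<le> C * sq (vadd x y)"
      using le[of "vadd x y"] x y by simp
    moreover have "- Re (ip (act a (vadd x (vscale (-1) y))) (vadd x (vscale (-1) y))) \<le> C * sq (vadd x (vscale (-1) y))"
      using le[of "vadd x (vscale (-1) y)"] x y by (simp del: ip_vadd ip_vadd_right)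
    ultimately have "2 * Re (ip (act a x) y) + 2 * Re (ip (act a y) x) \<le> C * (2 * sq x + 2 * sq y)"
      using a x y by (simp add: swap sq_vadd algebra_simps)
    then have "4 * sq (act a x) / D \<le> D * (2 * sq x + 2 * sq y)"
      using re re' mult_right_mono[of C D "2 * sq x + 2 * sq y"] D x y by simp
    then have "4 * sq (act a x) / D \<le> D * (2 * sq x) + 2 * sq (act a x) / D"
      using D0 by (simp add: sqy power2_eq_square algebra_simps)
    then show ?thesis using D0 by (simp add: field_simps power2_eq_square)
  qed
  show "sq (act a x) \<le> C\<^sup>2 * sq x"
  proof (rule tendsto_lowerbound)
    show "((\<lambda>D. D\<^sup>2 * sq x) \<longlongrightarrow> C\<^sup>2 * sq x) (at_right C)"
      by (intro tendsto_intros)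
    show "\<forall>\<^sub>F D in at_right C. sq (act a x) \<le> D\<^sup>2 * sq x"
      using eventually_at_right_less by (rule eventually_mono) (rule strict)
  qed simp
qed (rule C)

text \<open>Once the norm is the least operator bound, the norm laws and the C*-identity are facts
  about operators. What is left for each concrete algebra is nontriviality and completeness.\<close>

lemma cstar_algebraI:
  assumes N: "\<And>a C. a \<in> carrier A \<Longrightarrow> anorm A a \<le> C \<longleftrightarrow> bnd a C"
    and one: "\<one> \<noteq> \<zero>"
    and complete: "\<And>s. \<lbrakk>\<And>k. s k \<in> carrier A;
        \<And>e. e > 0 \<Longrightarrow> \<exists>N. \<forall>k\<ge>N. \<forall>l\<ge>N. anorm A (s k \<ominus> s l) < e\<rbrakk>
        \<Longrightarrow> \<exists>x \<in> carrier A. (\<lambda>k. anorm A (s k \<ominus> x)) \<longlonglongrightarrow> 0"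
  shows "unital_cstar_algebra A"
proof -
  have bN: "bnd a (anorm A a)" if "a \<in> carrier A" for a using N[OF that, of "anorm A a"] by simp
  have N0: "0 \<le> anorm A a" if "a \<in> carrier A" for a using bN[OF that] by (simp add: bnd_def)
  have sm: "anorm A (c \<odot> a) \<le> cmod c * anorm A a" if "a \<in> carrier A" for c a
    using N bnd_smult bN that by simp
  show ?thesis
  proof (intro unital_cstar_algebra.intro unital_cstar_algebra_axioms.intro)
    fix a assume a: "a \<in> carrier A"
    have "anorm A \<zero> = 0" using N0[of \<zero>] N[of \<zero> 0] bnd_zero by simp
    then show "(anorm A a = 0) = (a = \<zero>)" using bN[OF a] bnd_zero_imp[OF a] by auto
    show "anorm A (c \<odot> a) = cmod c * anorm A a" for c
    proof (cases "c = 0")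
      case True
      then show ?thesis using sm[OF a, of c] N0[of "c \<odot> a"] a by simp
    next
      case False
      have "(1 / c) \<odot> (c \<odot> a) = a"
        using a False by (intro act_faithful) auto
      then have "anorm A a \<le> cmod (1 / c) * anorm A (c \<odot> a)"
        using sm[of "c \<odot> a" "1 / c"] a by simp
      then have "cmod c * anorm A a \<le> anorm A (c \<odot> a)"
        using False by (simp add: norm_divide field_simps)
      then show ?thesis using sm[OF a, of c] by simp
    qed
    show "anorm A (star A a \<otimes> a) = (anorm A a)\<^sup>2"
    proof (rule antisym)
      define m where "m = star A a \<otimes> a"
      have m: "m \<in> carrier A" using a by (simp add: m_def)
      have "bnd m (anorm A a * anorm A a)"
        unfolding m_def using a by (intro bnd_mult bnd_star bN) auto
      then show "anorm A (star A a \<otimes> a) \<le> (anorm A a)\<^sup>2"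
        using N[OF m] by (simp add: m_def power2_eq_square)
      have "bnd a (sqrt (anorm A m))"
        by (rule bnd_of_star_mult) (use a bN[OF m] N0[OF m] in \<open>simp_all add: m_def\<close>)
      then have "anorm A a \<le> sqrt (anorm A m)" using N[OF a] by simp
      then have "(anorm A a)\<^sup>2 \<le> (sqrt (anorm A m))\<^sup>2"
        using N0[OF a] by (rule power_mono)
      then show "(anorm A a)\<^sup>2 \<le> anorm A (star A a \<otimes> a)"
        using N0[OF m] by (simp add: m_def)
    qed
  next
    fix a b assume ab: "a \<in> carrier A" "b \<in> carrier A"
    show "anorm A (a \<oplus> b) \<le> anorm A a + anorm A b"
      using ab bnd_add bN by (simp add: N)
    show "anorm A (a \<otimes> b) \<le> anorm A a * anorm A b"
      using ab bnd_mult bN by (simp add: N)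
  next
    show "\<exists>x\<in>carrier A. (\<lambda>k. anorm A (s k \<ominus> x)) \<longlonglongrightarrow> 0"
      if "\<And>k. s k \<in> carrier A" "\<And>e. e > 0 \<Longrightarrow> \<exists>N. \<forall>k\<ge>N. \<forall>l\<ge>N. anorm A (s k \<ominus> s l) < e" for s
      using that by (rule complete)
  next
    show "module complex_ring A" "ring A" using is_module_ring by auto
  qed (simp_all add: one smult_mult_left_rep smult_mult_right_rep)
qed

end

section \<open>Square roots and the norm of a faithful representation\<close>

text \<open>Iterates for the fixed point \<open>y = 1 - sqrt (1 - x)\<close> of \<open>y \<mapsto> (x + y\<^sup>2) / 2\<close>; the scalar sequence for
  \<open>x = 1\<close> majorizes the norms of the iterates and of their differences.\<close>

primrec sqrt_seq :: "('a, 'm) cstar_scheme \<Rightarrow> 'a \<Rightarrow> nat \<Rightarrow> 'a" where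
  "sqrt_seq A x 0 = \<zero>\<^bsub>A\<^esub>"
| "sqrt_seq A x (Suc n) = (1 / 2) \<odot>\<^bsub>A\<^esub> (x \<oplus>\<^bsub>A\<^esub> sqrt_seq A x n \<otimes>\<^bsub>A\<^esub> sqrt_seq A x n)"

primrec sqrt_bound :: "nat \<Rightarrow> real" where
  "sqrt_bound 0 = 0"
| "sqrt_bound (Suc n) = (1 + (sqrt_bound n)\<^sup>2) / 2"

lemma sqrt_bound_range: "0 \<le> sqrt_bound n \<and> sqrt_bound n \<le> 1"
  by (induction n) (auto simp: power_le_one)

text \<open>The increment is (1 - s)^2 / 2 for s = \<open>sqrt_bound n\<close>.\<close>

lemma sqrt_bound_le_Suc: "sqrt_bound n \<le> sqrt_bound (Suc n)"
  using sum_power2_ge_zero[of "1 - sqrt_bound n" 0] by (simp add: power2_diff)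

lemma Cauchy_sqrt_bound: "Cauchy sqrt_bound"
proof -
  have "incseq sqrt_bound"
    by (rule incseq_SucI) (rule sqrt_bound_le_Suc)
  then show ?thesis
    using sqrt_bound_range by (metis incseq_convergent convergentI convergent_Cauchy)
qed

text \<open>Norm and action are not related by assumption. That the norm is the least operator bound
  is proved below as \<open>anorm_le_iff\<close>.\<close>

locale cstar_rep = unital_cstar_algebra A + star_rep A V ip vzero vadd vscale act
  for A :: "('a, 'm) cstar_scheme" (structure)
    and V :: "'v set" and ip vzero vadd vscale act
begin

lemma anorm_zero [simp]: "anorm A \<zero> = 0"
  using norm_eq_zero by blast

lemma anorm_nonneg [simp]: "a \<in> carrier A \<Longrightarrow> 0 \<le> anorm A a"
proof -
  assume a: "a \<in> carrier A"
  have "a \<oplus> (-1) \<odot> a = \<zero>" using a by (intro act_faithful) auto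
  then show ?thesis using norm_triangle[of a "(-1) \<odot> a"] a by (simp add: norm_smult)
qed

lemma anorm_star [simp]: "a \<in> carrier A \<Longrightarrow> anorm A (star A a) = anorm A a"
proof -
  have le: "anorm A a \<le> anorm A (star A a)" if a: "a \<in> carrier A" for a
  proof (cases "anorm A a = 0")
    case False
    then have "anorm A a > 0" using anorm_nonneg[OF a] by linarith
    moreover have "anorm A a * anorm A a \<le> anorm A (star A a) * anorm A a"
      using cstar_identity[OF a] norm_mult[of "star A a" a] a by (simp add: power2_eq_square)
    ultimately show ?thesis by simp
  qed (use a in simp)
  assume "a \<in> carrier A"
  then show ?thesis using le[of a] le[of "star A a"] by simp
qed

lemma anorm_minus_le: "\<lbrakk>a \<in> carrier A; b \<in> carrier A\<rbrakk> \<Longrightarrow> anorm A (a \<ominus> b) \<le> anorm A a + anorm A b"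
  using norm_triangle[of a "(-1) \<odot> b"] by (simp add: minus_rep norm_smult)

lemma anorm_minus_commute: "\<lbrakk>a \<in> carrier A; b \<in> carrier A\<rbrakk> \<Longrightarrow> anorm A (a \<ominus> b) = anorm A (b \<ominus> a)"
proof -
  assume ab: "a \<in> carrier A" "b \<in> carrier A"
  have "a \<ominus> b = (-1) \<odot> (b \<ominus> a)" using ab by (intro act_faithful) auto
  then show ?thesis using ab by (simp add: norm_smult)
qed

lemma anorm_minus_triangle:
  assumes "a \<in> carrier A" "b \<in> carrier A" "c \<in> carrier A"
  shows "anorm A (a \<ominus> c) \<le> anorm A (a \<ominus> b) + anorm A (b \<ominus> c)"
proof -
  have "a \<ominus> c = (a \<ominus> b) \<oplus> (b \<ominus> c)" using assms by (intro act_faithful) auto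
  then show ?thesis using assms norm_triangle[of "a \<ominus> b" "b \<ominus> c"] by simp
qed

lemma anorm_square_diff:
  assumes a: "a \<in> carrier A" and b: "b \<in> carrier A"
  shows "anorm A (a \<otimes> a \<ominus> b \<otimes> b) \<le> (anorm A a + anorm A b) * anorm A (a \<ominus> b)"
proof -
  have "a \<otimes> a \<ominus> b \<otimes> b = a \<otimes> (a \<ominus> b) \<oplus> (a \<ominus> b) \<otimes> b"
    by (rule act_faithful) (use assms in \<open>simp_all add: algebra_expand algebra_simps\<close>)
  also have "anorm A \<dots> \<le> anorm A (a \<otimes> (a \<ominus> b)) + anorm A ((a \<ominus> b) \<otimes> b)"
    using assms by (intro norm_triangle) auto
  also have "\<dots> \<le> anorm A a * anorm A (a \<ominus> b) + anorm A (a \<ominus> b) * anorm A b"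
    using assms by (intro add_mono norm_mult) auto
  finally show ?thesis by (simp add: algebra_simps)
qed

context
  fixes x assumes x: "x \<in> carrier A" and x1: "anorm A x \<le> 1"
begin

lemma sqrt_seq_closed [simp]: "sqrt_seq A x n \<in> carrier A"
  by (induction n) (use x in auto)

lemma anorm_sqrt_seq: "anorm A (sqrt_seq A x n) \<le> sqrt_bound n"
proof (induction n)
  case (Suc n)
  have "anorm A (x \<oplus> sqrt_seq A x n \<otimes> sqrt_seq A x n)
      \<le> anorm A x + anorm A (sqrt_seq A x n \<otimes> sqrt_seq A x n)"
    using x by (intro norm_triangle) auto
  also have "\<dots> \<le> 1 + sqrt_bound n * sqrt_bound n"
    using x1 norm_mult[of "sqrt_seq A x n" "sqrt_seq A x n"]
      mult_mono[OF Suc Suc] sqrt_bound_range[of n] by simp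
  finally show ?case using x by (simp add: norm_smult power2_eq_square)
qed simp

text \<open>Successive differences are halves of differences of squares, which
  \<open>anorm_square_diff\<close> factors. The factors are bounded by the sum and the difference of
  two terms of the scalar sequence, whose half product is exactly its next increment.\<close>

lemma sqrt_seq_Suc_diff:
  "anorm A (sqrt_seq A x (Suc n) \<ominus> sqrt_seq A x n) \<le> sqrt_bound (Suc n) - sqrt_bound n"
proof (induction n)
  case 0
  have "sqrt_seq A x (Suc 0) \<ominus> sqrt_seq A x 0 = (1 / 2) \<odot> x"
    using x by (intro act_faithful) auto
  then show ?case using x x1 by (simp add: norm_smult)
next
  case (Suc n)
  let ?y = "sqrt_seq A x" and ?s = sqrt_bound
  have "?y (Suc (Suc n)) \<ominus> ?y (Suc n) = (1 / 2) \<odot> (?y (Suc n) \<otimes> ?y (Suc n) \<ominus> ?y n \<otimes> ?y n)"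
    using x by (subst sqrt_seq.simps(2), subst (3) sqrt_seq.simps(2), intro act_faithful)
      (simp_all del: sqrt_seq.simps add: algebra_simps)
  then have "anorm A (?y (Suc (Suc n)) \<ominus> ?y (Suc n))
      = anorm A (?y (Suc n) \<otimes> ?y (Suc n) \<ominus> ?y n \<otimes> ?y n) / 2"
    by (simp add: norm_smult del: sqrt_seq.simps)
  also have "\<dots> \<le> (anorm A (?y (Suc n)) + anorm A (?y n)) * anorm A (?y (Suc n) \<ominus> ?y n) / 2"
    using anorm_square_diff[of "?y (Suc n)" "?y n"] by (simp del: sqrt_seq.simps)
  also have "\<dots> \<le> (?s (Suc n) + ?s n) * (?s (Suc n) - ?s n) / 2"
    using Suc anorm_sqrt_seq[of n] anorm_sqrt_seq[of "Suc n"] sqrt_bound_range[of n]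
      sqrt_bound_range[of "Suc n"]
    by (intro divide_right_mono mult_mono) (auto simp del: sqrt_seq.simps sqrt_bound.simps)
  also have "\<dots> = ?s (Suc (Suc n)) - ?s (Suc n)"
    by (subst sqrt_bound.simps(2), subst (4) sqrt_bound.simps(2))
      (simp add: power2_eq_square field_simps del: sqrt_bound.simps)
  finally show ?case .
qed

lemma sqrt_seq_diff:
  "anorm A (sqrt_seq A x (n + m) \<ominus> sqrt_seq A x n) \<le> sqrt_bound (n + m) - sqrt_bound n"
proof (induction m)
  case 0
  have "sqrt_seq A x n \<ominus> sqrt_seq A x n = \<zero>"
    by (intro act_faithful) auto
  then show ?case by simp
next
  case (Suc m)
  then show ?case
    using sqrt_seq_Suc_diff[of "n + m"]
      anorm_minus_triangle[of "sqrt_seq A x (Suc (n + m))" "sqrt_seq A x (n + m)" "sqrt_seq A x n"]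
    by (simp del: sqrt_seq.simps sqrt_bound.simps)
qed

lemma sqrt_seq_limit:
  obtains y where "y \<in> carrier A" "(\<lambda>n. anorm A (sqrt_seq A x n \<ominus> y)) \<longlonglongrightarrow> 0"
proof -
  have "\<exists>N. \<forall>k\<ge>N. \<forall>l\<ge>N. anorm A (sqrt_seq A x k \<ominus> sqrt_seq A x l) < e" if "e > 0" for e
  proof -
    obtain N where N: "\<And>k l. \<lbrakk>k \<ge> N; l \<ge> N\<rbrakk> \<Longrightarrow> \<bar>sqrt_bound k - sqrt_bound l\<bar> < e"
      using metric_CauchyD[OF Cauchy_sqrt_bound \<open>e > 0\<close>] unfolding dist_real_def by blast
    have "anorm A (sqrt_seq A x k \<ominus> sqrt_seq A x l) < e" if "k \<ge> N" "l \<ge> N" for k l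
    proof (cases "l \<le> k")
      case True
      then show ?thesis using sqrt_seq_diff[of l "k - l"] N[OF that] by simp
    next
      case False
      then show ?thesis using sqrt_seq_diff[of k "l - k"] N[OF that]
          anorm_minus_commute[of "sqrt_seq A x k" "sqrt_seq A x l"] by simp
    qed
    then show ?thesis by blast
  qed
  then show ?thesis using complete[of "sqrt_seq A x"] that by auto
qed

lemma sqrt_seq_star: "star A x = x \<Longrightarrow> star A (sqrt_seq A x n) = sqrt_seq A x n"
  by (induction n) (use x in auto)

lemma sqrt_seq_commute:
  assumes z: "z \<in> carrier A" "z \<otimes> x = x \<otimes> z"
  shows "z \<otimes> sqrt_seq A x n = sqrt_seq A x n \<otimes> z"
proof (induction n)
  case (Suc n)
  let ?y = "sqrt_seq A x n"
  have "z \<otimes> (?y \<otimes> ?y) = (?y \<otimes> ?y) \<otimes> z"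
    using z Suc by (metis m_assoc sqrt_seq_closed)
  then show ?case using z x by (simp add: l_distr r_distr smult_mult_left smult_mult_right)
qed (use z in simp)

end

text \<open>The root is k = 1 - y with y the limit of the iterates. Two by-products matter later: k
  commutes with everything that commutes with x, and the bound on 1 - k allows the lemma to be
  applied again to 1 - k, which yields a root of k itself.\<close>

lemma sqrt_one_minus:
  assumes x: "x \<in> carrier A" and sa: "star A x = x" and x1: "anorm A x \<le> 1"
  obtains k where "k \<in> carrier A" "star A k = k" "k \<otimes> k = \<one> \<ominus> x"
    "anorm A (\<one> \<ominus> k) \<le> 1"
    "\<forall>z\<in>carrier A. z \<otimes> x = x \<otimes> z \<longrightarrow> z \<otimes> k = k \<otimes> z"
proof -
  let ?s = "sqrt_seq A x"
  obtain y where y: "y \<in> carrier A" and lim: "(\<lambda>n. anorm A (?s n \<ominus> y)) \<longlonglongrightarrow> 0"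
    using sqrt_seq_limit[OF x x1] .
  have s: "?s n \<in> carrier A" for n using x x1 by simp
  have eqI: "a = b" if ab: "a \<in> carrier A" "b \<in> carrier A"
    and f: "f \<longlonglongrightarrow> 0" and le: "\<And>n. anorm A (a \<ominus> b) \<le> f n" for a b and f :: "nat \<Rightarrow> real"
  proof -
    have "anorm A (a \<ominus> b) \<le> 0"
      by (rule LIMSEQ_le_const[OF f]) (use le in auto)
    then have "a \<ominus> b = \<zero>"
      using anorm_nonneg[OF minus_closed[OF ab]] norm_eq_zero[OF minus_closed[OF ab]] by linarith
    then show ?thesis
      using ab by (intro act_faithful) (metis act_minus act_zero right_minus_eq)+
  qed
  have sy: "star A y = y"
  proof (rule eqI)
    show "(\<lambda>n. 2 * anorm A (?s n \<ominus> y)) \<longlonglongrightarrow> 0"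
      using tendsto_mult_left[OF lim, of 2] by simp
    fix n
    have "star A y \<ominus> y = star A (y \<ominus> ?s n) \<oplus> (?s n \<ominus> y)"
      using y s[of n] sqrt_seq_star[OF x x1 sa, of n]
      by (intro act_faithful) (auto simp: minus_rep)
    also have "anorm A \<dots> \<le> anorm A (star A (y \<ominus> ?s n)) + anorm A (?s n \<ominus> y)"
      using y s by (intro norm_triangle) auto
    finally show "anorm A (star A y \<ominus> y) \<le> 2 * anorm A (?s n \<ominus> y)"
      using y s anorm_minus_commute[of y "?s n"] by simp
  qed (use y in auto)
  have comm: "z \<otimes> y = y \<otimes> z" if z: "z \<in> carrier A" "z \<otimes> x = x \<otimes> z" for z
  proof (rule eqI)
    show "(\<lambda>n. 2 * anorm A z * anorm A (?s n \<ominus> y)) \<longlonglongrightarrow> 0"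
      using tendsto_mult_left[OF lim, of "2 * anorm A z"] by simp
    fix n
    have "z \<otimes> y \<ominus> y \<otimes> z = z \<otimes> (y \<ominus> ?s n) \<oplus> (?s n \<ominus> y) \<otimes> z"
      using y s[of n] z sqrt_seq_commute[OF x x1 z, of n]
      by (intro act_faithful) (simp_all add: algebra_expand)
    also have "anorm A \<dots> \<le> anorm A (z \<otimes> (y \<ominus> ?s n)) + anorm A ((?s n \<ominus> y) \<otimes> z)"
      using y s z by (intro norm_triangle) auto
    also have "\<dots> \<le> anorm A z * anorm A (y \<ominus> ?s n) + anorm A (?s n \<ominus> y) * anorm A z"
      using y s z by (intro add_mono norm_mult) auto
    finally show "anorm A (z \<otimes> y \<ominus> y \<otimes> z) \<le> 2 * anorm A z * anorm A (?s n \<ominus> y)"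
      using y s[of n] anorm_minus_commute[of y "?s n"] by simp
  qed (use y z in auto)
  have fix_eq: "y = (1 / 2) \<odot> (x \<oplus> y \<otimes> y)"
  proof (rule eqI)
    let ?f = "\<lambda>n. anorm A (?s (Suc n) \<ominus> y) + (1 + anorm A y) * anorm A (?s n \<ominus> y)"
    show "?f \<longlonglongrightarrow> 0"
      using tendsto_add[OF LIMSEQ_Suc[OF lim] tendsto_mult_left[OF lim, of "1 + anorm A y"]] by simp
    fix n
    \<comment> \<open>The deviation from the fixed point equation is split into the distance to the
      next iterate and half the difference of the squares of an iterate and of the limit; both tend
      to zero.\<close>
    have eq: "y \<ominus> (1 / 2) \<odot> (x \<oplus> y \<otimes> y)
        = (y \<ominus> ?s (Suc n)) \<oplus> (1 / 2) \<odot> (?s n \<otimes> ?s n \<ominus> y \<otimes> y)"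
      using y s[of n] x by (intro act_faithful) (auto simp: algebra_simps)
    have "anorm A (y \<ominus> (1 / 2) \<odot> (x \<oplus> y \<otimes> y)) \<le> anorm A (y \<ominus> ?s (Suc n)) + anorm A ((1 / 2) \<odot> (?s n \<otimes> ?s n \<ominus> y \<otimes> y))"
      unfolding eq using y s[of n] s[of "Suc n"] by (intro norm_triangle) auto
    moreover have "anorm A (y \<ominus> ?s (Suc n)) = anorm A (?s (Suc n) \<ominus> y)"
      using y s by (intro anorm_minus_commute)
    moreover have "anorm A ((1 / 2) \<odot> (?s n \<otimes> ?s n \<ominus> y \<otimes> y)) \<le> (1 + anorm A y) * anorm A (?s n \<ominus> y)"
    proof -
      have "anorm A (?s n \<otimes> ?s n \<ominus> y \<otimes> y) \<le> (anorm A (?s n) + anorm A y) * anorm A (?s n \<ominus> y)"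
        using y s by (intro anorm_square_diff)
      also have "\<dots> \<le> (1 + anorm A y) * anorm A (?s n \<ominus> y)"
        using anorm_sqrt_seq[OF x x1, of n] sqrt_bound_range[of n] y s[of n]
        by (intro mult_right_mono) auto
      finally have "anorm A (?s n \<otimes> ?s n \<ominus> y \<otimes> y) \<le> (1 + anorm A y) * anorm A (?s n \<ominus> y)" .
      moreover have "0 \<le> anorm A (?s n \<otimes> ?s n \<ominus> y \<otimes> y)"
        using y s[of n] by (intro anorm_nonneg) simp
      moreover have "anorm A ((1 / 2) \<odot> (?s n \<otimes> ?s n \<ominus> y \<otimes> y)) = anorm A (?s n \<otimes> ?s n \<ominus> y \<otimes> y) / 2"
        using y s[of n] by (simp add: norm_smult)
      ultimately show ?thesis by linarith
    qed
    ultimately show "anorm A (y \<ominus> (1 / 2) \<odot> (x \<oplus> y \<otimes> y)) \<le> ?f n" by linarith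
  qed (use x y in auto)
  have y1: "anorm A y \<le> 1"
  proof (rule LIMSEQ_le_const)
    show "(\<lambda>n. anorm A (?s n \<ominus> y) + 1) \<longlonglongrightarrow> 1"
      using tendsto_add[OF lim tendsto_const, of 1] by simp
    have "anorm A y \<le> anorm A (?s n \<ominus> y) + 1" for n
    proof -
      have "y = ?s n \<ominus> (?s n \<ominus> y)" using y s[of n] by (intro act_faithful) auto
      then have "anorm A y \<le> anorm A (?s n) + anorm A (?s n \<ominus> y)"
        using anorm_minus_le[of "?s n" "?s n \<ominus> y"] y s[of n] by simp
      then show ?thesis using anorm_sqrt_seq[OF x x1, of n] sqrt_bound_range[of n] by linarith
    qed
    then show "\<exists>N. \<forall>n\<ge>N. anorm A y \<le> anorm A (?s n \<ominus> y) + 1" by blast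
  qed
  show ?thesis
  proof (rule that)
    show "\<one> \<ominus> y \<in> carrier A" using y by simp
    have "\<one> \<ominus> (\<one> \<ominus> y) = y" using y by (intro act_faithful) auto
    then show "anorm A (\<one> \<ominus> (\<one> \<ominus> y)) \<le> 1" using y1 by simp
    show "star A (\<one> \<ominus> y) = \<one> \<ominus> y" using y sy by (simp add: minus_rep)
    show "(\<one> \<ominus> y) \<otimes> (\<one> \<ominus> y) = \<one> \<ominus> x"
    proof (rule act_faithful)
      fix u v assume uv: "u \<in> V" "v \<in> V"
      have "2 * ip (act y u) v = ip (act x u) v + ip (act (y \<otimes> y) u) v"
      proof -
        have "ip (act y u) v = ip (act ((1 / 2) \<odot> (x \<oplus> y \<otimes> y)) u) v"
          by (rule arg_cong[OF fix_eq, of "\<lambda>a. ip (act a u) v"])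
        also have "\<dots> = (ip (act x u) v + ip (act (y \<otimes> y) u) v) / 2"
          using x y uv by simp
        finally have e: "ip (act y u) v = (ip (act x u) v + ip (act (y \<otimes> y) u) v) / 2" .
        show ?thesis by (simp add: e)
      qed
      then show "ip (act ((\<one> \<ominus> y) \<otimes> (\<one> \<ominus> y)) u) v = ip (act (\<one> \<ominus> x) u) v"
        using uv x y by (simp add: algebra_expand algebra_simps)
    qed (use x y in auto)
    show "\<forall>z\<in>carrier A. z \<otimes> x = x \<otimes> z \<longrightarrow> z \<otimes> (\<one> \<ominus> y) = (\<one> \<ominus> y) \<otimes> z"
      using comm y by (simp add: algebra_expand)
  qed
qed

section \<open>Agreement of the abstract norm with the operator bound\<close>

lemma anorm_one: "anorm A \<one> = 1"
proof -
  have "anorm A \<one> = (anorm A \<one>)\<^sup>2" using cstar_identity[of \<one>] by simp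
  moreover have "anorm A \<one> \<noteq> 0" using norm_eq_zero[of \<one>] one_neq_zero by simp
  ultimately show ?thesis by (simp add: power2_eq_square)
qed

text \<open>For commuting self-adjoint l and r the element u = l + i r satisfies u^* u = l^2 + r^2,
  so the C*-identity gives |u| = c, and l is the real part of u.\<close>

lemma commuting_squares:
  assumes l: "l \<in> carrier A" "star A l = l" and r: "r \<in> carrier A" "star A r = r"
    and lr: "l \<otimes> r = r \<otimes> l"
    and sum: "l \<otimes> l \<oplus> r \<otimes> r = complex_of_real (c\<^sup>2) \<odot> \<one>" and c: "0 \<le> c"
  shows "anorm A l \<le> c"
proof -
  define u where "u = l \<oplus> \<i> \<odot> r"
  have u: "u \<in> carrier A" using l r by (simp add: u_def)
  have "star A u \<otimes> u = l \<otimes> l \<oplus> r \<otimes> r"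
    using l r lr unfolding u_def by (intro act_faithful) (simp_all add: algebra_expand algebra_simps)
  then have "(anorm A u)\<^sup>2 = c\<^sup>2"
    using cstar_identity[OF u] sum by (simp add: norm_smult anorm_one norm_power)
  then have uc: "anorm A u = c" using c u by simp
  have "l = (1 / 2) \<odot> (u \<oplus> star A u)"
    using l r unfolding u_def by (intro act_faithful) auto
  then have "anorm A l = anorm A (u \<oplus> star A u) / 2" using u by (simp add: norm_smult)
  also have "\<dots> \<le> c" using norm_triangle[of u "star A u"] u uc by simp
  finally show ?thesis .
qed

text \<open>A root k of 1 - g^2 commutes with g and k^2 + g^2 = 1, so
  \<open>commuting_squares\<close> gives |k| \<le> 1. The lemma makes the square root available for
  1 - (1 - g^2), that is, it provides the modulus of g.\<close>

lemma one_minus_square: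
  assumes g: "g \<in> carrier A" "star A g = g" "anorm A g \<le> 1"
  shows "anorm A (\<one> \<ominus> g \<otimes> g) \<le> 1" and "anorm A (g \<otimes> g) \<le> 1"
proof -
  have "anorm A (g \<otimes> g) \<le> anorm A g * anorm A g"
    using g by (intro norm_mult)
  also have "\<dots> \<le> 1" using g by (simp add: mult_le_one)
  finally show gg: "anorm A (g \<otimes> g) \<le> 1" .
  have g2: "g \<otimes> g \<in> carrier A" "star A (g \<otimes> g) = g \<otimes> g" using g by simp_all
  obtain k where k: "k \<in> carrier A" "star A k = k" "k \<otimes> k = \<one> \<ominus> g \<otimes> g"
      "anorm A (\<one> \<ominus> k) \<le> 1"
    and comm: "\<forall>z\<in>carrier A. z \<otimes> (g \<otimes> g) = (g \<otimes> g) \<otimes> z \<longrightarrow> z \<otimes> k = k \<otimes> z"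
    by (rule sqrt_one_minus[OF g2 gg])
  have "g \<otimes> k = k \<otimes> g" using comm g by (simp add: m_assoc)
  moreover have "k \<otimes> k \<oplus> g \<otimes> g = complex_of_real (1\<^sup>2) \<odot> \<one>"
    using g k by (intro act_faithful) auto
  ultimately have "anorm A k \<le> 1"
    using commuting_squares[of k g 1] g k by simp
  then have "anorm A k * anorm A k \<le> 1" using k by (simp add: mult_le_one)
  then have "anorm A (k \<otimes> k) \<le> 1"
    using norm_mult[of k k] k by simp
  then show "anorm A (\<one> \<ominus> g \<otimes> g) \<le> 1" by (simp add: k)
qed

text \<open>A root k of 1 - l^2 gives |l x|^2 + |k x|^2 = |x|^2.\<close>

lemma bnd_self_adjoint_one:
  assumes l: "l \<in> carrier A" "star A l = l" "anorm A l \<le> 1"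
  shows "bnd l 1"
proof -
  have l2: "l \<otimes> l \<in> carrier A" "star A (l \<otimes> l) = l \<otimes> l" using l by simp_all
  obtain k where k: "k \<in> carrier A" "star A k = k" "k \<otimes> k = \<one> \<ominus> l \<otimes> l"
    by (rule sqrt_one_minus[OF l2 one_minus_square(2)[OF l]])
  have "sq (act l x) \<le> sq x" if x: "x \<in> V" for x
  proof -
    have lx: "ip (act (l \<otimes> l) x) x = complex_of_real (sq (act l x))"
      using act_mult'[of l l x x] l x by (simp add: ip_self)
    have "ip (act (k \<otimes> k) x) x = complex_of_real (sq (act k x))"
      using act_mult'[of k k x x] k x by (simp add: ip_self)
    moreover have "ip (act (k \<otimes> k) x) x = complex_of_real (sq x - sq (act l x))"
      using k(3) l x lx by (simp add: ip_self)
    ultimately have "sq (act k x) = sq x - sq (act l x)" by (metis of_real_eq_iff)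
    then show ?thesis using sq_nonneg[of "act k x"] k x by simp
  qed
  then show ?thesis by (simp add: bnd_def)
qed

lemma bnd_anorm:
  assumes a: "a \<in> carrier A"
  shows "bnd a (anorm A a)"
proof (cases "anorm A a = 0")
  case True
  then show ?thesis using norm_eq_zero[OF a] bnd_zero by simp
next
  case False
  define c where "c = anorm A a"
  define l where "l = complex_of_real (1 / c\<^sup>2) \<odot> (star A a \<otimes> a)"
  have c: "c > 0" using False anorm_nonneg[OF a] unfolding c_def by linarith
  have l: "l \<in> carrier A" "star A l = l" using a by (simp_all add: l_def)
  have "anorm A l \<le> 1"
    using a c cstar_identity[OF a] by (simp add: l_def norm_smult norm_divide norm_power c_def[symmetric])
  then have "bnd l 1" using bnd_self_adjoint_one l by blast
  then have "bnd (complex_of_real (c\<^sup>2) \<odot> l) (cmod (complex_of_real (c\<^sup>2)) * 1)"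
    using l by (intro bnd_smult)
  moreover have "complex_of_real (c\<^sup>2) \<odot> l = star A a \<otimes> a"
    using a c by (intro act_faithful) (auto simp: l_def)
  ultimately have "bnd (star A a \<otimes> a) (c\<^sup>2)" by (simp add: norm_power)
  then show ?thesis using bnd_of_star_mult[OF a] c by (simp add: c_def)
qed

text \<open>The hard half of isometry: the sign of a form has to produce an abstract square. The
  form of h = l^2 - c^2 is nonpositive. Let g be a positive multiple of h with norm at most 1 and p
  a root of g^2. Then p = -g, so c^2 - l^2 is the square of an element r commuting with l, and
  \<open>commuting_squares\<close> applies.\<close>

lemma anorm_le_self_adjoint:
  assumes l: "l \<in> carrier A" "star A l = l" and b: "bnd l c"
  shows "anorm A l \<le> c"
proof -
  have c: "0 \<le> c" using b by (simp add: bnd_def)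
  define h where "h = l \<otimes> l \<ominus> complex_of_real (c\<^sup>2) \<odot> \<one>"
  \<comment> \<open>The summand 1 keeps M positive when h = 0.\<close>
  define M where "M = anorm A h + 1"
  define g where "g = complex_of_real (1 / M) \<odot> h"
  have h: "h \<in> carrier A" "star A h = h" using l by (simp_all add: h_def minus_rep)
  have M: "M > 0" using anorm_nonneg[OF h(1)] by (simp add: M_def)
  have g: "g \<in> carrier A" "star A g = g" using h by (simp_all add: g_def)
  have g1: "anorm A g \<le> 1" using h M by (simp add: g_def norm_smult norm_divide M_def)
  have gneg: "Re (ip (act g w) w) \<le> 0" if w: "w \<in> V" for w
  proof -
    have "ip (act (l \<otimes> l) w) w = complex_of_real (sq (act l w))"
      using act_mult'[of l l w w] l w by (simp add: ip_self)
    then have "ip (act g w) w = complex_of_real ((sq (act l w) - c\<^sup>2 * sq w) / M)"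
      using l w by (simp add: g_def h_def ip_self)
    moreover have "sq (act l w) - c\<^sup>2 * sq w \<le> 0" using b w by (simp add: bnd_def)
    ultimately show ?thesis using M by (simp add: divide_nonpos_pos)
  qed
  define x where "x = \<one> \<ominus> g \<otimes> g"
  have x: "x \<in> carrier A" "star A x = x" "anorm A x \<le> 1"
    using g one_minus_square(1)[OF g g1] by (simp_all add: x_def minus_rep)
  obtain p where p: "p \<in> carrier A" "star A p = p" "p \<otimes> p = \<one> \<ominus> x" "anorm A (\<one> \<ominus> p) \<le> 1"
    and pcomm: "\<forall>z\<in>carrier A. z \<otimes> x = x \<otimes> z \<longrightarrow> z \<otimes> p = p \<otimes> z"
    by (rule sqrt_one_minus[OF x])
  have pp: "p \<otimes> p = g \<otimes> g"
    unfolding p(3) x_def using g by (intro act_faithful) auto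
  have xcomm: "z \<otimes> x = x \<otimes> z" if z: "z \<in> carrier A" "z \<otimes> g = g \<otimes> z" for z
  proof -
    have "z \<otimes> (g \<otimes> g) = (g \<otimes> g) \<otimes> z" using z g by (metis m_assoc)
    then show ?thesis unfolding x_def using g z by (simp add: l_distr r_distr minus_rep smult_mult_left smult_mult_right)
  qed
  have gp: "g \<otimes> p = p \<otimes> g" using pcomm xcomm[of g] g by simp
  have p': "\<one> \<ominus> p \<in> carrier A" "star A (\<one> \<ominus> p) = \<one> \<ominus> p" using p by (simp_all add: minus_rep)
  \<comment> \<open>The bound on 1 - p that came with p permits a second root, so that p = q^2 has a
    nonnegative form.\<close>
  obtain q where q: "q \<in> carrier A" "star A q = q" "q \<otimes> q = \<one> \<ominus> (\<one> \<ominus> p)"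
      "anorm A (\<one> \<ominus> q) \<le> 1"
    and qcomm: "\<forall>z\<in>carrier A. z \<otimes> (\<one> \<ominus> p) = (\<one> \<ominus> p) \<otimes> z \<longrightarrow> z \<otimes> q = q \<otimes> z"
    by (rule sqrt_one_minus[OF p' p(4)])
  have qq: "q \<otimes> q = p"
    unfolding q(3) using p by (intro act_faithful) auto
  \<comment> \<open>f is twice the positive part of g. From p f = g f, the form of p at f u is at
    least 0 as q^2 = p and at most 0 as g is form-negative; hence q f = 0, then p f = 0 and f^2 =
    0.\<close>
  define f where "f = p \<oplus> g"
  have f: "f \<in> carrier A" "star A f = f" using p g by (simp_all add: f_def)
  have pf: "p \<otimes> f = g \<otimes> f"
    unfolding f_def using p(1) g(1) by (simp add: r_distr pp gp a_comm)
  have qf: "q \<otimes> f = \<zero>"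
  proof (rule act_faithful)
    fix u v assume uv: "u \<in> V" "v \<in> V"
    have w: "act f u \<in> V" using f uv by simp
    have "ip (act (p \<otimes> f) u) (act f u) = ip (act q (act f u)) (act q (act f u))"
      using act_mult'[of q q "act f u" "act f u"] q p f uv w qq by (simp add: act_mult)
    moreover have "ip (act (p \<otimes> f) u) (act f u) = ip (act g (act f u)) (act f u)"
      using pf g f uv by (simp add: act_mult)
    ultimately have "sq (act q (act f u)) \<le> 0"
      using gneg[OF w] by (simp add: sq_def)
    then have "sq (act q (act f u)) = 0" using sq_nonneg[OF act_closed[OF q(1) w]] by linarith
    then have "ip (act q (act f u)) v = 0"
      using q w uv by (intro ip_self_zero_imp) auto
    then show "ip (act (q \<otimes> f) u) v = ip (act \<zero> u) v"
      using q f uv by (simp add: act_mult)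
  qed (use q f in auto)
  have "p \<otimes> f = \<zero>" using qf qq q f by (metis m_assoc r_null)
  then have "f \<otimes> f = \<zero>" using pf p g f by (simp add: f_def l_distr)
  then have "f = \<zero>" using cstar_identity[OF f(1)] f norm_eq_zero[OF f(1)] by simp
  \<comment> \<open>With p = -g one has c^2 - l^2 = M p = r^2.\<close>
  define r where "r = complex_of_real (sqrt M) \<odot> q"
  have r: "r \<in> carrier A" "star A r = r" using q by (simp_all add: r_def)
  have lg: "l \<otimes> g = g \<otimes> l"
    using l by (simp add: g_def h_def minus_rep l_distr r_distr smult_mult_left smult_mult_right m_assoc)
  then have lp: "l \<otimes> p = p \<otimes> l" using pcomm xcomm[OF l(1)] l by simp
  have lq: "l \<otimes> q = q \<otimes> l"
    using qcomm[rule_format, OF l(1)] l(1) p(1) lp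
    by (simp add: minus_rep l_distr r_distr smult_mult_left smult_mult_right)
  show ?thesis
  proof (rule commuting_squares[OF l r])
    show "l \<otimes> r = r \<otimes> l" using lq l q by (simp add: r_def smult_mult_left smult_mult_right)
    show "l \<otimes> l \<oplus> r \<otimes> r = complex_of_real (c\<^sup>2) \<odot> \<one>"
    proof (rule act_faithful)
      fix u v assume uv: "u \<in> V" "v \<in> V"
      have "ip (act p u) v + ip (act g u) v = 0"
        using \<open>f = \<zero>\<close> p g uv by (metis act_add act_zero f_def)
      then have "complex_of_real M * ip (act p u) v + complex_of_real M * ip (act g u) v = 0"
        by (simp flip: distrib_left)
      moreover have "complex_of_real (sqrt M) * complex_of_real (sqrt M) = complex_of_real M"
        using M by (simp flip: of_real_mult)
      then have "ip (act (r \<otimes> r) u) v = complex_of_real M * ip (act p u) v"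
        using q(1) p(1) uv qq by (simp add: r_def smult_mult_left smult_mult_right mult.assoc[symmetric])
      moreover have "complex_of_real M * ip (act g u) v
          = ip (act (l \<otimes> l) u) v - complex_of_real (c\<^sup>2) * ip u v"
        using M l uv by (simp add: g_def h_def)
      ultimately show "ip (act (l \<otimes> l \<oplus> r \<otimes> r) u) v = ip (act (complex_of_real (c\<^sup>2) \<odot> \<one>) u) v"
        using l(1) r(1) uv by (simp add: algebra_simps)
    qed (use l r in auto)
  qed (rule c)
qed

text \<open>The self-adjoint case is applied to the product of the adjoint of a with a. Consequently
  the C*-norm is determined by the *-algebra as soon as a faithful representation exists.\<close>

theorem anorm_le_iff:
  assumes a: "a \<in> carrier A"
  shows "anorm A a \<le> C \<longleftrightarrow> bnd a C"
proof
  assume "anorm A a \<le> C"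
  then show "bnd a C" using bnd_mono[OF bnd_anorm[OF a]] by simp
next
  assume b: "bnd a C"
  then have C: "0 \<le> C" by (simp add: bnd_def)
  have "bnd (star A a \<otimes> a) (C * C)" using a b by (intro bnd_mult bnd_star) auto
  then have "anorm A (star A a \<otimes> a) \<le> C * C" using a by (intro anorm_le_self_adjoint) auto
  then have "(anorm A a)\<^sup>2 \<le> C\<^sup>2" using cstar_identity[OF a] by (simp add: power2_eq_square)
  then show "anorm A a \<le> C" using C by (rule power2_le_imp_le)
qed

text \<open>On forms, 0 \<le> a \<le> r with r the norm of a. So x = 1 - a / r has numerical radius
  at most 1, hence norm at most 1, and a / r = 1 - x has a square root.\<close>

lemma form_pos_imp_positive:
  assumes a: "a \<in> carrier A" and p: "form_pos a"
  obtains k where "k \<in> carrier A" "star A k = k" "k \<otimes> k = a"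
proof (cases "anorm A a = 0")
  case True
  then show ?thesis using that[of \<zero>] norm_eq_zero[OF a] by simp
next
  case False
  define r where "r = anorm A a"
  have r: "r > 0" using False anorm_nonneg[OF a] unfolding r_def by linarith
  define x where "x = \<one> \<ominus> complex_of_real (1 / r) \<odot> a"
  have x: "x \<in> carrier A" "star A x = x"
    using a form_pos_self_adjoint[OF a p] by (simp_all add: x_def minus_rep)
  have "bnd x 1"
  proof (rule bnd_self_adjoint[OF x])
    fix u assume u: "u \<in> V"
    have "cmod (ip (act a u) u) \<le> r * sqrt (sq u) * sqrt (sq u)"
      unfolding r_def using a u by (intro bnd_ip bnd_anorm)
    then have "Re (ip (act a u) u) \<le> r * sq u"
      using complex_Re_le_cmod[of "ip (act a u) u"] u by (simp add: mult.assoc)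
    moreover have "0 \<le> Re (ip (act a u) u)" using p u by (simp add: form_pos_def)
    moreover have "Re (ip (act x u) u) = sq u - Re (ip (act a u) u) / r"
      using a u r by (simp add: x_def sq_def)
    moreover have "0 \<le> Re (ip (act a u) u) / r"
      using \<open>0 \<le> Re (ip (act a u) u)\<close> r by simp
    moreover have "Re (ip (act a u) u) / r \<le> sq u"
      using \<open>Re (ip (act a u) u) \<le> r * sq u\<close> r by (simp add: pos_divide_le_eq mult.commute)
    ultimately show "\<bar>Re (ip (act x u) u)\<bar> \<le> 1 * sq u"
      using sq_nonneg[OF u] by linarith
  qed simp
  then have "anorm A x \<le> 1" using x by (simp add: anorm_le_iff)
  obtain k where k: "k \<in> carrier A" "star A k = k" "k \<otimes> k = \<one> \<ominus> x"
    by (rule sqrt_one_minus[OF x \<open>anorm A x \<le> 1\<close>])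
  have s: "complex_of_real (sqrt r) * complex_of_real (sqrt r) = complex_of_real r"
    using r by (simp flip: of_real_mult)
  have "(complex_of_real (sqrt r) \<odot> k) \<otimes> (complex_of_real (sqrt r) \<odot> k) = a"
  proof (rule act_faithful)
    fix u v assume "u \<in> V" "v \<in> V"
    then show "ip (act ((complex_of_real (sqrt r) \<odot> k) \<otimes> (complex_of_real (sqrt r) \<odot> k)) u) v = ip (act a u) v"
      using k a r s x by (simp add: smult_mult_left smult_mult_right mult.assoc[symmetric] x_def)
  qed (use k a in auto)
  then show ?thesis using that[of "complex_of_real (sqrt r) \<odot> k"] k by simp
qed

lemma positive_elements_iff:
  assumes a: "a \<in> carrier A"
  shows "a \<in> positive_elements A \<longleftrightarrow> form_pos a"
proof
  assume "form_pos a"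
  then obtain k where "k \<in> carrier A" "star A k = k" "k \<otimes> k = a"
    using form_pos_imp_positive[OF a] by blast
  then show "a \<in> positive_elements A" unfolding positive_elements_def by force
qed (auto simp: positive_elements_def form_pos_star_mult)

end

section \<open>Matrix algebras\<close>

lemma matrix_algebra_with_simps [simp]:
  "carrier (matrix_algebra_with A n N) = {X \<in> carrier_mat n n. elements_mat X \<subseteq> carrier A}"
  "one (matrix_algebra_with A n N) = mat n n (\<lambda>(i, j). if i = j then \<one>\<^bsub>A\<^esub> else \<zero>\<^bsub>A\<^esub>)"
  "zero (matrix_algebra_with A n N) = mat n n (\<lambda>_. \<zero>\<^bsub>A\<^esub>)"
  "X \<oplus>\<^bsub>matrix_algebra_with A n N\<^esub> Y = mat n n (\<lambda>ij. X $$ ij \<oplus>\<^bsub>A\<^esub> Y $$ ij)"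
  "X \<otimes>\<^bsub>matrix_algebra_with A n N\<^esub> Y
    = mat n n (\<lambda>(i, j). \<Oplus>\<^bsub>A\<^esub>k\<in>{..<n}. X $$ (i, k) \<otimes>\<^bsub>A\<^esub> Y $$ (k, j))"
  "c \<odot>\<^bsub>matrix_algebra_with A n N\<^esub> X = mat n n (\<lambda>ij. c \<odot>\<^bsub>A\<^esub> X $$ ij)"
  "star (matrix_algebra_with A n N) X = mat n n (\<lambda>(i, j). star A (X $$ (j, i)))"
  "anorm (matrix_algebra_with A n N) X = N X"
  by (simp_all add: matrix_algebra_with_def)

definition mats :: "'a set \<Rightarrow> nat \<Rightarrow> 'a mat set" where
  "mats S n = {X \<in> carrier_mat n n. \<forall>i<n. \<forall>j<n. X $$ (i, j) \<in> S}"

lemma carrier_matrix_algebra_with: "carrier (matrix_algebra_with A n N) = mats (carrier A) n"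
  by (fastforce simp: mats_def)

lemma matsD: "X \<in> mats S n \<Longrightarrow> i < n \<Longrightarrow> j < n \<Longrightarrow> X $$ (i, j) \<in> S"
  by (simp add: mats_def)

lemma mats_mat: "mat n n f \<in> mats S n \<longleftrightarrow> (\<forall>i<n. \<forall>j<n. f (i, j) \<in> S)"
  by (auto simp: mats_def)

lemma mats_eqI: "\<lbrakk>X \<in> mats S n; Y \<in> mats S n; \<And>i j. i < n \<Longrightarrow> j < n \<Longrightarrow> X $$ (i, j) = Y $$ (i, j)\<rbrakk> \<Longrightarrow> X = Y"
  by (auto simp: mats_def)

definition vpow :: "nat \<Rightarrow> 'v set \<Rightarrow> (nat \<Rightarrow> 'v) set" where
  "vpow n V = {f. \<forall>i<n. f i \<in> V}"

definition ip_pow :: "nat \<Rightarrow> ('v \<Rightarrow> 'v \<Rightarrow> complex) \<Rightarrow> (nat \<Rightarrow> 'v) \<Rightarrow> (nat \<Rightarrow> 'v) \<Rightarrow> complex" where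
  "ip_pow n b f g = (\<Sum>i<n. b (f i) (g i))"

definition act_pow :: "nat \<Rightarrow> 'v \<Rightarrow> ('v \<Rightarrow> 'v \<Rightarrow> 'v) \<Rightarrow> ('a \<Rightarrow> 'v \<Rightarrow> 'v) \<Rightarrow> 'a mat
    \<Rightarrow> (nat \<Rightarrow> 'v) \<Rightarrow> nat \<Rightarrow> 'v" where
  "act_pow n vzero vadd act X f =
     (\<lambda>i. ip_space.vsum vzero vadd n (\<lambda>j. act (X $$ (i, j)) (f j)))"

context star_rep
begin

text \<open>The condition on a bound is closed, so it passes to the infimum by letting larger bounds
  decrease to it.\<close>

lemma bnd_Inf:
  assumes a: "a \<in> carrier A" and b: "bnd a C"
  shows "bnd a (Inf {C. bnd a C})" and "Inf {C. bnd a C} \<le> C"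
proof -
  let ?S = "{C. bnd a C}"
  have bdd: "bdd_below ?S" by (rule bdd_belowI[of _ 0]) (simp add: bnd_def)
  show "Inf ?S \<le> C" using b bdd by (intro cInf_lower) auto
  have I0: "0 \<le> Inf ?S" using b by (intro cInf_greatest) (auto simp: bnd_def)
  show "bnd a (Inf ?S)"
  proof (subst bnd_def, intro conjI ballI)
    fix x assume x: "x \<in> V"
    have strict: "sq (act a x) \<le> D\<^sup>2 * sq x" if D: "D > Inf ?S" for D
    proof -
      obtain E where "bnd a E" "E < D" using cInf_lessD[OF _ D] b by auto
      then show ?thesis using bnd_mono[of a E D] x by (simp add: bnd_def)
    qed
    show "sq (act a x) \<le> (Inf ?S)\<^sup>2 * sq x"
    proof (rule tendsto_lowerbound)
      show "((\<lambda>D. D\<^sup>2 * sq x) \<longlongrightarrow> (Inf ?S)\<^sup>2 * sq x) (at_right (Inf ?S))"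
        by (intro tendsto_intros)
      show "\<forall>\<^sub>F D in at_right (Inf ?S). sq (act a x) \<le> D\<^sup>2 * sq x"
        using eventually_at_right_less by (rule eventually_mono) (rule strict)
    qed simp
  qed (rule I0)
qed

lemma ip_act_vzero [simp]: "\<lbrakk>a \<in> carrier A; y \<in> V\<rbrakk> \<Longrightarrow> ip (act a vzero) y = 0"
  using act_swap[of a vzero y] by simp

abbreviation "Vn n \<equiv> vpow n V"
abbreviation "ipn n \<equiv> ip_pow n ip"
abbreviation "actn n \<equiv> act_pow n vzero vadd act"

lemma actn_closed: "\<lbrakk>X \<in> mats (carrier A) n; f \<in> Vn n\<rbrakk> \<Longrightarrow> actn n X f \<in> Vn n"
  by (auto simp: vpow_def act_pow_def mats_def)

lemma ip_actn:
  assumes X: "X \<in> mats (carrier A) n" and f: "f \<in> Vn n" and z: "z \<in> V" and i: "i < n"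
  shows "ip (actn n X f i) z = (\<Sum>j<n. ip (act (X $$ (i, j)) (f j)) z)"
  unfolding act_pow_def using assms by (intro ip_vsum) (auto simp: vpow_def mats_def)

lemma ipn_actn:
  assumes X: "X \<in> mats (carrier A) n" and f: "f \<in> Vn n" and g: "g \<in> Vn n"
  shows "ipn n (actn n X f) g = (\<Sum>i<n. \<Sum>j<n. ip (act (X $$ (i, j)) (f j)) (g i))"
  unfolding ip_pow_def using assms
  by (intro sum.cong refl) (auto intro!: ip_actn simp: vpow_def)

definition single :: "nat \<Rightarrow> 'v \<Rightarrow> nat \<Rightarrow> 'v" where
  "single j x = (\<lambda>k. if k = j then x else vzero)"

lemma single_closed: "x \<in> V \<Longrightarrow> single j x \<in> Vn n"
  by (simp add: single_def vpow_def)

text \<open>Test vectors with one nonzero coordinate recover the form of a single entry;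
  faithfulness of the matrix action and the bounds on entries both come from this.\<close>

lemma ipn_actn_single:
  assumes c: "c \<in> mats (carrier A) n" and ij: "i < n" "j < n" and xy: "x \<in> V" "y \<in> V"
  shows "ipn n (actn n c (single j x)) (single i y) = ip (act (c $$ (i, j)) x) y"
proof -
  have "ipn n (actn n c (single j x)) (single i y)
    = (\<Sum>k<n. \<Sum>l<n. if k = i then (if l = j then ip (act (c $$ (i, j)) x) y else 0) else 0)"
    using c xy by (subst ipn_actn) (auto simp: single_def vpow_def matsD intro!: sum.cong)
  also have "\<dots> = (\<Sum>k<n. if k = i then (\<Sum>l<n. if l = j then ip (act (c $$ (i, j)) x) y else 0) else 0)"
    by (intro sum.cong) auto
  also have "\<dots> = ip (act (c $$ (i, j)) x) y" using ij by simp
  finally show ?thesis .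
qed

lemma ip_space_pow:
  "ip_space (Vn n) (ipn n) (\<lambda>_. vzero) (\<lambda>f g i. vadd (f i) (g i)) (\<lambda>c f i. vscale c (f i))"
proof
  fix x y assume "x \<in> Vn n" "y \<in> Vn n"
  then show "ipn n y x = cnj (ipn n x y)"
    by (auto simp: ip_pow_def vpow_def intro!: sum.cong ip_commute)
qed (auto simp: ip_pow_def vpow_def sum.distrib sum_distrib_left Re_sum ip_self_nonneg intro!: sum_nonneg)

text \<open>Only the *-algebra structure is seen by the action, so \<open>N\<close> is arbitrary.
  One statement thus serves all candidate norms in the description defining
  \<open>matrix_norm\<close>.\<close>

lemma star_rep_matrix:
  "star_rep (matrix_algebra_with A n N) (Vn n) (ipn n) (\<lambda>_. vzero) (\<lambda>f g i. vadd (f i) (g i))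
     (\<lambda>c f i. vscale c (f i)) (actn n)"
proof -
  let ?M = "matrix_algebra_with A n N"
  let ?C = "mats (carrier A) n"
  note C = carrier_matrix_algebra_with
  note [simp del] = matrix_algebra_with_simps(1)
  interpret P: ip_space "Vn n" "ipn n" "\<lambda>_. vzero" "\<lambda>f g i. vadd (f i) (g i)" "\<lambda>c f i. vscale c (f i)"
    by (rule ip_space_pow)
  have mult: "a \<otimes>\<^bsub>?M\<^esub> b \<in> ?C" if "a \<in> ?C" "b \<in> ?C" for a b
    using that by (auto simp: mats_mat mats_def intro!: finsum_closed)
  have add: "a \<oplus>\<^bsub>?M\<^esub> b \<in> ?C" if "a \<in> ?C" "b \<in> ?C" for a b
    using that by (auto simp: mats_mat mats_def)
  have smult: "c \<odot>\<^bsub>?M\<^esub> a \<in> ?C" if "a \<in> ?C" for a c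
    using that by (auto simp: mats_mat mats_def)
  have star: "star ?M a \<in> ?C" if "a \<in> ?C" for a
    using that by (auto simp: mats_mat mats_def)
  have one: "\<one>\<^bsub>?M\<^esub> \<in> ?C" and zero: "\<zero>\<^bsub>?M\<^esub> \<in> ?C" by (auto simp: mats_mat)
  have vD: "f i \<in> V" if "f \<in> Vn n" "i < n" for f i using that by (simp add: vpow_def)
  show ?thesis
  proof (unfold_locales, unfold C)
    fix a b c x y assume a: "a \<in> ?C" and xy: "x \<in> Vn n" "y \<in> Vn n"
    show "ipn n (actn n (c \<odot>\<^bsub>?M\<^esub> a) x) y = c * ipn n (actn n a x) y"
      using a xy smult[OF a, of c]
      by (simp add: ipn_actn vD matsD sum_distrib_left cong: sum.cong_simp)
    show "ipn n (actn n (star ?M a) x) y = ipn n x (actn n a y)"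
    proof -
      have "ipn n (actn n (star ?M a) x) y = (\<Sum>i<n. \<Sum>j<n. ip (act (star A (a $$ (j, i))) (x j)) (y i))"
        using a xy star[OF a] by (simp add: ipn_actn vD)
      also have "\<dots> = (\<Sum>i<n. \<Sum>j<n. cnj (ip (act (a $$ (j, i)) (y i)) (x j)))"
        using a xy by (intro sum.cong refl) (auto intro!: ip_act_commute simp: vD matsD)
      also have "\<dots> = cnj (ipn n (actn n a y) x)"
        using a xy by (subst sum.swap) (simp add: ipn_actn)
      also have "\<dots> = ipn n x (actn n a y)"
        using P.ip_commute[OF actn_closed[OF a xy(2)] xy(1)] by simp
      finally show ?thesis .
    qed
    assume b: "b \<in> ?C"
    show "ipn n (actn n (a \<oplus>\<^bsub>?M\<^esub> b) x) y = ipn n (actn n a x) y + ipn n (actn n b x) y"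
      using a b xy add[OF a b] by (simp add: ipn_actn vD matsD sum.distrib cong: sum.cong_simp)
    \<comment> \<open>The action is known only through inner products, so the entry of a is moved to
      the second argument, the sum over j is collected there to the coordinate k of b x, and the
      entry is moved back.\<close>
    show "ipn n (actn n (a \<otimes>\<^bsub>?M\<^esub> b) x) y = ipn n (actn n a (actn n b x)) y"
    proof -
      have "ipn n (actn n (a \<otimes>\<^bsub>?M\<^esub> b) x) y
          = (\<Sum>i<n. \<Sum>j<n. \<Sum>k<n. ip (act (b $$ (k, j)) (x j)) (act (star A (a $$ (i, k))) (y i)))"
      proof -
        have "ip (act (\<Oplus>k\<in>{..<n}. a $$ (i, k) \<otimes> b $$ (k, j)) (x j)) (y i)
            = (\<Sum>k<n. ip (act (b $$ (k, j)) (x j)) (act (star A (a $$ (i, k))) (y i)))"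
          if "i < n" "j < n" for i j
          using a b xy that by (subst act_finsum) (auto simp: vD matsD act_mult' intro!: sum.cong)
        then show ?thesis
          using xy mult[OF a b] by (simp add: ipn_actn cong: sum.cong_simp)
      qed
      also have "\<dots> = (\<Sum>i<n. \<Sum>k<n. \<Sum>j<n. ip (act (b $$ (k, j)) (x j)) (act (star A (a $$ (i, k))) (y i)))"
        by (intro sum.cong refl sum.swap)
      also have "\<dots> = (\<Sum>i<n. \<Sum>k<n. ip (actn n b x k) (act (star A (a $$ (i, k))) (y i)))"
        using a b xy by (intro sum.cong refl) (auto intro!: ip_actn[symmetric] simp: vD matsD)
      also have "\<dots> = (\<Sum>i<n. \<Sum>k<n. ip (act (a $$ (i, k)) (actn n b x k)) (y i))"
        using a b xy actn_closed[OF b xy(1)]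
        by (intro sum.cong refl) (auto intro!: act_swap[symmetric] simp: vD matsD)
      also have "\<dots> = ipn n (actn n a (actn n b x)) y"
        using a b xy actn_closed[OF b xy(1)] by (simp add: ipn_actn)
      finally show ?thesis .
    qed
  next
    fix x y assume xy: "x \<in> Vn n" "y \<in> Vn n"
    show "ipn n (actn n \<zero>\<^bsub>?M\<^esub> x) y = 0"
      using zero xy by (simp add: ipn_actn vD)
    have "ipn n (actn n \<one>\<^bsub>?M\<^esub> x) y = (\<Sum>i<n. \<Sum>j<n. if i = j then ip (x j) (y i) else 0)"
      using one xy by (simp only: ipn_actn) (intro sum.cong refl, auto simp: vD)
    also have "\<dots> = ipn n x y" by (simp add: ip_pow_def)
    finally show "ipn n (actn n \<one>\<^bsub>?M\<^esub> x) y = ipn n x y" .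
  next
    fix a b assume a: "a \<in> ?C" and b: "b \<in> ?C"
      and eq: "\<And>x y. \<lbrakk>x \<in> Vn n; y \<in> Vn n\<rbrakk> \<Longrightarrow> ipn n (actn n a x) y = ipn n (actn n b x) y"
    show "a = b"
    proof (rule mats_eqI[OF a b])
      fix i j assume ij: "i < n" "j < n"
      show "a $$ (i, j) = b $$ (i, j)"
      proof (rule act_faithful)
        fix x y assume xy: "x \<in> V" "y \<in> V"
        show "ip (act (a $$ (i, j)) x) y = ip (act (b $$ (i, j)) x) y"
          using ipn_actn_single[OF a ij xy] ipn_actn_single[OF b ij xy]
            eq[OF single_closed[OF xy(1)] single_closed[OF xy(2)]] by simp
      qed (use a b ij in \<open>auto simp: matsD\<close>)
    qed
  qed (use add mult smult star one zero actn_closed in auto)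
qed

end

section \<open>A matrix compared with its entries; computation of the matrix norm\<close>

context star_rep
begin

abbreviation "mbnd n \<equiv> star_rep.bnd (vpow n V) (ip_pow n ip) (act_pow n vzero vadd act)"

abbreviation "sqn n \<equiv> ip_space.sq (ip_pow n ip)"

lemma sqn_eq: "sqn n f = (\<Sum>i<n. sq (f i))"
  by (simp add: ip_space.sq_def[OF ip_space_pow] sq_def ip_pow_def Re_sum)

lemma sqn_single: "\<lbrakk>x \<in> V; j < n\<rbrakk> \<Longrightarrow> sqn n (single j x) = sq x"
proof -
  assume "x \<in> V" "j < n"
  have "sqn n (single j x) = (\<Sum>i<n. if i = j then sq x else 0)"
    unfolding sqn_eq by (intro sum.cong) (auto simp: single_def)
  then show ?thesis using \<open>j < n\<close> by simp
qed

lemma sq_le_sqn: "\<lbrakk>f \<in> Vn n; i < n\<rbrakk> \<Longrightarrow> sq (f i) \<le> sqn n f"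
  unfolding sqn_eq by (rule member_le_sum) (auto simp: vpow_def)

lemma mbnd_entry:
  assumes X: "X \<in> mats (carrier A) n" and b: "mbnd n X C" and ij: "i < n" "j < n"
  shows "bnd (X $$ (i, j)) C"
proof -
  interpret M: star_rep "matrix_algebra_with A n N" "Vn n" "ipn n" "\<lambda>_. vzero"
    "\<lambda>f g i. vadd (f i) (g i)" "\<lambda>c f i. vscale c (f i)" "actn n" for N :: "'a mat \<Rightarrow> real"
    by (rule star_rep_matrix)
  show ?thesis
  proof (rule bndI_ip)
    fix x y assume xy: "x \<in> V" "y \<in> V"
    have "cmod (ipn n (actn n X (single j x)) (single i y))
        \<le> C * sqrt (sqn n (single j x)) * sqrt (sqn n (single i y))"
      using X b xy by (intro M.bnd_ip) (auto simp: carrier_matrix_algebra_with single_closed simp del: matrix_algebra_with_simps)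
    then show "cmod (ip (act (X $$ (i, j)) x) y) \<le> C * sqrt (sq x) * sqrt (sq y)"
      using X xy ij by (simp add: ipn_actn_single sqn_single)
  qed (use X ij b in \<open>auto simp: matsD M.bnd_def\<close>)
qed

text \<open>A crude converse of \<open>mbnd_entry\<close>. Together they make entrywise convergence
  equivalent to convergence in norm, which gives completeness and allows smallness to be tested on
  entries.\<close>

lemma mbnd_sum:
  assumes X: "X \<in> mats (carrier A) n" and b: "\<And>i j. \<lbrakk>i < n; j < n\<rbrakk> \<Longrightarrow> bnd (X $$ (i, j)) (D i j)"
  shows "mbnd n X (\<Sum>i<n. \<Sum>j<n. D i j)"
proof -
  interpret M: star_rep "matrix_algebra_with A n N" "Vn n" "ipn n" "\<lambda>_. vzero"
    "\<lambda>f g i. vadd (f i) (g i)" "\<lambda>c f i. vscale c (f i)" "actn n" for N :: "'a mat \<Rightarrow> real"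
    by (rule star_rep_matrix)
  have D: "0 \<le> D i j" if "i < n" "j < n" for i j using b[OF that] by (simp add: bnd_def)
  show ?thesis
  proof (rule M.bndI_ip)
    fix f g assume fg: "f \<in> Vn n" "g \<in> Vn n"
    have "cmod (ipn n (actn n X f) g) \<le> (\<Sum>i<n. \<Sum>j<n. cmod (ip (act (X $$ (i, j)) (f j)) (g i)))"
      using X fg by (simp add: ipn_actn sum_norm_le order.trans[OF norm_sum] sum_mono)
    also have "\<dots> \<le> (\<Sum>i<n. \<Sum>j<n. D i j * sqrt (sqn n f) * sqrt (sqn n g))"
    proof (intro sum_mono)
      fix i j assume "i \<in> {..<n}" "j \<in> {..<n}"
      then have ij: "i < n" "j < n" by auto
      have v: "f j \<in> V" "g i \<in> V" using fg ij by (auto simp: vpow_def)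
      have "cmod (ip (act (X $$ (i, j)) (f j)) (g i)) \<le> D i j * sqrt (sq (f j)) * sqrt (sq (g i))"
        using X ij v b by (intro bnd_ip) (auto simp: matsD)
      also have "\<dots> \<le> D i j * sqrt (sqn n f) * sqrt (sqn n g)"
        using D[OF ij] fg ij v by (intro mult_mono mult_nonneg_nonneg) (auto simp: sq_le_sqn)
      finally show "cmod (ip (act (X $$ (i, j)) (f j)) (g i)) \<le> D i j * sqrt (sqn n f) * sqrt (sqn n g)" .
    qed
    finally show "cmod (ipn n (actn n X f) g) \<le> (\<Sum>i<n. \<Sum>j<n. D i j) * sqrt (sqn n f) * sqrt (sqn n g)"
      by (simp add: sum_distrib_right)
  qed (use X D in \<open>auto simp: carrier_matrix_algebra_with intro!: sum_nonneg simp del: matrix_algebra_with_simps\<close>)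
qed

end

context cstar_rep
begin

text \<open>Completeness is the part with content: the entries of a Cauchy sequence are Cauchy
  because \<open>N\<close> dominates them, and the matrix of their limits is the limit because the
  sum of the entry norms dominates \<open>N\<close>.\<close>

lemma cstar_rep_matrix_with:
  assumes n: "n \<ge> 1" and N: "\<And>X C. X \<in> mats (carrier A) n \<Longrightarrow> N X \<le> C \<longleftrightarrow> mbnd n X C"
  shows "unital_cstar_algebra (matrix_algebra_with A n N)"
proof -
  note [simp del] = matrix_algebra_with_simps(1)
  let ?M = "matrix_algebra_with A n N"
  interpret M: star_rep ?M "Vn n" "ipn n" "\<lambda>_. vzero"
    "\<lambda>f g i. vadd (f i) (g i)" "\<lambda>c f i. vscale c (f i)" "actn n"
    by (rule star_rep_matrix)
  note C = carrier_matrix_algebra_with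
  have minus: "(X \<ominus>\<^bsub>?M\<^esub> Y) $$ (i, j) = X $$ (i, j) \<ominus> Y $$ (i, j)"
    if "X \<in> mats (carrier A) n" "Y \<in> mats (carrier A) n" "i < n" "j < n" for X Y i j
    using that M.minus_rep[of X Y] by (simp add: C minus_rep matsD)
  show ?thesis
  proof (rule M.cstar_algebraI)
    show "\<one>\<^bsub>?M\<^esub> \<noteq> \<zero>\<^bsub>?M\<^esub>"
    proof
      assume "\<one>\<^bsub>?M\<^esub> = \<zero>\<^bsub>?M\<^esub>"
      then have "\<one>\<^bsub>?M\<^esub> $$ (0, 0) = \<zero>\<^bsub>?M\<^esub> $$ (0, 0)" by simp
      then show False using n one_neq_zero by simp
    qed
    fix s :: "nat \<Rightarrow> 'a mat" assume s: "\<And>k. s k \<in> carrier ?M"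
      and Cy: "\<And>e. e > 0 \<Longrightarrow> \<exists>N. \<forall>k\<ge>N. \<forall>l\<ge>N. anorm ?M (s k \<ominus>\<^bsub>?M\<^esub> s l) < e"
    have s': "s k \<in> mats (carrier A) n" for k using s C by metis
    have ex: "\<exists>x\<in>carrier A. (\<lambda>k. anorm A (s k $$ (i, j) \<ominus> x)) \<longlonglongrightarrow> 0" if ij: "i < n" "j < n" for i j
    proof (rule complete)
      show "s k $$ (i, j) \<in> carrier A" for k using matsD[OF s' ij] .
      fix e :: real assume "e > 0"
      then obtain K where K: "\<And>k l. \<lbrakk>k \<ge> K; l \<ge> K\<rbrakk> \<Longrightarrow> N (s k \<ominus>\<^bsub>?M\<^esub> s l) < e"
        using Cy by auto blast
      have "anorm A (s k $$ (i, j) \<ominus> s l $$ (i, j)) < e" if "k \<ge> K" "l \<ge> K" for k l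
      proof -
        have m: "s k \<ominus>\<^bsub>?M\<^esub> s l \<in> mats (carrier A) n"
          using M.minus_closed[OF s s] C by metis
        then have "mbnd n (s k \<ominus>\<^bsub>?M\<^esub> s l) (N (s k \<ominus>\<^bsub>?M\<^esub> s l))" using N[OF m] by blast
        then have "bnd ((s k \<ominus>\<^bsub>?M\<^esub> s l) $$ (i, j)) (N (s k \<ominus>\<^bsub>?M\<^esub> s l))"
          using m ij mbnd_entry by blast
        then have "anorm A (s k $$ (i, j) \<ominus> s l $$ (i, j)) \<le> N (s k \<ominus>\<^bsub>?M\<^esub> s l)"
          using minus[OF s' s' ij, of k l] matsD[OF s' ij] by (simp add: anorm_le_iff)
        then show ?thesis using K[OF that] by simp
      qed
      then show "\<exists>K. \<forall>k\<ge>K. \<forall>l\<ge>K. anorm A (s k $$ (i, j) \<ominus> s l $$ (i, j)) < e" by blast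
    qed
    then obtain x where x: "\<And>i j. \<lbrakk>i < n; j < n\<rbrakk> \<Longrightarrow> x i j \<in> carrier A"
      and lim: "\<And>i j. \<lbrakk>i < n; j < n\<rbrakk> \<Longrightarrow> (\<lambda>k. anorm A (s k $$ (i, j) \<ominus> x i j)) \<longlonglongrightarrow> 0"
      by metis
    define X where "X = mat n n (\<lambda>(i, j). x i j)"
    have X: "X \<in> mats (carrier A) n" using x by (simp add: X_def mats_mat)
    have m: "s k \<ominus>\<^bsub>?M\<^esub> X \<in> mats (carrier A) n" for k
      using M.minus_closed[OF s, of X] X C by metis
    have le: "N (s k \<ominus>\<^bsub>?M\<^esub> X) \<le> (\<Sum>i<n. \<Sum>j<n. anorm A (s k $$ (i, j) \<ominus> x i j))" for k
      unfolding N[OF m]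
    proof (rule mbnd_sum[OF m])
      fix i j assume ij: "i < n" "j < n"
      show "bnd ((s k \<ominus>\<^bsub>?M\<^esub> X) $$ (i, j)) (anorm A (s k $$ (i, j) \<ominus> x i j))"
        using minus[OF s' X ij, of k] matsD[OF s' ij, of k] x[OF ij] ij by (simp add: X_def bnd_anorm)
    qed
    have "(\<lambda>k. N (s k \<ominus>\<^bsub>?M\<^esub> X)) \<longlonglongrightarrow> 0"
    proof (rule tendsto_sandwich[OF _ _ tendsto_const])
      have "(\<lambda>k. \<Sum>i<n. \<Sum>j<n. anorm A (s k $$ (i, j) \<ominus> x i j)) \<longlonglongrightarrow> (\<Sum>i<n. \<Sum>j<n. 0)"
        by (intro tendsto_sum lim) auto
      then show "(\<lambda>k. \<Sum>i<n. \<Sum>j<n. anorm A (s k $$ (i, j) \<ominus> x i j)) \<longlonglongrightarrow> 0" by simp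
      show "\<forall>\<^sub>F k in sequentially. 0 \<le> N (s k \<ominus>\<^bsub>?M\<^esub> X)"
        using N[OF m] by (intro always_eventually) (auto simp: M.bnd_def)
    qed (use le in auto)
    then show "\<exists>x\<in>carrier ?M. (\<lambda>k. anorm ?M (s k \<ominus>\<^bsub>?M\<^esub> x)) \<longlonglongrightarrow> 0"
      using X by (auto simp: C)
  qed (auto simp: N C)
qed

lemma mbnd_Inf:
  assumes X: "X \<in> mats (carrier A) n"
  shows "Inf {C. mbnd n X C} \<le> C \<longleftrightarrow> mbnd n X C"
proof -
  interpret M: star_rep "matrix_algebra_with A n N" "Vn n" "ipn n" "\<lambda>_. vzero"
    "\<lambda>f g i. vadd (f i) (g i)" "\<lambda>c f i. vscale c (f i)" "actn n" for N :: "'a mat \<Rightarrow> real"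
    by (rule star_rep_matrix)
  have "mbnd n X (\<Sum>i<n. \<Sum>j<n. anorm A (X $$ (i, j)))"
    using X by (intro mbnd_sum bnd_anorm) (auto simp: matsD)
  moreover have "X \<in> carrier (matrix_algebra_with A n N)" for N
    using X carrier_matrix_algebra_with by metis
  ultimately show ?thesis
    using M.bnd_Inf[of X] M.bnd_mono[of X] by blast
qed

text \<open>The least bound of the action on the n-th power is a C*-norm, which gives existence. Any
  other candidate turns the matrices into a represented C*-algebra, where
  \<open>anorm_le_iff\<close> identifies its norm with the same bound.\<close>

lemma matrix_norm_le_iff:
  assumes n: "n \<ge> 1" and X: "X \<in> mats (carrier A) n"
  shows "matrix_norm A n X \<le> C \<longleftrightarrow> mbnd n X C"
proof -
  let ?N = "\<lambda>X. Inf {C. mbnd n X C}"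
  have "matrix_norm A n X = ?N X"
    unfolding matrix_norm_def
  proof (rule the_equality)
    show "\<exists>N. unital_cstar_algebra (matrix_algebra_with A n N) \<and> ?N X = N X"
      using cstar_rep_matrix_with[of n ?N] n mbnd_Inf by blast
    fix r assume "\<exists>N. unital_cstar_algebra (matrix_algebra_with A n N) \<and> r = N X"
    then obtain N where N: "unital_cstar_algebra (matrix_algebra_with A n N)" "r = N X" by blast
    interpret M: cstar_rep "matrix_algebra_with A n N" "Vn n" "ipn n" "\<lambda>_. vzero"
      "\<lambda>f g i. vadd (f i) (g i)" "\<lambda>c f i. vscale c (f i)" "actn n"
      using N(1) star_rep_matrix by (rule cstar_rep.intro)
    have "N X \<le> C \<longleftrightarrow> mbnd n X C" for C
      using M.anorm_le_iff[of X C] X carrier_matrix_algebra_with[of A n N] by (metis matrix_algebra_with_simps(8))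
    then show "r = ?N X" using mbnd_Inf[OF X] N(2) by (metis order.refl antisym)
  qed
  then show ?thesis using mbnd_Inf[OF X] by simp
qed

theorem cstar_rep_matrix:
  assumes n: "n \<ge> 1"
  shows "cstar_rep (matrix_algebra A n) (Vn n) (ipn n) (\<lambda>_. vzero) (\<lambda>f g i. vadd (f i) (g i))
     (\<lambda>c f i. vscale c (f i)) (actn n)"
  unfolding matrix_algebra_def
  using cstar_rep_matrix_with[OF n matrix_norm_le_iff[OF n]] star_rep_matrix by (rule cstar_rep.intro)

end

section \<open>Bounded operators on a Hilbert space\<close>

text \<open>The quadratic function has its minimum 0 at t = 0, so its derivative there vanishes. In
  the proof t = -a / B, where B > 0 majorizes b.\<close>

lemma linear_coeff_zero:
  fixes a b :: real
  assumes "\<And>t. 0 \<le> 2 * t * a + t\<^sup>2 * b"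
  shows "a = 0"
proof (rule ccontr)
  assume a: "a \<noteq> 0"
  define B where "B = \<bar>b\<bar> + 1"
  have B: "B > 0" "b \<le> B" by (auto simp: B_def)
  have "0 \<le> 2 * (- a / B) * a + (- a / B)\<^sup>2 * b" by (rule assms)
  also have "\<dots> \<le> 2 * (- a / B) * a + (- a / B)\<^sup>2 * B"
    using B by (intro add_left_mono mult_left_mono) auto
  also have "\<dots> = - a\<^sup>2 / B" using B by (simp add: field_simps power2_eq_square)
  finally have "a\<^sup>2 / B \<le> 0" by simp
  moreover have "a\<^sup>2 / B > 0" using a B by simp
  ultimately show False by linarith
qed

context complex_hilbert_space
begin

sublocale hs: ip_space "carrier H" "ip H" "\<zero>" "\<lambda>x y. x \<oplus> y" "\<lambda>c x. c \<odot> x"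
proof
  show "ip H \<zero> y = 0" if "y \<in> carrier H" for y
    using ip_add[of \<zero> \<zero> y] that by simp
next
  show "ip H y x = cnj (ip H x y)" if "x \<in> carrier H" "y \<in> carrier H" for x y
    using that by (rule ip_cnj)
qed (simp_all add: ip_add ip_smult ip_nonneg smult_closed)

lemma hnorm_eq: "hnorm H x = sqrt (hs.sq x)"
  by (simp add: hnorm_def hs.sq_def)

lemma a_inv_smult: "y \<in> carrier H \<Longrightarrow> \<ominus> y = (-1) \<odot> y"
proof (rule minus_equality)
  assume y: "y \<in> carrier H"
  have "(-1) \<odot> y \<oplus> y = (-1) \<odot> y \<oplus> 1 \<odot> y" using y smult_one by simp
  also have "\<dots> = \<zero>" using smult_l_distr[of "-1" 1 y] smult_l_null[of y] y by simp
  finally show "(-1) \<odot> y \<oplus> y = \<zero>" .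
qed auto

lemma minus_smult: "\<lbrakk>x \<in> carrier H; y \<in> carrier H\<rbrakk> \<Longrightarrow> x \<ominus> y = x \<oplus> (-1) \<odot> y"
  unfolding a_minus_def by (simp only: a_inv_smult)

lemma ip_minus_left [simp]:
  "\<lbrakk>x \<in> carrier H; y \<in> carrier H; z \<in> carrier H\<rbrakk> \<Longrightarrow> ip H (x \<ominus> y) z = ip H x z - ip H y z"
  by (simp only: minus_smult) simp

lemma ip_minus_right [simp]:
  "\<lbrakk>x \<in> carrier H; y \<in> carrier H; z \<in> carrier H\<rbrakk> \<Longrightarrow> ip H z (x \<ominus> y) = ip H z x - ip H z y"
  by (simp only: minus_smult) simp

lemma ip_eqI:
  assumes xy: "x \<in> carrier H" "y \<in> carrier H" and eq: "\<And>z. z \<in> carrier H \<Longrightarrow> ip H x z = ip H y z"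
  shows "x = y"
proof -
  have "x \<ominus> y = \<zero>" using xy eq by (intro ip_eq_zero) auto
  then have "x \<oplus> \<ominus> y = \<zero>" by (simp add: a_minus_def)
  then show ?thesis using xy by (metis add.inv_solve_right' l_zero zero_closed)
qed

text \<open>Direct method: the functional J(x) = |x|^2 - 2 Re f(x) is bounded below by -C^2, its
  minimizing sequences are Cauchy, and the first variation at the limit z says that f is the inner
  product with z.\<close>

lemma Riesz:
  assumes add: "\<And>x y. \<lbrakk>x \<in> carrier H; y \<in> carrier H\<rbrakk> \<Longrightarrow> f (x \<oplus> y) = f x + f y"
    and scale: "\<And>c x. x \<in> carrier H \<Longrightarrow> f (c \<odot> x) = c * f x"
    and bound: "\<And>x. x \<in> carrier H \<Longrightarrow> cmod (f x) \<le> C * hnorm H x"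
  obtains z where "z \<in> carrier H" "\<And>x. x \<in> carrier H \<Longrightarrow> f x = ip H x z"
proof -
  define J where "J x = hs.sq x - 2 * Re (f x)" for x
  define m where "m = Inf (J ` carrier H)"
  have J_ge: "J x \<ge> - C\<^sup>2" if x: "x \<in> carrier H" for x
  proof -
    have "Re (f x) \<le> C * sqrt (hs.sq x)"
      using bound[OF x] complex_Re_le_cmod[of "f x"] by (simp add: hnorm_eq)
    moreover have "0 \<le> (sqrt (hs.sq x) - C)\<^sup>2" by simp
    then have "2 * (C * sqrt (hs.sq x)) \<le> hs.sq x + C\<^sup>2"
      using x by (simp add: power2_diff mult_ac)
    ultimately show ?thesis by (simp add: J_def)
  qed
  have bdd: "bdd_below (J ` carrier H)" using J_ge by (auto intro!: bdd_belowI[of _ "- C\<^sup>2"])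
  have m_le: "m \<le> J x" if "x \<in> carrier H" for x
    unfolding m_def using that bdd by (intro cInf_lower) auto
  have "\<exists>x\<in>carrier H. J x < m + 1 / (real n + 1)" for n
    using cInf_lessD[of "J ` carrier H" "m + 1 / (real n + 1)"] by (auto simp: m_def)
  then obtain s where s: "\<And>n. s n \<in> carrier H" and Js: "\<And>n. J (s n) < m + 1 / (real n + 1)"
    by metis
  \<comment> \<open>J at the midpoint is at least m; with the parallelogram identity this bounds the
    distance of x and y by their excess over the minimum.\<close>
  have par: "hs.sq (x \<ominus> y) \<le> 2 * (J x - m) + 2 * (J y - m)" if xy: "x \<in> carrier H" "y \<in> carrier H" for x y
  proof -
    let ?mid = "(1 / 2) \<odot> (x \<oplus> y)"
    have "m \<le> J ?mid" using xy by (intro m_le) (auto intro: smult_closed)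
    moreover have "J ?mid = (hs.sq x + 2 * Re (ip H x y) + hs.sq y) / 4 - Re (f x) - Re (f y)"
      using xy by (simp add: J_def scale add hs.sq_vadd power2_eq_square field_simps)
    moreover have "hs.sq (x \<ominus> y) = hs.sq x - 2 * Re (ip H x y) + hs.sq y"
      using xy by (simp add: minus_smult hs.sq_vadd)
    ultimately have "4 * m \<le> hs.sq x + 2 * Re (ip H x y) + hs.sq y - 4 * Re (f x) - 4 * Re (f y)"
      and "hs.sq (x \<ominus> y) = hs.sq x - 2 * Re (ip H x y) + hs.sq y"
      by (simp_all add: field_simps)
    then show ?thesis by (simp add: J_def)
  qed
  have "\<exists>N. \<forall>k\<ge>N. \<forall>l\<ge>N. hnorm H (s k \<ominus> s l) < e" if e: "e > 0" for e
  proof -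
    obtain N :: nat where N: "4 / e\<^sup>2 < real N" using reals_Archimedean2 by blast
    have "hnorm H (s k \<ominus> s l) < e" if kl: "k \<ge> N" "l \<ge> N" for k l
    proof -
      have N1: "1 / (real j + 1) \<le> 1 / (real N + 1)" if "j \<ge> N" for j
        using that by (simp add: frac_le)
      have "hs.sq (s k \<ominus> s l) \<le> 2 * (J (s k) - m) + 2 * (J (s l) - m)"
        using s by (intro par)
      also have "\<dots> < 4 * (1 / (real N + 1))"
      proof -
        have "J (s k) < m + 1 / (real N + 1)" "J (s l) < m + 1 / (real N + 1)"
          using Js N1[OF kl(1)] N1[OF kl(2)] by (meson add_left_mono order_less_le_trans)+
        then show ?thesis by simp
      qed
      also have "\<dots> < e\<^sup>2"
      proof -
        have "4 < real N * e\<^sup>2" using N e by (simp add: divide_less_eq)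
        also have "\<dots> \<le> (real N + 1) * e\<^sup>2" by (simp add: mult_right_mono)
        finally show ?thesis by (simp add: divide_less_eq mult.commute)
      qed
      finally show ?thesis using e by (simp add: hnorm_eq real_less_lsqrt)
    qed
    then show ?thesis by blast
  qed
  then obtain z where z: "z \<in> carrier H" and lim: "(\<lambda>k. hnorm H (s k \<ominus> z)) \<longlonglongrightarrow> 0"
    using complete[of s] s by auto
  have ip_lim: "(\<lambda>n. ip H (s n) h) \<longlonglongrightarrow> ip H z h" if h: "h \<in> carrier H" for h
  proof (rule LIM_zero_cancel, rule tendsto_rabs_zero_cancel[OF _, THEN tendsto_norm_zero_cancel])
    show "(\<lambda>n. \<bar>cmod (ip H (s n) h - ip H z h)\<bar>) \<longlonglongrightarrow> 0"
    proof (rule tendsto_sandwich[OF _ _ tendsto_const])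
      show "(\<lambda>n. hnorm H (s n \<ominus> z) * hnorm H h) \<longlonglongrightarrow> 0"
        using tendsto_mult_right[OF lim] by simp
      have "cmod (ip H (s n) h - ip H z h) \<le> hnorm H (s n \<ominus> z) * hnorm H h" for n
        using hs.cmod_ip_le[of "s n \<ominus> z" h] s[of n] z h by (simp add: hnorm_eq)
      then show "\<forall>\<^sub>F n in sequentially. \<bar>cmod (ip H (s n) h - ip H z h)\<bar> \<le> hnorm H (s n \<ominus> z) * hnorm H h"
        by simp
    qed simp
  qed
  have re: "Re (f h) = Re (ip H z h)" if h: "h \<in> carrier H" for h
  proof -
    \<comment> \<open>The inequality m \<le> J(s_n + t h) is expanded at the minimizing sequence and
      then passed to the limit; 1 / (n + 1) bounds the excess of J(s_n) over m.\<close>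
    have "0 \<le> 2 * t * (Re (ip H z h) - Re (f h)) + t\<^sup>2 * hs.sq h" for t :: real
    proof (rule LIMSEQ_le_const)
      have "(\<lambda>n. 2 * t * (Re (ip H (s n) h) - Re (f h)) + t\<^sup>2 * hs.sq h + 1 / (real n + 1))
          \<longlonglongrightarrow> 2 * t * (Re (ip H z h) - Re (f h)) + t\<^sup>2 * hs.sq h + 0"
        using LIMSEQ_inverse_real_of_nat
        by (intro tendsto_intros ip_lim h) (simp add: inverse_eq_divide add.commute)
      then show "(\<lambda>n. 2 * t * (Re (ip H (s n) h) - Re (f h)) + t\<^sup>2 * hs.sq h + 1 / (real n + 1))
          \<longlonglongrightarrow> 2 * t * (Re (ip H z h) - Re (f h)) + t\<^sup>2 * hs.sq h" by simp
      have "0 \<le> 2 * t * (Re (ip H (s n) h) - Re (f h)) + t\<^sup>2 * hs.sq h + 1 / (real n + 1)" for n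
      proof -
        let ?th = "complex_of_real t \<odot> h"
        have "m \<le> J (s n \<oplus> ?th)" using s h by (intro m_le) (auto intro: smult_closed)
        also have "\<dots> = J (s n) + 2 * t * (Re (ip H (s n) h) - Re (f h)) + t\<^sup>2 * hs.sq h"
          using s[of n] h by (simp add: J_def scale add hs.sq_vadd smult_closed algebra_simps)
        finally show ?thesis using Js[of n] by linarith
      qed
      then show "\<exists>N. \<forall>n\<ge>N. 0 \<le> 2 * t * (Re (ip H (s n) h) - Re (f h)) + t\<^sup>2 * hs.sq h + 1 / (real n + 1)"
        by blast
    qed
    then show ?thesis using linear_coeff_zero[of "Re (ip H z h) - Re (f h)" "hs.sq h"] by simp
  qed
  show ?thesis
  proof (rule that[OF z])
    fix h assume h: "h \<in> carrier H"
    have ih: "\<i> \<odot> h \<in> carrier H" using h by simp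
    \<comment> \<open>The imaginary part of a complex linear functional at h is minus its real part
      at i h.\<close>
    have "Im (f h) = - Re (f (\<i> \<odot> h))" using h by (simp add: scale)
    also have "\<dots> = - Re (ip H z (\<i> \<odot> h))" using re[OF ih] by simp
    also have "\<dots> = - Im (ip H z h)" using h z by simp
    also have "\<dots> = Im (ip H h z)" using hs.ip_commute[OF z h] by simp
    finally show "f h = ip H h z"
      using re[OF h] hs.ip_commute[OF z h] by (simp add: complex_eq_iff)
  qed
qed

lemma bounded_operatorI:
  assumes "T \<in> carrier H \<rightarrow>\<^sub>E carrier H"
    and "\<And>x y. \<lbrakk>x \<in> carrier H; y \<in> carrier H\<rbrakk> \<Longrightarrow> T (x \<oplus> y) = T x \<oplus> T y"
    and "\<And>c x. x \<in> carrier H \<Longrightarrow> T (c \<odot> x) = c \<odot> T x"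
    and "\<And>x. x \<in> carrier H \<Longrightarrow> hnorm H (T x) \<le> C * hnorm H x"
  shows "bounded_operator H T"
  unfolding bounded_operator_def
  by (intro conjI ballI allI exI[of _ C]) (simp_all only: assms)

lemma bounded_operatorI_ip:
  assumes closed: "T \<in> carrier H \<rightarrow>\<^sub>E carrier H"
    and add: "\<And>x y z. \<lbrakk>x \<in> carrier H; y \<in> carrier H; z \<in> carrier H\<rbrakk>
        \<Longrightarrow> ip H (T (x \<oplus> y)) z = ip H (T x) z + ip H (T y) z"
    and scale: "\<And>c x z. \<lbrakk>x \<in> carrier H; z \<in> carrier H\<rbrakk> \<Longrightarrow> ip H (T (c \<odot> x)) z = c * ip H (T x) z"
    and bound: "\<And>x. x \<in> carrier H \<Longrightarrow> hnorm H (T x) \<le> C * hnorm H x"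
  shows "bounded_operator H T"
proof (rule bounded_operatorI[OF closed _ _ bound])
  have T: "T x \<in> carrier H" if "x \<in> carrier H" for x using closed that by auto
  show "T (x \<oplus> y) = T x \<oplus> T y" if "x \<in> carrier H" "y \<in> carrier H" for x y
    by (rule ip_eqI) (simp_all add: that T add)
  show "T (c \<odot> x) = c \<odot> T x" if "x \<in> carrier H" for c x
    by (rule ip_eqI) (simp_all add: that T scale)
qed

lemma bounded_operatorD:
  assumes "bounded_operator H T"
  shows "\<And>x. x \<in> carrier H \<Longrightarrow> T x \<in> carrier H"
    and "\<And>x y. \<lbrakk>x \<in> carrier H; y \<in> carrier H\<rbrakk> \<Longrightarrow> T (x \<oplus> y) = T x \<oplus> T y"
    and "\<And>c x. x \<in> carrier H \<Longrightarrow> T (c \<odot> x) = c \<odot> T x"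
    and "\<exists>C\<ge>0. \<forall>x\<in>carrier H. hnorm H (T x) \<le> C * hnorm H x"
proof -
  from assms obtain C where C: "\<forall>x\<in>carrier H. hnorm H (T x) \<le> C * hnorm H x"
    unfolding bounded_operator_def by blast
  have "hnorm H (T x) \<le> \<bar>C\<bar> * hnorm H x" if "x \<in> carrier H" for x
  proof -
    have "C * hnorm H x \<le> \<bar>C\<bar> * hnorm H x"
      using that by (intro mult_right_mono) (auto simp: hnorm_eq)
    then show ?thesis using C that by force
  qed
  then show "\<exists>C\<ge>0. \<forall>x\<in>carrier H. hnorm H (T x) \<le> C * hnorm H x"
    by (metis abs_ge_zero)
  show "\<And>x. x \<in> carrier H \<Longrightarrow> T x \<in> carrier H"
    and "\<And>x y. \<lbrakk>x \<in> carrier H; y \<in> carrier H\<rbrakk> \<Longrightarrow> T (x \<oplus> y) = T x \<oplus> T y"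
    and "\<And>c x. x \<in> carrier H \<Longrightarrow> T (c \<odot> x) = c \<odot> T x"
    using assms unfolding bounded_operator_def by blast+
qed

lemma adjoint_operator:
  assumes T: "bounded_operator H T"
  shows "\<And>y. y \<in> carrier H \<Longrightarrow> adjoint_operator H T y \<in> carrier H"
    and "\<And>x y. \<lbrakk>x \<in> carrier H; y \<in> carrier H\<rbrakk> \<Longrightarrow> ip H (T x) y = ip H x (adjoint_operator H T y)"
proof -
  note TD = bounded_operatorD[OF T]
  obtain C where C: "C \<ge> 0" "\<And>x. x \<in> carrier H \<Longrightarrow> hnorm H (T x) \<le> C * hnorm H x" using TD(4) by blast
  have *: "adjoint_operator H T y \<in> carrier H \<and> (\<forall>x\<in>carrier H. ip H (T x) y = ip H x (adjoint_operator H T y))"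
    if y: "y \<in> carrier H" for y
  proof -
    obtain z where z: "z \<in> carrier H" "\<And>x. x \<in> carrier H \<Longrightarrow> ip H (T x) y = ip H x z"
    proof (rule Riesz[of "\<lambda>x. ip H (T x) y" "C * hnorm H y"])
      fix x assume x: "x \<in> carrier H"
      have "cmod (ip H (T x) y) \<le> hnorm H (T x) * hnorm H y"
        using hs.cmod_ip_le[OF TD(1)[OF x] y] by (simp add: hnorm_eq)
      also have "\<dots> \<le> C * hnorm H x * hnorm H y"
        using C(2)[OF x] y by (intro mult_right_mono) (auto simp: hnorm_eq)
      finally show "cmod (ip H (T x) y) \<le> C * hnorm H y * hnorm H x" by (simp add: mult_ac)
    qed (use y TD in auto)
    have "(THE z. z \<in> carrier H \<and> (\<forall>x\<in>carrier H. ip H (T x) y = ip H x z)) = z"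
    proof (rule the_equality)
      fix w assume w: "w \<in> carrier H \<and> (\<forall>x\<in>carrier H. ip H (T x) y = ip H x w)"
      show "w = z"
      proof (rule ip_eqI)
        fix x assume x: "x \<in> carrier H"
        show "ip H w x = ip H z x"
          using w z x hs.ip_commute[of x w] hs.ip_commute[of x z] by metis
      qed (use w z in auto)
    qed (use z in auto)
    then show ?thesis using z y by (simp add: adjoint_operator_def)
  qed
  show "\<And>y. y \<in> carrier H \<Longrightarrow> adjoint_operator H T y \<in> carrier H"
    and "\<And>x y. \<lbrakk>x \<in> carrier H; y \<in> carrier H\<rbrakk> \<Longrightarrow> ip H (T x) y = ip H x (adjoint_operator H T y)"
    using * by blast+
qed

lemma bounded_adjoint_operator:
  assumes T: "bounded_operator H T"
  shows "bounded_operator H (adjoint_operator H T)"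
proof -
  note TD = bounded_operatorD[OF T] and adj = adjoint_operator[OF T]
  obtain C where C: "C \<ge> 0" "\<And>x. x \<in> carrier H \<Longrightarrow> hnorm H (T x) \<le> C * hnorm H x" using TD(4) by blast
  have adj': "ip H (adjoint_operator H T y) x = ip H y (T x)" if "x \<in> carrier H" "y \<in> carrier H" for x y
    using adj(2)[OF that] adj(1)[OF that(2)] TD(1)[OF that(1)] that hs.ip_commute by metis
  show ?thesis
  proof (rule bounded_operatorI)
    show "adjoint_operator H T \<in> carrier H \<rightarrow>\<^sub>E carrier H"
      using adj(1) by (auto simp: adjoint_operator_def)
    show "adjoint_operator H T (x \<oplus> y) = adjoint_operator H T x \<oplus> adjoint_operator H T y"
      if "x \<in> carrier H" "y \<in> carrier H" for x y
      by (rule ip_eqI) (use that adj(1) TD(1) in \<open>auto simp: adj'\<close>)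
    show "adjoint_operator H T (c \<odot> x) = c \<odot> adjoint_operator H T x" if "x \<in> carrier H" for c x
      by (rule ip_eqI) (use that adj(1) TD(1) in \<open>auto simp: adj'\<close>)
    fix y assume y: "y \<in> carrier H"
    let ?z = "adjoint_operator H T y"
    have z: "?z \<in> carrier H" using adj(1) y .
    show "hnorm H ?z \<le> C * hnorm H y"
    proof (cases "hnorm H ?z = 0")
      case True
      then show ?thesis using C(1) y by (simp add: hnorm_eq)
    next
      case False
      then have pos: "hnorm H ?z > 0" using z by (simp add: hnorm_eq less_le)
      have "hnorm H ?z * hnorm H ?z = cmod (ip H ?z ?z)"
        using z by (simp add: hs.ip_self hnorm_eq)
      also have "\<dots> = cmod (ip H y (T ?z))" using adj'[OF z y] by simp
      also have "\<dots> \<le> hnorm H y * hnorm H (T ?z)"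
        using hs.cmod_ip_le[OF y TD(1)[OF z]] by (simp add: hnorm_eq)
      also have "\<dots> \<le> hnorm H y * (C * hnorm H ?z)"
        using C(2)[OF z] y by (intro mult_left_mono) (auto simp: hnorm_eq)
      finally have "hnorm H ?z * hnorm H ?z \<le> (C * hnorm H y) * hnorm H ?z" by (simp add: mult_ac)
      then show ?thesis using pos by simp
    qed
  qed
qed

lemma star_rep_bounded_operators:
  "star_rep (bounded_operators H) (carrier H) (ip H) \<zero> (\<lambda>x y. x \<oplus> y) (\<lambda>c x. c \<odot> x) (\<lambda>T. T)"
proof -
  let ?B = "bounded_operators H"
  have C: "T \<in> carrier ?B \<longleftrightarrow> bounded_operator H T" for T by (simp add: bounded_operators_def)
  have ops: "S \<oplus>\<^bsub>?B\<^esub> T = (\<lambda>x\<in>carrier H. S x \<oplus> T x)" "S \<otimes>\<^bsub>?B\<^esub> T = compose (carrier H) S T"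
    "c \<odot>\<^bsub>?B\<^esub> T = (\<lambda>x\<in>carrier H. c \<odot> T x)" "\<one>\<^bsub>?B\<^esub> = (\<lambda>x\<in>carrier H. x)" "\<zero>\<^bsub>?B\<^esub> = (\<lambda>x\<in>carrier H. \<zero>)"
    "star ?B T = adjoint_operator H T" for S T c by (simp_all add: bounded_operators_def)
  show ?thesis
  proof (unfold_locales, unfold C ops)
    fix S T assume S: "bounded_operator H S" and T: "bounded_operator H T"
    note SD = bounded_operatorD[OF S] and TD = bounded_operatorD[OF T]
    obtain C D where CD: "C \<ge> 0" "\<And>x. x \<in> carrier H \<Longrightarrow> hnorm H (S x) \<le> C * hnorm H x"
      "D \<ge> 0" "\<And>x. x \<in> carrier H \<Longrightarrow> hnorm H (T x) \<le> D * hnorm H x" using SD(4) TD(4) by blast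
    show "bounded_operator H (\<lambda>x\<in>carrier H. S x \<oplus> T x)"
    proof (rule bounded_operatorI_ip)
      fix x assume x: "x \<in> carrier H"
      have "hnorm H (S x \<oplus> T x) \<le> hnorm H (S x) + hnorm H (T x)"
        using hs.sqrt_sq_vadd[OF SD(1)[OF x] TD(1)[OF x]] by (simp add: hnorm_eq)
      also have "\<dots> \<le> (C + D) * hnorm H x"
        using CD(2)[OF x] CD(4)[OF x] by (simp add: algebra_simps)
      finally show "hnorm H ((\<lambda>x\<in>carrier H. S x \<oplus> T x) x) \<le> (C + D) * hnorm H x" using x by simp
    qed (simp_all add: SD(1-3) TD(1-3) distrib_left)
    show "bounded_operator H (compose (carrier H) S T)"
    proof (rule bounded_operatorI)
      fix x assume x: "x \<in> carrier H"
      have "hnorm H (S (T x)) \<le> C * hnorm H (T x)" using CD(2)[OF TD(1)[OF x]] .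
      also have "\<dots> \<le> C * (D * hnorm H x)" using CD(4)[OF x] CD(1) by (rule mult_left_mono)
      finally show "hnorm H (compose (carrier H) S T x) \<le> (C * D) * hnorm H x"
        using x by (simp add: compose_def mult.assoc)
    qed (simp_all add: compose_def SD(1-3) TD(1-3))
    fix x y assume xy: "x \<in> carrier H" "y \<in> carrier H"
    show "ip H (compose (carrier H) S T x) y = ip H (S (T x)) y" using xy by (simp add: compose_def)
    show "ip H ((\<lambda>x\<in>carrier H. S x \<oplus> T x) x) y = ip H (S x) y + ip H (T x) y"
      using xy SD TD by simp
  next
    show "bounded_operator H (\<lambda>x\<in>carrier H. \<zero>)"
      by (rule bounded_operatorI_ip[where C = 0]) (simp_all add: hnorm_eq)
    show "bounded_operator H (\<lambda>x\<in>carrier H. x)"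
      by (rule bounded_operatorI_ip[where C = 1]) simp_all
  next
    fix T c assume T: "bounded_operator H T"
    note TD = bounded_operatorD[OF T]
    obtain D where D: "D \<ge> 0" "\<And>x. x \<in> carrier H \<Longrightarrow> hnorm H (T x) \<le> D * hnorm H x" using TD(4) by blast
    show "bounded_operator H (\<lambda>x\<in>carrier H. c \<odot> T x)"
    proof (rule bounded_operatorI_ip)
      fix x assume x: "x \<in> carrier H"
      show "hnorm H ((\<lambda>x\<in>carrier H. c \<odot> T x) x) \<le> (cmod c * D) * hnorm H x"
        using x D(2)[OF x] TD(1)[OF x] by (simp add: hnorm_eq real_sqrt_mult mult_left_mono mult.assoc)
    qed (simp_all add: TD(1-3) distrib_left)
    show "bounded_operator H (adjoint_operator H T)" using T by (rule bounded_adjoint_operator)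
    fix x y assume xy: "x \<in> carrier H" "y \<in> carrier H"
    show "T x \<in> carrier H" using TD xy by simp
    show "ip H ((\<lambda>x\<in>carrier H. c \<odot> T x) x) y = c * ip H (T x) y" using xy TD by simp
    show "ip H (adjoint_operator H T x) y = ip H x (T y)"
      using adjoint_operator[OF T] TD(1) xy hs.ip_commute by metis
  next
    fix S T assume S: "bounded_operator H S" and T: "bounded_operator H T"
      and eq: "\<And>x y. \<lbrakk>x \<in> carrier H; y \<in> carrier H\<rbrakk> \<Longrightarrow> ip H (S x) y = ip H (T x) y"
    show "S = T"
    proof (rule extensionalityI[of _ "carrier H"])
      fix x assume "x \<in> carrier H"
      then show "S x = T x" using eq bounded_operatorD(1)[OF S] bounded_operatorD(1)[OF T] by (intro ip_eqI) auto
    qed (use S T in \<open>auto simp: bounded_operator_def PiE_def\<close>)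
  qed auto
qed

end

section \<open>Complex matrices\<close>

text \<open>The scalars act on a one-dimensional space, so complex matrices, and matrices over
  complex matrices, are instances of the general matrix construction.\<close>

lemma star_rep_complex:
  "star_rep complex_cstar UNIV (\<lambda>x y. x * cnj y) 0 (+) (*) (*)"
proof unfold_locales
  fix a b :: complex assume "\<And>x y. \<lbrakk>x \<in> UNIV; y \<in> UNIV\<rbrakk> \<Longrightarrow> a * x * cnj y = b * x * cnj y"
  from this[of 1 1] show "a = b" by simp
qed (auto simp: complex_cstar_def algebra_simps)

lemma cstar_rep_complex:
  "cstar_rep complex_cstar UNIV (\<lambda>x y. x * cnj y) 0 (+) (*) (*)"
proof -
  have e: "(cmod (a * x))\<^sup>2 = (cmod a)\<^sup>2 * (cmod x)\<^sup>2" for a x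
    by (simp add: norm_mult power_mult_distrib)
  have e': "(\<forall>x. (cmod a)\<^sup>2 * (cmod x)\<^sup>2 \<le> C\<^sup>2 * (cmod x)\<^sup>2) \<longleftrightarrow> (cmod a)\<^sup>2 \<le> C\<^sup>2" for a C
    by (metis mult.right_neutral mult_right_mono norm_one power_one zero_le_power2)
  interpret star_rep complex_cstar UNIV "\<lambda>x y. x * cnj y" 0 "(+)" "(*)" "(*)"
    by (rule star_rep_complex)
  have sq: "sq x = (cmod x)\<^sup>2" for x
    unfolding sq_def complex_norm_square[symmetric] by (rule Re_complex_of_real)
  have minus: "x \<ominus>\<^bsub>complex_cstar\<^esub> y = x - y" for x y
    using minus_rep[of x y] by (simp add: complex_cstar_def)
  have "unital_cstar_algebra complex_cstar"
  proof (rule cstar_algebraI)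
    fix a C
    show "(anorm complex_cstar a \<le> C) = bnd a C"
    proof -
      have "bnd a C \<longleftrightarrow> 0 \<le> C \<and> (cmod a)\<^sup>2 \<le> C\<^sup>2"
        unfolding bnd_def sq e e'[symmetric] by blast
      also have "\<dots> \<longleftrightarrow> cmod a \<le> C"
        by (metis norm_ge_zero order.trans power2_le_imp_le power_mono)
      finally show ?thesis by (simp add: complex_cstar_def)
    qed
  next
    fix s :: "nat \<Rightarrow> complex"
    assume "\<And>e. e > 0 \<Longrightarrow> \<exists>N. \<forall>k\<ge>N. \<forall>l\<ge>N. anorm complex_cstar (s k \<ominus>\<^bsub>complex_cstar\<^esub> s l) < e"
    then have "Cauchy s" unfolding minus by (simp add: Cauchy_def dist_norm complex_cstar_def)
    then obtain x where "s \<longlonglongrightarrow> x" using Cauchy_convergent convergent_def by blast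
    then have "(\<lambda>k. cmod (s k - x)) \<longlonglongrightarrow> 0" by (simp add: LIM_zero tendsto_norm_zero)
    then show "\<exists>x\<in>carrier complex_cstar. (\<lambda>k. anorm complex_cstar (s k \<ominus>\<^bsub>complex_cstar\<^esub> x)) \<longlonglongrightarrow> 0"
      unfolding minus by (auto simp: complex_cstar_def)
  qed (simp add: complex_cstar_def)
  then show ?thesis using star_rep_complex by (rule cstar_rep.intro)
qed

lemma cstar_rep_of_faithful:
  assumes A: "unital_cstar_algebra A" and H: "complex_hilbert_space H" and r: "faithful_representation A H \<pi>"
  shows "cstar_rep A (carrier H) (ip H) \<zero>\<^bsub>H\<^esub> (\<lambda>x y. x \<oplus>\<^bsub>H\<^esub> y) (\<lambda>c x. c \<odot>\<^bsub>H\<^esub> x) \<pi>"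
proof -
  interpret A: unital_cstar_algebra A by (rule A)
  interpret H: complex_hilbert_space H by (rule H)
  let ?B = "bounded_operators H"
  interpret B: star_rep ?B "carrier H" "ip H" "\<zero>\<^bsub>H\<^esub>" "\<lambda>x y. x \<oplus>\<^bsub>H\<^esub> y" "\<lambda>c x. c \<odot>\<^bsub>H\<^esub> x" "\<lambda>T. T"
    by (rule H.star_rep_bounded_operators)
  from r have hom: "\<pi> \<in> Ring.ring_hom A ?B" and inj: "inj_on \<pi> (carrier A)"
    and sm: "\<And>c x. x \<in> carrier A \<Longrightarrow> \<pi> (c \<odot>\<^bsub>A\<^esub> x) = c \<odot>\<^bsub>?B\<^esub> \<pi> x"
    and st: "\<And>x. x \<in> carrier A \<Longrightarrow> \<pi> (star A x) = star ?B (\<pi> x)"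
    unfolding faithful_representation_def unital_star_hom_def by blast+
  note hom_simps = ring_hom_closed[OF hom] ring_hom_mult[OF hom] ring_hom_add[OF hom] ring_hom_one[OF hom]
  \<comment> \<open>Preservation of zero is obtained from homogeneity with the scalar 0.\<close>
  have zero: "\<pi> \<zero>\<^bsub>A\<^esub> = \<zero>\<^bsub>?B\<^esub>"
    using sm[of "\<zero>\<^bsub>A\<^esub>" 0] A.smult_r_null[of 0] B.smult_l_null[of "\<pi> \<zero>\<^bsub>A\<^esub>"] hom_simps(1)[of "\<zero>\<^bsub>A\<^esub>"]
    by (metis A.M.zero_closed UNIV_I complex_ring_simps(1,5))
  have "star_rep A (carrier H) (ip H) \<zero>\<^bsub>H\<^esub> (\<lambda>x y. x \<oplus>\<^bsub>H\<^esub> y) (\<lambda>c x. c \<odot>\<^bsub>H\<^esub> x) \<pi>"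
  proof unfold_locales
    fix a b assume ab: "a \<in> carrier A" "b \<in> carrier A"
      and eq: "\<And>x y. \<lbrakk>x \<in> carrier H; y \<in> carrier H\<rbrakk> \<Longrightarrow> ip H (\<pi> a x) y = ip H (\<pi> b x) y"
    have "\<pi> a = \<pi> b" using ab eq hom_simps by (intro B.act_faithful) auto
    then show "a = b" using inj ab by (simp add: inj_on_eq_iff)
  qed (simp_all add: hom_simps sm st zero A.star_closed B.act_mult B.act_star)
  with A show ?thesis by (rule cstar_rep.intro)
qed

lemma sum_lessThan_add: "(\<Sum>i<m + n. g i) = (\<Sum>i<m. g i) + (\<Sum>i<n. g (m + i))"
  for g :: "nat \<Rightarrow> 'b::comm_monoid_add"
  by (induction n) (simp_all add: add.assoc)

lemma sum_swap3:
  "(\<Sum>a\<in>S. \<Sum>b\<in>T. \<Sum>c\<in>U. g a b c) = (\<Sum>c\<in>U. \<Sum>a\<in>S. \<Sum>b\<in>T. g a b c)"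
proof -
  have "(\<Sum>a\<in>S. \<Sum>b\<in>T. \<Sum>c\<in>U. g a b c) = (\<Sum>a\<in>S. \<Sum>c\<in>U. \<Sum>b\<in>T. g a b c)"
    by (intro sum.cong refl sum.swap)
  also have "\<dots> = (\<Sum>c\<in>U. \<Sum>a\<in>S. \<Sum>b\<in>T. g a b c)"
    by (rule sum.swap)
  finally show ?thesis .
qed

lemma complex_cstar_simps [simp]:
  "carrier complex_cstar = UNIV" "x \<otimes>\<^bsub>complex_cstar\<^esub> y = x * y" "\<one>\<^bsub>complex_cstar\<^esub> = 1"
  "\<zero>\<^bsub>complex_cstar\<^esub> = 0" "x \<oplus>\<^bsub>complex_cstar\<^esub> y = x + y" "c \<odot>\<^bsub>complex_cstar\<^esub> x = c * x"
  "star complex_cstar x = cnj x" "anorm complex_cstar x = cmod x"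
  by (simp_all add: complex_cstar_def)

interpretation cc: cstar_rep complex_cstar UNIV "\<lambda>x y. x * cnj y" 0 "(+)" "(*)" "(*)"
  by (rule cstar_rep_complex)

lemma finsum_complex_cstar: "finite I \<Longrightarrow> (\<Oplus>\<^bsub>complex_cstar\<^esub>i\<in>I. f i) = (\<Sum>i\<in>I. f i)"
  by (induction I rule: finite_induct) (simp_all add: cc.finsum_insert)

abbreviation "cvec n \<equiv> vpow n (UNIV :: complex set)"
abbreviation "cip n \<equiv> ip_pow n (\<lambda>x y. x * cnj y)"
abbreviation "cact n \<equiv> act_pow n (0 :: complex) (+) (*)"
abbreviation "cmats \<equiv> mats (UNIV :: complex set)"

lemma cvec [simp]: "cvec n = UNIV" by (auto simp: vpow_def)

lemma cm_rep: "n \<ge> 1 \<Longrightarrow> cstar_rep (complex_matrices n) (cvec n) (cip n) (\<lambda>_. 0) (\<lambda>f g i. f i + g i)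
    (\<lambda>c f i. c * f i) (cact n)"
  by (rule cc.cstar_rep_matrix)

lemma cm_carrier [simp]: "carrier (complex_matrices n) = cmats n"
  by (simp add: matrix_algebra_def carrier_matrix_algebra_with del: matrix_algebra_with_simps)

lemma cm_simps:
  "\<one>\<^bsub>complex_matrices n\<^esub> = mat n n (\<lambda>(i, j). if i = j then 1 else 0)"
  "X \<oplus>\<^bsub>complex_matrices n\<^esub> Y = mat n n (\<lambda>ij. X $$ ij + Y $$ ij)"
  "X \<otimes>\<^bsub>complex_matrices n\<^esub> Y = mat n n (\<lambda>(i, j). \<Sum>k<n. X $$ (i, k) * Y $$ (k, j))"
  "c \<odot>\<^bsub>complex_matrices n\<^esub> X = mat n n (\<lambda>ij. c * X $$ ij)"
  "star (complex_matrices n) X = mat n n (\<lambda>(i, j). cnj (X $$ (j, i)))"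
  by (simp_all add: matrix_algebra_def finsum_complex_cstar cong: if_cong)

lemma cm_rep2:
  assumes "n \<ge> 1" "k \<ge> 1"
  shows "cstar_rep (matrix_algebra (complex_matrices n) k) (vpow k (cvec n)) (ip_pow k (cip n))
    (\<lambda>_ _. 0) (\<lambda>f g i j. f i j + g i j) (\<lambda>c f i j. c * f i j)
    (act_pow k (\<lambda>_. 0) (\<lambda>f g i. f i + g i) (cact n))"
  by (rule cstar_rep.cstar_rep_matrix[OF cm_rep[OF assms(1)] assms(2)])

text \<open>The quadratic form of an element of M_k(M_n) on the tensor product of k- and
  n-dimensional space, in coordinates.\<close>

definition mform :: "nat \<Rightarrow> nat \<Rightarrow> complex mat mat \<Rightarrow> (nat \<Rightarrow> nat \<Rightarrow> complex) \<Rightarrow> complex" where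
  "mform n k Q w = (\<Sum>i<k. \<Sum>j<k. \<Sum>a<n. \<Sum>b<n. Q $$ (i, j) $$ (a, b) * w j b * cnj (w i a))"

lemma cm2_carrier: "carrier (matrix_algebra (complex_matrices n) k) = mats (cmats n) k"
  by (simp add: matrix_algebra_def[of "complex_matrices n"] carrier_matrix_algebra_with
      del: matrix_algebra_with_simps)

lemma cm2_form:
  assumes n: "n \<ge> 1" and Q: "Q \<in> mats (cmats n) k"
  shows "ip_pow k (cip n) (act_pow k (\<lambda>_. 0) (\<lambda>f g i. f i + g i) (cact n) Q w) w = mform n k Q w"
proof -
  interpret M: cstar_rep "complex_matrices n" "cvec n" "cip n" "\<lambda>_. 0" "\<lambda>f g i. f i + g i"
    "\<lambda>c f i. c * f i" "cact n"
    by (rule cm_rep[OF n])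
  have "ip_pow k (cip n) (act_pow k (\<lambda>_. 0) (\<lambda>f g i. f i + g i) (cact n) Q w) w
      = (\<Sum>i<k. \<Sum>j<k. cip n (cact n (Q $$ (i, j)) (w j)) (w i))"
    using Q by (intro M.ipn_actn) (auto simp: vpow_def)
  also have "\<dots> = mform n k Q w"
    unfolding mform_def
  proof (intro sum.cong refl)
    fix i j assume "i \<in> {..<k}" "j \<in> {..<k}"
    then have "Q $$ (i, j) \<in> cmats n" using Q by (auto simp: mats_def)
    then show "cip n (cact n (Q $$ (i, j)) (w j)) (w i)
        = (\<Sum>a<n. \<Sum>b<n. Q $$ (i, j) $$ (a, b) * w j b * cnj (w i a))"
      by (subst cc.ipn_actn) auto
  qed
  finally show ?thesis .
qed

lemma cm2_positive_iff:
  assumes n: "n \<ge> 1" and k: "k \<ge> 1" and Q: "Q \<in> mats (cmats n) k"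
  shows "Q \<in> positive_elements (matrix_algebra (complex_matrices n) k)
    \<longleftrightarrow> (\<forall>w. Im (mform n k Q w) = 0 \<and> 0 \<le> Re (mform n k Q w))"
proof -
  interpret M: cstar_rep "matrix_algebra (complex_matrices n) k" "vpow k (cvec n)" "ip_pow k (cip n)"
    "\<lambda>_ _. 0" "\<lambda>f g i j. f i j + g i j" "\<lambda>c f i j. c * f i j"
    "act_pow k (\<lambda>_. 0) (\<lambda>f g i. f i + g i) (cact n)"
    by (rule cm_rep2[OF n k])
  have "M.form_pos Q \<longleftrightarrow> (\<forall>w. Im (mform n k Q w) = 0 \<and> 0 \<le> Re (mform n k Q w))"
    unfolding M.form_pos_def cm2_form[OF n Q] by (simp add: vpow_def)
  moreover have "Q \<in> carrier (matrix_algebra (complex_matrices n) k)"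
    using Q unfolding cm2_carrier .
  ultimately show ?thesis by (simp only: M.positive_elements_iff)
qed

lemma cm2_self_adjoint:
  assumes n: "n \<ge> 1" and k: "k \<ge> 1" and Q: "Q \<in> mats (cmats n) k"
    and p: "Q \<in> positive_elements (matrix_algebra (complex_matrices n) k)"
    and ij: "i < k" "j < k" and ab: "a < n" "b < n"
  shows "Q $$ (i, j) $$ (a, b) = cnj (Q $$ (j, i) $$ (b, a))"
proof -
  interpret M: cstar_rep "matrix_algebra (complex_matrices n) k" "vpow k (cvec n)" "ip_pow k (cip n)"
    "\<lambda>_ _. 0" "\<lambda>f g i j. f i j + g i j" "\<lambda>c f i j. c * f i j"
    "act_pow k (\<lambda>_. 0) (\<lambda>f g i. f i + g i) (cact n)"
    by (rule cm_rep2[OF n k])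
  have Qc: "Q \<in> carrier (matrix_algebra (complex_matrices n) k)" using Q unfolding cm2_carrier .
  have "star (matrix_algebra (complex_matrices n) k) Q = Q"
    using M.form_pos_self_adjoint[OF Qc] M.positive_elements_iff[OF Qc] p by blast
  then have "Q $$ (i, j) = star (matrix_algebra (complex_matrices n) k) Q $$ (i, j)" by simp
  also have "\<dots> = star (complex_matrices n) (Q $$ (j, i))"
    using ij by (simp add: matrix_algebra_def[of "complex_matrices n"])
  finally show ?thesis using ab by (simp add: cm_simps)
qed

section \<open>Compressions of bounded operators as UCP maps\<close>

context complex_hilbert_space
begin

interpretation B: star_rep "bounded_operators H" "carrier H" "ip H" "\<zero>" "\<lambda>x y. x \<oplus> y"
  "\<lambda>c x. c \<odot> x" "\<lambda>T. T"
  by (rule star_rep_bounded_operators)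

text \<open>This is the Kraus form T \<mapsto> \<Sum>c V_c^* T V_c, where V_c maps the b-th basis
  vector of n-dimensional space to \<open>v c b\<close>.\<close>

definition compress :: "nat \<Rightarrow> nat \<Rightarrow> (nat \<Rightarrow> nat \<Rightarrow> 'h) \<Rightarrow> ('h \<Rightarrow> 'h) \<Rightarrow> complex mat" where
  "compress K n v T = mat n n (\<lambda>(a, b). \<Sum>c<K. ip H (T (v c b)) (v c a))"

text \<open>The condition \<open>iso\<close> says that the V_c^* V_c add up to 1. For complete
  positivity, a vector w is pushed forward by each V_c to a vector of the k-th power of H; the form
  of the compressed matrix at w is the sum of the forms of X at these vectors.\<close>

lemma ucp_compress:
  assumes n: "n \<ge> 1" and v: "\<And>c j. \<lbrakk>c < K; j < n\<rbrakk> \<Longrightarrow> v c j \<in> carrier H"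
    and iso: "\<And>a b. \<lbrakk>a < n; b < n\<rbrakk> \<Longrightarrow> (\<Sum>c<K. ip H (v c b) (v c a)) = (if a = b then 1 else 0)"
  shows "compress K n v \<in> ucp (bounded_operators H) (complex_matrices n)"
  unfolding ucp_def
proof (intro CollectI conjI ballI allI impI)
  let ?B = "bounded_operators H"
  show "compress K n v \<in> carrier ?B \<rightarrow> carrier (complex_matrices n)"
    by (auto simp: compress_def mats_mat)
  fix S T c assume S: "S \<in> carrier ?B"
  show "compress K n v (c \<odot>\<^bsub>?B\<^esub> S) = c \<odot>\<^bsub>complex_matrices n\<^esub> compress K n v S"
    using S v by (intro eq_matI) (simp_all add: compress_def cm_simps sum_distrib_left)
  assume T: "T \<in> carrier ?B"
  show "compress K n v (S \<oplus>\<^bsub>?B\<^esub> T) = compress K n v S \<oplus>\<^bsub>complex_matrices n\<^esub> compress K n v T"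
    using S T v by (intro eq_matI) (simp_all add: compress_def cm_simps sum.distrib)
next
  show "compress K n v \<one>\<^bsub>bounded_operators H\<^esub> = \<one>\<^bsub>complex_matrices n\<^esub>"
    using v by (intro eq_matI) (simp_all add: compress_def cm_simps iso)
next
  let ?B = "bounded_operators H"
  fix k :: nat and X assume k: "1 \<le> k" and X: "X \<in> positive_elements (matrix_algebra ?B k)"
  interpret BM: star_rep "matrix_algebra ?B k" "B.Vn k" "B.ipn k" "\<lambda>_. \<zero>" "\<lambda>f g i. f i \<oplus> g i"
    "\<lambda>c f i. c \<odot> f i" "B.actn k"
    unfolding matrix_algebra_def by (rule B.star_rep_matrix)
  have carr: "carrier (matrix_algebra ?B k) = mats (carrier ?B) k"
    unfolding matrix_algebra_def by (rule carrier_matrix_algebra_with)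
  obtain Y where Y: "Y \<in> carrier (matrix_algebra ?B k)"
    and XY: "X = star (matrix_algebra ?B k) Y \<otimes>\<^bsub>matrix_algebra ?B k\<^esub> Y"
    using X by (auto simp: positive_elements_def)
  have Xc: "X \<in> mats (carrier ?B) k"
    unfolding carr[symmetric] XY by (intro BM.sr_mult BM.sr_star Y)
  have pos: "BM.form_pos X" unfolding XY by (rule BM.form_pos_star_mult[OF Y])
  let ?Q = "map_mat (compress K n v) X"
  have Q: "?Q \<in> mats (cmats n) k" using Xc by (auto simp: mats_def compress_def)
  have "Im (mform n k ?Q w) = 0 \<and> 0 \<le> Re (mform n k ?Q w)" for w
  proof -
    \<comment> \<open>The vector V_c w_j.\<close>
    define f where "f c j = hs.vsum n (\<lambda>b. w j b \<odot> v c b)" for c j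
    have f: "f c j \<in> carrier H" if "c < K" for c j
      unfolding f_def using v that by (intro hs.vsum_closed) simp
    have fV: "f c \<in> B.Vn k" if "c < K" for c using f[OF that] by (simp add: vpow_def)
    have ipf: "ip H (T (f c j)) (f c i) = (\<Sum>a<n. \<Sum>b<n. w j b * cnj (w i a) * ip H (T (v c b)) (v c a))"
      if T: "T \<in> carrier ?B" and c: "c < K" for T c i j
    proof -
      have Tf: "T (f c j) \<in> carrier H" using B.act_closed[OF T f[OF c]] .
      have "ip H (T (f c j)) (f c i) = (\<Sum>a<n. cnj (w i a) * ip H (T (f c j)) (v c a))"
        using v c Tf unfolding f_def[of c i] by (subst hs.ip_vsum_right) auto
      also have "\<dots> = (\<Sum>a<n. cnj (w i a) * (\<Sum>b<n. w j b * ip H (T (v c b)) (v c a)))"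
      proof (intro sum.cong refl arg_cong2[where f = "(*)"])
        fix a assume "a \<in> {..<n}"
        then have a: "v c a \<in> carrier H" using v c by simp
        have Ta: "star ?B T (v c a) \<in> carrier H" using T a B.act_closed B.sr_star by blast
        have "ip H (T (f c j)) (v c a) = ip H (f c j) (star ?B T (v c a))"
          using B.act_swap[OF T f[OF c] a] .
        also have "\<dots> = (\<Sum>b<n. w j b * ip H (v c b) (star ?B T (v c a)))"
          using v c Ta unfolding f_def by (subst hs.ip_vsum) auto
        also have "\<dots> = (\<Sum>b<n. w j b * ip H (T (v c b)) (v c a))"
          using B.act_swap[OF T _ a] v c by (intro sum.cong refl) simp
        finally show "ip H (T (f c j)) (v c a) = (\<Sum>b<n. w j b * ip H (T (v c b)) (v c a))" .
      qed
      finally show ?thesis by (simp add: sum_distrib_left mult_ac)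
    qed
    have "mform n k ?Q w = (\<Sum>i<k. \<Sum>j<k. \<Sum>a<n. \<Sum>b<n. \<Sum>c<K. w j b * cnj (w i a) * ip H ((X $$ (i, j)) (v c b)) (v c a))"
      unfolding mform_def using Xc
      by (intro sum.cong refl) (auto simp: mats_def compress_def sum_distrib_right sum_distrib_left mult_ac)
    also have "\<dots> = (\<Sum>i<k. \<Sum>j<k. \<Sum>c<K. \<Sum>a<n. \<Sum>b<n. w j b * cnj (w i a) * ip H ((X $$ (i, j)) (v c b)) (v c a))"
      by (intro sum.cong[OF refl] sum_swap3)
    also have "\<dots> = (\<Sum>i<k. \<Sum>j<k. \<Sum>c<K. ip H ((X $$ (i, j)) (f c j)) (f c i))"
      using Xc by (intro sum.cong refl) (auto simp: ipf matsD)
    also have "\<dots> = (\<Sum>c<K. \<Sum>i<k. \<Sum>j<k. ip H ((X $$ (i, j)) (f c j)) (f c i))"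
      by (rule sum_swap3)
    also have "\<dots> = (\<Sum>c<K. B.ipn k (B.actn k X (f c)) (f c))"
      using Xc fV by (intro sum.cong refl) (auto simp: B.ipn_actn)
    finally have eq: "mform n k ?Q w = (\<Sum>c<K. B.ipn k (B.actn k X (f c)) (f c))" .
    have "Im (B.ipn k (B.actn k X (f c)) (f c)) = 0 \<and> 0 \<le> Re (B.ipn k (B.actn k X (f c)) (f c))"
      if "c < K" for c
      using pos fV[OF that] unfolding BM.form_pos_def by blast
    then show ?thesis unfolding eq by (auto simp: Im_sum Re_sum intro!: sum_nonneg)
  qed
  then show "?Q \<in> positive_elements (matrix_algebra (complex_matrices n) k)"
    using cm2_positive_iff[OF n k Q] by blast
qed

end

text \<open>On complex numbers these rules would rewrite ordinary multiplication.\<close>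

declare cc.ip_vscale [simp del] cc.ip_vscale_right [simp del] cc.ip_vadd [simp del]
  cc.ip_vadd_right [simp del] cc.act_add [simp del] cc.act_smult [simp del] cc.act_one [simp del]
  cc.act_minus [simp del]

context star_rep
begin

text \<open>The converse direction of the block matrix criterion for norms. Testing with y = -s a x
  and s = 1 / C gives the bound; for C = 0 any positive s shows that a x has length zero.\<close>

lemma bndI_Re:
  assumes a: "a \<in> carrier A" and C: "0 \<le> C"
    and le: "\<And>x y. \<lbrakk>x \<in> V; y \<in> V\<rbrakk> \<Longrightarrow> 0 \<le> C * (sq x + sq y) + 2 * Re (ip (act a x) y)"
  shows "bnd a C"
  unfolding bnd_def
proof (intro conjI ballI)
  fix x assume x: "x \<in> V"
  define q where "q = sq (act a x)"
  have q: "q \<ge> 0" using a x by (simp add: q_def)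
  have *: "0 \<le> C * (sq x + s\<^sup>2 * q) - 2 * s * q" for s :: real
  proof -
    let ?y = "vscale (complex_of_real (- s)) (act a x)"
    have "0 \<le> C * (sq x + sq ?y) + 2 * Re (ip (act a x) ?y)" using a x by (intro le) auto
    moreover have "sq ?y = s\<^sup>2 * q" using a x by (simp add: q_def)
    moreover have "Re (ip (act a x) ?y) = - s * q"
      using a x by (simp add: q_def sq_def)
    ultimately show ?thesis by simp
  qed
  show "sq (act a x) \<le> C\<^sup>2 * sq x"
  proof (cases "C = 0")
    case True
    then show ?thesis using *[of 1] q by (simp add: q_def)
  next
    case False
    then have "C > 0" using C by simp
    then show ?thesis using *[of "1 / C"] by (simp add: q_def[symmetric] field_simps power2_eq_square)
  qed
qed (rule C)

context
  fixes X :: "'d \<Rightarrow> 'a" assumes X: "range X \<subseteq> carrier A"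
begin

lemma eval_letter_closed: "eval_letter A X l \<in> carrier A"
  by (cases l) (use X in \<open>auto simp: image_subset_iff\<close>)

lemma eval_word_closed: "eval_word A X w \<in> carrier A"
  by (induction w) (auto simp: eval_letter_closed)

lemma eval_poly_closed: "eval_poly A X p \<in> carrier A"
  unfolding eval_poly_def by (intro finsum_closed) (auto simp: eval_word_closed)

text \<open>Summing over a finite superset of the support allows several polynomials to be compared
  over the same words.\<close>

lemma ip_eval_poly:
  assumes S: "finite S" "Poly_Mapping.keys p \<subseteq> S" and xy: "x \<in> V" "y \<in> V"
  shows "ip (act (eval_poly A X p) x) y
    = (\<Sum>w\<in>S. Poly_Mapping.lookup p w * ip (act (eval_word A X w) x) y)"
proof -
  have "ip (act (eval_poly A X p) x) y
      = (\<Sum>w\<in>Poly_Mapping.keys p. Poly_Mapping.lookup p w * ip (act (eval_word A X w) x) y)"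
    unfolding eval_poly_def using xy
    by (subst act_finsum) (auto simp: eval_word_closed)
  also have "\<dots> = (\<Sum>w\<in>S. Poly_Mapping.lookup p w * ip (act (eval_word A X w) x) y)"
    using S by (intro sum.mono_neutral_left) (auto simp: in_keys_iff)
  finally show ?thesis .
qed

end

end

section \<open>Completely positive maps\<close>

definition short_words :: "'d::finite letter list set" where
  "short_words = {[]} \<union> range (\<lambda>i. [Z i]) \<union> range (\<lambda>i. [ZStar i])"

lemma finite_short_words [simp]: "finite short_words"
  by (simp add: short_words_def)

lemma keys_degree_le_one: "degree_le_one p \<Longrightarrow> Poly_Mapping.keys p \<subseteq> short_words"
proof
  fix w assume "degree_le_one p" "w \<in> Poly_Mapping.keys p"
  then have "length w \<le> 1" by (auto simp: degree_le_one_def)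
  then consider "w = []" | l where "w = [l]" by (cases w) auto
  then show "w \<in> short_words"
  proof cases
    case 2
    then show ?thesis by (cases l) (auto simp: short_words_def)
  qed (simp add: short_words_def)
qed

primrec letter_entry :: "('d \<Rightarrow> complex mat) \<Rightarrow> 'd letter \<Rightarrow> nat \<Rightarrow> nat \<Rightarrow> complex" where
  "letter_entry X (Z i) a b = X i $$ (a, b)"
| "letter_entry X (ZStar i) a b = cnj (X i $$ (b, a))"

text \<open>Meant for words of length at most one; for longer words everything behind the first
  letter is ignored.\<close>

definition word_entry :: "('d \<Rightarrow> complex mat) \<Rightarrow> 'd letter list \<Rightarrow> nat \<Rightarrow> nat \<Rightarrow> complex" where
  "word_entry X w a b = (case w of [] \<Rightarrow> if a = b then 1 else 0 | l # _ \<Rightarrow> letter_entry X l a b)"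

locale rep_tuple =
  fixes A :: "'a cstar" (structure) and \<xi> :: "'d::finite \<Rightarrow> 'a"
    and H :: "'h inner_product_space" and \<pi> :: "'a \<Rightarrow> 'h \<Rightarrow> 'h"
  assumes A: "unital_cstar_algebra A" and H: "complex_hilbert_space H"
    and faithful: "faithful_representation A H \<pi>" and \<xi>: "range \<xi> \<subseteq> carrier A"
begin

sublocale cstar_rep A "carrier H" "ip H" "\<zero>\<^bsub>H\<^esub>" "\<lambda>x y. x \<oplus>\<^bsub>H\<^esub> y" "\<lambda>c x. c \<odot>\<^bsub>H\<^esub> x" \<pi>
  using cstar_rep_of_faithful[OF A H faithful] .

abbreviation "BH \<equiv> bounded_operators H"

lemma BH_rep: "star_rep BH (carrier H) (ip H) \<zero>\<^bsub>H\<^esub> (\<lambda>x y. x \<oplus>\<^bsub>H\<^esub> y) (\<lambda>c x. c \<odot>\<^bsub>H\<^esub> x) (\<lambda>T. T)"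
  by (rule complex_hilbert_space.star_rep_bounded_operators[OF H])

lemma pi_closed: "a \<in> carrier A \<Longrightarrow> \<pi> a \<in> carrier BH"
  using faithful unfolding faithful_representation_def unital_star_hom_def
  by (metis ring_hom_closed)

lemma pi_eqI:
  assumes "a \<in> carrier A" "T \<in> carrier BH"
    and "\<And>x y. \<lbrakk>x \<in> carrier H; y \<in> carrier H\<rbrakk> \<Longrightarrow> ip H (\<pi> a x) y = ip H (T x) y"
  shows "\<pi> a = T"
  using star_rep.act_faithful[OF BH_rep pi_closed[OF assms(1)] assms(2)] assms(3) by blast

lemma pi_matrix_star_mult:
  assumes Y: "Y \<in> mats (carrier A) k"
  shows "map_mat \<pi> (star (matrix_algebra A k) Y \<otimes>\<^bsub>matrix_algebra A k\<^esub> Y)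
    = star (matrix_algebra BH k) (map_mat \<pi> Y) \<otimes>\<^bsub>matrix_algebra BH k\<^esub> map_mat \<pi> Y"
proof -
  interpret B: star_rep BH "carrier H" "ip H" "\<zero>\<^bsub>H\<^esub>" "\<lambda>x y. x \<oplus>\<^bsub>H\<^esub> y" "\<lambda>c x. c \<odot>\<^bsub>H\<^esub> x" "\<lambda>T. T"
    by (rule BH_rep)
  have Yc: "Y $$ (i, j) \<in> carrier A" if "i < k" "j < k" for i j using matsD[OF Y that] .
  have dim: "dim_row Y = k" "dim_col Y = k" using Y by (auto simp: mats_def)
  have fs: "\<pi> (\<Oplus>l\<in>{..<k}. star A (Y $$ (l, i)) \<otimes> Y $$ (l, j))
      = (\<Oplus>\<^bsub>BH\<^esub>l\<in>{..<k}. star BH (\<pi> (Y $$ (l, i))) \<otimes>\<^bsub>BH\<^esub> \<pi> (Y $$ (l, j)))"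
    if ij: "i < k" "j < k" for i j
  proof (rule pi_eqI)
    have BY: "\<pi> (Y $$ (l, i)) \<in> carrier BH" "\<pi> (Y $$ (l, j)) \<in> carrier BH" if "l < k" for l
      using Yc ij that pi_closed by auto
    have BT: "star BH (\<pi> (Y $$ (l, i))) \<otimes>\<^bsub>BH\<^esub> \<pi> (Y $$ (l, j)) \<in> carrier BH" if "l < k" for l
      by (intro B.sr_mult B.sr_star BY that)
    show "(\<Oplus>l\<in>{..<k}. star A (Y $$ (l, i)) \<otimes> Y $$ (l, j)) \<in> carrier A"
      using Yc ij by (intro finsum_closed) auto
    show "(\<Oplus>\<^bsub>BH\<^esub>l\<in>{..<k}. star BH (\<pi> (Y $$ (l, i))) \<otimes>\<^bsub>BH\<^esub> \<pi> (Y $$ (l, j))) \<in> carrier BH"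
      using BT by (intro B.finsum_closed) auto
    fix x y assume xy: "x \<in> carrier H" "y \<in> carrier H"
    have "ip H (\<pi> (\<Oplus>l\<in>{..<k}. star A (Y $$ (l, i)) \<otimes> Y $$ (l, j)) x) y
        = (\<Sum>l<k. ip H (\<pi> (star A (Y $$ (l, i)) \<otimes> Y $$ (l, j)) x) y)"
      using Yc ij xy by (intro act_finsum) auto
    also have "\<dots> = (\<Sum>l<k. ip H ((star BH (\<pi> (Y $$ (l, i))) \<otimes>\<^bsub>BH\<^esub> \<pi> (Y $$ (l, j))) x) y)"
    proof (intro sum.cong refl)
      fix l assume "l \<in> {..<k}"
      then have l: "l < k" by simp
      have "ip H (\<pi> (star A (Y $$ (l, i)) \<otimes> Y $$ (l, j)) x) y
          = ip H (\<pi> (Y $$ (l, j)) x) (\<pi> (Y $$ (l, i)) y)"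
        using Yc[OF l ij(1)] Yc[OF l ij(2)] xy by (simp add: act_mult act_star)
      also have "\<dots> = ip H ((star BH (\<pi> (Y $$ (l, i))) \<otimes>\<^bsub>BH\<^esub> \<pi> (Y $$ (l, j))) x) y"
        using BY[OF l] xy B.act_closed[OF BY(2)[OF l] xy(1)]
        by (simp only: B.act_mult B.act_star B.sr_star)
      finally show "ip H (\<pi> (star A (Y $$ (l, i)) \<otimes> Y $$ (l, j)) x) y
          = ip H ((star BH (\<pi> (Y $$ (l, i))) \<otimes>\<^bsub>BH\<^esub> \<pi> (Y $$ (l, j))) x) y" .
    qed
    also have "\<dots> = ip H ((\<Oplus>\<^bsub>BH\<^esub>l\<in>{..<k}. star BH (\<pi> (Y $$ (l, i))) \<otimes>\<^bsub>BH\<^esub> \<pi> (Y $$ (l, j))) x) y"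
      using BT xy by (intro B.act_finsum[symmetric]) auto
    finally show "ip H (\<pi> (\<Oplus>l\<in>{..<k}. star A (Y $$ (l, i)) \<otimes> Y $$ (l, j)) x) y
        = ip H ((\<Oplus>\<^bsub>BH\<^esub>l\<in>{..<k}. star BH (\<pi> (Y $$ (l, i))) \<otimes>\<^bsub>BH\<^esub> \<pi> (Y $$ (l, j))) x) y" .
  qed
  have e1: "(\<Oplus>l\<in>{..<k}. star (matrix_algebra A k) Y $$ (i, l) \<otimes> Y $$ (l, j))
      = (\<Oplus>l\<in>{..<k}. star A (Y $$ (l, i)) \<otimes> Y $$ (l, j))" if "i < k" "j < k" for i j
    using Yc that by (intro finsum_cong') (auto simp: matrix_algebra_def)
  have e2: "(\<Oplus>\<^bsub>BH\<^esub>l\<in>{..<k}. star (matrix_algebra BH k) (map_mat \<pi> Y) $$ (i, l) \<otimes>\<^bsub>BH\<^esub> map_mat \<pi> Y $$ (l, j))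
      = (\<Oplus>\<^bsub>BH\<^esub>l\<in>{..<k}. star BH (\<pi> (Y $$ (l, i))) \<otimes>\<^bsub>BH\<^esub> \<pi> (Y $$ (l, j)))" if "i < k" "j < k" for i j
  proof (rule B.finsum_cong'[OF refl])
    show "(\<lambda>l. star BH (\<pi> (Y $$ (l, i))) \<otimes>\<^bsub>BH\<^esub> \<pi> (Y $$ (l, j))) \<in> {..<k} \<rightarrow> carrier BH"
      using that Yc pi_closed by (intro Pi_I B.sr_mult B.sr_star) auto
  qed (use that dim in \<open>auto simp: matrix_algebra_def\<close>)
  show ?thesis
    by (rule eq_matI) (simp_all add: matrix_algebra_def[of A] matrix_algebra_def[of BH]
        fs e1[unfolded matrix_algebra_def matrix_algebra_with_simps(7)]
        e2[unfolded matrix_algebra_def matrix_algebra_with_simps(7)])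
qed

abbreviation "mpos k \<equiv> star_rep.form_pos (vpow k (carrier H)) (ip_pow k (ip H)) (actn k)"

text \<open>UCP maps in the matrix range are defined on B(H), so positivity must be carried from
  matrices over A to matrices over B(H). A root R of Y is available in the matrix algebra over A,
  and the representation preserves the product of R with its adjoint.\<close>

lemma pi_positive:
  assumes k: "k \<ge> 1" and Y: "Y \<in> mats (carrier A) k" and pos: "mpos k Y"
  shows "map_mat \<pi> Y \<in> positive_elements (matrix_algebra BH k)"
proof -
  interpret M: cstar_rep "matrix_algebra A k" "Vn k" "ipn k" "\<lambda>_. \<zero>\<^bsub>H\<^esub>"
    "\<lambda>f g i. f i \<oplus>\<^bsub>H\<^esub> g i" "\<lambda>c f i. c \<odot>\<^bsub>H\<^esub> f i" "actn k"
    by (rule cstar_rep_matrix[OF k])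
  have carr: "carrier (matrix_algebra A k) = mats (carrier A) k"
    unfolding matrix_algebra_def by (rule carrier_matrix_algebra_with)
  obtain R where R: "R \<in> mats (carrier A) k" "star (matrix_algebra A k) R = R"
      "R \<otimes>\<^bsub>matrix_algebra A k\<^esub> R = Y"
    using M.form_pos_imp_positive[of Y] Y pos unfolding carr by blast
  then have "map_mat \<pi> Y = star (matrix_algebra BH k) (map_mat \<pi> R) \<otimes>\<^bsub>matrix_algebra BH k\<^esub> map_mat \<pi> R"
    using pi_matrix_star_mult[OF R(1)] by simp
  moreover have "map_mat \<pi> R \<in> carrier (matrix_algebra BH k)"
    unfolding matrix_algebra_def carrier_matrix_algebra_with
    using R(1) pi_closed by (auto simp: mats_def)
  ultimately show ?thesis unfolding positive_elements_def by blast
qed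

section \<open>UCP maps on a represented algebra: adjoints and complete contractivity\<close>

context
  fixes n :: nat and \<phi> assumes n: "n \<ge> 1" and \<phi>: "\<phi> \<in> ucp BH (complex_matrices n)"
begin

lemma ucp_closed: "a \<in> carrier A \<Longrightarrow> \<phi> (\<pi> a) \<in> cmats n"
  using \<phi> pi_closed by (auto simp: ucp_def)

lemma ucp_add: "\<lbrakk>a \<in> carrier A; b \<in> carrier A\<rbrakk> \<Longrightarrow>
    \<phi> (\<pi> (a \<oplus> b)) = \<phi> (\<pi> a) \<oplus>\<^bsub>complex_matrices n\<^esub> \<phi> (\<pi> b)"
  using \<phi> pi_closed faithful unfolding ucp_def faithful_representation_def unital_star_hom_def
  by (auto simp: ring_hom_add)

lemma ucp_smult: "a \<in> carrier A \<Longrightarrow> \<phi> (\<pi> (c \<odot> a)) = c \<odot>\<^bsub>complex_matrices n\<^esub> \<phi> (\<pi> a)"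
  using \<phi> pi_closed faithful unfolding ucp_def faithful_representation_def unital_star_hom_def
  by auto

lemma ucp_one: "\<phi> (\<pi> \<one>) = \<one>\<^bsub>complex_matrices n\<^esub>"
  using \<phi> faithful unfolding ucp_def faithful_representation_def unital_star_hom_def
  by (auto simp: ring_hom_one)

lemma ucp_add_entry: "\<lbrakk>a \<in> carrier A; b \<in> carrier A; i < n; j < n\<rbrakk> \<Longrightarrow>
    \<phi> (\<pi> (a \<oplus> b)) $$ (i, j) = \<phi> (\<pi> a) $$ (i, j) + \<phi> (\<pi> b) $$ (i, j)"
  by (simp add: ucp_add cm_simps)

lemma ucp_smult_entry: "\<lbrakk>a \<in> carrier A; i < n; j < n\<rbrakk> \<Longrightarrow>
    \<phi> (\<pi> (c \<odot> a)) $$ (i, j) = c * \<phi> (\<pi> a) $$ (i, j)"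
  by (simp add: ucp_smult cm_simps)

lemma ucp_one_entry: "\<lbrakk>i < n; j < n\<rbrakk> \<Longrightarrow> \<phi> (\<pi> \<one>) $$ (i, j) = (if i = j then 1 else 0)"
  by (simp add: ucp_one cm_simps)

lemma ucp_zero_entry: "\<lbrakk>i < n; j < n\<rbrakk> \<Longrightarrow> \<phi> (\<pi> \<zero>) $$ (i, j) = 0"
  using ucp_smult_entry[of \<zero> i j 0] by simp

lemma ucp_finsum_entry:
  assumes "finite I" "\<And>i. i \<in> I \<Longrightarrow> f i \<in> carrier A" and ab: "a < n" "b < n"
  shows "\<phi> (\<pi> (\<Oplus>i\<in>I. f i)) $$ (a, b) = (\<Sum>i\<in>I. \<phi> (\<pi> (f i)) $$ (a, b))"
  using assms(1,2)
proof (induction I rule: finite_induct)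
  case (insert i I)
  then have "(\<Oplus>i\<in>insert i I. f i) = f i \<oplus> (\<Oplus>i\<in>I. f i)"
    by (intro finsum_insert) auto
  moreover have "(\<Oplus>i\<in>I. f i) \<in> carrier A"
    using insert by (intro finsum_closed) auto
  ultimately show ?case using insert ab by (simp add: ucp_add_entry)
qed (use ab ucp_zero_entry in simp)

lemma ucp_positive:
  assumes k: "k \<ge> 1" and Y: "Y \<in> mats (carrier A) k" and pos: "mpos k Y"
  shows "map_mat (\<lambda>a. \<phi> (\<pi> a)) Y \<in> positive_elements (matrix_algebra (complex_matrices n) k)"
proof -
  have "map_mat \<phi> (map_mat \<pi> Y) \<in> positive_elements (matrix_algebra (complex_matrices n) k)"
    using \<phi> pi_positive[OF assms] k unfolding ucp_def by blast
  moreover have "map_mat \<phi> (map_mat \<pi> Y) = map_mat (\<lambda>a. \<phi> (\<pi> a)) Y"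
    by (rule eq_matI) auto
  ultimately show ?thesis by simp
qed

lemma ucp_mats: "Y \<in> mats (carrier A) k \<Longrightarrow> map_mat (\<lambda>a. \<phi> (\<pi> a)) Y \<in> mats (cmats n) k"
  using ucp_closed by (auto simp: mats_def[of _ k])

text \<open>An operator \<open>Y\<close> has norm at most \<open>c\<close> if and only if the block matrix with diagonal blocks \<open>c\<close> and
  off-diagonal blocks \<open>Y\<close>, \<open>Y\<^sup>*\<close> is positive.\<close>

definition dilation :: "nat \<Rightarrow> real \<Rightarrow> 'a mat \<Rightarrow> 'a mat" where
  "dilation N c Y = mat (N + N) (N + N) (\<lambda>(i, j).
     if i < N then (if j < N then (if i = j then complex_of_real c \<odot> \<one> else \<zero>) else Y $$ (i, j - N))
     else (if j < N then star A (Y $$ (j, i - N)) else (if i = j then complex_of_real c \<odot> \<one> else \<zero>)))"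

lemma dilation_closed: "Y \<in> mats (carrier A) N \<Longrightarrow> dilation N c Y \<in> mats (carrier A) (N + N)"
  by (auto simp: dilation_def mats_mat matsD)

text \<open>At a vector with halves f and y the form is c (|f|^2 + |y|^2) + 2 Re <Y y, f>; the last
  term is controlled by the bound on Y and the inequality of arithmetic and geometric means.\<close>

lemma mpos_dilation:
  assumes Y: "Y \<in> mats (carrier A) N" and b: "mbnd N Y c"
  shows "mpos (N + N) (dilation N c Y)"
proof -
  interpret M: star_rep "matrix_algebra A k" "Vn k" "ipn k" "\<lambda>_. \<zero>\<^bsub>H\<^esub>"
    "\<lambda>f g i. f i \<oplus>\<^bsub>H\<^esub> g i" "\<lambda>c f i. c \<odot>\<^bsub>H\<^esub> f i" "actn k" for k
    unfolding matrix_algebra_def by (rule star_rep_matrix)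
  have carr: "carrier (matrix_algebra A k) = mats (carrier A) k" for k
    unfolding matrix_algebra_def by (rule carrier_matrix_algebra_with)
  have c: "0 \<le> c" using b by (simp add: M.bnd_def)
  show ?thesis
    unfolding M.form_pos_def
  proof
    fix f assume f: "f \<in> Vn (N + N)"
    define y where "y i = f (N + i)" for i
    have fx: "f \<in> Vn N" and y: "y \<in> Vn N" using f by (auto simp: vpow_def y_def)
    have fi: "f i \<in> carrier H" and yi: "y i \<in> carrier H" if "i < N" for i
      using fx y that by (auto simp: vpow_def)
    let ?T = "ipn N (actn N Y y) f"
    have "ipn (N + N) (actn (N + N) (dilation N c Y) f) f
        = (\<Sum>i<N. \<Sum>j<N. ip H (\<pi> (dilation N c Y $$ (i, j)) (f j)) (f i))
        + (\<Sum>i<N. \<Sum>j<N. ip H (\<pi> (dilation N c Y $$ (i, N + j)) (y j)) (f i))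
        + ((\<Sum>i<N. \<Sum>j<N. ip H (\<pi> (dilation N c Y $$ (N + i, j)) (f j)) (y i))
        + (\<Sum>i<N. \<Sum>j<N. ip H (\<pi> (dilation N c Y $$ (N + i, N + j)) (y j)) (y i)))"
      using f dilation_closed[OF Y] by (simp add: ipn_actn sum_lessThan_add sum.distrib y_def)
    also have "(\<Sum>i<N. \<Sum>j<N. ip H (\<pi> (dilation N c Y $$ (i, j)) (f j)) (f i))
        = (\<Sum>i<N. \<Sum>j<N. if i = j then complex_of_real c * ip H (f i) (f i) else 0)"
      by (intro sum.cong refl) (auto simp: dilation_def fi)
    also have "(\<Sum>i<N. \<Sum>j<N. ip H (\<pi> (dilation N c Y $$ (N + i, N + j)) (y j)) (y i))
        = (\<Sum>i<N. \<Sum>j<N. if i = j then complex_of_real c * ip H (y i) (y i) else 0)"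
      by (intro sum.cong refl) (auto simp: dilation_def yi)
    also have "(\<Sum>i<N. \<Sum>j<N. ip H (\<pi> (dilation N c Y $$ (i, N + j)) (y j)) (f i)) = ?T"
      unfolding ipn_actn[OF Y y fx] by (intro sum.cong refl) (auto simp: dilation_def)
    also have "(\<Sum>i<N. \<Sum>j<N. ip H (\<pi> (dilation N c Y $$ (N + i, j)) (f j)) (y i)) = cnj ?T"
    proof -
      have "(\<Sum>i<N. \<Sum>j<N. ip H (\<pi> (dilation N c Y $$ (N + i, j)) (f j)) (y i))
          = (\<Sum>i<N. \<Sum>j<N. cnj (ip H (\<pi> (Y $$ (j, i)) (y i)) (f j)))"
        by (intro sum.cong refl) (auto simp: dilation_def fi yi matsD[OF Y] ip_act_commute)
      also have "\<dots> = cnj ?T"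
        unfolding ipn_actn[OF Y y fx] by (subst sum.swap) simp
      finally show ?thesis .
    qed
    finally have eq: "ipn (N + N) (actn (N + N) (dilation N c Y) f) f
        = complex_of_real (c * (sqn N f + sqn N y)) + (?T + cnj ?T)"
      by (simp add: sqn_eq sum_distrib_left[symmetric] ip_self fi yi algebra_simps)
    have "cmod ?T \<le> c * sqrt (sqn N y) * sqrt (sqn N f)"
      using b Y y fx unfolding carr[symmetric] by (intro M.bnd_ip)
    also have "\<dots> \<le> c * ((sqn N f + sqn N y) / 2)"
    proof -
      have "sqrt (sqn N y * sqn N f) \<le> (sqn N y + sqn N f) / 2"
        using y fx by (intro arith_geo_mean_sqrt) auto
      then show ?thesis using c by (simp add: real_sqrt_mult mult.assoc add.commute mult_left_mono)
    qed
    finally have "\<bar>Re ?T\<bar> \<le> c * ((sqn N f + sqn N y) / 2)"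
      using abs_Re_le_cmod order_trans by blast
    then show "Im (ipn (N + N) (actn (N + N) (dilation N c Y) f) f) = 0
        \<and> 0 \<le> Re (ipn (N + N) (actn (N + N) (dilation N c Y) f) f)"
      unfolding eq by simp
  qed
qed

text \<open>Preservation of adjoints is not part of the definition of \<open>ucp\<close>. It follows
  from positivity of the 2 by 2 dilation of a: the image is positive, hence self-adjoint, so its
  off-diagonal blocks are adjoint to each other.\<close>

lemma ucp_star_entry:
  assumes a: "a \<in> carrier A" and ij: "i < n" "j < n"
  shows "\<phi> (\<pi> (star A a)) $$ (i, j) = cnj (\<phi> (\<pi> a) $$ (j, i))"
proof -
  define Y where "Y = mat 1 1 (\<lambda>_. a)"
  have Y: "Y \<in> mats (carrier A) 1" using a by (simp add: Y_def mats_mat)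
  have "mbnd 1 Y (\<Sum>i<1::nat. \<Sum>j<1::nat. anorm A a)"
    by (rule mbnd_sum[OF Y]) (use a bnd_anorm in \<open>simp add: Y_def\<close>)
  then have "mbnd 1 Y (anorm A a)" by simp
  then have D: "map_mat (\<lambda>a. \<phi> (\<pi> a)) (dilation 1 (anorm A a) Y)
      \<in> positive_elements (matrix_algebra (complex_matrices n) (1 + 1))"
    using Y by (intro ucp_positive dilation_closed mpos_dilation) auto
  have "map_mat (\<lambda>a. \<phi> (\<pi> a)) (dilation 1 (anorm A a) Y) $$ (1, 0) $$ (i, j)
      = cnj (map_mat (\<lambda>a. \<phi> (\<pi> a)) (dilation 1 (anorm A a) Y) $$ (0, 1) $$ (j, i))"
    using n ij D Y by (intro cm2_self_adjoint[of n "1 + 1"] ucp_mats dilation_closed) auto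
  then show ?thesis by (simp add: dilation_def Y_def)
qed

lemma ucp_word_entry:
  assumes w: "w \<in> short_words" and ij: "i < n" "j < n"
  shows "\<phi> (\<pi> (eval_word A \<xi> w)) $$ (i, j) = word_entry (\<lambda>i. \<phi> (\<pi> (\<xi> i))) w i j"
  using w ij \<xi> unfolding short_words_def
  by (auto simp: word_entry_def ucp_one_entry ucp_star_entry image_subset_iff)

lemma ucp_poly_entry:
  assumes p: "degree_le_one p" and ij: "i < n" "j < n"
  shows "\<phi> (\<pi> (eval_poly A \<xi> p)) $$ (i, j)
    = (\<Sum>w\<in>short_words. Poly_Mapping.lookup p w * word_entry (\<lambda>i. \<phi> (\<pi> (\<xi> i))) w i j)"
proof -
  have "\<phi> (\<pi> (eval_poly A \<xi> p)) $$ (i, j)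
      = (\<Sum>w\<in>Poly_Mapping.keys p. Poly_Mapping.lookup p w * word_entry (\<lambda>i. \<phi> (\<pi> (\<xi> i))) w i j)"
    unfolding eval_poly_def using ij keys_degree_le_one[OF p]
    by (subst ucp_finsum_entry)
      (auto simp: eval_word_closed[OF \<xi>] ucp_smult_entry ucp_word_entry subset_iff intro!: sum.cong)
  also have "\<dots> = (\<Sum>w\<in>short_words. Poly_Mapping.lookup p w * word_entry (\<lambda>i. \<phi> (\<pi> (\<xi> i))) w i j)"
    using keys_degree_le_one[OF p] by (intro sum.mono_neutral_left) (auto simp: in_keys_iff)
  finally show ?thesis .
qed

text \<open>Since the map is unital and preserves adjoints, it sends \<open>dilation N c Y\<close>
  to the block matrix of the same shape over the image of Y. The form of that block matrix is the
  expression required by \<open>bndI_Re\<close>.\<close>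

lemma ucp_contractive:
  assumes N: "N \<ge> 1" and Y: "Y \<in> mats (carrier A) N" and b: "mbnd N Y c"
  shows "star_rep.bnd (vpow N (cvec n)) (ip_pow N (cip n))
    (act_pow N (\<lambda>_. 0) (\<lambda>f g i. f i + g i) (cact n)) (map_mat (\<lambda>a. \<phi> (\<pi> a)) Y) c"
proof -
  let ?ca = "act_pow N (\<lambda>_. 0) (\<lambda>f g i. f i + g i) (cact n)"
  let ?Y = "map_mat (\<lambda>a. \<phi> (\<pi> a)) Y"
  let ?D = "map_mat (\<lambda>a. \<phi> (\<pi> a)) (dilation N c Y)"
  interpret M: cstar_rep "matrix_algebra (complex_matrices n) N" "vpow N (cvec n)" "ip_pow N (cip n)"
    "\<lambda>_ _. 0" "\<lambda>f g i j. f i j + g i j" "\<lambda>c f i j. c * f i j" ?ca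
    by (rule cm_rep2[OF n N])
  interpret C: cstar_rep "complex_matrices n" "cvec n" "cip n" "\<lambda>_. 0" "\<lambda>f g i. f i + g i"
    "\<lambda>c f i. c * f i" "cact n"
    by (rule cm_rep[OF n])
  have Yc: "?Y \<in> mats (cmats n) N" using Y by (rule ucp_mats)
  have Dc: "?D \<in> mats (cmats n) (N + N)" using dilation_closed[OF Y] by (rule ucp_mats)
  have D: "?D \<in> positive_elements (matrix_algebra (complex_matrices n) (N + N))"
    using N Y b by (intro ucp_positive dilation_closed mpos_dilation) auto
  interpret S: star_rep "matrix_algebra A N" "Vn N" "ipn N" "\<lambda>_. \<zero>\<^bsub>H\<^esub>"
    "\<lambda>f g i. f i \<oplus>\<^bsub>H\<^esub> g i" "\<lambda>c f i. c \<odot>\<^bsub>H\<^esub> f i" "actn N"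
    unfolding matrix_algebra_def by (rule star_rep_matrix)
  have c: "0 \<le> c" using b by (simp add: S.bnd_def)
  have dim: "dim_row Y = N" "dim_col Y = N" using Y by (auto simp: mats_def)
  show ?thesis
  proof (rule M.bndI_Re)
    show "?Y \<in> carrier (matrix_algebra (complex_matrices n) N)" using Yc unfolding cm2_carrier .
    fix y x :: "nat \<Rightarrow> nat \<Rightarrow> complex"
    \<comment> \<open>The vector with halves x and y, to be inserted into the form of the 2N by 2N
      block matrix.\<close>
    define w where "w i = (if i < N then x i else y (i - N))" for i
    let ?q = "\<lambda>B u v. \<Sum>a<n. \<Sum>b<n. B $$ (a, b) * u b * cnj (v a)"
    let ?T = "\<Sum>i<N. \<Sum>j<N. ?q (?Y $$ (i, j)) (y j) (x i)"
    have T: "ip_pow N (cip n) (?ca ?Y y) x = ?T"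
    proof -
      have "ip_pow N (cip n) (?ca ?Y y) x = (\<Sum>i<N. \<Sum>j<N. cip n (cact n (?Y $$ (i, j)) (y j)) (x i))"
        using Yc by (intro C.ipn_actn) (auto simp: vpow_def)
      also have "\<dots> = ?T"
      proof (intro sum.cong refl)
        fix i j assume "i \<in> {..<N}" "j \<in> {..<N}"
        then have "?Y $$ (i, j) \<in> cmats n" using Yc by (auto simp: mats_def[of "cmats n"])
        then show "cip n (cact n (?Y $$ (i, j)) (y j)) (x i) = ?q (?Y $$ (i, j)) (y j) (x i)"
          by (subst cc.ipn_actn) auto
      qed
      finally show ?thesis .
    qed
    have diag: "?q (\<phi> (\<pi> (if i = j then complex_of_real c \<odot> \<one> else \<zero>))) u v
        = (if i = j then complex_of_real c * (\<Sum>a<n. u a * cnj (v a)) else 0)" for i j :: nat and u v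
    proof (cases "i = j")
      case True
      have "?q (\<phi> (\<pi> (complex_of_real c \<odot> \<one>))) u v
          = (\<Sum>a<n. \<Sum>b<n. if b = a then complex_of_real c * (u a * cnj (v a)) else 0)"
        by (intro sum.cong refl) (auto simp: ucp_smult_entry ucp_one_entry)
      then show ?thesis using True by (simp add: sum_distrib_left)
    qed (simp add: ucp_zero_entry)
    have "mform n (N + N) ?D w
        = (\<Sum>i<N. \<Sum>j<N. ?q (?D $$ (i, j)) (x j) (x i)) + (\<Sum>i<N. \<Sum>j<N. ?q (?D $$ (i, N + j)) (y j) (x i))
        + ((\<Sum>i<N. \<Sum>j<N. ?q (?D $$ (N + i, j)) (x j) (y i))
          + (\<Sum>i<N. \<Sum>j<N. ?q (?D $$ (N + i, N + j)) (y j) (y i)))"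
      unfolding mform_def sum_lessThan_add by (simp add: w_def sum.distrib)
    also have "(\<Sum>i<N. \<Sum>j<N. ?q (?D $$ (i, j)) (x j) (x i))
        = (\<Sum>i<N. \<Sum>j<N. if i = j then complex_of_real c * (\<Sum>a<n. x i a * cnj (x i a)) else 0)"
      by (intro sum.cong refl) (simp add: dilation_def diag)
    also have "(\<Sum>i<N. \<Sum>j<N. ?q (?D $$ (N + i, N + j)) (y j) (y i))
        = (\<Sum>i<N. \<Sum>j<N. if i = j then complex_of_real c * (\<Sum>a<n. y i a * cnj (y i a)) else 0)"
      by (intro sum.cong refl) (simp add: dilation_def diag)
    also have "(\<Sum>i<N. \<Sum>j<N. ?q (?D $$ (i, N + j)) (y j) (x i)) = ?T"
      by (intro sum.cong refl) (simp add: dilation_def dim)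
    also have "(\<Sum>i<N. \<Sum>j<N. ?q (?D $$ (N + i, j)) (x j) (y i)) = cnj ?T"
    proof -
      have "?q (?D $$ (N + i, j)) (x j) (y i) = cnj (?q (?Y $$ (j, i)) (y i) (x j))"
        if "i < N" "j < N" for i j
      proof -
        have "?q (?D $$ (N + i, j)) (x j) (y i)
            = (\<Sum>a<n. \<Sum>b<n. cnj (?Y $$ (j, i) $$ (b, a)) * x j b * cnj (y i a))"
          using that dim by (intro sum.cong refl) (simp add: dilation_def ucp_star_entry matsD[OF Y])
        also have "\<dots> = (\<Sum>b<n. \<Sum>a<n. cnj (?Y $$ (j, i) $$ (b, a)) * x j b * cnj (y i a))"
          by (rule sum.swap)
        also have "\<dots> = cnj (?q (?Y $$ (j, i)) (y i) (x j))"
          by (simp add: mult_ac)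
        finally show ?thesis .
      qed
      then have "(\<Sum>i<N. \<Sum>j<N. ?q (?D $$ (N + i, j)) (x j) (y i))
          = (\<Sum>i<N. \<Sum>j<N. cnj (?q (?Y $$ (j, i)) (y i) (x j)))"
        by (intro sum.cong refl) auto
      also have "\<dots> = cnj ?T" by (subst sum.swap) simp
      finally show ?thesis .
    qed
    finally have eq: "mform n (N + N) ?D w = complex_of_real c * (ip_pow N (cip n) x x)
        + (?T + cnj ?T) + complex_of_real c * (ip_pow N (cip n) y y)"
      by (simp add: ip_pow_def sum_distrib_left algebra_simps)
    have "0 \<le> Re (mform n (N + N) ?D w)"
      using cm2_positive_iff[of n "N + N" ?D] n N Dc D by auto
    then show "0 \<le> c * (M.sq y + M.sq x) + 2 * Re (ip_pow N (cip n) (?ca ?Y y) x)"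
      unfolding eq T M.sq_def by (simp add: algebra_simps)
  qed (rule c)
qed

end

end

section \<open>Norms of matrix polynomials and of their entries\<close>

primrec letter_star :: "'d letter \<Rightarrow> 'd letter" where
  "letter_star (Z i) = ZStar i"
| "letter_star (ZStar i) = Z i"

definition poly_mult :: "'d star_poly \<Rightarrow> 'd star_poly \<Rightarrow> 'd star_poly" where
  "poly_mult p q = (\<Sum>u\<in>Poly_Mapping.keys p. \<Sum>w\<in>Poly_Mapping.keys q.
     Poly_Mapping.single (u @ w) (Poly_Mapping.lookup p u * Poly_Mapping.lookup q w))"

definition poly_star :: "'d star_poly \<Rightarrow> 'd star_poly" where
  "poly_star p = (\<Sum>u\<in>Poly_Mapping.keys p.
     Poly_Mapping.single (rev (map letter_star u)) (cnj (Poly_Mapping.lookup p u)))"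

definition poly_scale :: "complex \<Rightarrow> 'd star_poly \<Rightarrow> 'd star_poly" where
  "poly_scale c p = (\<Sum>u\<in>Poly_Mapping.keys p. Poly_Mapping.single u (c * Poly_Mapping.lookup p u))"

context star_rep
begin

context
  fixes X :: "'d \<Rightarrow> 'a" assumes X: "range X \<subseteq> carrier A"
begin

lemma eval_poly_add: "eval_poly A X (p + q) = eval_poly A X p \<oplus> eval_poly A X q"
proof (rule act_faithful)
  fix x y assume xy: "x \<in> V" "y \<in> V"
  let ?S = "Poly_Mapping.keys p \<union> Poly_Mapping.keys q"
  have "ip (act (eval_poly A X r) x) y
      = (\<Sum>w\<in>?S. Poly_Mapping.lookup r w * ip (act (eval_word A X w) x) y)"
    if "Poly_Mapping.keys r \<subseteq> ?S" for r
    using that xy by (intro ip_eval_poly X) auto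
  then show "ip (act (eval_poly A X (p + q)) x) y = ip (act (eval_poly A X p \<oplus> eval_poly A X q) x) y"
    using xy Poly_Mapping.keys_add[of p q]
    by (simp add: eval_poly_closed[OF X] lookup_add distrib_right sum.distrib)
qed (simp_all add: eval_poly_closed[OF X])

lemma eval_poly_zero: "eval_poly A X 0 = \<zero>"
  by (simp add: eval_poly_def)

lemma eval_poly_single: "eval_poly A X (Poly_Mapping.single w c) = c \<odot> eval_word A X w"
proof (rule act_faithful)
  fix x y assume xy: "x \<in> V" "y \<in> V"
  show "ip (act (eval_poly A X (Poly_Mapping.single w c)) x) y = ip (act (c \<odot> eval_word A X w) x) y"
    using xy by (subst ip_eval_poly[OF X, of "{w}"]) (auto simp: eval_word_closed[OF X])
qed (simp_all add: eval_poly_closed[OF X] eval_word_closed[OF X])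

lemma ip_eval_poly_sum:
  assumes "finite I" "x \<in> V" "y \<in> V"
  shows "ip (act (eval_poly A X (\<Sum>i\<in>I. f i)) x) y = (\<Sum>i\<in>I. ip (act (eval_poly A X (f i)) x) y)"
  using assms(1)
  by (induction I rule: finite_induct)
    (use assms in \<open>simp_all add: eval_poly_zero eval_poly_add eval_poly_closed[OF X]\<close>)

lemma eval_word_append: "eval_word A X (u @ w) = eval_word A X u \<otimes> eval_word A X w"
  by (induction u) (simp_all add: eval_word_closed[OF X] eval_letter_closed[OF X] m_assoc)

lemma eval_letter_star: "eval_letter A X (letter_star l) = star A (eval_letter A X l)"
  by (cases l) (use X in \<open>auto simp: image_subset_iff\<close>)

lemma eval_word_star: "eval_word A X (rev (map letter_star w)) = star A (eval_word A X w)"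
  by (induction w)
    (simp_all add: eval_word_append eval_letter_star eval_word_closed[OF X] eval_letter_closed[OF X])

lemma eval_poly_mult: "eval_poly A X (poly_mult p q) = eval_poly A X p \<otimes> eval_poly A X q"
proof (rule act_faithful)
  fix x y assume xy: "x \<in> V" "y \<in> V"
  let ?P = "Poly_Mapping.keys p" and ?Q = "Poly_Mapping.keys q"
  let ?p = "Poly_Mapping.lookup p" and ?q = "Poly_Mapping.lookup q"
  let ?e = "eval_poly A X" and ?w = "eval_word A X"
  have "ip (act (?e p \<otimes> ?e q) x) y = (\<Sum>u\<in>?P. ?p u * ip (act (?w u) (act (?e q) x)) y)"
    using xy by (simp add: act_mult eval_poly_closed[OF X] ip_eval_poly[OF X, of ?P])
  also have "\<dots> = (\<Sum>u\<in>?P. ?p u * (\<Sum>w\<in>?Q. ?q w * ip (act (?w w) x) (act (star A (?w u)) y)))"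
    using xy by (intro sum.cong refl arg_cong2[where f = "(*)"])
      (simp add: act_swap[of "?w _"] eval_word_closed[OF X] eval_poly_closed[OF X] ip_eval_poly[OF X, of ?Q])
  also have "\<dots> = (\<Sum>u\<in>?P. \<Sum>w\<in>?Q. ip (act (?e (Poly_Mapping.single (u @ w) (?p u * ?q w))) x) y)"
    using xy by (simp add: eval_poly_single eval_word_append eval_word_closed[OF X] act_mult'
        sum_distrib_left mult.assoc)
  also have "\<dots> = ip (act (?e (poly_mult p q)) x) y"
    unfolding poly_mult_def using xy by (simp add: ip_eval_poly_sum)
  finally show "ip (act (?e (poly_mult p q)) x) y = ip (act (?e p \<otimes> ?e q) x) y" ..
qed (simp_all add: eval_poly_closed[OF X])

lemma eval_poly_star: "eval_poly A X (poly_star p) = star A (eval_poly A X p)"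
proof (rule act_faithful)
  fix x y assume xy: "x \<in> V" "y \<in> V"
  let ?P = "Poly_Mapping.keys p" and ?p = "Poly_Mapping.lookup p"
  have "ip (act (star A (eval_poly A X p)) x) y = cnj (ip (act (eval_poly A X p) y) x)"
    using xy by (simp add: ip_act_commute eval_poly_closed[OF X])
  also have "\<dots> = (\<Sum>u\<in>?P. cnj (?p u) * cnj (ip (act (eval_word A X u) y) x))"
    using xy by (simp add: ip_eval_poly[OF X, of ?P])
  also have "\<dots> = (\<Sum>u\<in>?P. ip (act (eval_poly A X (Poly_Mapping.single (rev (map letter_star u)) (cnj (?p u)))) x) y)"
    using xy by (simp add: eval_poly_single eval_word_star eval_word_closed[OF X] ip_act_commute)
  also have "\<dots> = ip (act (eval_poly A X (poly_star p)) x) y"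
    unfolding poly_star_def using xy by (simp add: ip_eval_poly_sum)
  finally show "ip (act (eval_poly A X (poly_star p)) x) y = ip (act (star A (eval_poly A X p)) x) y" ..
qed (simp_all add: eval_poly_closed[OF X])

lemma eval_poly_scale: "eval_poly A X (poly_scale c p) = c \<odot> eval_poly A X p"
proof (rule act_faithful)
  fix x y assume xy: "x \<in> V" "y \<in> V"
  let ?P = "Poly_Mapping.keys p" and ?p = "Poly_Mapping.lookup p"
  show "ip (act (eval_poly A X (poly_scale c p)) x) y = ip (act (c \<odot> eval_poly A X p) x) y"
    unfolding poly_scale_def using xy
    by (simp add: ip_eval_poly_sum eval_poly_single eval_word_closed[OF X] eval_poly_closed[OF X]
        ip_eval_poly[OF X, of ?P] sum_distrib_left mult.assoc)
qed (simp_all add: eval_poly_closed[OF X])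

end

end

section \<open>Matrix polynomials, square root iterates and the defect\<close>

definition mpoly_mult :: "nat \<Rightarrow> 'd star_poly mat \<Rightarrow> 'd star_poly mat \<Rightarrow> 'd star_poly mat" where
  "mpoly_mult n P Q = mat n n (\<lambda>(i, j). \<Sum>k<n. poly_mult (P $$ (i, k)) (Q $$ (k, j)))"

definition mpoly_star :: "nat \<Rightarrow> 'd star_poly mat \<Rightarrow> 'd star_poly mat" where
  "mpoly_star n P = mat n n (\<lambda>(i, j). poly_star (P $$ (j, i)))"

definition mpoly_scale :: "nat \<Rightarrow> complex \<Rightarrow> 'd star_poly mat \<Rightarrow> 'd star_poly mat" where
  "mpoly_scale n c P = mat n n (\<lambda>ij. poly_scale c (P $$ ij))"

definition mpoly_add :: "nat \<Rightarrow> 'd star_poly mat \<Rightarrow> 'd star_poly mat \<Rightarrow> 'd star_poly mat" where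
  "mpoly_add n P Q = mat n n (\<lambda>ij. P $$ ij + Q $$ ij)"

primrec mpoly_sqrt_seq :: "nat \<Rightarrow> 'd star_poly mat \<Rightarrow> nat \<Rightarrow> 'd star_poly mat" where
  "mpoly_sqrt_seq n P 0 = mat n n (\<lambda>_. 0)"
| "mpoly_sqrt_seq n P (Suc m) = mpoly_scale n (1 / 2)
     (mpoly_add n P (mpoly_mult n (mpoly_sqrt_seq n P m) (mpoly_sqrt_seq n P m)))"

text \<open>With \<open>x = P\<^sup>* P\<close> and \<open>y\<^sub>m\<close> the iterates for \<open>1 - sqrt (1 - x)\<close>, this is
  \<open>1 - x - (1 - y\<^sub>m)\<^sup>2 = 2 (y\<^sub>m - y\<^sub>m\<^sub>+\<^sub>1)\<close>.\<close>

definition defect_poly :: "nat \<Rightarrow> 'd star_poly mat \<Rightarrow> nat \<Rightarrow> 'd star_poly mat" where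
  "defect_poly n P m = (let x = mpoly_mult n (mpoly_star n P) P in
     mpoly_scale n 2 (mpoly_add n (mpoly_sqrt_seq n x m) (mpoly_scale n (-1) (mpoly_sqrt_seq n x (Suc m)))))"

context cstar_rep
begin

definition defect :: "'a \<Rightarrow> nat \<Rightarrow> 'a" where
  "defect p m = 2 \<odot> (sqrt_seq A (star A p \<otimes> p) m \<oplus> (-1) \<odot> sqrt_seq A (star A p \<otimes> p) (Suc m))"

lemma sqrt_seq_cl: "x \<in> carrier A \<Longrightarrow> sqrt_seq A x m \<in> carrier A"
  by (induction m) auto

lemma sqrt_seq_sa: "\<lbrakk>x \<in> carrier A; star A x = x\<rbrakk> \<Longrightarrow> star A (sqrt_seq A x m) = sqrt_seq A x m"
  by (induction m) (auto simp: sqrt_seq_cl)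

lemma defect_closed: "p \<in> carrier A \<Longrightarrow> defect p m \<in> carrier A"
  unfolding defect_def by (intro smult_cl sr_add sqrt_seq_cl sr_mult sr_star)

text \<open>The defect is twice a successive difference of the square root iteration for the product
  of the adjoint of p with p. The bound involves neither the algebra nor p, so one m works for all
  t.\<close>

lemma anorm_defect:
  assumes p: "p \<in> carrier A" "anorm A p \<le> 1"
  shows "anorm A (defect p m) \<le> 2 * (sqrt_bound (Suc m) - sqrt_bound m)"
proof -
  let ?x = "star A p \<otimes> p"
  have x: "?x \<in> carrier A" using p by simp
  have x1: "anorm A ?x \<le> 1"
    using p cstar_identity[OF p(1)] by (simp add: power_le_one)
  have "defect p m = 2 \<odot> (sqrt_seq A ?x m \<ominus> sqrt_seq A ?x (Suc m))"
    unfolding defect_def using sqrt_seq_cl[OF x] by (simp only: minus_rep)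
  then have "anorm A (defect p m) = 2 * anorm A (sqrt_seq A ?x m \<ominus> sqrt_seq A ?x (Suc m))"
    using minus_closed[OF sqrt_seq_cl[OF x] sqrt_seq_cl[OF x]] by (simp only: norm_smult) simp
  then show ?thesis
    using sqrt_seq_Suc_diff[OF x x1, of m]
      anorm_minus_commute[OF sqrt_seq_cl[OF x] sqrt_seq_cl[OF x], of m "Suc m"]
    by (simp del: sqrt_seq.simps sqrt_bound.simps)
qed

text \<open>The square of the self-adjoint element 1 - y is 1 - x - defect, where x is the product
  of the adjoint of p with p. Its form is nonnegative for every m, so |p v|^2 \<le> (1 + e) |v|^2,
  without any prior bound on p.\<close>

lemma bnd_of_defect:
  assumes p: "p \<in> carrier A" and d: "anorm A (defect p m) \<le> e"
  shows "anorm A p \<le> sqrt (1 + e)"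
proof -
  let ?x = "star A p \<otimes> p"
  have x: "?x \<in> carrier A" "star A ?x = ?x" using p by simp_all
  define y where "y = sqrt_seq A ?x m"
  have y: "y \<in> carrier A" "star A y = y" using sqrt_seq_cl[OF x(1)] sqrt_seq_sa[OF x] by (simp_all add: y_def)
  have D: "defect p m \<in> carrier A" using p by (rule defect_closed)
  have e0: "0 \<le> e" using anorm_nonneg[OF D] d by linarith
  have b: "bnd (defect p m) e" using d D by (simp only: anorm_le_iff)
  have Deq: "defect p m = 2 \<odot> (y \<oplus> (-1) \<odot> ((1 / 2) \<odot> (?x \<oplus> y \<otimes> y)))"
    by (simp add: defect_def y_def)
  have "bnd p (sqrt (1 + e))"
    unfolding bnd_def
  proof (intro conjI ballI)
    show "0 \<le> sqrt (1 + e)" using e0 by simp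
  next
    fix v assume v: "v \<in> V"
    let ?u = "\<one> \<ominus> y"
    have u: "?u \<in> carrier A" "star A ?u = ?u" using y by (simp_all add: minus_rep)
    have "ip (act (?u \<otimes> ?u) v) v = ip v v - ip (act ?x v) v - ip (act (defect p m) v) v"
      unfolding Deq using y x(1) v by (simp add: algebra_expand algebra_simps)
    moreover have "ip (act (?u \<otimes> ?u) v) v = complex_of_real (sq (act ?u v))"
      using act_mult'[OF u(1) u(1) v v] u v by (simp add: ip_self del: act_minus)
    moreover have "ip (act ?x v) v = complex_of_real (sq (act p v))"
      using p v by (simp add: act_mult act_star ip_self)
    ultimately have "sq (act ?u v) = sq v - sq (act p v) - Re (ip (act (defect p m) v) v)"
      using v by (simp add: ip_self complex_eq_iff)
    moreover have "0 \<le> sq (act ?u v)" using u v by simp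
    moreover have "cmod (ip (act (defect p m) v) v) \<le> e * sqrt (sq v) * sqrt (sq v)"
      using D b v by (intro bnd_ip)
    then have "- Re (ip (act (defect p m) v) v) \<le> e * sq v"
      using abs_Re_le_cmod[of "ip (act (defect p m) v) v"] v by (simp add: mult.assoc)
    ultimately show "sq (act p v) \<le> (sqrt (1 + e))\<^sup>2 * sq v"
      using e0 by (simp add: algebra_simps)
  qed
  then show ?thesis using anorm_le_iff[OF p] by blast
qed

end

lemma (in star_rep) eval_mats:
  assumes "range X \<subseteq> carrier A" "P \<in> carrier_mat n n"
  shows "eval_poly_mat A X P \<in> mats (carrier A) n"
  using assms eval_poly_closed[of X] by (auto simp: mats_def)

context cstar_rep
begin

lemma matrix_norm_entry:
  assumes n: "n \<ge> 1" and Y: "Y \<in> mats (carrier A) n" and ij: "i < n" "j < n"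
  shows "anorm A (Y $$ (i, j)) \<le> matrix_norm A n Y"
  using mbnd_entry[OF Y _ ij, of "matrix_norm A n Y"] matrix_norm_le_iff[OF n Y] anorm_le_iff[OF matsD[OF Y ij]]
  by blast

lemma matrix_norm_sum:
  assumes n: "n \<ge> 1" and Y: "Y \<in> mats (carrier A) n"
    and le: "\<And>i j. \<lbrakk>i < n; j < n\<rbrakk> \<Longrightarrow> anorm A (Y $$ (i, j)) \<le> D i j"
  shows "matrix_norm A n Y \<le> (\<Sum>i<n. \<Sum>j<n. D i j)"
  unfolding matrix_norm_le_iff[OF n Y]
  using le by (intro mbnd_sum[OF Y]) (metis anorm_le_iff matsD[OF Y])

lemma matrix_norm_nonneg:
  assumes n: "n \<ge> 1" and Y: "Y \<in> mats (carrier A) n"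
  shows "0 \<le> matrix_norm A n Y"
proof -
  have "0 \<le> anorm A (Y $$ (0, 0))" using matsD[OF Y] n by simp
  also have "\<dots> \<le> matrix_norm A n Y" using n by (intro matrix_norm_entry Y) auto
  finally show ?thesis .
qed

lemma matrix_norm_one:
  assumes a: "a \<in> carrier A"
  shows "matrix_norm A 1 (mat 1 1 (\<lambda>_. a)) = anorm A a"
proof (rule antisym)
  have Y: "mat 1 1 (\<lambda>_. a) \<in> mats (carrier A) 1" using a by (simp add: mats_mat)
  show "matrix_norm A 1 (mat 1 1 (\<lambda>_. a)) \<le> anorm A a"
    using matrix_norm_sum[OF order_refl Y, of "\<lambda>_ _. anorm A a"] by simp
  show "anorm A a \<le> matrix_norm A 1 (mat 1 1 (\<lambda>_. a))"
    using matrix_norm_entry[OF order_refl Y, of 0 0] by simp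
qed

context
  fixes X :: "'d \<Rightarrow> 'a" and n :: nat assumes X: "range X \<subseteq> carrier A"
begin

abbreviation "evm \<equiv> eval_poly_mat A X"
abbreviation "Mn \<equiv> matrix_algebra A n"

lemma Mn_simps:
  "\<zero>\<^bsub>Mn\<^esub> = mat n n (\<lambda>_. \<zero>)"
  "Y \<oplus>\<^bsub>Mn\<^esub> Y' = mat n n (\<lambda>ij. Y $$ ij \<oplus> Y' $$ ij)"
  "Y \<otimes>\<^bsub>Mn\<^esub> Y' = mat n n (\<lambda>(i, j). \<Oplus>k\<in>{..<n}. Y $$ (i, k) \<otimes> Y' $$ (k, j))"
  "c \<odot>\<^bsub>Mn\<^esub> Y = mat n n (\<lambda>ij. c \<odot> Y $$ ij)"
  "star Mn Y = mat n n (\<lambda>(i, j). star A (Y $$ (j, i)))"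
  by (simp_all add: matrix_algebra_def)

lemma evm_mult:
  assumes P: "P \<in> carrier_mat n n" and Q: "Q \<in> carrier_mat n n"
  shows "evm (mpoly_mult n P Q) = evm P \<otimes>\<^bsub>Mn\<^esub> evm Q"
proof (rule eq_matI)
  fix i j assume "i < dim_row (evm P \<otimes>\<^bsub>Mn\<^esub> evm Q)" "j < dim_col (evm P \<otimes>\<^bsub>Mn\<^esub> evm Q)"
  then have ij: "i < n" "j < n" by (simp_all add: Mn_simps)
  have cl: "eval_poly A X (P $$ (i, k)) \<otimes> eval_poly A X (Q $$ (k, j)) \<in> carrier A" for k
    by (simp add: eval_poly_closed[OF X])
  have "evm (mpoly_mult n P Q) $$ (i, j) = eval_poly A X (\<Sum>k<n. poly_mult (P $$ (i, k)) (Q $$ (k, j)))"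
    using ij by (simp add: mpoly_mult_def)
  also have "\<dots> = (\<Oplus>k\<in>{..<n}. eval_poly A X (P $$ (i, k)) \<otimes> eval_poly A X (Q $$ (k, j)))"
    by (rule act_faithful)
      (use cl in \<open>auto simp: eval_poly_closed[OF X] ip_eval_poly_sum[OF X] eval_poly_mult[OF X] act_finsum
        intro!: finsum_closed\<close>)
  also have "\<dots> = (\<Oplus>k\<in>{..<n}. evm P $$ (i, k) \<otimes> evm Q $$ (k, j))"
    using P Q ij cl by (intro finsum_cong') auto
  finally show "evm (mpoly_mult n P Q) $$ (i, j) = (evm P \<otimes>\<^bsub>Mn\<^esub> evm Q) $$ (i, j)"
    using ij by (simp add: Mn_simps)
qed (use P Q in \<open>auto simp: mpoly_mult_def Mn_simps\<close>)

lemma evm_star: "P \<in> carrier_mat n n \<Longrightarrow> evm (mpoly_star n P) = star Mn (evm P)"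
  by (rule eq_matI) (auto simp: mpoly_star_def Mn_simps eval_poly_star[OF X])

lemma evm_scale: "P \<in> carrier_mat n n \<Longrightarrow> evm (mpoly_scale n c P) = c \<odot>\<^bsub>Mn\<^esub> evm P"
  by (rule eq_matI) (auto simp: mpoly_scale_def Mn_simps eval_poly_scale[OF X])

lemma evm_add: "\<lbrakk>P \<in> carrier_mat n n; Q \<in> carrier_mat n n\<rbrakk>
    \<Longrightarrow> evm (mpoly_add n P Q) = evm P \<oplus>\<^bsub>Mn\<^esub> evm Q"
  by (rule eq_matI) (auto simp: mpoly_add_def Mn_simps eval_poly_add[OF X])

lemma mpoly_carrier [simp]:
  "mpoly_mult n P Q \<in> carrier_mat n n" "mpoly_star n P \<in> carrier_mat n n"
  "mpoly_scale n c P \<in> carrier_mat n n" "mpoly_add n P Q \<in> carrier_mat n n"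
  "mpoly_sqrt_seq n P m \<in> carrier_mat n n"
  by (cases m; simp add: mpoly_mult_def mpoly_star_def mpoly_scale_def mpoly_add_def)+

lemma evm_sqrt_seq: "P \<in> carrier_mat n n \<Longrightarrow> evm (mpoly_sqrt_seq n P m) = sqrt_seq Mn (evm P) m"
proof (induction m)
  case 0
  show ?case by (rule eq_matI) (auto simp: Mn_simps eval_poly_zero[OF X])
qed (simp add: evm_scale evm_add evm_mult)

lemma evm_defect:
  assumes n: "n \<ge> 1" and P: "P \<in> carrier_mat n n"
  shows "evm (defect_poly n P m) = cstar_rep.defect Mn (evm P) m"
  unfolding defect_poly_def cstar_rep.defect_def[OF cstar_rep_matrix[OF n]] Let_def using P
  by (simp add: evm_scale evm_add evm_mult evm_star evm_sqrt_seq del: mpoly_sqrt_seq.simps sqrt_seq.simps)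

lemma defect_poly_le:
  assumes n: "n \<ge> 1" and P: "P \<in> carrier_mat n n" and P1: "matrix_norm A n (evm P) \<le> 1"
    and ij: "i < n" "j < n"
  shows "anorm A (eval_poly A X (defect_poly n P m $$ (i, j))) \<le> 2 * (sqrt_bound (Suc m) - sqrt_bound m)"
proof -
  interpret M: cstar_rep Mn "Vn n" "ipn n" "\<lambda>_. vzero" "\<lambda>f g i. vadd (f i) (g i)"
    "\<lambda>c f i. vscale c (f i)" "actn n"
    by (rule cstar_rep_matrix[OF n])
  have an: "anorm Mn = matrix_norm A n" by (simp add: matrix_algebra_def fun_eq_iff)
  have carr: "carrier Mn = mats (carrier A) n"
    unfolding matrix_algebra_def by (rule carrier_matrix_algebra_with)
  have D: "defect_poly n P m \<in> carrier_mat n n" by (simp add: defect_poly_def Let_def)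
  have Pc: "evm P \<in> carrier Mn" unfolding carr using X P by (rule eval_mats)
  have "anorm A (evm (defect_poly n P m) $$ (i, j)) \<le> matrix_norm A n (evm (defect_poly n P m))"
    using n eval_mats[OF X D] ij by (rule matrix_norm_entry)
  also have "\<dots> \<le> 2 * (sqrt_bound (Suc m) - sqrt_bound m)"
    using M.anorm_defect[OF Pc] P1 unfolding an evm_defect[OF n P] .
  finally show ?thesis using D ij by simp
qed

lemma matrix_norm_le_of_defect:
  assumes n: "n \<ge> 1" and P: "P \<in> carrier_mat n n"
    and le: "\<And>i j. \<lbrakk>i < n; j < n\<rbrakk> \<Longrightarrow> anorm A (eval_poly A X (defect_poly n P m $$ (i, j))) \<le> e"
  shows "matrix_norm A n (evm P) \<le> sqrt (1 + (real n)\<^sup>2 * e)"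
proof -
  interpret M: cstar_rep Mn "Vn n" "ipn n" "\<lambda>_. vzero" "\<lambda>f g i. vadd (f i) (g i)"
    "\<lambda>c f i. vscale c (f i)" "actn n"
    by (rule cstar_rep_matrix[OF n])
  have an: "anorm Mn = matrix_norm A n" by (simp add: matrix_algebra_def fun_eq_iff)
  have carr: "carrier Mn = mats (carrier A) n"
    unfolding matrix_algebra_def by (rule carrier_matrix_algebra_with)
  have D: "defect_poly n P m \<in> carrier_mat n n" by (simp add: defect_poly_def Let_def)
  have Pc: "evm P \<in> carrier Mn" unfolding carr using X P by (rule eval_mats)
  have "matrix_norm A n (evm (defect_poly n P m)) \<le> (\<Sum>i<n. \<Sum>j<n. e)"
    using le D by (intro matrix_norm_sum[OF n eval_mats[OF X D]]) simp
  then have "matrix_norm A n (evm (defect_poly n P m)) \<le> (real n)\<^sup>2 * e"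
    by (simp add: power2_eq_square mult.assoc)
  then show ?thesis using M.bnd_of_defect[OF Pc, of m] unfolding an evm_defect[OF n P] by blast
qed

lemma matrix_norm_scale:
  assumes n: "n \<ge> 1" and P: "P \<in> carrier_mat n n"
  shows "matrix_norm A n (evm (mpoly_scale n c P)) = cmod c * matrix_norm A n (evm P)"
proof -
  interpret M: cstar_rep Mn "Vn n" "ipn n" "\<lambda>_. vzero" "\<lambda>f g i. vadd (f i) (g i)"
    "\<lambda>c f i. vscale c (f i)" "actn n"
    by (rule cstar_rep_matrix[OF n])
  have an: "anorm Mn = matrix_norm A n" by (simp add: matrix_algebra_def fun_eq_iff)
  have carr: "carrier Mn = mats (carrier A) n"
    unfolding matrix_algebra_def by (rule carrier_matrix_algebra_with)
  have Pc: "evm P \<in> carrier Mn" unfolding carr using X P by (rule eval_mats)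
  show ?thesis using M.norm_smult[OF Pc] unfolding an evm_scale[OF P] .
qed

end

end

lemma sqrt_bound_diff_small:
  assumes "e > 0"
  obtains m where "2 * (sqrt_bound (Suc m) - sqrt_bound m) \<le> e"
proof -
  obtain M where M: "\<And>k l. \<lbrakk>k \<ge> M; l \<ge> M\<rbrakk> \<Longrightarrow> \<bar>sqrt_bound k - sqrt_bound l\<bar> < e / 2"
    using metric_CauchyD[OF Cauchy_sqrt_bound, of "e / 2"] assms unfolding dist_real_def by auto
  then have "\<bar>sqrt_bound (Suc M) - sqrt_bound M\<bar> < e / 2" by (meson le_SucI order_refl)
  moreover have "\<bar>a - b\<bar> < e / 2 \<Longrightarrow> 2 * (a - b) \<le> e" for a b :: real using abs_ge_self[of "a - b"] by argo
  ultimately have "2 * (sqrt_bound (Suc M) - sqrt_bound M) \<le> e" by blast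
  then show ?thesis by (rule that)
qed

section \<open>Families of tuples: from scalar to matrix polynomials\<close>

locale rep_family =
  fixes A :: "'t::metric_space \<Rightarrow> 'a cstar" and \<xi> :: "'t \<Rightarrow> 'd::finite \<Rightarrow> 'a"
    and H :: "'t \<Rightarrow> 'h inner_product_space" and \<pi> :: "'t \<Rightarrow> 'a \<Rightarrow> 'h \<Rightarrow> 'h" and t0 :: 't
  assumes rep: "rep_tuple (A t) (\<xi> t) (H t) (\<pi> t)"
begin

sublocale S: rep_tuple "A t" "\<xi> t" "H t" "\<pi> t" for t
  by (rule rep)

text \<open>If the entries of the defect polynomial have nearly the same norms at \<open>t\<close> and \<open>t'\<close>, then \<open>P\<close> is
  almost a contraction at \<open>t'\<close> as soon as it is one at \<open>t\<close>.\<close>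

lemma matrix_norm_transfer:
  assumes n: "n \<ge> 1" and P: "P \<in> carrier_mat n n" and c: "0 < c" "c < C"
  shows "\<exists>e>0. \<exists>R. \<forall>t t'. matrix_norm (A t) n (eval_poly_mat (A t) (\<xi> t) P) \<le> c
    \<longrightarrow> (\<forall>i<n. \<forall>j<n. anorm (A t') (eval_poly (A t') (\<xi> t') (R $$ (i, j)))
        \<le> anorm (A t) (eval_poly (A t) (\<xi> t) (R $$ (i, j))) + e)
    \<longrightarrow> matrix_norm (A t') n (eval_poly_mat (A t') (\<xi> t') P) < C"
proof -
  \<comment> \<open>Chosen so that 1 + n^2 (2 e) is the midpoint of 1 and (C / c)^2. The factor 2 e
    occurs because the entries of the defect are at most e at t and may be larger by e at
    t'.\<close>
  define e where "e = ((C / c)\<^sup>2 - 1) / (4 * (real n)\<^sup>2)"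
  have Cc: "1 < C / c" using c by simp
  then have "1 < (C / c)\<^sup>2" by (simp add: one_less_power)
  then have e: "e > 0" using n by (simp add: e_def)
  have "1 + (real n)\<^sup>2 * (2 * e) = 1 + ((C / c)\<^sup>2 - 1) / 2"
    using n by (simp add: e_def)
  also have "\<dots> < (C / c)\<^sup>2" using \<open>1 < (C / c)\<^sup>2\<close> by (simp add: field_simps)
  finally have "sqrt (1 + (real n)\<^sup>2 * (2 * e)) < C / c" using Cc by (simp add: real_less_lsqrt)
  then have lt: "c * sqrt (1 + (real n)\<^sup>2 * (2 * e)) < C" using c by (simp add: pos_less_divide_eq mult.commute)
  obtain m where m: "2 * (sqrt_bound (Suc m) - sqrt_bound m) \<le> e" using sqrt_bound_diff_small[OF e] .
  define P1 where "P1 = mpoly_scale n (complex_of_real (1 / c)) P"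
  have P1: "P1 \<in> carrier_mat n n" by (simp add: P1_def mpoly_scale_def)
  have scale: "matrix_norm (A t) n (eval_poly_mat (A t) (\<xi> t) P1)
      = matrix_norm (A t) n (eval_poly_mat (A t) (\<xi> t) P) / c" for t
    using S.matrix_norm_scale[OF S.\<xi> n P, of t "complex_of_real (1 / c)"] c
    by (simp add: P1_def norm_divide)
  define R where "R = defect_poly n P1 m"
  have "matrix_norm (A t') n (eval_poly_mat (A t') (\<xi> t') P) < C"
    if Pc: "matrix_norm (A t) n (eval_poly_mat (A t) (\<xi> t) P) \<le> c"
      and close: "\<forall>i<n. \<forall>j<n. anorm (A t') (eval_poly (A t') (\<xi> t') (R $$ (i, j)))
        \<le> anorm (A t) (eval_poly (A t) (\<xi> t) (R $$ (i, j))) + e" for t t'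
  proof -
    have "matrix_norm (A t) n (eval_poly_mat (A t) (\<xi> t) P1) \<le> 1"
      using Pc c by (simp add: scale)
    then have "anorm (A t) (eval_poly (A t) (\<xi> t) (R $$ (i, j))) \<le> e" if "i < n" "j < n" for i j
      using S.defect_poly_le[OF S.\<xi> n P1 _ that, of t m] m unfolding R_def by linarith
    then have "anorm (A t') (eval_poly (A t') (\<xi> t') (R $$ (i, j))) \<le> 2 * e" if "i < n" "j < n" for i j
      using close that by force
    then have "matrix_norm (A t') n (eval_poly_mat (A t') (\<xi> t') P1) \<le> sqrt (1 + (real n)\<^sup>2 * (2 * e))"
      using S.matrix_norm_le_of_defect[OF S.\<xi> n P1, of t' m "2 * e"] unfolding R_def by blast
    then have "matrix_norm (A t') n (eval_poly_mat (A t') (\<xi> t') P) \<le> c * sqrt (1 + (real n)\<^sup>2 * (2 * e))"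
      using c by (simp add: scale pos_divide_le_eq mult.commute)
    then show ?thesis using lt by simp
  qed
  then show ?thesis using e by blast
qed

text \<open>Upper semicontinuity at t0 transfers a bound from t0 to t, and lower semicontinuity
  transfers one from t to t0. Both use the finitely many scalar polynomials in the entries of R,
  where (i) applies.\<close>

lemma matrix_poly_norms_converge_if:
  assumes conv: "poly_norms_converge A \<xi> t0"
  shows "matrix_poly_norms_converge A \<xi> t0"
  unfolding matrix_poly_norms_converge_def
proof (intro allI impI)
  fix n :: nat and P :: "'d star_poly mat" assume n: "n \<ge> 1" and P: "P \<in> carrier_mat n n"
  define f where "f t = matrix_norm (A t) n (eval_poly_mat (A t) (\<xi> t) P)" for t
  have f0: "0 \<le> f t" for t
    unfolding f_def using n S.\<xi> P by (intro S.matrix_norm_nonneg S.eval_mats) auto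
  let ?r = "\<lambda>t R i j. anorm (A t) (eval_poly (A t) (\<xi> t) (R $$ (i, j)))"
  have ev: "\<forall>\<^sub>F t in at t0. \<forall>i<n. \<forall>j<n. \<bar>?r t R i j - ?r t0 R i j\<bar> < e" if "e > 0" for e R
  proof -
    have "\<forall>\<^sub>F t in at t0. \<forall>i\<in>{..<n}. \<forall>j\<in>{..<n}. \<bar>?r t R i j - ?r t0 R i j\<bar> < e"
    proof (intro eventually_ball_finite ballI finite_lessThan)
      fix i j
      have "((\<lambda>t. ?r t R i j) \<longlongrightarrow> ?r t0 R i j) (at t0)"
        using conv by (simp add: poly_norms_converge_def)
      then show "\<forall>\<^sub>F t in at t0. \<bar>?r t R i j - ?r t0 R i j\<bar> < e"
        using that by (auto simp: tendsto_iff dist_real_def)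
    qed
    then show ?thesis by (rule eventually_mono) auto
  qed
  have "(f \<longlongrightarrow> f t0) (at t0)"
  proof (rule order_tendstoI)
    fix C assume C: "f t0 < C"
    obtain c where c: "f t0 < c" "c < C" using dense[OF C] by blast
    then have c0: "0 < c" using f0[of t0] by linarith
    obtain e R where e: "e > 0" and tr: "\<forall>t t'. f t \<le> c
        \<longrightarrow> (\<forall>i<n. \<forall>j<n. ?r t' R i j \<le> ?r t R i j + e) \<longrightarrow> f t' < C"
      using matrix_norm_transfer[OF n P c0 c(2)] unfolding f_def by blast
    show "\<forall>\<^sub>F t in at t0. f t < C"
      using ev[OF e, of R]
    proof (rule eventually_mono)
      fix t assume t: "\<forall>i<n. \<forall>j<n. \<bar>?r t R i j - ?r t0 R i j\<bar> < e"
      have "?r t R i j \<le> ?r t0 R i j + e" if "i < n" "j < n" for i j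
        using t that by (smt (verit))
      then show "f t < C" using tr[rule_format, of t0 t] c by simp
    qed
  next
    fix c assume c: "c < f t0"
    \<comment> \<open>A positive number strictly below \<open>f t0\<close> when c is nonnegative:
      the transfer lemma rescales P by the bound, which must therefore not be zero.\<close>
    define c' where "c' = (max c 0 + f t0) / 2"
    show "\<forall>\<^sub>F t in at t0. c < f t"
    proof (cases "c < 0")
      case True
      then show ?thesis using f0 by (intro always_eventually) (metis order_less_le_trans)
    next
      case False
      then have c': "0 < c'" "c' < f t0" "c \<le> c'" using c by (auto simp: c'_def)
      obtain e R where e: "e > 0" and tr: "\<forall>t t'. f t \<le> c'
          \<longrightarrow> (\<forall>i<n. \<forall>j<n. ?r t' R i j \<le> ?r t R i j + e) \<longrightarrow> f t' < f t0"
        using matrix_norm_transfer[OF n P c'(1) c'(2)] unfolding f_def by blast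
      show ?thesis
        using ev[OF e, of R]
      proof (rule eventually_mono)
        fix t assume t: "\<forall>i<n. \<forall>j<n. \<bar>?r t R i j - ?r t0 R i j\<bar> < e"
        have "?r t0 R i j \<le> ?r t R i j + e" if "i < n" "j < n" for i j
          using t that by (smt (verit))
        \<comment> \<open>Otherwise the transfer from t to t0 would give
          \<open>f t0 < f t0\<close>.\<close>
        then have "\<not> f t \<le> c'" using tr[rule_format, of t t0] by blast
        then show "c < f t" using c' by simp
      qed
    qed
  qed
  then show "((\<lambda>t. matrix_norm (A t) n (eval_poly_mat (A t) (\<xi> t) P))
      \<longlongrightarrow> matrix_norm (A t0) n (eval_poly_mat (A t0) (\<xi> t0) P)) (at t0)"
    by (simp add: f_def[abs_def])
qed

lemma eval_poly_mat_one: "eval_poly_mat B X (mat 1 1 (\<lambda>_. p)) = mat 1 1 (\<lambda>_. eval_poly B X p)"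
  by (rule eq_matI) auto

lemma poly_norms_converge_iff:
  "poly_norms_converge A \<xi> t0 \<longleftrightarrow> matrix_poly_norms_converge A \<xi> t0"
proof
  assume m: "matrix_poly_norms_converge A \<xi> t0"
  show "poly_norms_converge A \<xi> t0"
    unfolding poly_norms_converge_def
  proof
    fix p :: "'d star_poly"
    have "((\<lambda>t. matrix_norm (A t) 1 (eval_poly_mat (A t) (\<xi> t) (mat 1 1 (\<lambda>_. p))))
        \<longlongrightarrow> matrix_norm (A t0) 1 (eval_poly_mat (A t0) (\<xi> t0) (mat 1 1 (\<lambda>_. p)))) (at t0)"
      by (rule m[unfolded matrix_poly_norms_converge_def, rule_format]) simp_all
    then show "((\<lambda>t. anorm (A t) (eval_poly (A t) (\<xi> t) p))
        \<longlongrightarrow> anorm (A t0) (eval_poly (A t0) (\<xi> t0) p)) (at t0)"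
      unfolding eval_poly_mat_one S.matrix_norm_one[OF S.eval_poly_closed[OF S.\<xi>]] .
  qed
qed (rule matrix_poly_norms_converge_if)

lemma linear_if_matrix:
  "matrix_poly_norms_converge A \<xi> t0 \<Longrightarrow> linear_matrix_poly_norms_converge A \<xi> t0"
  unfolding matrix_poly_norms_converge_def linear_matrix_poly_norms_converge_def by blast

end

section \<open>Norms of linear pencils and matrix ranges\<close>

text \<open>The expansions are stated weakly, through inner products, since the form may be
  degenerate. A residual of length zero adds no basis vector, so linear dependence only makes m
  smaller than M.\<close>

lemma (in ip_space) Gram_Schmidt:
  fixes M :: nat
  assumes "\<And>k. k < M \<Longrightarrow> w k \<in> V"
  shows "\<exists>m\<le>M. \<exists>e \<gamma>. (\<forall>a<m. e a \<in> V) \<and> (\<forall>a<m. \<forall>b<m. ip (e a) (e b) = (if a = b then 1 else 0))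
    \<and> (\<forall>k<M. \<forall>z\<in>V. ip (w k) z = (\<Sum>a<m. \<gamma> k a * ip (e a) z))"
  using assms
proof (induction M)
  case (Suc M)
  then have "\<exists>m\<le>M. \<exists>e \<gamma>. (\<forall>a<m. e a \<in> V) \<and> (\<forall>a<m. \<forall>b<m. ip (e a) (e b) = (if a = b then 1 else 0))
    \<and> (\<forall>k<M. \<forall>z\<in>V. ip (w k) z = (\<Sum>a<m. \<gamma> k a * ip (e a) z))" by simp
  then obtain m e \<gamma> where m: "m \<le> M" and e: "\<And>a. a < m \<Longrightarrow> e a \<in> V"
    and on: "\<And>a b. \<lbrakk>a < m; b < m\<rbrakk> \<Longrightarrow> ip (e a) (e b) = (if a = b then 1 else 0)"
    and \<gamma>: "\<And>k z. \<lbrakk>k < M; z \<in> V\<rbrakk> \<Longrightarrow> ip (w k) z = (\<Sum>a<m. \<gamma> k a * ip (e a) z)"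
    by blast
  have wM: "w M \<in> V" using Suc.prems by simp
  define p where "p = vsum m (\<lambda>a. vscale (ip (w M) (e a)) (e a))"
  have p: "p \<in> V" using e by (simp add: p_def)
  have ip_p: "ip p z = (\<Sum>a<m. ip (w M) (e a) * ip (e a) z)" if "z \<in> V" for z
    using e that by (simp add: p_def ip_vsum)
  define r where "r = vadd (w M) (vscale (-1) p)"
  have r: "r \<in> V" using wM p by (simp add: r_def)
  have ip_r: "ip r z = ip (w M) z - ip p z" if "z \<in> V" for z
    using wM p that by (simp add: r_def)
  have orth: "ip r (e b) = 0" if b: "b < m" for b
  proof -
    have "ip p (e b) = (\<Sum>a<m. if a = b then ip (w M) (e a) else 0)"
      unfolding ip_p[OF e[OF b]] by (intro sum.cong refl) (simp add: on b)
    then show ?thesis using b e by (simp add: ip_r)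
  qed
  show ?case
  proof (cases "sq r = 0")
    case True
    define \<gamma>' where "\<gamma>' k a = (if k = M then ip (w M) (e a) else \<gamma> k a)" for k a
    have "ip (w k) z = (\<Sum>a<m. \<gamma>' k a * ip (e a) z)" if "k < Suc M" "z \<in> V" for k z
    proof (cases "k = M")
      case eq: True
      have "ip r z = 0" using r that True by (intro ip_self_zero_imp)
      then show ?thesis using that eq by (simp add: ip_r ip_p \<gamma>'_def)
    next
      case False
      then show ?thesis using that \<gamma>[of k z] by (simp add: \<gamma>'_def)
    qed
    then have "(\<forall>a<m. e a \<in> V) \<and> (\<forall>a<m. \<forall>b<m. ip (e a) (e b) = (if a = b then 1 else 0))
      \<and> (\<forall>k<Suc M. \<forall>z\<in>V. ip (w k) z = (\<Sum>a<m. \<gamma>' k a * ip (e a) z))"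
      using e on by blast
    then show ?thesis using le_SucI[OF m] by blast
  next
    case False
    define s where "s = sqrt (sq r)"
    have s: "s > 0" using False r by (simp add: s_def less_le)
    define f where "f = vscale (complex_of_real (1 / s)) r"
    have f: "f \<in> V" using r by (simp add: f_def)
    define e' where "e' a = (if a = m then f else e a)" for a
    have fe: "ip f (e b) = 0" "ip (e b) f = 0" if "b < m" for b
      using orth[OF that] r e[OF that] ip_commute[OF r e[OF that]] by (simp_all add: f_def)
    have "sq f = (1 / s)\<^sup>2 * sq r" using r s by (simp add: f_def norm_divide)
    also have "\<dots> = 1" using s r by (simp add: power_divide s_def)
    finally have ff: "ip f f = 1" using f by (simp add: ip_self)
    have on': "ip (e' a) (e' b) = (if a = b then 1 else 0)" if "a < Suc m" "b < Suc m" for a b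
      using that on fe ff by (auto simp: e'_def less_Suc_eq)
    define \<gamma>' where "\<gamma>' k a = (if k = M then (if a = m then complex_of_real s else ip (w M) (e a))
      else (if a = m then 0 else \<gamma> k a))" for k a
    have "ip (w k) z = (\<Sum>a<Suc m. \<gamma>' k a * ip (e' a) z)" if "k < Suc M" "z \<in> V" for k z
    proof (cases "k = M")
      case eq: True
      have "ip r z = complex_of_real s * ip f z" using r that s by (simp add: f_def)
      then show ?thesis using that eq by (simp add: ip_r ip_p \<gamma>'_def e'_def algebra_simps)
    next
      case False
      then show ?thesis using that \<gamma>[of k z] by (simp add: \<gamma>'_def e'_def)
    qed
    moreover have "e' a \<in> V" if "a < Suc m" for a
      using that e f by (auto simp: e'_def less_Suc_eq)
    ultimately have "(\<forall>a<Suc m. e' a \<in> V)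
      \<and> (\<forall>a<Suc m. \<forall>b<Suc m. ip (e' a) (e' b) = (if a = b then 1 else 0))
      \<and> (\<forall>k<Suc M. \<forall>z\<in>V. ip (w k) z = (\<Sum>a<Suc m. \<gamma>' k a * ip (e' a) z))"
      using on' by blast
    moreover have "Suc m \<le> Suc M" using m by simp
    ultimately show ?thesis by blast
  qed
qed auto

definition sq2 :: "nat \<Rightarrow> nat \<Rightarrow> (nat \<Rightarrow> nat \<Rightarrow> complex) \<Rightarrow> real" where
  "sq2 N m U = (\<Sum>l<N. \<Sum>b<m. (cmod (U l b))\<^sup>2)"

lemma sq2_nonneg [simp]: "0 \<le> sq2 N m U"
  by (simp add: sq2_def sum_nonneg)

lemma cmod_le_sq2: "\<lbrakk>l < N; b < m\<rbrakk> \<Longrightarrow> cmod (U l b) \<le> sqrt (sq2 N m U)"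
proof (rule real_le_rsqrt)
  assume lb: "l < N" "b < m"
  have "(cmod (U l b))\<^sup>2 \<le> (\<Sum>b<m. (cmod (U l b))\<^sup>2)"
    using lb by (intro member_le_sum) auto
  also have "\<dots> \<le> sq2 N m U"
    unfolding sq2_def using lb by (intro member_le_sum[of l]) (auto intro: sum_nonneg)
  finally show "(cmod (U l b))\<^sup>2 \<le> sq2 N m U" .
qed

text \<open>The number \<open>\<langle>P(X) U, W\<rangle>\<close> for \<open>U\<close>, \<open>W\<close> in the tensor product of \<open>N\<close>- and \<open>m\<close>-dimensional space.\<close>

definition pencil_form :: "'d::finite star_poly mat \<Rightarrow> nat \<Rightarrow> nat \<Rightarrow> ('d \<Rightarrow> complex mat)
    \<Rightarrow> (nat \<Rightarrow> nat \<Rightarrow> complex) \<Rightarrow> (nat \<Rightarrow> nat \<Rightarrow> complex) \<Rightarrow> complex" where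
  "pencil_form P N m X U W = (\<Sum>j<N. \<Sum>l<N. \<Sum>a<m. \<Sum>b<m.
     (\<Sum>w\<in>short_words. Poly_Mapping.lookup (P $$ (j, l)) w * word_entry X w a b) * U l b * cnj (W j a))"

text \<open>A Lipschitz constant of \<open>pencil_form\<close> as a function of the entries of X.
  The factor \<open>real m * real m\<close> counts the entries in each block.\<close>

definition pencil_size :: "'d::finite star_poly mat \<Rightarrow> nat \<Rightarrow> nat \<Rightarrow> real" where
  "pencil_size P N m = (\<Sum>j<N. \<Sum>l<N. real m * real m
     * (\<Sum>w\<in>short_words. cmod (Poly_Mapping.lookup (P $$ (j, l)) w)))"

lemma pencil_size_mono: "m \<le> m' \<Longrightarrow> pencil_size P N m \<le> pencil_size P N m'"
  unfolding pencil_size_def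
  by (intro sum_mono mult_right_mono mult_mono) (auto intro: sum_nonneg)

lemma pencil_size_nonneg: "0 \<le> pencil_size P N m"
  by (simp add: pencil_size_def sum_nonneg)

lemma pencil_form_diff:
  assumes close: "\<And>i a b. \<lbrakk>a < m; b < m\<rbrakk> \<Longrightarrow> cmod (X i $$ (a, b) - X' i $$ (a, b)) \<le> \<delta>" and \<delta>: "0 \<le> \<delta>"
  shows "cmod (pencil_form P N m X U W - pencil_form P N m X' U W)
    \<le> pencil_size P N m * \<delta> * sqrt (sq2 N m U) * sqrt (sq2 N m W)"
proof -
  let ?c = "\<lambda>j l w. Poly_Mapping.lookup (P $$ (j, l)) w"
  have we: "cmod (word_entry X w a b - word_entry X' w a b) \<le> \<delta>" if ab: "a < m" "b < m" for w a b
  proof (cases w)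
    case (Cons l w')
    show ?thesis
    proof (cases l)
      case (ZStar i)
      have "cmod (cnj (X i $$ (b, a)) - cnj (X' i $$ (b, a))) = cmod (X i $$ (b, a) - X' i $$ (b, a))"
        by (metis complex_cnj_diff complex_mod_cnj)
      then show ?thesis using Cons ZStar close ab by (simp add: word_entry_def)
    qed (use Cons close ab in \<open>simp add: word_entry_def\<close>)
  qed (use \<delta> in \<open>simp add: word_entry_def\<close>)
  let ?d = "\<lambda>j l a b. (\<Sum>w\<in>short_words. ?c j l w * (word_entry X w a b - word_entry X' w a b))
    * U l b * cnj (W j a)"
  have eq: "pencil_form P N m X U W - pencil_form P N m X' U W = (\<Sum>j<N. \<Sum>l<N. \<Sum>a<m. \<Sum>b<m. ?d j l a b)"
    unfolding pencil_form_def by (simp add: sum_subtractf right_diff_distrib left_diff_distrib)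
  have "cmod (\<Sum>j<N. \<Sum>l<N. \<Sum>a<m. \<Sum>b<m. ?d j l a b) \<le> (\<Sum>j<N. \<Sum>l<N. \<Sum>a<m. \<Sum>b<m. cmod (?d j l a b))"
    by (intro sum_norm_le order.refl)
  also have "\<dots> \<le> (\<Sum>j<N. \<Sum>l<N. \<Sum>a<m. \<Sum>b<m. (\<Sum>w\<in>short_words. cmod (?c j l w))
      * (\<delta> * sqrt (sq2 N m U) * sqrt (sq2 N m W)))"
  proof (intro sum_mono)
    fix j l a b assume "j \<in> {..<N}" "l \<in> {..<N}" "a \<in> {..<m}" "b \<in> {..<m}"
    then have jl: "j < N" "l < N" "a < m" "b < m" by auto
    have "cmod (\<Sum>w\<in>short_words. ?c j l w * (word_entry X w a b - word_entry X' w a b))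
        \<le> (\<Sum>w\<in>short_words. cmod (?c j l w) * \<delta>)"
      using we jl by (intro sum_norm_le) (auto simp: norm_mult intro!: mult_left_mono)
    then have "cmod (\<Sum>w\<in>short_words. ?c j l w * (word_entry X w a b - word_entry X' w a b))
          * cmod (U l b) * cmod (W j a)
        \<le> ((\<Sum>w\<in>short_words. cmod (?c j l w)) * \<delta>) * sqrt (sq2 N m U) * sqrt (sq2 N m W)"
      using jl \<delta> cmod_le_sq2[of l N b m U] cmod_le_sq2[of j N a m W]
      by (intro mult_mono) (auto simp: sum_distrib_right intro!: sum_nonneg mult_nonneg_nonneg)
    then show "cmod ((\<Sum>w\<in>short_words. ?c j l w * (word_entry X w a b - word_entry X' w a b)) * U l b * cnj (W j a))
        \<le> (\<Sum>w\<in>short_words. cmod (?c j l w)) * (\<delta> * sqrt (sq2 N m U) * sqrt (sq2 N m W))"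
      by (simp add: norm_mult mult.assoc)
  qed
  also have "\<dots> = pencil_size P N m * \<delta> * sqrt (sq2 N m U) * sqrt (sq2 N m W)"
    by (simp add: pencil_size_def sum_distrib_right sum_distrib_left mult_ac)
  finally show ?thesis unfolding eq .
qed

context rep_tuple
begin

abbreviation "Wn n \<equiv> matrix_range H n (\<lambda>i. \<pi> (\<xi> i))"

text \<open>If all vectors had length zero, the forms of 1 and 0 would agree, contrary to
  faithfulness.\<close>

lemma unit_vector: obtains u where "u \<in> carrier H" "ip H u u = 1"
proof -
  have "\<exists>x\<in>carrier H. sq x \<noteq> 0"
  proof (rule ccontr)
    assume n: "\<not> ?thesis"
    have "\<one> = \<zero>"
    proof (rule act_faithful)
      fix x y assume xy: "x \<in> carrier H" "y \<in> carrier H"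
      have "ip H x y = 0" using n xy by (intro ip_self_zero_imp) auto
      then show "ip H (\<pi> \<one> x) y = ip H (\<pi> \<zero> x) y" using xy by simp
    qed auto
    then show False using one_neq_zero by simp
  qed
  then obtain x where x: "x \<in> carrier H" "sq x \<noteq> 0" by blast
  then have pos: "sq x > 0" by (simp add: less_le)
  let ?u = "complex_of_real (1 / sqrt (sq x)) \<odot>\<^bsub>H\<^esub> x"
  have u: "?u \<in> carrier H" using x(1) by (rule vscale_closed)
  have "sq ?u = (1 / sqrt (sq x))\<^sup>2 * sq x" using x pos by (simp add: norm_divide)
  also have "\<dots> = 1" using pos by (simp add: power_divide)
  finally show ?thesis using that[OF u] ip_self[OF u] by simp
qed

text \<open>The vectors chosen give the UCP map T \<mapsto> <T u, u> 1 for a unit vector u.\<close>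

lemma Wn_nonempty:
  assumes n: "n \<ge> 1"
  shows "Wn n \<noteq> {}"
proof -
  obtain u where u: "u \<in> carrier H" "ip H u u = 1" by (rule unit_vector)
  let ?v = "\<lambda>c j :: nat. if c = j then u else \<zero>\<^bsub>H\<^esub>"
  have "complex_hilbert_space.compress H n n ?v \<in> ucp BH (complex_matrices n)"
  proof (rule complex_hilbert_space.ucp_compress[OF H n])
    fix a b assume ab: "a < n" "b < n"
    have "(\<Sum>c<n. ip H (?v c b) (?v c a)) = (\<Sum>c<n. if c = a then (if a = b then 1 else 0) else 0)"
      using u by (intro sum.cong refl) auto
    then show "(\<Sum>c<n. ip H (?v c b) (?v c a)) = (if a = b then 1 else 0)" using ab by simp
  qed (use u in auto)
  then show ?thesis by (auto simp: matrix_range_def)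
qed

lemma Wn_mats: "\<lbrakk>n \<ge> 1; X \<in> Wn n\<rbrakk> \<Longrightarrow> X i \<in> cmats n"
proof -
  assume n: "n \<ge> 1" and "X \<in> Wn n"
  then obtain \<phi> where "\<phi> \<in> ucp BH (complex_matrices n)" "X = (\<lambda>i. \<phi> (\<pi> (\<xi> i)))"
    by (auto simp: matrix_range_def)
  then show ?thesis using ucp_closed[OF n] \<xi> by blast
qed

lemma ucp_entry_le:
  assumes n: "n \<ge> 1" and \<phi>: "\<phi> \<in> ucp BH (complex_matrices n)" and a: "a \<in> carrier A"
    and ij: "i < n" "j < n"
  shows "cmod (\<phi> (\<pi> a) $$ (i, j)) \<le> anorm A a"
proof -
  interpret C: cstar_rep "complex_matrices n" "cvec n" "cip n" "\<lambda>_. 0" "\<lambda>f g i. f i + g i"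
    "\<lambda>c f i. c * f i" "cact n"
    by (rule cm_rep[OF n])
  have Y: "mat 1 1 (\<lambda>_. a) \<in> mats (carrier A) 1" using a by (simp add: mats_mat)
  have "mbnd 1 (mat 1 1 (\<lambda>_. a)) (anorm A a)"
    using matrix_norm_one[OF a] matrix_norm_le_iff[OF _ Y] by (metis order_refl)
  then have "C.mbnd 1 (map_mat (\<lambda>a. \<phi> (\<pi> a)) (mat 1 1 (\<lambda>_. a))) (anorm A a)"
    using ucp_contractive[OF n \<phi> _ Y] by blast
  then have "C.bnd (map_mat (\<lambda>a. \<phi> (\<pi> a)) (mat 1 1 (\<lambda>_. a)) $$ (0, 0)) (anorm A a)"
    using ucp_mats[OF n \<phi> Y] by (intro C.mbnd_entry) auto
  then have "cc.mbnd n (\<phi> (\<pi> a)) (anorm A a)" by simp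
  then have "cc.bnd (\<phi> (\<pi> a) $$ (i, j)) (anorm A a)"
    using ucp_closed[OF n \<phi> a] ij by (intro cc.mbnd_entry) auto
  then show ?thesis using cc.anorm_le_iff[of "\<phi> (\<pi> a) $$ (i, j)" "anorm A a"] by simp
qed

lemma Wn_entry_le:
  assumes n: "n \<ge> 1" and X: "X \<in> Wn n" and ab: "a < n" "b < n"
  shows "cmod (X i $$ (a, b)) \<le> anorm A (\<xi> i)"
proof -
  obtain \<phi> where \<phi>: "\<phi> \<in> ucp BH (complex_matrices n)" "X = (\<lambda>i. \<phi> (\<pi> (\<xi> i)))"
    using X by (auto simp: matrix_range_def)
  have "\<xi> i \<in> carrier A" using \<xi> by blast
  then show ?thesis using ucp_entry_le[OF n \<phi>(1) _ ab] \<phi>(2) by simp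
qed

context
  fixes P :: "'d star_poly mat" and N :: nat
  assumes N: "N \<ge> 1" and P: "P \<in> carrier_mat N N" and deg: "\<forall>q\<in>elements_mat P. degree_le_one q"
begin

lemma degree_entry: "\<lbrakk>j < N; l < N\<rbrakk> \<Longrightarrow> degree_le_one (P $$ (j, l))"
  using deg P by blast

lemma pencil_form_ucp:
  assumes m: "m \<ge> 1" and \<phi>: "\<phi> \<in> ucp BH (complex_matrices m)"
  shows "pencil_form P N m (\<lambda>i. \<phi> (\<pi> (\<xi> i))) U W
    = (\<Sum>j<N. \<Sum>l<N. \<Sum>a<m. \<Sum>b<m. \<phi> (\<pi> (eval_poly A \<xi> (P $$ (j, l)))) $$ (a, b) * U l b * cnj (W j a))"
  unfolding pencil_form_def
  by (intro sum.cong refl) (auto simp: ucp_poly_entry[OF m \<phi>] degree_entry)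

text \<open>For a polynomial of degree at most 1, applying \<phi> to the entries of P(\<xi>) gives
  P(\<phi>(\<xi>)): \<phi> is linear, unital and preserves adjoints, though it need not be
  multiplicative. The bound is then complete contractivity.\<close>

lemma pencil_form_le:
  assumes m: "m \<ge> 1" and X: "X \<in> Wn m" and c: "matrix_norm A N (eval_poly_mat A \<xi> P) \<le> c"
  shows "cmod (pencil_form P N m X U W) \<le> c * sqrt (sq2 N m U) * sqrt (sq2 N m W)"
proof -
  obtain \<phi> where \<phi>: "\<phi> \<in> ucp BH (complex_matrices m)" and X_eq: "X = (\<lambda>i. \<phi> (\<pi> (\<xi> i)))"
    using X by (auto simp: matrix_range_def)
  let ?ca = "act_pow N (\<lambda>_. 0) (\<lambda>f g i. f i + g i) (cact m)"
  interpret M: cstar_rep "matrix_algebra (complex_matrices m) N" "vpow N (cvec m)" "ip_pow N (cip m)"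
    "\<lambda>_ _. 0" "\<lambda>f g i j. f i j + g i j" "\<lambda>c f i j. c * f i j" ?ca
    by (rule cm_rep2[OF m N])
  interpret C: cstar_rep "complex_matrices m" "cvec m" "cip m" "\<lambda>_. 0" "\<lambda>f g i. f i + g i"
    "\<lambda>c f i. c * f i" "cact m"
    by (rule cm_rep[OF m])
  let ?E = "eval_poly_mat A \<xi> P" and ?Y = "map_mat (\<lambda>a. \<phi> (\<pi> a)) (eval_poly_mat A \<xi> P)"
  have E: "?E \<in> mats (carrier A) N" using \<xi> P by (rule eval_mats)
  have Y: "?Y \<in> mats (cmats m) N" using E by (rule ucp_mats[OF m \<phi>])
  have b: "M.bnd ?Y c"
    using c matrix_norm_le_iff[OF N E] by (intro ucp_contractive[OF m \<phi> N E]) blast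
  have "ip_pow N (cip m) (?ca ?Y U) W = (\<Sum>j<N. \<Sum>l<N. cip m (cact m (?Y $$ (j, l)) (U l)) (W j))"
    using Y by (intro C.ipn_actn) (auto simp: vpow_def)
  also have "\<dots> = pencil_form P N m X U W"
    unfolding X_eq pencil_form_ucp[OF m \<phi>]
  proof (intro sum.cong refl)
    fix j l assume jl: "j \<in> {..<N}" "l \<in> {..<N}"
    then have "?Y $$ (j, l) \<in> cmats m" using Y by (auto simp: mats_def[of "cmats m"])
    moreover have "?Y $$ (j, l) = \<phi> (\<pi> (eval_poly A \<xi> (P $$ (j, l))))" using jl P by simp
    ultimately show "cip m (cact m (?Y $$ (j, l)) (U l)) (W j)
        = (\<Sum>a<m. \<Sum>b<m. \<phi> (\<pi> (eval_poly A \<xi> (P $$ (j, l)))) $$ (a, b) * U l b * cnj (W j a))"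
      by (subst cc.ipn_actn) auto
  qed
  finally have eq: "ip_pow N (cip m) (?ca ?Y U) W = pencil_form P N m X U W" .
  have sq: "M.sq U = sq2 N m U" for U
    unfolding M.sq_def ip_pow_def sq2_def
    unfolding Re_sum complex_norm_square[symmetric] Re_complex_of_real .. 
  have "cmod (ip_pow N (cip m) (?ca ?Y U) W) \<le> c * sqrt (M.sq U) * sqrt (M.sq W)"
  proof (rule M.bnd_ip[OF _ b])
    show "?Y \<in> carrier (matrix_algebra (complex_matrices m) N)" using Y unfolding cm2_carrier .
  qed (auto simp: vpow_def)
  then show ?thesis by (simp add: eq sq)
qed

text \<open>Compression to the span of the coordinates of u and v is a UCP map onto M_m, where m
  \<le> 2N is the size of an orthonormal basis, and U and W are coordinates in this basis. An empty
  basis corresponds to no level of the matrix range, but then the value is 0.\<close>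

lemma pencil_form_attained:
  assumes u: "u \<in> Vn N" and v: "v \<in> Vn N"
  shows "ipn N (actn N (eval_poly_mat A \<xi> P) u) v = 0 \<or>
    (\<exists>m X U W. 1 \<le> m \<and> m \<le> N + N \<and> X \<in> Wn m \<and> sqn N u = sq2 N m U \<and> sqn N v = sq2 N m W
      \<and> ipn N (actn N (eval_poly_mat A \<xi> P) u) v = pencil_form P N m X U W)"
proof -
  define w where "w k = (if k < N then u k else v (k - N))" for k
  have w: "w k \<in> carrier H" if "k < N + N" for k
    using u v that by (auto simp: w_def vpow_def)
  obtain m e \<gamma> where m: "m \<le> N + N" and e: "\<And>a. a < m \<Longrightarrow> e a \<in> carrier H"
    and on: "\<And>a b. \<lbrakk>a < m; b < m\<rbrakk> \<Longrightarrow> ip H (e a) (e b) = (if a = b then 1 else 0)"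
    and \<gamma>: "\<And>k z. \<lbrakk>k < N + N; z \<in> carrier H\<rbrakk> \<Longrightarrow> ip H (w k) z = (\<Sum>a<m. \<gamma> k a * ip H (e a) z)"
    using Gram_Schmidt[of "N + N" w, OF w] by blast
  define U where "U l b = \<gamma> l b" for l b
  define W where "W j a = \<gamma> (N + j) a" for j a
  have uV: "u l \<in> carrier H" and vV: "v l \<in> carrier H" if "l < N" for l
    using u v that by (auto simp: vpow_def)
  have ip_u: "ip H (u l) z = (\<Sum>b<m. U l b * ip H (e b) z)" if "l < N" "z \<in> carrier H" for l z
    using \<gamma>[of l z] that by (simp add: w_def U_def)
  have ip_v: "ip H (v j) z = (\<Sum>a<m. W j a * ip H (e a) z)" if "j < N" "z \<in> carrier H" for j z
    using \<gamma>[of "N + j" z] that by (simp add: w_def W_def)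
  have ip_v': "ip H z (v j) = (\<Sum>a<m. cnj (W j a) * ip H z (e a))" if j: "j < N" and z: "z \<in> carrier H" for j z
    using ip_v[OF that] ip_commute[OF vV[OF j] z] ip_commute[OF e z] by simp
  have ip_u': "ip H z (u j) = (\<Sum>a<m. cnj (U j a) * ip H z (e a))" if j: "j < N" and z: "z \<in> carrier H" for j z
    using ip_u[OF that] ip_commute[OF uV[OF j] z] ip_commute[OF e z] by simp
  have norm_eq: "(\<Sum>b<m. c b * (\<Sum>a<m. cnj (c a) * ip H (e b) (e a))) = complex_of_real (\<Sum>b<m. (cmod (c b))\<^sup>2)"
    for c
  proof -
    have "(\<Sum>a<m. cnj (c a) * ip H (e b) (e a)) = cnj (c b)" if "b < m" for b
    proof -
      have "(\<Sum>a<m. cnj (c a) * ip H (e b) (e a)) = (\<Sum>a<m. if a = b then cnj (c a) else 0)"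
        using that by (intro sum.cong refl) (simp add: on)
      then show ?thesis using that by simp
    qed
    then have "(\<Sum>b<m. c b * (\<Sum>a<m. cnj (c a) * ip H (e b) (e a))) = (\<Sum>b<m. c b * cnj (c b))"
      by (intro sum.cong refl) simp
    then show ?thesis by (simp add: complex_norm_square del: of_real_power)
  qed
  have squ: "sq (u l) = (\<Sum>b<m. (cmod (U l b))\<^sup>2)" if l: "l < N" for l
  proof -
    have "ip H (u l) (u l) = (\<Sum>b<m. U l b * (\<Sum>a<m. cnj (U l a) * ip H (e b) (e a)))"
      using ip_u[OF l uV[OF l]] ip_u'[OF l e] by simp
    then show ?thesis unfolding norm_eq by (simp add: sq_def)
  qed
  have sqv: "sq (v l) = (\<Sum>b<m. (cmod (W l b))\<^sup>2)" if l: "l < N" for l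
  proof -
    have "ip H (v l) (v l) = (\<Sum>b<m. W l b * (\<Sum>a<m. cnj (W l a) * ip H (e b) (e a)))"
      using ip_v[OF l vV[OF l]] ip_v'[OF l e] by simp
    then show ?thesis unfolding norm_eq by (simp add: sq_def)
  qed
  have E: "eval_poly_mat A \<xi> P \<in> mats (carrier A) N" using \<xi> P by (rule eval_mats)
  let ?p = "\<lambda>j l. \<pi> (eval_poly A \<xi> (P $$ (j, l)))"
  have form: "ipn N (actn N (eval_poly_mat A \<xi> P) u) v
      = (\<Sum>j<N. \<Sum>l<N. \<Sum>a<m. \<Sum>b<m. ip H (?p j l (e b)) (e a) * U l b * cnj (W j a))"
    unfolding ipn_actn[OF E u v]
  proof (intro sum.cong refl)
    fix j l assume "j \<in> {..<N}" "l \<in> {..<N}"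
    then have jl: "j < N" "l < N" by auto
    define q where "q = eval_poly A \<xi> (P $$ (j, l))"
    have q: "q \<in> carrier A" by (simp add: q_def eval_poly_closed[OF \<xi>])
    have "ip H (\<pi> q (u l)) (v j) = (\<Sum>b<m. U l b * ip H (e b) (\<pi> (star A q) (v j)))"
      using act_swap[OF q uV[OF jl(2)] vV[OF jl(1)]] ip_u[OF jl(2), of "\<pi> (star A q) (v j)"] q vV[OF jl(1)] by simp
    also have "\<dots> = (\<Sum>b<m. U l b * (\<Sum>a<m. cnj (W j a) * ip H (\<pi> q (e b)) (e a)))"
    proof (intro sum.cong refl arg_cong2[where f = "(*)"])
      fix b assume "b \<in> {..<m}"
      then have b: "b < m" by simp
      show "ip H (e b) (\<pi> (star A q) (v j)) = (\<Sum>a<m. cnj (W j a) * ip H (\<pi> q (e b)) (e a))"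
        using act_swap[OF q e[OF b] vV[OF jl(1)]] ip_v'[OF jl(1) act_closed[OF q e[OF b]]] by simp
    qed
    also have "\<dots> = (\<Sum>b<m. \<Sum>a<m. ip H (\<pi> q (e b)) (e a) * U l b * cnj (W j a))"
      by (simp add: sum_distrib_left mult_ac)
    also have "\<dots> = (\<Sum>a<m. \<Sum>b<m. ip H (\<pi> q (e b)) (e a) * U l b * cnj (W j a))"
      by (rule sum.swap)
    finally show "ip H (\<pi> (eval_poly_mat A \<xi> P $$ (j, l)) (u l)) (v j)
        = (\<Sum>a<m. \<Sum>b<m. ip H (?p j l (e b)) (e a) * U l b * cnj (W j a))"
      using jl P by (simp add: q_def)
  qed
  show ?thesis
  proof (cases "m = 0")
    case True
    then show ?thesis using form by simp
  next
    case False
    then have m1: "m \<ge> 1" by simp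
    let ?\<phi> = "complex_hilbert_space.compress H 1 m (\<lambda>_. e)"
    have \<phi>: "?\<phi> \<in> ucp BH (complex_matrices m)"
      using e on by (intro complex_hilbert_space.ucp_compress[OF H m1]) auto
    have "?\<phi> T $$ (a, b) = ip H (T (e b)) (e a)" if "a < m" "b < m" for T a b
      using that by (simp add: complex_hilbert_space.compress_def[OF H])
    then have "pencil_form P N m (\<lambda>i. ?\<phi> (\<pi> (\<xi> i))) U W = ipn N (actn N (eval_poly_mat A \<xi> P) u) v"
      unfolding form pencil_form_ucp[OF m1 \<phi>] by (intro sum.cong refl) auto
    moreover have "(\<lambda>i. ?\<phi> (\<pi> (\<xi> i))) \<in> Wn m" using \<phi> by (auto simp: matrix_range_def)
    moreover have "sqn N u = sq2 N m U" "sqn N v = sq2 N m W"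
      unfolding sqn_eq sq2_def using squ sqv by simp_all
    ultimately show ?thesis using m m1 by metis
  qed
qed

end

end

text \<open>A value of the form of P at \<xi>' is a value of \<open>pencil_form\<close> at some X'
  in a level up to 2N. Exchanging X' for a nearby X in the range of \<xi> costs
  \<open>pencil_size\<close> times \<delta>, and the value at X is bounded by c. Monotonicity of
  \<open>pencil_size\<close> in the level lets 2N serve for all levels.\<close>

lemma matrix_norm_le_of_ranges:
  assumes r: "rep_tuple A \<xi> H \<pi>" and r': "rep_tuple A' \<xi>' H' \<pi>'"
    and N: "N \<ge> 1" and P: "P \<in> carrier_mat N N" and deg: "\<forall>q\<in>elements_mat P. degree_le_one q"
    and c: "matrix_norm A N (eval_poly_mat A \<xi> P) \<le> c" and \<delta>: "0 \<le> \<delta>"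
    and close: "\<And>m X'. \<lbrakk>1 \<le> m; m \<le> N + N; X' \<in> matrix_range H' m (\<lambda>i. \<pi>' (\<xi>' i))\<rbrakk>
      \<Longrightarrow> \<exists>X \<in> matrix_range H m (\<lambda>i. \<pi> (\<xi> i)). \<forall>i. \<forall>a<m. \<forall>b<m. cmod (X' i $$ (a, b) - X i $$ (a, b)) \<le> \<delta>"
  shows "matrix_norm A' N (eval_poly_mat A' \<xi>' P) \<le> c + pencil_size P N (N + N) * \<delta>"
proof -
  interpret R: rep_tuple A \<xi> H \<pi> by (rule r)
  interpret R': rep_tuple A' \<xi>' H' \<pi>' by (rule r')
  let ?K = "pencil_size P N (N + N)"
  have E': "eval_poly_mat A' \<xi>' P \<in> mats (carrier A') N" using R'.\<xi> P by (rule R'.eval_mats)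
  have c0: "0 \<le> c" using R.matrix_norm_nonneg[OF N R.eval_mats[OF R.\<xi> P]] c by linarith
  have cK: "0 \<le> c + ?K * \<delta>" using c0 \<delta> pencil_size_nonneg[of P N "N + N"] by simp
  interpret M: star_rep "matrix_algebra A' N" "R'.Vn N" "R'.ipn N" "\<lambda>_. \<zero>\<^bsub>H'\<^esub>"
    "\<lambda>f g i. f i \<oplus>\<^bsub>H'\<^esub> g i" "\<lambda>c f i. c \<odot>\<^bsub>H'\<^esub> f i" "R'.actn N"
    unfolding matrix_algebra_def by (rule R'.star_rep_matrix)
  have "R'.mbnd N (eval_poly_mat A' \<xi>' P) (c + ?K * \<delta>)"
  proof (rule M.bndI_ip[OF _ cK])
    show "eval_poly_mat A' \<xi>' P \<in> carrier (matrix_algebra A' N)"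
      using E' unfolding matrix_algebra_def carrier_matrix_algebra_with .
    fix u v assume u: "u \<in> R'.Vn N" and v: "v \<in> R'.Vn N"
    let ?T = "R'.ipn N (R'.actn N (eval_poly_mat A' \<xi>' P) u) v"
    from R'.pencil_form_attained[OF N P deg u v]
    consider "?T = 0" | m X' U W where "1 \<le> m" "m \<le> N + N" "X' \<in> R'.Wn m"
      "R'.sqn N u = sq2 N m U" "R'.sqn N v = sq2 N m W" "?T = pencil_form P N m X' U W" by blast
    then show "cmod ?T \<le> (c + ?K * \<delta>) * sqrt (M.sq u) * sqrt (M.sq v)"
    proof cases
      case 1
      then show ?thesis using cK M.sq_nonneg[OF u] M.sq_nonneg[OF v] by simp
    next
      case 2
      obtain X where X: "X \<in> R.Wn m" and cl: "\<forall>i. \<forall>a<m. \<forall>b<m. cmod (X' i $$ (a, b) - X i $$ (a, b)) \<le> \<delta>"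
        using close[OF 2(1-3)] by blast
      let ?s = "sqrt (sq2 N m U) * sqrt (sq2 N m W)"
      have s0: "0 \<le> ?s" by simp
      have "cmod ?T \<le> cmod (pencil_form P N m X U W) + cmod (pencil_form P N m X' U W - pencil_form P N m X U W)"
        unfolding 2(6) using norm_triangle_ineq[of "pencil_form P N m X U W"] by (metis add_diff_cancel_left' add_diff_eq)
      also have "\<dots> \<le> c * ?s + pencil_size P N m * \<delta> * ?s"
        using R.pencil_form_le[OF N P deg 2(1) X c, of U W] pencil_form_diff[of m X' X \<delta> P N U W] cl \<delta>
        by (simp add: mult.assoc)
      also have "\<dots> \<le> c * ?s + ?K * \<delta> * ?s"
        using pencil_size_mono[OF 2(2)] \<delta> s0 by (intro add_left_mono mult_right_mono)
      finally show ?thesis using 2(4,5) by (simp add: algebra_simps)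
    qed
  qed
  then show ?thesis using R'.matrix_norm_le_iff[OF N E'] by blast
qed

section \<open>The Hausdorff distance of matrix ranges\<close>

text \<open>The suprema and infima are those of a conditionally complete order, hence the bounds 0
  and K. They are stated for both orders of the arguments because \<delta> is not assumed
  symmetric.\<close>

lemma hausdorff_dist_less:
  assumes ne: "E \<noteq> {}" "F \<noteq> {}"
    and bd: "\<forall>x\<in>E. \<forall>y\<in>F. 0 \<le> \<delta> x y \<and> \<delta> x y \<le> K" "\<forall>y\<in>F. \<forall>x\<in>E. 0 \<le> \<delta> y x \<and> \<delta> y x \<le> K"
    and less: "hausdorff_dist \<delta> E F < r"
  shows "x \<in> E \<Longrightarrow> \<exists>y\<in>F. \<delta> x y < r" and "y \<in> F \<Longrightarrow> \<exists>x\<in>E. \<delta> y x < r"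
proof -
  have one: "\<exists>y\<in>F'. \<delta> x y < r"
    if x: "x \<in> E'" and ne': "F' \<noteq> {}" and b: "\<And>x y. \<lbrakk>x \<in> E'; y \<in> F'\<rbrakk> \<Longrightarrow> 0 \<le> \<delta> x y \<and> \<delta> x y \<le> K"
      and l: "(SUP x\<in>E'. INF y\<in>F'. \<delta> x y) < r" for E' F' x
  proof -
    have bb: "bdd_below (\<delta> x ` F')" if "x \<in> E'" for x using b that by (intro bdd_belowI2[of _ 0]) auto
    obtain y0 where y0: "y0 \<in> F'" using ne' by blast
    have "bdd_above ((\<lambda>x. INF y\<in>F'. \<delta> x y) ` E')"
    proof (rule bdd_aboveI2)
      fix x assume x: "x \<in> E'"
      have "(INF y\<in>F'. \<delta> x y) \<le> \<delta> x y0" using bb[OF x] y0 by (rule cINF_lower)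
      then show "(INF y\<in>F'. \<delta> x y) \<le> K" using b[OF x y0] by linarith
    qed
    then have "(INF y\<in>F'. \<delta> x y) < r"
      using cSUP_upper[OF x] l by (meson order_le_less_trans)
    then show ?thesis using cINF_less_iff[OF ne' bb[OF x]] by blast
  qed
  show "x \<in> E \<Longrightarrow> \<exists>y\<in>F. \<delta> x y < r"
    using one[of x E F] ne bd less by (auto simp: hausdorff_dist_def)
  show "y \<in> F \<Longrightarrow> \<exists>x\<in>E. \<delta> y x < r"
    using one[of y F E] ne bd less by (auto simp: hausdorff_dist_def)
qed

lemma hausdorff_dist_le:
  assumes ne: "E \<noteq> {}" "F \<noteq> {}"
    and nn: "\<And>x y. \<lbrakk>x \<in> E; y \<in> F\<rbrakk> \<Longrightarrow> 0 \<le> \<delta> x y \<and> 0 \<le> \<delta> y x"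
    and le: "\<And>x. x \<in> E \<Longrightarrow> \<exists>y\<in>F. \<delta> x y \<le> r" "\<And>y. y \<in> F \<Longrightarrow> \<exists>x\<in>E. \<delta> y x \<le> r"
  shows "\<bar>hausdorff_dist \<delta> E F\<bar> \<le> r"
proof -
  have one: "(SUP x\<in>E'. INF y\<in>F'. \<delta> x y) \<le> r \<and> 0 \<le> (SUP x\<in>E'. INF y\<in>F'. \<delta> x y)"
    if ne': "E' \<noteq> {}" "F' \<noteq> {}" and n: "\<And>x y. \<lbrakk>x \<in> E'; y \<in> F'\<rbrakk> \<Longrightarrow> 0 \<le> \<delta> x y"
      and l: "\<And>x. x \<in> E' \<Longrightarrow> \<exists>y\<in>F'. \<delta> x y \<le> r" for E' F'
  proof -
    have i: "(INF y\<in>F'. \<delta> x y) \<le> r" if x: "x \<in> E'" for x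
    proof -
      obtain y where y: "y \<in> F'" "\<delta> x y \<le> r" using l x by blast
      have "bdd_below (\<delta> x ` F')" using n x by (intro bdd_belowI2[of _ 0]) auto
      then show ?thesis using y by (rule cINF_lower2)
    qed
    obtain x0 where x0: "x0 \<in> E'" using ne' by blast
    have "0 \<le> (INF y\<in>F'. \<delta> x0 y)" using ne' n x0 by (intro cINF_greatest) auto
    also have "\<dots> \<le> (SUP x\<in>E'. INF y\<in>F'. \<delta> x y)"
      using i x0 by (intro cSUP_upper bdd_aboveI2[of _ _ r])
    finally show ?thesis using ne' i by (auto intro: cSUP_least)
  qed
  show ?thesis
    using one[of E F] one[of F E] assms unfolding hausdorff_dist_def by (auto simp: max_def)
qed

context
  fixes n :: nat assumes n: "n \<ge> 1"
begin

interpretation M: cstar_rep "complex_matrices n" "cvec n" "cip n" "\<lambda>_. 0" "\<lambda>f g i. f i + g i"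
  "\<lambda>c f i. c * f i" "cact n"
  by (rule cm_rep[OF n])

lemma cm_finsum_entry:
  assumes "finite I" "\<And>i. i \<in> I \<Longrightarrow> f i \<in> cmats n" "a < n" "b < n"
  shows "(\<Oplus>\<^bsub>complex_matrices n\<^esub>i\<in>I. f i) $$ (a, b) = (\<Sum>i\<in>I. f i $$ (a, b))"
  using assms(1,2)
proof (induction I rule: finite_induct)
  case empty
  show ?case unfolding M.finsum_empty using assms(3,4) by (simp add: matrix_algebra_def)
next
  case (insert i I)
  then have "(\<Oplus>\<^bsub>complex_matrices n\<^esub>i\<in>insert i I. f i) = f i \<oplus>\<^bsub>complex_matrices n\<^esub> (\<Oplus>\<^bsub>complex_matrices n\<^esub>i\<in>I. f i)"
    by (intro M.finsum_insert) auto
  then show ?case using insert assms(3,4) by (simp add: cm_simps)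
qed

lemma tuple_norm_square:
  fixes D :: "'d::finite \<Rightarrow> complex mat"
  assumes D: "\<And>i. D i \<in> cmats n"
  defines "S \<equiv> (\<Oplus>\<^bsub>complex_matrices n\<^esub>i\<in>UNIV. D i \<otimes>\<^bsub>complex_matrices n\<^esub> star (complex_matrices n) (D i))"
  shows "S \<in> cmats n" and "tuple_norm (complex_matrices n) D = sqrt (matrix_norm complex_cstar n S)"
    and "\<lbrakk>a < n; b < n\<rbrakk> \<Longrightarrow> S $$ (a, b) = (\<Sum>i\<in>UNIV. \<Sum>k<n. D i $$ (a, k) * cnj (D i $$ (b, k)))"
proof -
  have cl: "D i \<otimes>\<^bsub>complex_matrices n\<^esub> star (complex_matrices n) (D i) \<in> cmats n" for i
    by (simp add: cm_simps mats_mat)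
  show "S \<in> cmats n"
    using M.finsum_closed[of "\<lambda>i. D i \<otimes>\<^bsub>complex_matrices n\<^esub> star (complex_matrices n) (D i)" UNIV] cl
    by (simp add: S_def Pi_def)
  show "tuple_norm (complex_matrices n) D = sqrt (matrix_norm complex_cstar n S)"
    by (simp add: tuple_norm_def S_def matrix_algebra_def)
  show "S $$ (a, b) = (\<Sum>i\<in>UNIV. \<Sum>k<n. D i $$ (a, k) * cnj (D i $$ (b, k)))" if "a < n" "b < n"
    unfolding S_def using cl that by (subst cm_finsum_entry) (auto simp: cm_simps intro!: sum.cong)
qed

text \<open>The diagonal entry at a of the sum of D_i D_i^* is the sum of the squared moduli of the
  a-th rows of all D_i.\<close>

lemma entry_le_tuple_norm:
  fixes D :: "'d::finite \<Rightarrow> complex mat"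
  assumes D: "\<And>i. D i \<in> cmats n" and ab: "a < n" "b < n"
  shows "cmod (D i $$ (a, b)) \<le> tuple_norm (complex_matrices n) D"
proof -
  define S where "S = (\<Oplus>\<^bsub>complex_matrices n\<^esub>i\<in>UNIV. D i \<otimes>\<^bsub>complex_matrices n\<^esub> star (complex_matrices n) (D i))"
  have S: "S \<in> cmats n" "tuple_norm (complex_matrices n) D = sqrt (matrix_norm complex_cstar n S)"
    and Saa: "S $$ (a, a) = (\<Sum>i\<in>UNIV. \<Sum>k<n. D i $$ (a, k) * cnj (D i $$ (a, k)))"
    using tuple_norm_square[of D, OF D, folded S_def] ab by auto
  have Saa': "S $$ (a, a) = complex_of_real (\<Sum>i\<in>UNIV. \<Sum>k<n. (cmod (D i $$ (a, k)))\<^sup>2)"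
    unfolding Saa complex_norm_square[symmetric] by simp
  have "(cmod (D i $$ (a, b)))\<^sup>2 \<le> (\<Sum>k<n. (cmod (D i $$ (a, k)))\<^sup>2)"
    using ab by (intro member_le_sum[of b "{..<n}" "\<lambda>k. (cmod (D i $$ (a, k)))\<^sup>2"]) auto
  also have "\<dots> \<le> (\<Sum>i\<in>UNIV. \<Sum>k<n. (cmod (D i $$ (a, k)))\<^sup>2)"
    by (intro member_le_sum[of i UNIV "\<lambda>i. \<Sum>k<n. (cmod (D i $$ (a, k)))\<^sup>2"]) (auto intro: sum_nonneg)
  also have "\<dots> \<le> cmod (S $$ (a, a))"
    unfolding Saa' norm_of_real by simp
  also have "\<dots> \<le> matrix_norm complex_cstar n S"
    using cc.matrix_norm_entry[OF n _ ab(1) ab(1), of S] S(1) by simp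
  finally show ?thesis unfolding S(2) by (rule real_le_rsqrt)
qed

lemma tuple_norm_le:
  fixes D :: "'d::finite \<Rightarrow> complex mat"
  assumes D: "\<And>i. D i \<in> cmats n" and e: "0 \<le> e"
    and le: "\<And>i a b. \<lbrakk>a < n; b < n\<rbrakk> \<Longrightarrow> cmod (D i $$ (a, b)) \<le> e"
  shows "tuple_norm (complex_matrices n) D \<le> sqrt (real (n * n * card (UNIV :: 'd set) * n)) * e"
proof -
  define S where "S = (\<Oplus>\<^bsub>complex_matrices n\<^esub>i\<in>UNIV. D i \<otimes>\<^bsub>complex_matrices n\<^esub> star (complex_matrices n) (D i))"
  have S: "S \<in> cmats n" "tuple_norm (complex_matrices n) D = sqrt (matrix_norm complex_cstar n S)"
    and Sab: "\<And>a b. \<lbrakk>a < n; b < n\<rbrakk> \<Longrightarrow> S $$ (a, b) = (\<Sum>i\<in>UNIV. \<Sum>k<n. D i $$ (a, k) * cnj (D i $$ (b, k)))"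
    using tuple_norm_square[of D, OF D, folded S_def] by auto
  have "cmod (S $$ (a, b)) \<le> real (card (UNIV :: 'd set) * n) * e\<^sup>2" if ab: "a < n" "b < n" for a b
  proof -
    have "cmod (S $$ (a, b)) \<le> (\<Sum>i\<in>(UNIV :: 'd set). \<Sum>k<n. e * e)"
      unfolding Sab[OF ab] using le ab e
      by (intro sum_norm_le) (auto simp: norm_mult intro!: mult_mono)
    then show ?thesis by (simp add: power2_eq_square mult_ac)
  qed
  then have "matrix_norm complex_cstar n S \<le> (\<Sum>a<n. \<Sum>b<n. real (card (UNIV :: 'd set) * n) * e\<^sup>2)"
    using S(1) by (intro cc.matrix_norm_sum[OF n]) auto
  also have "\<dots> = real (n * n * card (UNIV :: 'd set) * n) * e\<^sup>2" by simp
  finally have "sqrt (matrix_norm complex_cstar n S) \<le> sqrt (real (n * n * card (UNIV :: 'd set) * n) * e\<^sup>2)" by simp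
  then show ?thesis unfolding S(2) using e by (simp only: real_sqrt_mult real_sqrt_abs abs_of_nonneg)
qed

lemma cm_minus_entry:
  "\<lbrakk>X \<in> cmats n; Y \<in> cmats n; a < n; b < n\<rbrakk> \<Longrightarrow> (X \<ominus>\<^bsub>complex_matrices n\<^esub> Y) $$ (a, b) = X $$ (a, b) - Y $$ (a, b)"
  using M.minus_rep[of X Y] by (simp add: cm_simps)

text \<open>The distance is equivalent to the maximal distance of entries, with constants depending
  on n and d. All approximation of matrix ranges below is therefore entrywise.\<close>

lemma tuple_dist_bounds:
  fixes X Y :: "'d::finite \<Rightarrow> complex mat"
  assumes X: "\<forall>i. X i \<in> cmats n" and Y: "\<forall>i. Y i \<in> cmats n"
  shows "0 \<le> tuple_dist (complex_matrices n) X Y"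
    and "\<lbrakk>a < n; b < n\<rbrakk> \<Longrightarrow> cmod (X i $$ (a, b) - Y i $$ (a, b)) \<le> tuple_dist (complex_matrices n) X Y"
    and "\<lbrakk>0 \<le> e; \<And>i a b. \<lbrakk>a < n; b < n\<rbrakk> \<Longrightarrow> cmod (X i $$ (a, b) - Y i $$ (a, b)) \<le> e\<rbrakk>
      \<Longrightarrow> tuple_dist (complex_matrices n) X Y \<le> sqrt (real (n * n * card (UNIV :: 'd set) * n)) * e"
proof -
  let ?D = "\<lambda>i. X i \<ominus>\<^bsub>complex_matrices n\<^esub> Y i"
  have D: "?D i \<in> cmats n" for i using M.minus_closed[of "X i" "Y i"] X Y by simp
  show *: "cmod (X i $$ (a, b) - Y i $$ (a, b)) \<le> tuple_dist (complex_matrices n) X Y"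
    if "a < n" "b < n" for i a b
    using entry_le_tuple_norm[of ?D, OF D that, of i] cm_minus_entry[OF _ _ that, of "X i" "Y i"] X Y
    by (simp add: tuple_dist_def)
  show "0 \<le> tuple_dist (complex_matrices n) X Y"
    by (rule order.trans[OF norm_ge_zero *[of 0 0 undefined]]) (use n in auto)
  show "tuple_dist (complex_matrices n) X Y \<le> sqrt (real (n * n * card (UNIV :: 'd set) * n)) * e"
    if "0 \<le> e" "\<And>i a b. \<lbrakk>a < n; b < n\<rbrakk> \<Longrightarrow> cmod (X i $$ (a, b) - Y i $$ (a, b)) \<le> e"
    unfolding tuple_dist_def
    using that(2) X Y by (intro tuple_norm_le[of ?D, OF D that(1)]) (simp add: cm_minus_entry)
qed

end

lemma matrix_ranges_bounded:
  fixes \<xi> :: "'d::finite \<Rightarrow> 'a" and \<xi>' :: "'d \<Rightarrow> 'b"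
  assumes r: "rep_tuple A \<xi> H \<pi>" and r': "rep_tuple A' \<xi>' H' \<pi>'" and n: "n \<ge> 1"
  shows "\<exists>K. \<forall>X \<in> matrix_range H n (\<lambda>i. \<pi> (\<xi> i)). \<forall>Y \<in> matrix_range H' n (\<lambda>i. \<pi>' (\<xi>' i)).
    0 \<le> tuple_dist (complex_matrices n) X Y \<and> tuple_dist (complex_matrices n) X Y \<le> K"
proof -
  interpret R: rep_tuple A \<xi> H \<pi> by (rule r)
  interpret R': rep_tuple A' \<xi>' H' \<pi>' by (rule r')
  define e where "e = (\<Sum>i\<in>UNIV. anorm A (\<xi> i)) + (\<Sum>i\<in>UNIV. anorm A' (\<xi>' i))"
  have a: "0 \<le> anorm A (\<xi> i)" and a': "0 \<le> anorm A' (\<xi>' i)" for i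
    using R.\<xi> R'.\<xi> R.anorm_nonneg R'.anorm_nonneg by blast+
  have e: "anorm A (\<xi> i) + anorm A' (\<xi>' i) \<le> e" for i
    unfolding e_def using a a' by (intro add_mono member_le_sum) auto
  have e0: "0 \<le> e" unfolding e_def using a a' by (intro add_nonneg_nonneg sum_nonneg)
  have "0 \<le> tuple_dist (complex_matrices n) X Y
      \<and> tuple_dist (complex_matrices n) X Y \<le> sqrt (real (n * n * card (UNIV :: 'd set) * n)) * e"
    if X: "X \<in> R.Wn n" and Y: "Y \<in> R'.Wn n" for X Y
  proof -
    have m: "\<forall>i. X i \<in> cmats n" "\<forall>i. Y i \<in> cmats n"
      using R.Wn_mats[OF n X] R'.Wn_mats[OF n Y] by blast+
    have "cmod (X i $$ (a, b) - Y i $$ (a, b)) \<le> e" if "a < n" "b < n" for i a b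
      using norm_triangle_ineq4[of "X i $$ (a, b)" "Y i $$ (a, b)"] R.Wn_entry_le[OF n X that, of i]
        R'.Wn_entry_le[OF n Y that, of i] e[of i] by linarith
    then show ?thesis using tuple_dist_bounds[OF n m] e0 by blast
  qed
  then show ?thesis by blast
qed

context rep_family
begin

abbreviation "W t n \<equiv> matrix_range (H t) n (\<lambda>i. \<pi> t (\<xi> t i))"

lemma matrix_ranges_close:
  assumes n: "n \<ge> 1" and h: "hausdorff_dist (tuple_dist (complex_matrices n)) (W t n) (W t' n) < \<delta>"
  shows "X \<in> W t n \<Longrightarrow> \<exists>Y\<in>W t' n. \<forall>i. \<forall>a<n. \<forall>b<n. cmod (X i $$ (a, b) - Y i $$ (a, b)) \<le> \<delta>"
    and "Y \<in> W t' n \<Longrightarrow> \<exists>X\<in>W t n. \<forall>i. \<forall>a<n. \<forall>b<n. cmod (Y i $$ (a, b) - X i $$ (a, b)) \<le> \<delta>"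
proof -
  let ?d = "tuple_dist (complex_matrices n)"
  obtain K where K: "\<forall>X\<in>W t n. \<forall>Y\<in>W t' n. 0 \<le> ?d X Y \<and> ?d X Y \<le> K"
    using matrix_ranges_bounded[OF rep rep n] by blast
  obtain K' where K': "\<forall>Y\<in>W t' n. \<forall>X\<in>W t n. 0 \<le> ?d Y X \<and> ?d Y X \<le> K'"
    using matrix_ranges_bounded[OF rep rep n] by blast
  let ?M = "max K K'"
  have K1: "\<forall>X\<in>W t n. \<forall>Y\<in>W t' n. 0 \<le> ?d X Y \<and> ?d X Y \<le> ?M"
    "\<forall>Y\<in>W t' n. \<forall>X\<in>W t n. 0 \<le> ?d Y X \<and> ?d Y X \<le> ?M"
    using K K' by (auto simp: le_max_iff_disj)
  note hd = hausdorff_dist_less[OF S.Wn_nonempty[OF n] S.Wn_nonempty[OF n] K1 h]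
  have m: "\<forall>i. X i \<in> cmats n" if "X \<in> W s n" for X s
    using S.Wn_mats[OF n that] by blast
  have entries: "\<forall>i. \<forall>a<n. \<forall>b<n. cmod (X i $$ (a, b) - Y i $$ (a, b)) \<le> \<delta>"
    if "?d X Y < \<delta>" "X \<in> W s n" "Y \<in> W s' n" for X Y s s'
    using tuple_dist_bounds(2)[OF n m[OF that(2)] m[OF that(3)]] that(1) by (meson less_imp_le order_trans)
  show "\<exists>Y\<in>W t' n. \<forall>i. \<forall>a<n. \<forall>b<n. cmod (X i $$ (a, b) - Y i $$ (a, b)) \<le> \<delta>" if X: "X \<in> W t n"
    using hd(1)[OF X] entries X by blast
  show "\<exists>X\<in>W t n. \<forall>i. \<forall>a<n. \<forall>b<n. cmod (Y i $$ (a, b) - X i $$ (a, b)) \<le> \<delta>" if Y: "Y \<in> W t' n"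
    using hd(2)[OF Y] entries Y by blast
qed

lemma linear_norms_if_ranges:
  assumes conv: "matrix_ranges_converge H (\<lambda>t i. \<pi> t (\<xi> t i)) t0"
  shows "linear_matrix_poly_norms_converge A \<xi> t0"
  unfolding linear_matrix_poly_norms_converge_def
proof (intro allI impI, elim conjE)
  fix N :: nat and P :: "'d star_poly mat"
  assume N: "N \<ge> 1" and P: "P \<in> carrier_mat N N" and deg: "\<forall>q\<in>elements_mat P. degree_le_one q"
  let ?f = "\<lambda>t. matrix_norm (A t) N (eval_poly_mat (A t) (\<xi> t) P)"
  let ?K = "pencil_size P N (N + N)"
  show "(?f \<longlongrightarrow> ?f t0) (at t0)"
  proof (rule tendstoI)
    fix e :: real assume e: "e > 0"
    \<comment> \<open>Adding 1 covers the case that the pencil has size 0 and makes the final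
      inequality strict.\<close>
    define \<delta> where "\<delta> = e / (?K + 1)"
    have K: "0 \<le> ?K" by (rule pencil_size_nonneg)
    have \<delta>: "\<delta> > 0" using e K by (simp add: \<delta>_def)
    have K\<delta>: "?K * \<delta> < e" using e K by (simp add: \<delta>_def field_simps)
    have "\<forall>\<^sub>F t in at t0. \<forall>m\<in>{1..N + N}. hausdorff_dist (tuple_dist (complex_matrices m)) (W t m) (W t0 m) < \<delta>"
    proof (intro eventually_ball_finite ballI)
      fix m assume "m \<in> {1..N + N}"
      then have "((\<lambda>t. hausdorff_dist (tuple_dist (complex_matrices m)) (W t m) (W t0 m)) \<longlongrightarrow> 0) (at t0)"
        using conv by (simp add: matrix_ranges_converge_def)
      then show "\<forall>\<^sub>F t in at t0. hausdorff_dist (tuple_dist (complex_matrices m)) (W t m) (W t0 m) < \<delta>"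
        using \<delta> by (rule order_tendstoD)
    qed simp
    then show "\<forall>\<^sub>F t in at t0. dist (?f t) (?f t0) < e"
    proof (rule eventually_mono)
      fix t assume h: "\<forall>m\<in>{1..N + N}. hausdorff_dist (tuple_dist (complex_matrices m)) (W t m) (W t0 m) < \<delta>"
      have "?f t \<le> ?f t0 + ?K * \<delta>"
      proof (rule matrix_norm_le_of_ranges[OF rep rep N P deg order_refl])
        show "0 \<le> \<delta>" using \<delta> by simp
        fix m X assume "1 \<le> m" "m \<le> N + N" "X \<in> W t m"
        then show "\<exists>Y\<in>W t0 m. \<forall>i. \<forall>a<m. \<forall>b<m. cmod (X i $$ (a, b) - Y i $$ (a, b)) \<le> \<delta>"
          using h by (intro matrix_ranges_close(1)) auto
      qed
      moreover have "?f t0 \<le> ?f t + ?K * \<delta>"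
      proof (rule matrix_norm_le_of_ranges[OF rep rep N P deg order_refl])
        show "0 \<le> \<delta>" using \<delta> by simp
        fix m X assume "1 \<le> m" "m \<le> N + N" "X \<in> W t0 m"
        then show "\<exists>Y\<in>W t m. \<forall>i. \<forall>a<m. \<forall>b<m. cmod (X i $$ (a, b) - Y i $$ (a, b)) \<le> \<delta>"
          using h by (intro matrix_ranges_close(2)) auto
      qed
      ultimately show "dist (?f t) (?f t0) < e" using K\<delta> by (simp add: dist_real_def)
    qed
  qed
qed

end

section \<open>Separation from the cone of moments\<close>

text \<open>For c0 the point of the cone nearest to x, the vector F = x - c0 would be orthogonal to
  c0 and nonpositive on the cone. Here c0 is only a near-minimizer, with error \<sigma>^2 in the
  squared distance. The error in the inequality at c then grows with the length of c, which is why
  only elements with \<open>sq c \<le> K\<close> are covered.\<close>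

lemma (in ip_space) cone_separation:
  assumes C: "C \<subseteq> V" and zero: "vzero \<in> C"
    and add: "\<And>c d. \<lbrakk>c \<in> C; d \<in> C\<rbrakk> \<Longrightarrow> vadd c d \<in> C"
    and scale: "\<And>s c. \<lbrakk>0 \<le> s; c \<in> C\<rbrakk> \<Longrightarrow> vscale (complex_of_real s) c \<in> C"
    and x: "x \<in> V" and far: "\<And>c. c \<in> C \<Longrightarrow> \<delta> \<le> sq (vadd x (vscale (-1) c))"
    and \<eta>: "0 < \<eta>" and K: "0 \<le> K"
  shows "\<exists>F\<in>V. sq F \<le> sq x + 1 \<and> (\<forall>c\<in>C. sq c \<le> K \<longrightarrow> Re (ip F c) \<le> \<eta>) \<and> \<delta> - \<eta> \<le> Re (ip F x)"
proof -
  let ?d = "\<lambda>c. vadd x (vscale (-1) c)"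
  define M where "M = 1 + K + 4 * (sq x + 1)"
  have sx: "0 \<le> sq x" using x by simp
  have M: "M \<ge> 1" using K sx by (simp add: M_def)
  define \<sigma> where "\<sigma> = min 1 (\<eta> / M)"
  have \<sigma>: "0 < \<sigma>" "\<sigma> \<le> 1" "\<sigma> * M \<le> \<eta>"
    using \<eta> M by (auto simp: \<sigma>_def min_def field_simps)
  define m where "m = Inf ((\<lambda>c. sq (?d c)) ` C)"
  have d_closed: "?d c \<in> V" if "c \<in> C" for c using that C x by auto
  have bdd: "bdd_below ((\<lambda>c. sq (?d c)) ` C)"
    using d_closed by (intro bdd_belowI2[of _ 0]) auto
  have m_le: "m \<le> sq (?d c)" if "c \<in> C" for c
    unfolding m_def using bdd that by (intro cINF_lower)
  have m\<delta>: "\<delta> \<le> m" unfolding m_def using zero far by (intro cINF_greatest) auto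
  have "sq (?d vzero) = sq x" using x by (simp add: sq_vadd)
  then have mx: "m \<le> sq x" using m_le[OF zero] by simp
  have "\<exists>c\<in>C. sq (?d c) < m + \<sigma>\<^sup>2"
    using cINF_less_iff[OF _ bdd, of "m + \<sigma>\<^sup>2"] zero \<sigma> unfolding m_def by auto
  then obtain c0 where c0: "c0 \<in> C" and near: "sq (?d c0) < m + \<sigma>\<^sup>2" by blast
  have c0V: "c0 \<in> V" using c0 C by blast
  define F where "F = ?d c0"
  have F: "F \<in> V" using d_closed[OF c0] by (simp add: F_def)
  have \<sigma>2: "\<sigma>\<^sup>2 \<le> 1" using \<sigma> by (simp add: power_le_one)
  have sqF: "sq F \<le> sq x + 1" using near mx \<sigma>2 by (simp add: F_def)
  have half: "b \<le> \<sigma> / 2 * (1 + k)" if "2 * \<sigma> * b \<le> \<sigma>\<^sup>2 + \<sigma>\<^sup>2 * k" for b k :: real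
  proof -
    have "\<sigma> * (2 * b) \<le> \<sigma> * (\<sigma> * (1 + k))" using that by (simp add: power2_eq_square algebra_simps)
    then have "2 * b \<le> \<sigma> * (1 + k)" using \<sigma> by simp
    then show ?thesis by simp
  qed
  have le: "\<sigma> / 2 * (1 + k) \<le> \<eta>" if "k \<le> M - 1" "0 \<le> k" for k
  proof -
    have "\<sigma> / 2 * (1 + k) \<le> \<sigma> * M" using that \<sigma> M by (intro mult_mono) auto
    then show ?thesis using \<sigma> by linarith
  qed
  have cone: "Re (ip F c) \<le> \<eta>" if c: "c \<in> C" "sq c \<le> K" for c
  proof -
    have cV: "c \<in> V" using c C by blast
    \<comment> \<open>Comparison of c0 with the competitor c0 + \<sigma> c.\<close>
    have "m \<le> sq (?d (vadd c0 (vscale (complex_of_real \<sigma>) c)))"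
      using c c0 \<sigma> by (intro m_le add scale) auto
    also have "\<dots> = sq F - 2 * \<sigma> * Re (ip F c) + \<sigma>\<^sup>2 * sq c"
    proof -
      have "sq (?d (vadd c0 (vscale (complex_of_real \<sigma>) c))) = sq (vadd F (vscale (complex_of_real (- \<sigma>)) c))"
        using x c0V cV by (simp add: sq_def F_def algebra_simps)
      also have "\<dots> = sq F - 2 * \<sigma> * Re (ip F c) + \<sigma>\<^sup>2 * sq c"
        using F cV by (simp add: sq_vadd)
      finally show ?thesis .
    qed
    finally have "2 * \<sigma> * Re (ip F c) \<le> \<sigma>\<^sup>2 + \<sigma>\<^sup>2 * sq c" using near by (simp add: F_def)
    then have "Re (ip F c) \<le> \<sigma> / 2 * (1 + sq c)" by (rule half)
    also have "\<dots> \<le> \<eta>" using c cV sx by (intro le) (auto simp: M_def)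
    finally show ?thesis .
  qed
  \<comment> \<open>Comparison of c0 with the competitor (1 - \<sigma>) c0, which is in the cone
    because \<sigma> \<le> 1; it replaces orthogonality of F and c0.\<close>
  have "- Re (ip F c0) \<le> \<sigma> / 2 * (1 + sq c0)"
  proof (rule half)
    have "m \<le> sq (?d (vscale (complex_of_real (1 - \<sigma>)) c0))"
      using c0 \<sigma> by (intro m_le scale) auto
    also have "\<dots> = sq (vadd F (vscale (complex_of_real \<sigma>) c0))"
      using x c0V by (simp add: sq_def F_def algebra_simps)
    also have "\<dots> = sq F + 2 * \<sigma> * Re (ip F c0) + \<sigma>\<^sup>2 * sq c0"
      using F c0V by (simp add: sq_vadd)
    finally show "2 * \<sigma> * - Re (ip F c0) \<le> \<sigma>\<^sup>2 + \<sigma>\<^sup>2 * sq c0" using near by (simp add: F_def)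
  qed
  also have "\<dots> \<le> \<eta>"
  proof (rule le)
    have eq: "sq c0 = sq x - 2 * Re (ip x F) + sq F"
      using x c0V ip_commute[OF x c0V] by (simp add: F_def sq_vadd) (simp add: sq_def)
    have "0 \<le> sq (vadd x F)" using x F by simp
    then have "- 2 * Re (ip x F) \<le> sq x + sq F" using x F by (simp add: sq_vadd)
    then have "sq c0 \<le> 2 * sq x + 2 * sq F" using eq by simp
    then show "sq c0 \<le> M - 1" using sqF sx K by (simp add: M_def)
  qed (use c0V in simp)
  finally have low: "- Re (ip F c0) \<le> \<eta>" .
  have "Re (ip F x) = sq F + Re (ip F c0)"
    using x c0V ip_commute[OF x c0V] by (simp add: F_def sq_vadd) (simp add: sq_def)
  moreover have "\<delta> \<le> sq F" using far[OF c0] by (simp add: F_def)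
  ultimately have "\<delta> - \<eta> \<le> Re (ip F x)" using low by linarith
  then show ?thesis using F sqF cone by blast
qed

lemma finite_complex_net:
  assumes e: "0 < e"
  obtains S :: "complex set" where "finite S" "\<And>z. cmod z \<le> R \<Longrightarrow> \<exists>g\<in>S. cmod (z - g) < e"
proof -
  \<comment> \<open>Rounding down errs by at most s in each coordinate, so the modulus errs by at
    most 2 s < e.\<close>
  define s where "s = e / 3"
  have s: "s > 0" using e by (simp add: s_def)
  define m where "m = \<lceil>R / s\<rceil> + 1"
  define S where "S = (\<lambda>(k, l). Complex (s * real_of_int k) (s * real_of_int l)) ` ({- m..m} \<times> {- m..m})"
  have fl: "\<lfloor>x / s\<rfloor> \<in> {- m..m} \<and> \<bar>x - s * real_of_int \<lfloor>x / s\<rfloor>\<bar> \<le> s" if x: "\<bar>x\<bar> \<le> R" for x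
  proof -
    have "\<bar>x / s\<bar> \<le> R / s" using x s by (simp add: divide_right_mono)
    then have "\<bar>x / s\<bar> \<le> real_of_int \<lceil>R / s\<rceil>" using le_of_int_ceiling order_trans by blast
    then have "\<lfloor>x / s\<rfloor> \<le> \<lceil>R / s\<rceil>" "- \<lceil>R / s\<rceil> - 1 \<le> \<lfloor>x / s\<rfloor>" by linarith+
    moreover have eq: "s * (x / s) = x" using s by simp
    have "s * real_of_int \<lfloor>x / s\<rfloor> \<le> s * (x / s)"
      using s by (intro mult_left_mono) auto
    moreover have "s * (x / s) < s * (real_of_int \<lfloor>x / s\<rfloor> + 1)"
      using s by (intro mult_strict_left_mono) linarith+
    ultimately show ?thesis unfolding eq by (auto simp: m_def distrib_left)
  qed
  show ?thesis
  proof (rule that[of S])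
    show "finite S" by (simp add: S_def)
    fix z assume z: "cmod z \<le> R"
    define g where "g = Complex (s * real_of_int \<lfloor>Re z / s\<rfloor>) (s * real_of_int \<lfloor>Im z / s\<rfloor>)"
    have re: "\<bar>Re z\<bar> \<le> R" and im: "\<bar>Im z\<bar> \<le> R"
      using z abs_Re_le_cmod[of z] abs_Im_le_cmod[of z] by linarith+
    have "g \<in> S"
      unfolding S_def g_def
      by (rule image_eqI[of _ _ "(\<lfloor>Re z / s\<rfloor>, \<lfloor>Im z / s\<rfloor>)"]) (use fl[OF re] fl[OF im] in auto)
    moreover have "cmod (z - g) \<le> \<bar>Re (z - g)\<bar> + \<bar>Im (z - g)\<bar>" by (rule cmod_le)
    then have "cmod (z - g) \<le> 2 * s" using fl[OF re] fl[OF im] by (simp add: g_def)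
    then have "cmod (z - g) < e" using s by (simp add: s_def)
    ultimately show "\<exists>g\<in>S. cmod (z - g) < e" by blast
  qed
qed

lemma finite_function_net:
  assumes I: "finite I" and e: "0 < e"
  obtains S :: "('i \<Rightarrow> complex) set" where "finite S"
    "\<And>F. (\<And>i. i \<in> I \<Longrightarrow> cmod (F i) \<le> R) \<Longrightarrow> \<exists>G\<in>S. \<forall>i\<in>I. cmod (F i - G i) < e"
proof -
  obtain S where S: "finite S" "\<And>z. cmod z \<le> R \<Longrightarrow> \<exists>g\<in>S. cmod (z - g) < e"
    using finite_complex_net[OF e] by blast
  show ?thesis
  proof (rule that[of "I \<rightarrow>\<^sub>E S"])
    show "finite (I \<rightarrow>\<^sub>E S)" using I S(1) by (simp add: finite_PiE)
    fix F :: "'i \<Rightarrow> complex" assume F: "\<And>i. i \<in> I \<Longrightarrow> cmod (F i) \<le> R"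
    then have "\<forall>i\<in>I. \<exists>g\<in>S. cmod (F i - g) < e" using S(2) by blast
    then obtain g where g: "\<forall>i\<in>I. g i \<in> S \<and> cmod (F i - g i) < e" by metis
    then show "\<exists>G\<in>I \<rightarrow>\<^sub>E S. \<forall>i\<in>I. cmod (F i - G i) < e"
      by (intro bexI[of _ "restrict g I"]) auto
  qed
qed

text \<open>Index \<open>None\<close> stands for the unit and \<open>Some i\<close> for z_i. The
  type serves for points (1, X), for moments and, through the real part of \<open>fip n\<close>, for
  functionals on them; \<open>fip n\<close> reads only entries below n.\<close>

type_synonym 'd dual = "'d option \<Rightarrow> nat \<Rightarrow> nat \<Rightarrow> complex"

definition fip :: "nat \<Rightarrow> 'd::finite dual \<Rightarrow> 'd dual \<Rightarrow> complex" where
  "fip n F G = (\<Sum>i\<in>UNIV. \<Sum>a<n. \<Sum>b<n. F i a b * cnj (G i a b))"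

definition fsq :: "nat \<Rightarrow> 'd::finite dual \<Rightarrow> real" where
  "fsq n F = (\<Sum>i\<in>UNIV. \<Sum>a<n. \<Sum>b<n. (cmod (F i a b))\<^sup>2)"

lemma fip_space: "ip_space UNIV (fip n) (\<lambda>_ _ _. 0) (\<lambda>F G i a b. F i a b + G i a b) (\<lambda>c F i a b. c * F i a b)"
proof
  fix F :: "'d::finite dual"
  have "fip n F F = complex_of_real (fsq n F)"
    unfolding fip_def complex_norm_square[symmetric] fsq_def by simp
  then show "0 \<le> Re (fip n F F)" by (simp add: fsq_def sum_nonneg)
next
  fix F G :: "'d::finite dual"
  show "fip n G F = cnj (fip n F G)" by (simp add: fip_def mult.commute)
qed (auto simp: fip_def sum.distrib sum_distrib_left distrib_right mult.assoc)

lemma fsq_eq: "ip_space.sq (fip n) F = fsq n F"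
proof -
  have "fip n F F = complex_of_real (fsq n F)"
    unfolding fip_def complex_norm_square[symmetric] fsq_def by simp
  then show ?thesis by (simp add: ip_space.sq_def[OF fip_space])
qed

lemma cmod_le_fsq:
  assumes "a < n" "b < n"
  shows "(cmod (F i a b))\<^sup>2 \<le> fsq n F"
proof -
  have "(cmod (F i a b))\<^sup>2 \<le> (\<Sum>b<n. (cmod (F i a b))\<^sup>2)"
    using assms by (intro member_le_sum[of b "{..<n}" "\<lambda>b. (cmod (F i a b))\<^sup>2"]) auto
  also have "\<dots> \<le> (\<Sum>a<n. \<Sum>b<n. (cmod (F i a b))\<^sup>2)"
    using assms by (intro member_le_sum[of a "{..<n}" "\<lambda>a. \<Sum>b<n. (cmod (F i a b))\<^sup>2"]) (auto intro: sum_nonneg)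
  also have "\<dots> \<le> fsq n F"
    unfolding fsq_def
    by (intro member_le_sum[of i UNIV "\<lambda>i. \<Sum>a<n. \<Sum>b<n. (cmod (F i a b))\<^sup>2"]) (auto intro!: sum_nonneg)
  finally show ?thesis .
qed

lemma fsq_le:
  fixes F :: "'d::finite dual"
  assumes "\<And>i a b. \<lbrakk>a < n; b < n\<rbrakk> \<Longrightarrow> cmod (F i a b) \<le> K"
  shows "fsq n F \<le> real (card (UNIV :: 'd option set) * n * n) * K\<^sup>2"
proof -
  have "fsq n F \<le> (\<Sum>i\<in>(UNIV :: 'd option set). \<Sum>a<n. \<Sum>b<n. K\<^sup>2)"
    unfolding fsq_def using assms by (intro sum_mono power_mono) auto
  then show ?thesis by simp
qed

definition point :: "('d \<Rightarrow> complex mat) \<Rightarrow> 'd dual" where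
  "point X i a b = (case i of None \<Rightarrow> if a = b then 1 else 0 | Some j \<Rightarrow> X j $$ (a, b))"

text \<open>The self-adjoint pencil \<open>r + Re (\<Sum>\<^sub>i cnj F\<^sub>i \<otimes> z\<^sub>i)\<close>, with entrywise conjugates and with \<open>z\<^sub>0 = 1\<close> for the
  index \<^const>\<open>None\<close>.\<close>

definition dual_pencil :: "nat \<Rightarrow> real \<Rightarrow> 'd::finite dual \<Rightarrow> 'd star_poly mat" where
  "dual_pencil n r F = mat n n (\<lambda>(a, b).
     Poly_Mapping.single [] ((if a = b then complex_of_real r else 0) + (cnj (F None a b) + F None b a) / 2)
     + (\<Sum>i\<in>UNIV. Poly_Mapping.single [Z i] (cnj (F (Some i) a b) / 2))
     + (\<Sum>i\<in>UNIV. Poly_Mapping.single [ZStar i] (F (Some i) b a / 2)))"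

lemma dual_pencil_carrier: "dual_pencil n r F \<in> carrier_mat n n"
  by (simp add: dual_pencil_def)

lemma lookup_dual_pencil:
  assumes ab: "a < n" "b < n"
  shows "Poly_Mapping.lookup (dual_pencil n r F $$ (a, b)) []
      = (if a = b then complex_of_real r else 0) + (cnj (F None a b) + F None b a) / 2"
    and "Poly_Mapping.lookup (dual_pencil n r F $$ (a, b)) [Z i] = cnj (F (Some i) a b) / 2"
    and "Poly_Mapping.lookup (dual_pencil n r F $$ (a, b)) [ZStar i] = F (Some i) b a / 2"
  using ab by (auto simp: dual_pencil_def lookup_add lookup_sum lookup_single when_def)

lemma lookup_dual_pencil_long:
  assumes ab: "a < n" "b < n" and w: "length w > 1"
  shows "Poly_Mapping.lookup (dual_pencil n r F $$ (a, b)) w = 0"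
proof -
  have "[] \<noteq> w" "[l] \<noteq> w" for l using w by auto
  then show ?thesis using ab by (simp add: dual_pencil_def lookup_add lookup_sum lookup_single)
qed

lemma degree_dual_pencil: "q \<in> elements_mat (dual_pencil n r F) \<Longrightarrow> degree_le_one q"
proof -
  assume "q \<in> elements_mat (dual_pencil n r F)"
  then obtain a b where ab: "a < n" "b < n" and q: "q = dual_pencil n r F $$ (a, b)"
    using dual_pencil_carrier[of n r F] by (auto dest!: elements_matD)
  show ?thesis
    unfolding degree_le_one_def q
    using lookup_dual_pencil_long[OF ab, of _ r F] by (metis in_keys_iff not_le)
qed

lemma sum_short_words:
  "(\<Sum>w\<in>short_words. g w) = g [] + (\<Sum>i\<in>UNIV. g [Z i]) + (\<Sum>i\<in>UNIV. g [ZStar i])"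
proof -
  have "(\<Sum>w\<in>short_words. g w) = (\<Sum>w\<in>{[]} \<union> range (\<lambda>i. [Z i]). g w) + (\<Sum>w\<in>range (\<lambda>i. [ZStar i]). g w)"
    unfolding short_words_def by (intro sum.union_disjoint) auto
  also have "(\<Sum>w\<in>{[]} \<union> range (\<lambda>i. [Z i]). g w) = g [] + (\<Sum>w\<in>range (\<lambda>i. [Z i]). g w)"
    by (subst sum.union_disjoint) auto
  also have "(\<Sum>w\<in>range (\<lambda>i. [Z i]). g w) = (\<Sum>i\<in>UNIV. g [Z i])"
    by (subst sum.reindex) (auto simp: inj_on_def)
  also have "(\<Sum>w\<in>range (\<lambda>i. [ZStar i]). g w) = (\<Sum>i\<in>UNIV. g [ZStar i])"
    by (subst sum.reindex) (auto simp: inj_on_def)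
  finally show ?thesis by simp
qed

definition word_dual :: "(nat \<Rightarrow> nat \<Rightarrow> 'd letter list \<Rightarrow> complex) \<Rightarrow> 'd dual" where
  "word_dual h i a b = (case i of None \<Rightarrow> h a b [] | Some j \<Rightarrow> h a b [Z j])"

text \<open>The computation common to both uses of the pencil: \<open>h a b w\<close> is either
  <w(\<xi>) f_b, f_a> for a vector f, or the entry (a, b) of w(X). The coefficients of z_i and of
  its adjoint contribute conjugate halves, which add up to a real part.\<close>

lemma dual_pencil_pairing:
  fixes F :: "'d::finite dual"
  assumes h1: "\<And>a b. \<lbrakk>a < n; b < n\<rbrakk> \<Longrightarrow> h b a [] = cnj (h a b [])"
    and h2: "\<And>a b i. \<lbrakk>a < n; b < n\<rbrakk> \<Longrightarrow> h b a [ZStar i] = cnj (h a b [Z i])"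
  shows "(\<Sum>a<n. \<Sum>b<n. \<Sum>w\<in>short_words. Poly_Mapping.lookup (dual_pencil n r F $$ (a, b)) w * h a b w)
    = complex_of_real r * (\<Sum>a<n. h a a []) + complex_of_real (Re (fip n F (word_dual h)))"
proof -
  let ?l = "\<lambda>a b w. Poly_Mapping.lookup (dual_pencil n r F $$ (a, b)) w"
  have A: "(\<Sum>a<n. \<Sum>b<n. F i b a * cnj (v b a)) = (\<Sum>a<n. \<Sum>b<n. F i a b * cnj (v a b))" for i v
    by (rule sum.swap)
  let ?g = "\<lambda>i. (\<Sum>a<n. \<Sum>b<n. F i a b * cnj (word_dual h i a b))"
  have half: "(\<Sum>a<n. \<Sum>b<n. cnj (F i a b) / 2 * word_dual h i a b) + (\<Sum>a<n. \<Sum>b<n. F i b a / 2 * cnj (word_dual h i b a))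
      = complex_of_real (Re (?g i))" for i
  proof -
    have "(\<Sum>a<n. \<Sum>b<n. F i b a / 2 * cnj (word_dual h i b a)) = ?g i / 2"
      by (subst sum.swap) (simp add: sum_divide_distrib)
    moreover have "(\<Sum>a<n. \<Sum>b<n. cnj (F i a b) / 2 * word_dual h i a b) = cnj (?g i) / 2"
      by (simp add: sum_divide_distrib)
    moreover have "cnj z / 2 + z / 2 = complex_of_real (Re z)" for z by (simp add: complex_eq_iff)
    ultimately show ?thesis by (simp only:)
  qed
  have "(\<Sum>a<n. \<Sum>b<n. \<Sum>w\<in>short_words. ?l a b w * h a b w)
      = (\<Sum>a<n. \<Sum>b<n. (if a = b then complex_of_real r * h a a [] else 0)
          + (cnj (F None a b) / 2 * word_dual h None a b + F None b a / 2 * cnj (word_dual h None b a))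
          + (\<Sum>i\<in>UNIV. cnj (F (Some i) a b) / 2 * word_dual h (Some i) a b
              + F (Some i) b a / 2 * cnj (word_dual h (Some i) b a)))"
  proof (intro sum.cong refl)
    fix a b assume "a \<in> {..<n}" "b \<in> {..<n}"
    then have ab: "a < n" "b < n" by auto
    show "(\<Sum>w\<in>short_words. ?l a b w * h a b w)
      = (if a = b then complex_of_real r * h a a [] else 0)
          + (cnj (F None a b) / 2 * word_dual h None a b + F None b a / 2 * cnj (word_dual h None b a))
          + (\<Sum>i\<in>UNIV. cnj (F (Some i) a b) / 2 * word_dual h (Some i) a b
              + F (Some i) b a / 2 * cnj (word_dual h (Some i) b a))"
      unfolding sum_short_words lookup_dual_pencil(1-3)[OF ab]
      using h1[OF ab(2,1)] h2[OF ab(2,1)]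
      by (auto simp: word_dual_def sum.distrib distrib_right add_divide_distrib)
  qed
  also have "\<dots> = (\<Sum>a<n. \<Sum>b<n. if a = b then complex_of_real r * h a a [] else 0)
      + complex_of_real (Re (?g None)) + (\<Sum>i\<in>UNIV. complex_of_real (Re (?g (Some i))))"
  proof -
    have "(\<Sum>a<n. \<Sum>b<n. \<Sum>i\<in>UNIV. cnj (F (Some i) a b) / 2 * word_dual h (Some i) a b
              + F (Some i) b a / 2 * cnj (word_dual h (Some i) b a))
        = (\<Sum>i\<in>UNIV. \<Sum>a<n. \<Sum>b<n. cnj (F (Some i) a b) / 2 * word_dual h (Some i) a b
              + F (Some i) b a / 2 * cnj (word_dual h (Some i) b a))"
      by (rule sum_swap3)
    also have "\<dots> = (\<Sum>i\<in>UNIV. complex_of_real (Re (?g (Some i))))"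
      unfolding half[symmetric] by (simp add: sum.distrib)
    finally show ?thesis unfolding half[symmetric] by (simp add: sum.distrib)
  qed
  also have "(\<Sum>a<n. \<Sum>b<n. if a = b then complex_of_real r * h a a [] else 0) = complex_of_real r * (\<Sum>a<n. h a a [])"
    by (simp add: sum_distrib_left)
  also have "complex_of_real r * (\<Sum>a<n. h a a []) + complex_of_real (Re (?g None)) + (\<Sum>i\<in>UNIV. complex_of_real (Re (?g (Some i))))
      = complex_of_real r * (\<Sum>a<n. h a a []) + complex_of_real (Re (fip n F (word_dual h)))"
    by (simp add: fip_def UNIV_option_conv sum.reindex)
  finally show ?thesis .
qed

lemma (in star_rep) ip_act_vscale:
  assumes "a \<in> carrier A" "x \<in> V" "y \<in> V"
  shows "ip (act a (vscale c x)) y = c * ip (act a x) y"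
  using assms by (simp add: act_swap[of a])

lemma (in cstar_rep) anorm_eval_poly_diff:
  fixes X :: "'d::finite \<Rightarrow> 'a"
  assumes X: "range X \<subseteq> carrier A" and pq: "degree_le_one p" "degree_le_one q"
    and close: "\<And>w. w \<in> short_words \<Longrightarrow> cmod (Poly_Mapping.lookup p w - Poly_Mapping.lookup q w) \<le> \<epsilon>"
    and K: "\<And>w. w \<in> short_words \<Longrightarrow> anorm A (eval_word A X w) \<le> K" and \<epsilon>: "0 \<le> \<epsilon>"
  shows "anorm A (eval_poly A X p \<ominus> eval_poly A X q) \<le> real (card (short_words :: 'd letter list set)) * (\<epsilon> * K)"
proof -
  let ?S = "short_words :: 'd letter list set"
  note cl = eval_poly_closed[OF X] eval_word_closed[OF X]
  have K0: "0 \<le> K"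
    by (rule order.trans[OF anorm_nonneg[OF cl(2)] K[of "[]"]]) (simp add: short_words_def)
  have "bnd (eval_poly A X p \<ominus> eval_poly A X q) (real (card ?S) * (\<epsilon> * K))"
  proof (rule bndI_ip)
    fix x y assume xy: "x \<in> V" "y \<in> V"
    let ?s = "sqrt (sq x) * sqrt (sq y)"
    have "ip (act (eval_poly A X p \<ominus> eval_poly A X q) x) y
        = (\<Sum>w\<in>?S. (Poly_Mapping.lookup p w - Poly_Mapping.lookup q w) * ip (act (eval_word A X w) x) y)"
      using xy cl pq[THEN keys_degree_le_one]
      by (simp add: ip_eval_poly[OF X, of ?S] sum_subtractf left_diff_distrib)
    also have "cmod \<dots> \<le> (\<Sum>w\<in>?S. \<epsilon> * (K * ?s))"
    proof (rule sum_norm_le)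
      fix w :: "'d letter list" assume w: "w \<in> ?S"
      have "cmod (ip (act (eval_word A X w) x) y) \<le> anorm A (eval_word A X w) * sqrt (sq x) * sqrt (sq y)"
        using xy cl by (intro bnd_ip bnd_anorm) auto
      also have "\<dots> \<le> K * ?s"
        unfolding mult.assoc using K[OF w] xy by (intro mult_right_mono) auto
      finally show "cmod ((Poly_Mapping.lookup p w - Poly_Mapping.lookup q w) * ip (act (eval_word A X w) x) y) \<le> \<epsilon> * (K * ?s)"
        unfolding Real_Vector_Spaces.norm_mult using close[OF w] \<epsilon> by (intro mult_mono) auto
    qed
    finally show "cmod (ip (act (eval_poly A X p \<ominus> eval_poly A X q) x) y) \<le> real (card ?S) * (\<epsilon> * K) * sqrt (sq x) * sqrt (sq y)"
      by (simp add: mult_ac)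
  qed (use cl \<epsilon> K0 in auto)
  then show ?thesis using cl by (simp add: anorm_le_iff)
qed

lemma (in cstar_rep) matrix_norm_diff:
  assumes n: "n \<ge> 1" and Y: "Y \<in> mats (carrier A) n" "Y' \<in> mats (carrier A) n"
    and le: "\<And>i j. \<lbrakk>i < n; j < n\<rbrakk> \<Longrightarrow> anorm A (Y $$ (i, j) \<ominus> Y' $$ (i, j)) \<le> D"
  shows "matrix_norm A n Y \<le> matrix_norm A n Y' + real (n * n) * D"
proof -
  interpret M: cstar_rep "matrix_algebra A n" "Vn n" "ipn n" "\<lambda>_. vzero" "\<lambda>f g i. vadd (f i) (g i)"
    "\<lambda>c f i. vscale c (f i)" "actn n"
    by (rule cstar_rep_matrix[OF n])
  have an: "anorm (matrix_algebra A n) = matrix_norm A n" by (simp add: matrix_algebra_def fun_eq_iff)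
  have carr: "carrier (matrix_algebra A n) = mats (carrier A) n"
    unfolding matrix_algebra_def by (rule carrier_matrix_algebra_with)
  define Z' where "Z' = mat n n (\<lambda>ij. Y $$ ij \<ominus> Y' $$ ij)"
  have Z': "Z' \<in> mats (carrier A) n"
    using matsD[OF Y(1)] matsD[OF Y(2)] by (simp add: Z'_def mats_mat)
  have "Y = Y' \<oplus>\<^bsub>matrix_algebra A n\<^esub> Z'"
  proof (rule mats_eqI[OF Y(1)])
    show "Y' \<oplus>\<^bsub>matrix_algebra A n\<^esub> Z' \<in> mats (carrier A) n"
      using M.sr_add[of Y' Z'] Y Z' unfolding carr by blast
    fix i j assume ij: "i < n" "j < n"
    have "Y $$ (i, j) = Y' $$ (i, j) \<oplus> (Y $$ (i, j) \<ominus> Y' $$ (i, j))"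
      using matsD[OF Y(1) ij] matsD[OF Y(2) ij] by (intro act_faithful) auto
    then show "Y $$ (i, j) = (Y' \<oplus>\<^bsub>matrix_algebra A n\<^esub> Z') $$ (i, j)"
      using ij by (simp add: matrix_algebra_def Z'_def)
  qed
  then have "matrix_norm A n Y \<le> matrix_norm A n Y' + matrix_norm A n Z'"
    using M.norm_triangle[of Y' Z'] Y Z' unfolding an carr by simp
  also have "matrix_norm A n Z' \<le> (\<Sum>i<n. \<Sum>j<n. D)"
    using le by (intro matrix_norm_sum[OF n Z']) (simp add: Z'_def)
  finally show ?thesis by (simp add: mult.assoc)
qed

lemma dual_pencil_lookup_diff:
  fixes F G :: "'d::finite dual"
  assumes ab: "a < n" "b < n" and w: "w \<in> short_words"
    and close: "\<And>i a b. \<lbrakk>a < n; b < n\<rbrakk> \<Longrightarrow> cmod (F i a b - G i a b) \<le> \<epsilon>"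
  shows "cmod (Poly_Mapping.lookup (dual_pencil n r F $$ (a, b)) w - Poly_Mapping.lookup (dual_pencil n r G $$ (a, b)) w) \<le> \<epsilon>"
proof -
  have \<epsilon>: "0 \<le> \<epsilon>" using close[OF ab, of None] norm_ge_zero order_trans by blast
  have c: "cmod (cnj (F i a b) - cnj (G i a b)) \<le> \<epsilon>" for i
    using close[OF ab, of i] by (metis complex_cnj_diff complex_mod_cnj)
  from w consider "w = []" | i where "w = [Z i]" | i where "w = [ZStar i]" by (auto simp: short_words_def)
  then show ?thesis
  proof cases
    case 1
    have "Poly_Mapping.lookup (dual_pencil n r F $$ (a, b)) [] - Poly_Mapping.lookup (dual_pencil n r G $$ (a, b)) []
        = ((cnj (F None a b) - cnj (G None a b)) + (F None b a - G None b a)) / 2"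
      unfolding lookup_dual_pencil[OF ab] by (simp add: add_divide_distrib diff_divide_distrib)
    also have "cmod \<dots> \<le> (\<epsilon> + \<epsilon>) / 2"
      using norm_triangle_ineq[of "cnj (F None a b) - cnj (G None a b)" "F None b a - G None b a"]
        c[of None] close[OF ab(2,1), of None] by (simp add: norm_divide)
    finally show ?thesis using 1 by simp
  next
    case (2 i)
    have "cmod (cnj (F (Some i) a b) / 2 - cnj (G (Some i) a b) / 2) = cmod (cnj (F (Some i) a b) - cnj (G (Some i) a b)) / 2"
      by (simp add: norm_divide flip: diff_divide_distrib)
    then show ?thesis unfolding 2 lookup_dual_pencil[OF ab] using c[of "Some i"] \<epsilon> by linarith
  next
    case (3 i)
    have "cmod (F (Some i) b a / 2 - G (Some i) b a / 2) = cmod (F (Some i) b a - G (Some i) b a) / 2"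
      by (simp add: norm_divide flip: diff_divide_distrib)
    then show ?thesis unfolding 3 lookup_dual_pencil[OF ab] using close[OF ab(2,1), of "Some i"] \<epsilon> by linarith
  qed
qed

section \<open>Moments of a represented tuple and norms of dual pencils\<close>

context rep_tuple
begin

definition gen :: "'d option \<Rightarrow> 'a" where
  "gen i = (case i of None \<Rightarrow> \<one> | Some j \<Rightarrow> \<xi> j)"

lemma xi_closed [simp]: "\<xi> j \<in> carrier A"
  using \<xi> by blast

lemma gen_closed [simp]: "gen i \<in> carrier A"
  by (cases i) (simp_all add: gen_def)

text \<open>The tuples \<open>\<Sum>\<^sub>c V\<^sub>c\<^sup>* \<xi>\<^sub>i V\<^sub>c\<close> with \<open>V\<^sub>c\<close> mapping \<open>n\<close>-dimensional space to \<open>H\<close>; those with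
  \<open>\<Sum>\<^sub>c V\<^sub>c\<^sup>* V\<^sub>c = 1\<close> lie in the matrix range.\<close>

definition moments :: "nat \<Rightarrow> nat \<Rightarrow> (nat \<Rightarrow> nat \<Rightarrow> 'h) \<Rightarrow> 'd dual" where
  "moments n k f i a b = (if a < n \<and> b < n then \<Sum>c<k. ip H (\<pi> (gen i) (f c b)) (f c a) else 0)"

definition moment_cone :: "nat \<Rightarrow> 'd dual set" where
  "moment_cone n = {moments n k f |k f. \<forall>c<k. f c \<in> Vn n}"

lemma moment_cone_zero: "(\<lambda>_ _ _. 0) \<in> moment_cone n"
  unfolding moment_cone_def by (intro CollectI exI[of _ 0]) (auto simp: moments_def fun_eq_iff)

lemma moment_cone_add:
  assumes "F \<in> moment_cone n" "G \<in> moment_cone n"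
  shows "(\<lambda>i a b. F i a b + G i a b) \<in> moment_cone n"
proof -
  obtain k f k' g where f: "\<forall>c<k. f c \<in> Vn n" "F = moments n k f" and g: "\<forall>c<k'. g c \<in> Vn n" "G = moments n k' g"
    using assms by (auto simp: moment_cone_def)
  define h where "h c = (if c < k then f c else g (c - k))" for c
  have "(\<lambda>i a b. F i a b + G i a b) = moments n (k + k') h"
    by (intro ext) (simp add: f g moments_def sum_lessThan_add h_def)
  moreover have "\<forall>c<k + k'. h c \<in> Vn n" using f g by (auto simp: h_def)
  ultimately show ?thesis by (auto simp: moment_cone_def)
qed

lemma moment_cone_scale:
  assumes "0 \<le> s" "F \<in> moment_cone n"
  shows "(\<lambda>i a b. complex_of_real s * F i a b) \<in> moment_cone n"
proof -
  obtain k f where f: "\<forall>c<k. f c \<in> Vn n" "F = moments n k f"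
    using assms(2) by (auto simp: moment_cone_def)
  define h where "h c b = complex_of_real (sqrt s) \<odot>\<^bsub>H\<^esub> f c b" for c b
  have ss: "complex_of_real (sqrt s) * complex_of_real (sqrt s) = complex_of_real s"
    using assms(1) by (simp flip: of_real_mult)
  have fc: "f c b \<in> carrier H" if "c < k" "b < n" for c b using f that by (auto simp: vpow_def)
  have "ip H (\<pi> (gen i) (h c b)) (h c a) = complex_of_real s * ip H (\<pi> (gen i) (f c b)) (f c a)"
    if "c < k" "a < n" "b < n" for i a b c
    using fc that ss by (simp add: h_def ip_act_vscale mult.assoc[symmetric])
  then have "(\<lambda>i a b. complex_of_real s * F i a b) = moments n k h"
    by (intro ext) (simp add: f moments_def sum_distrib_left)
  moreover have "\<forall>c<k. h c \<in> Vn n" using fc by (auto simp: h_def vpow_def)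
  ultimately show ?thesis by (auto simp: moment_cone_def)
qed

text \<open>Thus an operator inequality for the pencil is an inequality for F on the moments of
  single vectors, which generate the cone.\<close>

lemma dual_pencil_form:
  assumes f: "f \<in> Vn n"
  shows "ipn n (actn n (eval_poly_mat A \<xi> (dual_pencil n r F)) f) f
    = complex_of_real (r * sqn n f + Re (fip n F (moments n 1 (\<lambda>_. f))))"
proof -
  let ?B = "dual_pencil n r F"
  define h where "h a b w = ip H (\<pi> (eval_word A \<xi> w) (f b)) (f a)" for a b w
  have fc: "f a \<in> carrier H" if "a < n" for a using f that by (simp add: vpow_def)
  have "ipn n (actn n (eval_poly_mat A \<xi> ?B) f) f
      = (\<Sum>a<n. \<Sum>b<n. ip H (\<pi> (eval_poly_mat A \<xi> ?B $$ (a, b)) (f b)) (f a))"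
    using f by (intro ipn_actn eval_mats[OF \<xi>] dual_pencil_carrier)
  also have "\<dots> = (\<Sum>a<n. \<Sum>b<n. \<Sum>w\<in>short_words. Poly_Mapping.lookup (?B $$ (a, b)) w * h a b w)"
  proof (intro sum.cong refl)
    fix a b assume "a \<in> {..<n}" "b \<in> {..<n}"
    then have ab: "a < n" "b < n" by auto
    have "degree_le_one (?B $$ (a, b))"
      using dual_pencil_carrier[of n r F] ab by (intro degree_dual_pencil) blast
    then show "ip H (\<pi> (eval_poly_mat A \<xi> ?B $$ (a, b)) (f b)) (f a)
        = (\<Sum>w\<in>short_words. Poly_Mapping.lookup (?B $$ (a, b)) w * h a b w)"
      using ab fc dual_pencil_carrier[of n r F]
      by (simp add: h_def ip_eval_poly[OF \<xi> finite_short_words keys_degree_le_one])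
  qed
  also have "\<dots> = complex_of_real r * (\<Sum>a<n. h a a []) + complex_of_real (Re (fip n F (word_dual h)))"
  proof (rule dual_pencil_pairing)
    show "h b a [] = cnj (h a b [])" if "a < n" "b < n" for a b
      using fc that ip_commute[of "f b" "f a"] by (simp add: h_def)
    show "h b a [ZStar i] = cnj (h a b [Z i])" if "a < n" "b < n" for a b i
      using fc that by (simp add: h_def ip_act_commute)
  qed
  also have "(\<Sum>a<n. h a a []) = complex_of_real (sqn n f)"
    unfolding sqn_eq using fc by (simp add: h_def ip_self)
  also have "fip n F (word_dual h) = fip n F (moments n 1 (\<lambda>_. f))"
    unfolding fip_def
    by (intro sum.cong refl) (auto simp: word_dual_def moments_def h_def gen_def split: option.split)
  finally show ?thesis by simp
qed

lemma moments_entry_le: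
  assumes f: "f \<in> Vn n" and K: "\<And>i. anorm A (gen i) \<le> K" and ab: "a < n" "b < n"
  shows "cmod (moments n 1 (\<lambda>_. f) i a b) \<le> K * sqn n f"
proof -
  have fc: "f a \<in> carrier H" if "a < n" for a using f that by (simp add: vpow_def)
  have s: "sqrt (sq (f a)) \<le> sqrt (sqn n f)" if "a < n" for a
    using sq_le_sqn[OF f that] by simp
  have K0: "0 \<le> K" by (rule order.trans[OF anorm_nonneg[OF gen_closed] K])
  have q: "0 \<le> sqn n f" unfolding sqn_eq using fc by (intro sum_nonneg) auto
  have "cmod (ip H (\<pi> (gen i) (f b)) (f a)) \<le> K * sqrt (sq (f b)) * sqrt (sq (f a))"
    using fc ab K by (intro bnd_ip) (auto simp: anorm_le_iff[symmetric])
  also have "\<dots> \<le> K * sqrt (sqn n f) * sqrt (sqn n f)"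
    using s ab K0 q fc by (intro mult_mono mult_nonneg_nonneg) auto
  finally show ?thesis using ab q by (simp add: moments_def mult.assoc)
qed

text \<open>The moments m of f satisfy \<open>fsq n m\<close> \<le> Kc |f|^4. With Kc \<le> R and
  \<open>fsq n F\<close> \<le> R, Cauchy-Schwarz makes the pencil shifted by R positive, while the
  hypothesis on the cone bounds it above by R + \<eta>. The shift is what turns a one-sided estimate
  into a norm.\<close>

lemma dual_norm_le:
  fixes F :: "'d dual"
  assumes n: "n \<ge> 1" and K: "\<And>i. anorm A (gen i) \<le> K"
    and Kc: "Kc = real (card (UNIV :: 'd option set) * n * n) * K\<^sup>2" and R: "Kc \<le> R" and F: "fsq n F \<le> R"
    and cone: "\<forall>c\<in>moment_cone n. fsq n c \<le> Kc \<longrightarrow> Re (fip n F c) \<le> \<eta>" and \<eta>: "0 < \<eta>"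
  shows "matrix_norm A n (eval_poly_mat A \<xi> (dual_pencil n R F)) \<le> R + \<eta>"
proof -
  let ?E = "eval_poly_mat A \<xi> (dual_pencil n R F)"
  let ?m = "\<lambda>f. moments n 1 (\<lambda>_. f)"
  interpret F: ip_space UNIV "fip n" "\<lambda>_ _ _. 0" "\<lambda>F G i a b. F i a b + G i a b" "\<lambda>c F i a b. c * F i a b"
    by (rule fip_space)
  have E: "?E \<in> mats (carrier A) n" by (intro eval_mats[OF \<xi>] dual_pencil_carrier)
  interpret M: star_rep "matrix_algebra A n" "Vn n" "ipn n" "\<lambda>_. \<zero>\<^bsub>H\<^esub>"
    "\<lambda>f g i. f i \<oplus>\<^bsub>H\<^esub> g i" "\<lambda>c f i. c \<odot>\<^bsub>H\<^esub> f i" "actn n"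
    unfolding matrix_algebra_def by (rule star_rep_matrix)
  have carr: "carrier (matrix_algebra A n) = mats (carrier A) n"
    unfolding matrix_algebra_def by (rule carrier_matrix_algebra_with)
  have R0: "0 \<le> R" using R unfolding Kc by (meson mult_nonneg_nonneg of_nat_0_le_iff order_trans zero_le_power2)
  have fm: "fsq n (?m f) \<le> Kc * (sqn n f)\<^sup>2" if f: "f \<in> Vn n" for f
    using fsq_le[of n "?m f" "K * sqn n f"] moments_entry_le[OF f K]
    by (simp add: Kc power_mult_distrib mult.assoc)
  have abs_le: "\<bar>Re (fip n F (?m f))\<bar> \<le> R * sqn n f" if f: "f \<in> Vn n" for f
  proof -
    have q: "0 \<le> sqn n f" using M.sq_nonneg[OF f] .
    have "cmod (fip n F (?m f)) \<le> sqrt (fsq n F) * sqrt (fsq n (?m f))"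
      using F.cmod_ip_le[of F "?m f"] by (simp add: fsq_eq)
    also have "\<dots> \<le> sqrt R * sqrt (R * (sqn n f)\<^sup>2)"
    proof (intro mult_mono real_sqrt_le_mono F)
      show "fsq n (?m f) \<le> R * (sqn n f)\<^sup>2"
        using fm[OF f] R by (meson mult_right_mono order_trans zero_le_power2)
    qed (use R0 in \<open>auto simp: fsq_def intro!: sum_nonneg\<close>)
    also have "\<dots> = R * sqn n f" using R0 q by (simp add: real_sqrt_mult mult.assoc[symmetric])
    finally show ?thesis using abs_Re_le_cmod order_trans by blast
  qed
  \<comment> \<open>The moments are divided by |f|^2, which brings them into the part of the cone
    with \<open>fsq\<close> at most Kc.\<close>
  have up: "Re (fip n F (?m f)) \<le> \<eta> * sqn n f" if f: "f \<in> Vn n" for f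
  proof (cases "sqn n f = 0")
    case True
    then show ?thesis using abs_le[OF f] by simp
  next
    case False
    define q where "q = sqn n f"
    have q: "q > 0" using False M.sq_nonneg[OF f] by (simp add: q_def)
    let ?c = "\<lambda>i a b. complex_of_real (1 / q) * ?m f i a b"
    have "?m f \<in> moment_cone n" using f unfolding moment_cone_def by blast
    then have c: "?c \<in> moment_cone n" using q by (intro moment_cone_scale) auto
    have "fsq n ?c = (1 / q)\<^sup>2 * fsq n (?m f)"
      using F.sq_vscale[of "?m f" "complex_of_real (1 / q)"] q by (simp add: fsq_eq norm_divide)
    also have "\<dots> \<le> (1 / q)\<^sup>2 * (Kc * q\<^sup>2)"
      using fm[OF f] by (intro mult_left_mono) (auto simp: q_def)
    also have "\<dots> = Kc" using q by (simp add: power_divide)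
    finally have "Re (fip n F ?c) \<le> \<eta>" using cone c by blast
    moreover have "fip n F ?c = complex_of_real (1 / q) * fip n F (?m f)"
      using F.ip_vscale_right[of "?m f" F "complex_of_real (1 / q)"] by simp
    ultimately have "Re (fip n F (?m f)) / q \<le> \<eta>" by simp
    then show ?thesis using q by (simp add: q_def pos_divide_le_eq)
  qed
  have form: "ipn n (actn n ?E f) f = complex_of_real (R * sqn n f + Re (fip n F (?m f)))" if "f \<in> Vn n" for f
    using that by (rule dual_pencil_form)
  have "M.form_pos ?E"
    unfolding M.form_pos_def
  proof
    fix f assume f: "f \<in> Vn n"
    show "Im (ipn n (actn n ?E f) f) = 0 \<and> 0 \<le> Re (ipn n (actn n ?E f) f)"
      unfolding form[OF f] Im_complex_of_real Re_complex_of_real using abs_le[OF f] by linarith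
  qed
  then have sa: "star (matrix_algebra A n) ?E = ?E"
    using E unfolding carr[symmetric] by (intro M.form_pos_self_adjoint)
  have "M.bnd ?E (R + \<eta>)"
  proof (rule M.bnd_self_adjoint[OF _ sa])
    show "?E \<in> carrier (matrix_algebra A n)" using E unfolding carr .
    show "0 \<le> R + \<eta>" using R0 \<eta> by simp
    fix f assume f: "f \<in> Vn n"
    have "0 \<le> \<eta> * sqn n f" using \<eta> M.sq_nonneg[OF f] by simp
    then show "\<bar>Re (ipn n (actn n ?E f) f)\<bar> \<le> (R + \<eta>) * M.sq f"
      unfolding form[OF f] Re_complex_of_real distrib_right using abs_le[OF f] up[OF f] by linarith
  qed
  then show ?thesis using matrix_norm_le_iff[OF n E] by blast
qed

text \<open>The pencil at X is evaluated on the sum of the vectors e_j \<otimes> e_j, of squared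
  norm n. This picks the entry (a, b) of the block (a, b) and returns r n + Re <F, (1, X)>, while
  the norm bound allows at most (r + \<eta>) n.\<close>

lemma dual_point_le:
  fixes F :: "'d dual"
  assumes n: "n \<ge> 1" and X: "X \<in> Wn n"
    and b: "matrix_norm A n (eval_poly_mat A \<xi> (dual_pencil n r F)) \<le> r + \<eta>"
  shows "Re (fip n F (point X)) \<le> real n * \<eta>"
proof -
  let ?B = "dual_pencil n r F"
  define U where "U l b = (if l = b then 1 else 0 :: complex)" for l b :: nat
  let ?h = "\<lambda>a b w. word_entry X w a b"
  have sU: "sq2 n n U = real n"
  proof -
    have "sq2 n n U = (\<Sum>l<n. \<Sum>b<n. if l = b then 1 else 0)"
      unfolding sq2_def by (intro sum.cong refl) (simp add: U_def)
    then show ?thesis by simp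
  qed
  have "pencil_form ?B n n X U U = (\<Sum>j<n. \<Sum>l<n. \<Sum>w\<in>short_words. Poly_Mapping.lookup (?B $$ (j, l)) w * ?h j l w)"
    unfolding pencil_form_def
  proof (intro sum.cong refl)
    fix j l assume jl: "j \<in> {..<n}" "l \<in> {..<n}"
    let ?g = "\<lambda>a b. \<Sum>w\<in>short_words. Poly_Mapping.lookup (?B $$ (j, l)) w * ?h a b w"
    have "(\<Sum>a<n. \<Sum>b<n. ?g a b * U l b * cnj (U j a)) = (\<Sum>a<n. \<Sum>b<n. if b = l then (if a = j then ?g j l else 0) else 0)"
      by (intro sum.cong refl) (auto simp: U_def)
    also have "\<dots> = ?g j l" using jl by simp
    finally show "(\<Sum>a<n. \<Sum>b<n. ?g a b * U l b * cnj (U j a)) = ?g j l" .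
  qed
  also have "\<dots> = complex_of_real r * (\<Sum>a<n. ?h a a []) + complex_of_real (Re (fip n F (word_dual ?h)))"
    by (rule dual_pencil_pairing) (auto simp: word_entry_def)
  also have "(\<Sum>a<n. ?h a a []) = of_nat n" by (simp add: word_entry_def)
  also have "word_dual ?h = point X"
    by (intro ext) (simp add: word_dual_def point_def word_entry_def split: option.split)
  finally have "Re (pencil_form ?B n n X U U) = r * real n + Re (fip n F (point X))" by simp
  moreover have "cmod (pencil_form ?B n n X U U) \<le> (r + \<eta>) * sqrt (sq2 n n U) * sqrt (sq2 n n U)"
    using n X b by (intro pencil_form_le dual_pencil_carrier) (auto intro: degree_dual_pencil)
  then have "Re (pencil_form ?B n n X U U) \<le> (r + \<eta>) * real n"
    using complex_Re_le_cmod[of "pencil_form ?B n n X U U"] by (simp add: sU mult.assoc)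
  ultimately show ?thesis by (simp add: algebra_simps)
qed

text \<open>A moment sequence whose Gram matrix is close to the identity is close to a point of the matrix range:
  shrink it slightly and fill up the defect \<open>1 - G\<close> of the Gram matrix by \<open>S \<otimes> u\<close>, where \<open>u\<close> is a unit
  vector and \<open>S\<^sup>2 = 1 - G\<close>.\<close>

lemma near_moment_cone:
  fixes X :: "'d \<Rightarrow> complex mat"
  assumes n: "n \<ge> 1" and K: "\<And>i. anorm A (gen i) \<le> K" "1 \<le> K"
    and XK: "\<And>i a b. \<lbrakk>a < n; b < n\<rbrakk> \<Longrightarrow> cmod (X i $$ (a, b)) \<le> K"
    and G: "G \<in> moment_cone n" and \<delta>: "0 \<le> \<delta>" "\<delta> \<le> 1"
    and near: "\<And>i a b. \<lbrakk>a < n; b < n\<rbrakk> \<Longrightarrow> cmod (point X i a b - G i a b) \<le> \<delta>"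
  shows "\<exists>Y\<in>Wn n. \<forall>i. \<forall>a<n. \<forall>b<n. cmod (X i $$ (a, b) - Y i $$ (a, b)) \<le> K * \<delta> * (2 + 4 * (real n)\<^sup>2)"
proof -
  obtain k f where f: "\<forall>c<k. f c \<in> Vn n" and Gf: "G = moments n k f"
    using G by (auto simp: moment_cone_def)
  have fc: "f c b \<in> carrier H" if "c < k" "b < n" for c b using f that by (auto simp: vpow_def)
  obtain u where u: "u \<in> carrier H" "ip H u u = 1" by (rule unit_vector)
  \<comment> \<open>The Gram matrix is 1 + E with entries of E at most \<delta>, so \<kappa> bounds
    the norm of E, and shrinking by \<sigma> = 1 / (1 + \<kappa>) brings the Gram matrix to norm at
    most 1.\<close>
  define \<kappa> where "\<kappa> = (real n)\<^sup>2 * \<delta>"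
  define \<sigma> where "\<sigma> = 1 / (1 + \<kappa>)"
  have \<kappa>: "0 \<le> \<kappa>" using \<delta> by (simp add: \<kappa>_def)
  have \<sigma>: "0 < \<sigma>" "\<sigma> \<le> 1" using \<kappa> by (simp_all add: \<sigma>_def)
  have "1 - \<sigma> = \<kappa> / (1 + \<kappa>)" using \<kappa> by (simp add: \<sigma>_def field_simps)
  also have "\<dots> \<le> \<kappa> / 1" using \<kappa> by (intro divide_left_mono) auto
  finally have \<sigma>\<kappa>: "1 - \<sigma> \<le> \<kappa>" by simp
  interpret M: cstar_rep "complex_matrices n" "cvec n" "cip n" "\<lambda>_. 0" "\<lambda>f g i. f i + g i"
    "\<lambda>c f i. c * f i" "cact n"
    by (rule cm_rep[OF n])
  define E where "E = mat n n (\<lambda>(a, b). G None a b - (if a = b then 1 else 0))"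
  have E: "E \<in> cmats n" by (simp add: E_def mats_mat)
  have Eab: "cmod (E $$ (a, b)) \<le> \<delta>" if "a < n" "b < n" for a b
    using near[OF that, of None] that by (simp add: E_def point_def norm_minus_commute)
  have an: "anorm (complex_matrices n) = matrix_norm complex_cstar n"
    by (simp add: matrix_algebra_def fun_eq_iff)
  have "anorm (complex_matrices n) E \<le> (\<Sum>a<n. \<Sum>b<n. \<delta>)"
    unfolding an using E Eab by (intro cc.matrix_norm_sum[OF n]) auto
  then have Enorm: "anorm (complex_matrices n) E \<le> \<kappa>" by (simp add: \<kappa>_def power2_eq_square mult.assoc)
  define g where "g = complex_of_real \<sigma> \<odot>\<^bsub>complex_matrices n\<^esub> (\<one>\<^bsub>complex_matrices n\<^esub> \<oplus>\<^bsub>complex_matrices n\<^esub> E)"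
  have gc: "g \<in> carrier (complex_matrices n)"
    unfolding g_def using E by (intro M.sr_smult M.sr_add M.sr_one) simp
  have gab: "g $$ (a, b) = complex_of_real \<sigma> * G None a b" if "a < n" "b < n" for a b
    using that by (simp add: g_def cm_simps E_def)
  have "anorm (complex_matrices n) g = \<sigma> * anorm (complex_matrices n) (\<one>\<^bsub>complex_matrices n\<^esub> \<oplus>\<^bsub>complex_matrices n\<^esub> E)"
    unfolding g_def using E \<sigma> M.sr_add[OF M.sr_one, of E] by (simp add: M.norm_smult)
  also have "\<dots> \<le> \<sigma> * (1 + \<kappa>)"
    using M.norm_triangle[OF M.sr_one, of E] E Enorm M.anorm_one \<sigma> by (intro mult_left_mono) auto
  also have "\<dots> = 1" using \<kappa> by (simp add: \<sigma>_def)
  finally have g1: "anorm (complex_matrices n) g \<le> 1" .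
  have Gsym: "G None a b = cnj (G None b a)" if "a < n" "b < n" for a b
    using that fc by (auto simp: Gf moments_def gen_def intro!: sum.cong ip_commute)
  have gs: "star (complex_matrices n) g = g"
  proof (rule mats_eqI[of _ UNIV n])
    show "star (complex_matrices n) g \<in> cmats n" "g \<in> cmats n"
      using M.sr_star[OF gc] gc by simp_all
    show "star (complex_matrices n) g $$ (a, b) = g $$ (a, b)" if "a < n" "b < n" for a b
      using that Gsym[OF that] by (simp add: cm_simps gab)
  qed
  obtain S where S: "S \<in> carrier (complex_matrices n)" "star (complex_matrices n) S = S"
    "S \<otimes>\<^bsub>complex_matrices n\<^esub> S = \<one>\<^bsub>complex_matrices n\<^esub> \<ominus>\<^bsub>complex_matrices n\<^esub> g"
    using M.sqrt_one_minus[OF gc gs g1] by blast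
  have Ssym: "cnj (S $$ (c, a)) = S $$ (a, c)" if "a < n" "c < n" for a c
  proof -
    have "S $$ (a, c) = star (complex_matrices n) S $$ (a, c)" by (simp add: S(2))
    then show ?thesis using that by (simp add: cm_simps)
  qed
  have SS: "(\<Sum>c<n. S $$ (c, b) * cnj (S $$ (c, a))) = (if a = b then 1 else 0) - g $$ (a, b)" if ab: "a < n" "b < n" for a b
  proof -
    have "(\<Sum>c<n. S $$ (c, b) * cnj (S $$ (c, a))) = (S \<otimes>\<^bsub>complex_matrices n\<^esub> S) $$ (a, b)"
      using ab by (simp add: cm_simps Ssym mult.commute)
    also have "\<dots> = \<one>\<^bsub>complex_matrices n\<^esub> $$ (a, b) - g $$ (a, b)"
      unfolding S(3) using ab gc M.sr_one by (intro cm_minus_entry[OF n]) auto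
    finally show ?thesis using ab by (simp add: cm_simps)
  qed
  \<comment> \<open>The first k members are the shrunk vectors of the moment sequence. The remaining
    n carry the rows of S times u; their Gram matrix is S^2 = 1 - g, so the total is the
    identity.\<close>
  define v where "v c b = (if c < k then complex_of_real (sqrt \<sigma>) \<odot>\<^bsub>H\<^esub> f c b else S $$ (c - k, b) \<odot>\<^bsub>H\<^esub> u)" for c b
  have v: "v c b \<in> carrier H" if "b < n" for c b using that fc u by (simp add: v_def)
  have s2: "complex_of_real (sqrt \<sigma>) * complex_of_real (sqrt \<sigma>) = complex_of_real \<sigma>"
    using \<sigma> by (simp flip: of_real_mult)
  have sumv: "(\<Sum>c<k + n. ip H (\<pi> t (v c b)) (v c a))
      = complex_of_real \<sigma> * (\<Sum>c<k. ip H (\<pi> t (f c b)) (f c a)) + ip H (\<pi> t u) u * ((if a = b then 1 else 0) - g $$ (a, b))"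
    if t: "t \<in> carrier A" and ab: "a < n" "b < n" for t a b
  proof -
    have "(\<Sum>c<k. ip H (\<pi> t (v c b)) (v c a)) = (\<Sum>c<k. complex_of_real \<sigma> * ip H (\<pi> t (f c b)) (f c a))"
      using t ab fc by (intro sum.cong refl) (simp add: v_def ip_act_vscale s2[symmetric] mult_ac)
    moreover have "(\<Sum>c<n. ip H (\<pi> t (v (k + c) b)) (v (k + c) a))
        = (\<Sum>c<n. ip H (\<pi> t u) u * (S $$ (c, b) * cnj (S $$ (c, a))))"
      using t ab u by (intro sum.cong refl) (simp add: v_def ip_act_vscale mult_ac)
    ultimately show ?thesis
      unfolding sum_lessThan_add SS[OF ab, symmetric] by (simp add: sum_distrib_left)
  qed
  let ?\<phi> = "complex_hilbert_space.compress H (k + n) n v"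
  have \<phi>: "?\<phi> \<in> ucp BH (complex_matrices n)"
  proof (rule complex_hilbert_space.ucp_compress[OF H n v])
    fix a b assume ab: "a < n" "b < n"
    have "(\<Sum>c<k + n. ip H (v c b) (v c a)) = (\<Sum>c<k + n. ip H (\<pi> \<one> (v c b)) (v c a))"
      using v ab by simp
    also have "\<dots> = (if a = b then 1 else 0)"
      unfolding sumv[OF one_closed ab] gab[OF ab] using ab u by (simp add: Gf moments_def gen_def)
    finally show "(\<Sum>c<k + n. ip H (v c b) (v c a)) = (if a = b then 1 else 0)" .
  qed
  define Y where "Y i = ?\<phi> (\<pi> (\<xi> i))" for i
  have Y: "Y \<in> Wn n" using \<phi> unfolding matrix_range_def Y_def[abs_def] by blast
  have "cmod (X i $$ (a, b) - Y i $$ (a, b)) \<le> K * \<delta> * (2 + 4 * (real n)\<^sup>2)" if ab: "a < n" "b < n" for i a b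
  proof -
    define y where "y = G (Some i) a b"
    define d where "d = (if a = b then 1 else 0 :: complex)"
    define e where "e = ip H (\<pi> (\<xi> i) u) u"
    have Yab: "Y i $$ (a, b) = complex_of_real \<sigma> * y + e * (d - complex_of_real \<sigma> * G None a b)"
      using ab sumv[OF xi_closed[of i] ab]
      by (simp add: Y_def complex_hilbert_space.compress_def[OF H] y_def e_def d_def Gf moments_def gen_def gab[OF ab, unfolded Gf])
    have xy: "cmod (X i $$ (a, b) - y) \<le> \<delta>" using near[OF ab, of "Some i"] by (simp add: point_def y_def)
    have dG: "cmod (d - G None a b) \<le> \<delta>" using near[OF ab, of None] by (simp add: point_def d_def)
    have y: "cmod y \<le> 2 * K"
      using norm_triangle_ineq2[of y "X i $$ (a, b)"] xy XK[OF ab, of i] \<delta> K by (simp add: norm_minus_commute)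
    have G2: "cmod (G None a b) \<le> 2"
      using norm_triangle_ineq2[of "G None a b" d] dG \<delta> by (simp add: norm_minus_commute d_def split: if_splits)
    have "cmod e \<le> anorm A (\<xi> i) * sqrt (sq u) * sqrt (sq u)"
      unfolding e_def using u by (intro bnd_ip bnd_anorm) auto
    also have "\<dots> \<le> K" using K(1)[of "Some i"] u by (simp add: gen_def sq_def)
    finally have eK: "cmod e \<le> K" .
    have "X i $$ (a, b) - Y i $$ (a, b) = (X i $$ (a, b) - y) + complex_of_real (1 - \<sigma>) * y
        - e * ((d - G None a b) + complex_of_real (1 - \<sigma>) * G None a b)"
      by (simp add: Yab algebra_simps)
    also have "cmod \<dots> \<le> cmod (X i $$ (a, b) - y) + (1 - \<sigma>) * cmod y
        + cmod e * (cmod (d - G None a b) + (1 - \<sigma>) * cmod (G None a b))"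
    proof -
      have tri: "cmod (p + q - e * (z + w)) \<le> cmod p + cmod q + cmod e * (cmod z + cmod w)" for p q z w
        using norm_triangle_ineq4[of "p + q" "e * (z + w)"] norm_triangle_ineq[of p q]
          mult_left_mono[OF norm_triangle_ineq[of z w], of "cmod e"]
        by (simp add: Real_Vector_Spaces.norm_mult)
      have "cmod (complex_of_real (1 - \<sigma>)) = 1 - \<sigma>" unfolding norm_of_real using \<sigma> by simp
      then show ?thesis
        using tri[of "X i $$ (a, b) - y" "complex_of_real (1 - \<sigma>) * y" "d - G None a b"
            "complex_of_real (1 - \<sigma>) * G None a b"]
        by (simp only: Real_Vector_Spaces.norm_mult)
    qed
    \<comment> \<open>From \<delta> \<le> 1 one has |y| \<le> 2 K and |G_0| \<le> 2 for the entries,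
      and 1 - \<sigma> \<le> \<kappa> = n^2 \<delta>; collecting terms gives the constant 2 + 4
      n^2.\<close>
    also have "\<dots> \<le> \<delta> + \<kappa> * (2 * K) + K * (\<delta> + \<kappa> * 2)"
      using xy y dG G2 eK \<sigma> \<sigma>\<kappa> \<kappa> \<delta> K(2) by (intro add_mono mult_mono) auto
    also have "\<dots> \<le> K * \<delta> + \<kappa> * (2 * K) + K * (\<delta> + \<kappa> * 2)"
      using K(2) \<delta> by (simp add: mult_right_mono[of 1 K \<delta>, simplified])
    also have "\<dots> = K * \<delta> * (2 + 4 * (real n)\<^sup>2)" by (simp add: \<kappa>_def algebra_simps)
    finally show ?thesis .
  qed
  then show ?thesis using Y by blast
qed

end

text \<open>If X had no such neighbour, a functional F would separate (1, X) from the cone of \<xi>,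
  making the pencil norm at most R + \<eta> at \<xi> and so at most R + 4 \<eta> at \<xi>'.
  Evaluation at X then contradicts the gap \<delta>^2 - \<eta>.\<close>

lemma ranges_close_of_dual_norms:
  fixes \<xi> :: "'d::finite \<Rightarrow> 'a" and \<xi>' :: "'d \<Rightarrow> 'b"
  assumes r: "rep_tuple A \<xi> H \<pi>" and r': "rep_tuple A' \<xi>' H' \<pi>'" and n: "n \<ge> 1"
    and K: "\<And>i. anorm A (\<xi> i) \<le> K" "\<And>i. anorm A' (\<xi>' i) \<le> K" "1 \<le> K"
    and R: "R = real (card (UNIV :: 'd option set) * n * n) * K\<^sup>2 + 1"
    and \<delta>: "0 < \<delta>" "\<delta> \<le> 1" and \<eta>: "\<eta> = \<delta>\<^sup>2 / (2 * (1 + 4 * real n))"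
    and close: "\<And>F :: 'd dual. fsq n F \<le> R \<Longrightarrow>
      matrix_norm A' n (eval_poly_mat A' \<xi>' (dual_pencil n R F))
      \<le> matrix_norm A n (eval_poly_mat A \<xi> (dual_pencil n R F)) + 3 * \<eta>"
    and X: "X \<in> matrix_range H' n (\<lambda>i. \<pi>' (\<xi>' i))"
  shows "\<exists>Y \<in> matrix_range H n (\<lambda>i. \<pi> (\<xi> i)).
    \<forall>i. \<forall>a<n. \<forall>b<n. cmod (X i $$ (a, b) - Y i $$ (a, b)) \<le> K * \<delta> * (2 + 4 * (real n)\<^sup>2)"
proof (rule ccontr)
  assume no: "\<not> ?thesis"
  interpret S: rep_tuple A \<xi> H \<pi> by (rule r)
  interpret S': rep_tuple A' \<xi>' H' \<pi>' by (rule r')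
  interpret F: ip_space UNIV "fip n" "\<lambda>_ _ _. 0" "\<lambda>(F :: 'd dual) G i a b. F i a b + G i a b"
    "\<lambda>c F i a b. c * F i a b"
    by (rule fip_space)
  define Kc where "Kc = real (card (UNIV :: 'd option set) * n * n) * K\<^sup>2"
  have gen: "anorm A (S.gen i) \<le> K" for i
    using K S.anorm_one by (cases i) (auto simp: S.gen_def)
  have XK: "cmod (X i $$ (a, b)) \<le> K" if "a < n" "b < n" for i a b
    using S'.Wn_entry_le[OF n X that, of i] K(2)[of i] by linarith
  have pK: "cmod (point X i a b) \<le> K" if "a < n" "b < n" for i a b
    using XK[OF that] K(3) by (auto simp: point_def split: option.split)
  have \<eta>0: "0 < \<eta>" unfolding \<eta> using \<delta> by (intro divide_pos_pos) auto
  have Kc0: "0 \<le> Kc" by (simp add: Kc_def)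
  let ?x = "point X"
  \<comment> \<open>A cone element closer than \<delta> in the norm of \<open>fip\<close> is close
    in every entry, and \<open>near_moment_cone\<close> would produce the point Y that is assumed
    not to exist.\<close>
  have far: "\<delta>\<^sup>2 \<le> F.sq (\<lambda>i a b. ?x i a b + (- 1) * c i a b)" if c: "c \<in> S.moment_cone n" for c
  proof (rule ccontr)
    assume lt: "\<not> ?thesis"
    have "cmod (?x i a b - c i a b) \<le> \<delta>" if ab: "a < n" "b < n" for i a b
    proof -
      have "(cmod (?x i a b - c i a b))\<^sup>2 \<le> \<delta>\<^sup>2"
        using cmod_le_fsq[OF ab, of "\<lambda>i a b. ?x i a b + (- 1) * c i a b" i] lt by (simp add: fsq_eq)
      then show ?thesis by (rule power2_le_imp_le) (use \<delta> in argo)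
    qed
    then show False
      using S.near_moment_cone[OF n gen K(3) XK c, of \<delta>] \<delta> no by auto
  qed
  have "\<exists>F\<in>UNIV. F.sq F \<le> F.sq ?x + 1 \<and> (\<forall>c\<in>S.moment_cone n. F.sq c \<le> Kc \<longrightarrow> Re (fip n F c) \<le> \<eta>)
      \<and> \<delta>\<^sup>2 - \<eta> \<le> Re (fip n F ?x)"
    by (rule F.cone_separation[OF subset_UNIV S.moment_cone_zero S.moment_cone_add S.moment_cone_scale UNIV_I far \<eta>0 Kc0])
  then obtain F :: "'d dual" where F: "fsq n F \<le> fsq n ?x + 1"
    and cone: "\<forall>c\<in>S.moment_cone n. fsq n c \<le> Kc \<longrightarrow> Re (fip n F c) \<le> \<eta>"
    and Fx: "\<delta>\<^sup>2 - \<eta> \<le> Re (fip n F ?x)"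
    unfolding fsq_eq by blast
  \<comment> \<open>The summand 1 in R is the excess of \<open>fsq n F\<close> over the point
    permitted by the separation lemma.\<close>
  have "fsq n ?x \<le> Kc" unfolding Kc_def using pK by (rule fsq_le)
  then have FR: "fsq n F \<le> R" using F unfolding R Kc_def by linarith
  have "matrix_norm A n (eval_poly_mat A \<xi> (dual_pencil n R F)) \<le> R + \<eta>"
    by (rule S.dual_norm_le[OF n gen Kc_def _ FR cone \<eta>0]) (simp add: R Kc_def)
  then have "matrix_norm A' n (eval_poly_mat A' \<xi>' (dual_pencil n R F)) \<le> R + 4 * \<eta>"
    using close[OF FR] by linarith
  then have "Re (fip n F ?x) \<le> real n * (4 * \<eta>)" by (rule S'.dual_point_le[OF n X])
  \<comment> \<open>The value of \<eta> makes \<eta> (1 + 4 n) equal to half of \<delta>^2.\<close>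
  then have "\<delta>\<^sup>2 \<le> \<eta> * (1 + 4 * real n)" using Fx by (simp add: algebra_simps)
  also have "\<dots> = \<delta>\<^sup>2 / 2"
  proof -
    have "1 + 4 * real n > 0" by simp
    then show ?thesis unfolding \<eta> by (simp add: field_simps)
  qed
  finally show False using \<delta> by simp
qed

context rep_tuple
begin

lemma dual_pencil_Lipschitz:
  fixes F G :: "'d dual"
  assumes n: "n \<ge> 1" and K: "\<And>i. anorm A (\<xi> i) \<le> K" "1 \<le> K" and \<epsilon>: "0 \<le> \<epsilon>"
    and close: "\<And>i a b. \<lbrakk>a < n; b < n\<rbrakk> \<Longrightarrow> cmod (F i a b - G i a b) \<le> \<epsilon>"
  shows "matrix_norm A n (eval_poly_mat A \<xi> (dual_pencil n r F))
    \<le> matrix_norm A n (eval_poly_mat A \<xi> (dual_pencil n r G))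
      + real (n * n) * (real (card (short_words :: 'd letter list set)) * (\<epsilon> * K))"
proof (rule matrix_norm_diff[OF n])
  note c = dual_pencil_carrier[of n r]
  show "eval_poly_mat A \<xi> (dual_pencil n r F) \<in> mats (carrier A) n"
    "eval_poly_mat A \<xi> (dual_pencil n r G) \<in> mats (carrier A) n"
    by (intro eval_mats[OF \<xi>] c)+
  fix i j assume ij: "i < n" "j < n"
  have w: "anorm A (eval_word A \<xi> w) \<le> K" if "w \<in> short_words" for w
    using that K anorm_one by (auto simp: short_words_def)
  have "degree_le_one (dual_pencil n r F' $$ (i, j))" for F' :: "'d dual"
    using c[of F'] ij by (intro degree_dual_pencil) blast
  then have "anorm A (eval_poly A \<xi> (dual_pencil n r F $$ (i, j)) \<ominus> eval_poly A \<xi> (dual_pencil n r G $$ (i, j)))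
      \<le> real (card (short_words :: 'd letter list set)) * (\<epsilon> * K)"
    using close ij w \<epsilon> by (intro anorm_eval_poly_diff[OF \<xi>] dual_pencil_lookup_diff) auto
  then show "anorm A (eval_poly_mat A \<xi> (dual_pencil n r F) $$ (i, j) \<ominus> eval_poly_mat A \<xi> (dual_pencil n r G) $$ (i, j))
      \<le> real (card (short_words :: 'd letter list set)) * (\<epsilon> * K)"
    using ij dual_pencil_carrier[of n r F] dual_pencil_carrier[of n r G] by simp
qed

end

section \<open>Uniform estimates near t0 and convergence of the matrix ranges\<close>

context rep_family
begin

text \<open>The 1 by 1 pencil z_i. It supplies the bound K on the generators, common to all t near
  t0, on which the radius and the Lipschitz constant depend.\<close>

lemma generator_norms_converge:
  assumes conv: "linear_matrix_poly_norms_converge A \<xi> t0"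
  shows "((\<lambda>t. anorm (A t) (\<xi> t i)) \<longlongrightarrow> anorm (A t0) (\<xi> t0 i)) (at t0)"
proof -
  define p :: "'d star_poly" where "p = Poly_Mapping.single [Z i] 1"
  have "q = p" if "q \<in> elements_mat (mat 1 1 (\<lambda>_. p))" for q using that by auto
  then have "\<forall>q\<in>elements_mat (mat 1 1 (\<lambda>_. p)). degree_le_one q"
    by (auto simp: p_def degree_le_one_def)
  then have "((\<lambda>t. matrix_norm (A t) 1 (eval_poly_mat (A t) (\<xi> t) (mat 1 1 (\<lambda>_. p))))
      \<longlongrightarrow> matrix_norm (A t0) 1 (eval_poly_mat (A t0) (\<xi> t0) (mat 1 1 (\<lambda>_. p)))) (at t0)"
    by (intro conv[unfolded linear_matrix_poly_norms_converge_def, rule_format]) auto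
  moreover have "eval_poly (A t) (\<xi> t) p = \<xi> t i" for t
    unfolding p_def S.eval_poly_single[OF S.\<xi>]
    using S.xi_closed[of t i] by (intro S.act_faithful[of _ t]) (simp_all add: S.act_mult)
  ultimately show ?thesis
    unfolding eval_poly_mat_one S.matrix_norm_one[OF S.eval_poly_closed[OF S.\<xi>]] by simp
qed

lemma ranges_if_linear_norms:
  assumes conv: "linear_matrix_poly_norms_converge A \<xi> t0"
  shows "matrix_ranges_converge H (\<lambda>t i. \<pi> t (\<xi> t i)) t0"
  unfolding matrix_ranges_converge_def
proof (intro allI impI tendstoI)
  fix n :: nat and e :: real assume n: "n \<ge> 1" and e: "e > 0"
  \<comment> \<open>The norms at t0 are at most K - 1, which leaves room for nearby t.\<close>
  define K where "K = 1 + (\<Sum>i\<in>UNIV. anorm (A t0) (\<xi> t0 i))"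
  have a0: "0 \<le> anorm (A t) (\<xi> t i)" for t i by simp
  have K1: "1 \<le> K" unfolding K_def using a0 by (simp add: sum_nonneg)
  have K0: "anorm (A t0) (\<xi> t0 i) \<le> K - 1" for i
    unfolding K_def using a0 member_le_sum[of i UNIV "\<lambda>i. anorm (A t0) (\<xi> t0 i)"] by simp
  define L where "L = sqrt (real (n * n * card (UNIV :: 'd set) * n))"
  have L: "0 \<le> L" by (simp add: L_def)
  define M where "M = K * (2 + 4 * (real n)\<^sup>2)"
  have M: "M \<ge> 1"
  proof -
    have "1 * 1 \<le> K * (2 + 4 * (real n)\<^sup>2)" using K1 by (intro mult_mono) auto
    then show ?thesis by (simp add: M_def)
  qed
  \<comment> \<open>M \<delta> is the entrywise error of the approximation and L converts entrywise
    errors into distances. Using L + 1 keeps the denominator positive and the result strictly below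
    e.\<close>
  define \<delta> where "\<delta> = min 1 (e / ((L + 1) * M))"
  have pos: "0 < (L + 1) * M" using L M by simp
  have \<delta>: "0 < \<delta>" "\<delta> \<le> 1" using e pos by (auto simp: \<delta>_def)
  have "L * (M * \<delta>) < e"
  proof -
    have "(L + 1) * M * \<delta> \<le> (L + 1) * M * (e / ((L + 1) * M))"
      using pos by (intro mult_left_mono) (auto simp: \<delta>_def)
    also have "\<dots> = e" by (rule nonzero_mult_div_cancel_left[of "(L + 1) * M" e, folded times_divide_eq_right]) (use pos in auto)
    finally have "(L + 1) * M * \<delta> \<le> e" .
    moreover have "0 < M * \<delta>" using M \<delta> by simp
    ultimately show ?thesis by (simp add: algebra_simps)
  qed
  then have small: "L * (K * \<delta> * (2 + 4 * (real n)\<^sup>2)) < e" by (simp add: M_def mult_ac)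
  define \<eta> where "\<eta> = \<delta>\<^sup>2 / (2 * (1 + 4 * real n))"
  have \<eta>0: "0 < \<eta>" unfolding \<eta>_def using \<delta> by (intro divide_pos_pos) auto
  define R where "R = real (card (UNIV :: 'd option set) * n * n) * K\<^sup>2 + 1"
  let ?c = "real (n * n) * (real (card (short_words :: 'd letter list set)) * K)"
  let ?N = "\<lambda>t F. matrix_norm (A t) n (eval_poly_mat (A t) (\<xi> t) (dual_pencil n R F))"
  \<comment> \<open>\<open>?c\<close> is the Lipschitz constant of the pencil norms for all t with
    generators bounded by K, so moving to a net point costs at most \<eta>.\<close>
  define \<epsilon> where "\<epsilon> = \<eta> / (?c + 1)"
  have c0: "0 \<le> ?c" using K1 by (intro mult_nonneg_nonneg) auto
  have \<epsilon>: "0 < \<epsilon>" unfolding \<epsilon>_def using \<eta>0 c0 by (intro divide_pos_pos) linarith+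
  have c\<epsilon>: "?c * \<epsilon> \<le> \<eta>"
  proof -
    have "(?c + 1) * \<epsilon> = \<eta>" using c0 by (simp add: \<epsilon>_def)
    then show ?thesis using \<epsilon> by (simp add: distrib_right)
  qed
  define J :: "('d option \<times> nat \<times> nat) set" where "J = UNIV \<times> {..<n} \<times> {..<n}"
  have "finite J" by (simp add: J_def)
  then obtain G :: "('d option \<times> nat \<times> nat \<Rightarrow> complex) set" where G: "finite G"
    and net: "\<And>F. (\<And>i. i \<in> J \<Longrightarrow> cmod (F i) \<le> sqrt R) \<Longrightarrow> \<exists>g\<in>G. \<forall>i\<in>J. cmod (F i - g i) < \<epsilon>"
    using finite_function_net[OF _ \<epsilon>] by blast
  let ?u = "\<lambda>g i a b. g (i, a, b)"
  \<comment> \<open>Functionals in the ball have entries of modulus at most the root of R, so a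
    single finite net serves all of them.\<close>
  have near: "\<exists>g\<in>G. \<forall>i a b. a < n \<longrightarrow> b < n \<longrightarrow> cmod (F i a b - ?u g i a b) \<le> \<epsilon>" if F: "fsq n F \<le> R" for F
  proof -
    have le: "cmod (case x of (i, a, b) \<Rightarrow> F i a b) \<le> sqrt R" if x: "x \<in> J" for x
    proof -
      obtain i a b where x': "x = (i, a, b)" "a < n" "b < n" using x by (auto simp: J_def)
      have "(cmod (F i a b))\<^sup>2 \<le> R" using cmod_le_fsq[OF x'(2,3), of F i] F by linarith
      then show ?thesis using x'(1) by (simp add: real_le_rsqrt)
    qed
    obtain g where g: "g \<in> G" "\<forall>x\<in>J. cmod ((case x of (i, a, b) \<Rightarrow> F i a b) - g x) < \<epsilon>"
      using net[of "\<lambda>x. case x of (i, a, b) \<Rightarrow> F i a b", OF le] by blast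
    have "cmod (F i a b - g (i, a, b)) \<le> \<epsilon>" if "a < n" "b < n" for i a b
      using g(2)[rule_format, of "(i, a, b)"] that by (simp add: J_def)
    then show ?thesis using g(1) by blast
  qed
  have ev1: "\<forall>\<^sub>F t in at t0. \<forall>g\<in>G. \<bar>?N t (?u g) - ?N t0 (?u g)\<bar> < \<eta>"
  proof (intro eventually_ball_finite ballI G)
    fix g assume "g \<in> G"
    have lim: "((\<lambda>t. ?N t (?u g)) \<longlongrightarrow> ?N t0 (?u g)) (at t0)"
      by (intro conv[unfolded linear_matrix_poly_norms_converge_def, rule_format] n conjI dual_pencil_carrier ballI)
        (rule degree_dual_pencil)
    then show "\<forall>\<^sub>F t in at t0. \<bar>?N t (?u g) - ?N t0 (?u g)\<bar> < \<eta>"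
      using tendstoD[OF lim \<eta>0] by (simp add: dist_real_def)
  qed
  have "\<forall>\<^sub>F t in at t0. \<forall>i\<in>UNIV. anorm (A t) (\<xi> t i) < K"
  proof (intro eventually_ball_finite ballI finite)
    fix i
    show "\<forall>\<^sub>F t in at t0. anorm (A t) (\<xi> t i) < K"
      by (rule order_tendstoD(2)[OF generator_norms_converge[OF conv]]) (use K0[of i] in linarith)
  qed
  with ev1 show "\<forall>\<^sub>F t in at t0. dist (hausdorff_dist (tuple_dist (complex_matrices n)) (W t n) (W t0 n)) 0 < e"
  proof eventually_elim
    case (elim t)
    have Kt: "anorm (A t) (\<xi> t i) \<le> K" and Kt0: "anorm (A t0) (\<xi> t0 i) \<le> K" for i
      using elim(2) K0[of i] by (auto intro: less_imp_le)
    \<comment> \<open>One \<eta> for passing from F to the net point at s, one for passing from s to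
      s', one for returning to F at s'.\<close>
    have Ns: "?N s F \<le> ?N s' F + 3 * \<eta>"
      if F: "fsq n F \<le> R" and Ks: "\<And>i. anorm (A s) (\<xi> s i) \<le> K" and Ks': "\<And>i. anorm (A s') (\<xi> s' i) \<le> K"
        and cl: "\<And>g. g \<in> G \<Longrightarrow> \<bar>?N s (?u g) - ?N s' (?u g)\<bar> < \<eta>" for F s s'
    proof -
      obtain g where g: "g \<in> G" and Fg: "\<And>i a b. \<lbrakk>a < n; b < n\<rbrakk> \<Longrightarrow> cmod (F i a b - ?u g i a b) \<le> \<epsilon>"
        using near[OF F] by blast
      have gF: "cmod (?u g i a b - F i a b) \<le> \<epsilon>" if "a < n" "b < n" for i a b
        using Fg[OF that, of i] by (simp add: norm_minus_commute)
      have "?N s F \<le> ?N s (?u g) + ?c * \<epsilon>"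
        using S.dual_pencil_Lipschitz[OF n Ks K1 less_imp_le[OF \<epsilon>] Fg, where r = R] by (simp add: mult_ac)
      moreover have "?N s' (?u g) \<le> ?N s' F + ?c * \<epsilon>"
        using S.dual_pencil_Lipschitz[OF n Ks' K1 less_imp_le[OF \<epsilon>] gF, where r = R] by (simp add: mult_ac)
      ultimately show ?thesis using c\<epsilon> cl[OF g] by linarith
    qed
    have fwd: "\<exists>Y\<in>W s n. \<forall>i. \<forall>a<n. \<forall>b<n. cmod (X i $$ (a, b) - Y i $$ (a, b)) \<le> K * \<delta> * (2 + 4 * (real n)\<^sup>2)"
      if X: "X \<in> W s' n" and Ks: "\<And>i. anorm (A s) (\<xi> s i) \<le> K" and Ks': "\<And>i. anorm (A s') (\<xi> s' i) \<le> K"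
        and cl: "\<And>g. g \<in> G \<Longrightarrow> \<bar>?N s' (?u g) - ?N s (?u g)\<bar> < \<eta>" for X s s'
      by (rule ranges_close_of_dual_norms[OF rep rep n Ks Ks' K1 R_def \<delta> \<eta>_def _ X])
        (rule Ns[OF _ Ks' Ks cl])
    have m: "\<forall>i. X i \<in> cmats n" if "X \<in> W s n" for X s
      using S.Wn_mats[OF n that] by blast
    have B0: "0 \<le> K * \<delta> * (2 + 4 * (real n)\<^sup>2)" using K1 \<delta> by simp
    have td: "tuple_dist (complex_matrices n) X Y \<le> L * (K * \<delta> * (2 + 4 * (real n)\<^sup>2))"
      if "X \<in> W s n" "Y \<in> W s' n" "\<forall>i. \<forall>a<n. \<forall>b<n. cmod (X i $$ (a, b) - Y i $$ (a, b)) \<le> K * \<delta> * (2 + 4 * (real n)\<^sup>2)"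
      for X Y s s'
      unfolding L_def using tuple_dist_bounds(3)[OF n m[OF that(1)] m[OF that(2)] B0] that(3) by blast
    have "\<bar>hausdorff_dist (tuple_dist (complex_matrices n)) (W t n) (W t0 n)\<bar> \<le> L * (K * \<delta> * (2 + 4 * (real n)\<^sup>2))"
    proof (rule hausdorff_dist_le[OF S.Wn_nonempty[OF n] S.Wn_nonempty[OF n]])
      fix X Y assume XY: "X \<in> W t n" "Y \<in> W t0 n"
      show "0 \<le> tuple_dist (complex_matrices n) X Y \<and> 0 \<le> tuple_dist (complex_matrices n) Y X"
        using tuple_dist_bounds(1)[OF n m[OF XY(1)] m[OF XY(2)]] tuple_dist_bounds(1)[OF n m[OF XY(2)] m[OF XY(1)]] by blast
    next
      fix X assume X: "X \<in> W t n"
      have "\<exists>Y\<in>W t0 n. \<forall>i. \<forall>a<n. \<forall>b<n. cmod (X i $$ (a, b) - Y i $$ (a, b)) \<le> K * \<delta> * (2 + 4 * (real n)\<^sup>2)"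
        using X Kt0 Kt elim(1) by (intro fwd) auto
      then show "\<exists>Y\<in>W t0 n. tuple_dist (complex_matrices n) X Y \<le> L * (K * \<delta> * (2 + 4 * (real n)\<^sup>2))"
        using td[OF X] by blast
    next
      fix X assume X: "X \<in> W t0 n"
      have "\<exists>Y\<in>W t n. \<forall>i. \<forall>a<n. \<forall>b<n. cmod (X i $$ (a, b) - Y i $$ (a, b)) \<le> K * \<delta> * (2 + 4 * (real n)\<^sup>2)"
        using X Kt0 Kt elim(1) by (intro fwd) (auto simp: abs_minus_commute)
      then show "\<exists>Y\<in>W t n. tuple_dist (complex_matrices n) X Y \<le> L * (K * \<delta> * (2 + 4 * (real n)\<^sup>2))"
        using td[OF X] by blast
    qed
    then show ?case using small by (simp add: dist_real_def)
  qed
qed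

end

theorem theorem2p3:
  fixes A :: "'t::metric_space \<Rightarrow> 'a cstar"
    and \<xi> :: "'t \<Rightarrow> 'd::finite \<Rightarrow> 'a"
    and H :: "'t \<Rightarrow> 'h inner_product_space"
    and \<pi> :: "'t \<Rightarrow> 'a \<Rightarrow> 'h \<Rightarrow> 'h"
    and t0 :: 't
  assumes "\<And>t. unital_cstar_algebra (A t)"
    and "\<And>t. generates_cstar (A t) (\<xi> t)"
    and "\<And>t. complex_hilbert_space (H t)"
    and "\<And>t. faithful_representation (A t) (H t) (\<pi> t)"
  shows "(poly_norms_converge A \<xi> t0 \<longleftrightarrow> matrix_poly_norms_converge A \<xi> t0)
    \<and> (matrix_poly_norms_converge A \<xi> t0 \<longrightarrow> linear_matrix_poly_norms_converge A \<xi> t0)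
    \<and> (linear_matrix_poly_norms_converge A \<xi> t0
        \<longleftrightarrow> matrix_ranges_converge H (\<lambda>t i. \<pi> t (\<xi> t i)) t0)"
proof -
  have rep: "rep_tuple (A t) (\<xi> t) (H t) (\<pi> t)" for t
    using assms(2)[of t] by (intro rep_tuple.intro assms) (simp add: generates_cstar_def)
  interpret rep_family A \<xi> H \<pi> t0
    by (rule rep_family.intro) (rule rep)
  show ?thesis
    using poly_norms_converge_iff linear_if_matrix linear_norms_if_ranges ranges_if_linear_norms by blast
qed

end
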